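(* Let $K$ be a finite extension of $\mathbb{Q}_\ell$, $p\neq\ell$ a prime, $q$ the cardinality of the residue field of $K$, and fix a square root $q^{1/2}\in\overline{\mathbb{Q}}_p$. Let $\psi:W_K\to\overline{\mathbb{Q}}_p^\times$ be the unramified character sending the geometric Frobenius to $q^{1/2}$. Let $(\rho_1,N_1)$ and $(\rho_2,N_2)$ be Weil--Deligne representations of $W_K$ with coefficients in $\overline{\mathbb{Q}}_p$, pure of weights $w_1$ and $w_2$ respectively, such that $\rho_1,\rho_2$ have equal normalized traces, i.e. $\mathrm{tr}(\psi^{-w_1}\otimes\rho_1)=\mathrm{tr}(\psi^{-w_2}\otimes\rho_2)$ as functions on $W_K$. Then $(\rho_1,N_1)^{\mathrm{Fr\text{-}ss}}$ is isomorphic to $\psi^{w}\otimes(\rho_2,N_2)^{\mathrm{Fr\text{-}ss}}$, where $w=w_1-w_2$.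
   Context: $W_K$ is the Weil group of $K$ (preimage in $\mathrm{Gal}(\overline K/K)$ of the subgroup generated by the geometric Frobenius $\mathrm{Fr}$ of $\mathrm{Gal}(\overline K/K)/I_K$, topologized so that inertia $I_K$ is open), $v_K:W_K\to\mathbb{Z}$ is trivial on inertia with $v_K(\mathrm{Fr})=1$, and $\varphi\in W_K$ is a fixed lift of $\mathrm{Fr}$. A Weil--Deligne representation on a finite-dimensional $\overline{\mathbb{Q}}_p$-space $V$ is a pair $(r,N)$ with $r$ a representation of $W_K$ with open kernel and $N$ nilpotent with $r(\sigma)Nr(\sigma)^{-1}=q^{-v_K(\sigma)}N$ for all $\sigma\in W_K$; for a character $\chi$, $\chi\otimes(r,N):=(\chi\otimes r,N)$; isomorphisms intertwine both $r$ and $N$. The Frobenius-semisimplification $(r,N)^{\mathrm{Fr\text{-}ss}}$ is $(\tilde r,N)$ with $\tilde r(g)=r(g)(r(\varphi)^u)^{-v_K(g)}$, where $r(\varphi)^u$ is the unipotent part of the Jordan decomposition of $r(\varphi)$. Monodromy filtration: the unique increasing filtration $M_\bullet$ of $V$ with $NM_k\subset M_{k-2}$ and $N^k:\mathrm{Gr}_k\xrightarrow{\sim}\mathrm{Gr}_{-k}$ for $k\ge0$. A $q$-Weil number of weight $m$ is an algebraic number all of whose complex conjugates have absolute value $q^{m/2}$. $(r,N)$ is pure of weight $w$ if for every $i$ the eigenvalues of $r(\varphi)$ on $\mathrm{Gr}^M_i$ are $q$-Weil numbers of weight $w+i$. The normalized trace of a pure Weil--Deligne representation $(r,N)$ of weight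 $w$ is the trace of $\psi^{-w}\otimes r$. *)

theory Defs
  imports "HOL-Analysis.Analysis" "HOL-Algebra.Generated_Groups"
    "HOL-Computational_Algebra.Computational_Algebra"
begin

section \<open>Local fields inside an algebraic closure\<close>

text \<open>
  An algebraic closure is modelled by a type of class \<open>alg_closed_field\<close>, and its subfields by
  sets.
\<close>

definition subfield_set :: "'a::field set \<Rightarrow> bool" where
  "subfield_set K \<longleftrightarrow> 0 \<in> K \<and> 1 \<in> K \<and>
     (\<forall>x\<in>K. \<forall>y\<in>K. x + y \<in> K \<and> x * y \<in> K) \<and> (\<forall>x\<in>K. - x \<in> K \<and> inverse x \<in> K)"

definition finite_extension :: "'a::field set \<Rightarrow> 'a set \<Rightarrow> bool" where
  "finite_extension K L \<longleftrightarrow> subfield_set K \<and> subfield_set L \<and> K \<subseteq> L \<and>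
     (\<exists>B. finite B \<and> B \<subseteq> L \<and> (\<forall>x\<in>L. \<exists>c. (\<forall>b\<in>B. c b \<in> K) \<and> x = (\<Sum>b\<in>B. c b * b)))"

definition algebraic_over :: "'a::field set \<Rightarrow> 'a \<Rightarrow> bool" where
  "algebraic_over K x \<longleftrightarrow> (\<exists>f. f \<noteq> 0 \<and> (\<forall>i. coeff f i \<in> K) \<and> poly f x = 0)"

definition nonarch_abs :: "('a::field \<Rightarrow> real) \<Rightarrow> bool" where
  "nonarch_abs av \<longleftrightarrow> (\<forall>x. 0 \<le> av x) \<and> (\<forall>x. av x = 0 \<longleftrightarrow> x = 0) \<and>
     (\<forall>x y. av (x * y) = av x * av y) \<and> (\<forall>x y. av (x + y) \<le> max (av x) (av y))"

definition padic_abs :: "nat \<Rightarrow> rat \<Rightarrow> real" where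
  "padic_abs l x = (if x = 0 then 0 else
     real l powi (int (multiplicity (int l) (snd (quotient_of x)))
                  - int (multiplicity (int l) (fst (quotient_of x)))))"

text \<open>
  \<open>padic_closure l Q av\<close>: the type \<open>'a\<close> is an algebraic closure of its subfield \<open>Q\<close>, which is
  the field of \<open>l\<close>-adic numbers (the completion of the rationals for the \<open>l\<close>-adic absolute
  value), and \<open>av\<close> is the extension of the \<open>l\<close>-adic absolute value to the closure.
\<close>

definition padic_closure ::
    "nat \<Rightarrow> 'a::{alg_closed_field, field_char_0} set \<Rightarrow> ('a \<Rightarrow> real) \<Rightarrow> bool" where
  "padic_closure l Q av \<longleftrightarrow> nonarch_abs av \<and> (\<forall>x. av (of_rat x) = padic_abs l x) \<and>
     subfield_set Q \<and>
     Metric_space Q (\<lambda>x y. av (x - y)) \<and>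
     Metric_space.mcomplete Q (\<lambda>x y. av (x - y)) \<and>
     Metric_space.mtopology Q (\<lambda>x y. av (x - y)) closure_of (range of_rat) = Q \<and>
     (\<forall>x. algebraic_over Q x)"

definition residue_card :: "('a::field \<Rightarrow> real) \<Rightarrow> 'a set \<Rightarrow> nat" where
  "residue_card av K =
     card ({x\<in>K. av x \<le> 1} // {(x, y). x \<in> K \<and> y \<in> K \<and> av x \<le> 1 \<and> av y \<le> 1 \<and> av (x - y) < 1})"


section \<open>The Weil group\<close>

definition galois_group :: "'a::field set \<Rightarrow> ('a \<Rightarrow> 'a) monoid" where
  "galois_group K = \<lparr>carrier = {\<sigma>. bij \<sigma> \<and> (\<forall>x y. \<sigma> (x + y) = \<sigma> x + \<sigma> y) \<and>
       (\<forall>x y. \<sigma> (x * y) = \<sigma> x * \<sigma> y) \<and> (\<forall>x\<in>K. \<sigma> x = x)}, mult = (\<circ>), one = id\<rparr>"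

definition inertia :: "('a::field \<Rightarrow> real) \<Rightarrow> 'a set \<Rightarrow> ('a \<Rightarrow> 'a) set" where
  "inertia av K = {\<sigma> \<in> carrier (galois_group K). \<forall>x. av x \<le> 1 \<longrightarrow> av (\<sigma> x - x) < 1}"

text \<open>
  The geometric Frobenius, the inverse of \<open>x \<mapsto> x ^ q\<close> on the residue field, as an element of
  \<open>galois_group K Mod inertia av K\<close>; its elements are the lifts of the Frobenius.
\<close>

definition geom_frob :: "('a::field \<Rightarrow> real) \<Rightarrow> 'a set \<Rightarrow> ('a \<Rightarrow> 'a) set" where
  "geom_frob av K = {\<sigma> \<in> carrier (galois_group K).
     \<forall>x. av x \<le> 1 \<longrightarrow> av (\<sigma> x ^ residue_card av K - x) < 1}"

definition weil_group :: "('a::field \<Rightarrow> real) \<Rightarrow> 'a set \<Rightarrow> ('a \<Rightarrow> 'a) monoid" where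
  "weil_group av K = (galois_group K)\<lparr>carrier :=
     {\<sigma> \<in> carrier (galois_group K). inertia av K #>\<^bsub>galois_group K\<^esub> \<sigma>
        \<in> generate (galois_group K Mod inertia av K) {geom_frob av K}}\<rparr>"

definition weil_val :: "('a::field \<Rightarrow> real) \<Rightarrow> 'a set \<Rightarrow> ('a \<Rightarrow> 'a) \<Rightarrow> int" where
  "weil_val av K \<sigma> = (THE n. inertia av K #>\<^bsub>galois_group K\<^esub> \<sigma>
     = geom_frob av K [^]\<^bsub>galois_group K Mod inertia av K\<^esub> n)"

text \<open>
  The group topology in which inertia, with its Krull topology, is an open subgroup: a basis is
  given by the cosets of the intersections of inertia with the Galois groups of the finite
  extensions of \<open>K\<close>.
\<close>

definition weil_topology :: "('a::field \<Rightarrow> real) \<Rightarrow> 'a set \<Rightarrow> ('a \<Rightarrow> 'a) topology" where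
  "weil_topology av K = topology_generated_by
     {\<sigma> <#\<^bsub>galois_group K\<^esub> (inertia av K \<inter> carrier (galois_group L)) | \<sigma> L.
        \<sigma> \<in> carrier (weil_group av K) \<and> finite_extension K L}"

text \<open>Unramified characters are trivial on the open subgroup of inertia, so they are continuous.\<close>

definition unramified_char ::
    "('a::field \<Rightarrow> real) \<Rightarrow> 'a set \<Rightarrow> (('a \<Rightarrow> 'a) \<Rightarrow> 'c::field) \<Rightarrow> bool" where
  "unramified_char av K \<eta> \<longleftrightarrow>
     \<eta> \<in> hom (weil_group av K) \<lparr>carrier = - {0}, mult = (*), one = 1\<rparr> \<and>
     (\<forall>\<sigma>\<in>inertia av K. \<eta> \<sigma> = 1)"


section \<open>Linear algebra\<close>

text \<open>
  A vector space is a type with a scalar multiplication \<open>sc\<close> satisfying the locale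
  \<open>vector_space\<close>.
\<close>

definition GL :: "('c::field \<Rightarrow> 'v::ab_group_add \<Rightarrow> 'v) \<Rightarrow> ('v \<Rightarrow> 'v) monoid" where
  "GL sc = \<lparr>carrier = {f. Vector_Spaces.linear sc sc f \<and> bij f}, mult = (\<circ>), one = id\<rparr>"

definition nilpotent_map ::
    "('c::field \<Rightarrow> 'v::ab_group_add \<Rightarrow> 'v) \<Rightarrow> ('v \<Rightarrow> 'v) \<Rightarrow> bool" where
  "nilpotent_map sc f \<longleftrightarrow> Vector_Spaces.linear sc sc f \<and> (\<exists>n. \<forall>v. (f ^^ n) v = 0)"

text \<open>The trace is computed in the basis \<open>B\<close>, but does not depend on it.\<close>

definition lin_trace ::
    "('c::field \<Rightarrow> 'v::ab_group_add \<Rightarrow> 'v) \<Rightarrow> 'v set \<Rightarrow> ('v \<Rightarrow> 'v) \<Rightarrow> 'c" where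
  "lin_trace sc B f = (\<Sum>b\<in>B. module.representation sc B (f b) b)"

definition diagonalizable ::
    "('c::field \<Rightarrow> 'v::ab_group_add \<Rightarrow> 'v) \<Rightarrow> ('v \<Rightarrow> 'v) \<Rightarrow> bool" where
  "diagonalizable sc f \<longleftrightarrow> Vector_Spaces.linear sc sc f \<and>
     module.span sc {v. \<exists>c. f v = sc c v} = UNIV"

text \<open>
  Multiplicative Jordan decomposition over an algebraically closed field, where semisimple
  means diagonalizable.
\<close>

definition unipotent_part ::
    "('c::alg_closed_field \<Rightarrow> 'v::ab_group_add \<Rightarrow> 'v) \<Rightarrow> ('v \<Rightarrow> 'v) \<Rightarrow> 'v \<Rightarrow> 'v" where
  "unipotent_part sc f = (THE u. nilpotent_map sc (\<lambda>v. u v - v) \<and>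
     (\<exists>s. diagonalizable sc s \<and> s \<circ> u = f \<and> u \<circ> s = f))"

text \<open>For a filtration \<open>M\<close>, the quotient \<open>M i / M (i - 1)\<close> as a set of cosets.\<close>

definition gr_class :: "(int \<Rightarrow> 'v::ab_group_add set) \<Rightarrow> int \<Rightarrow> 'v \<Rightarrow> 'v set" where
  "gr_class M i x = (\<lambda>y. x + y) ` M (i - 1)"

definition gr :: "(int \<Rightarrow> 'v::ab_group_add set) \<Rightarrow> int \<Rightarrow> 'v set set" where
  "gr M i = gr_class M i ` M i"

text \<open>
  The map from degree \<open>i\<close> to degree \<open>j\<close> induced by a linear map \<open>f\<close> with \<open>f ` M i \<subseteq> M j\<close> and
  \<open>f ` M (i - 1) \<subseteq> M (j - 1)\<close>; the union is then a single coset.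
\<close>

definition gr_map ::
    "(int \<Rightarrow> 'v::ab_group_add set) \<Rightarrow> ('v \<Rightarrow> 'v) \<Rightarrow> int \<Rightarrow> 'v set \<Rightarrow> 'v set" where
  "gr_map M f j X = (\<Union>x\<in>X. gr_class M j (f x))"

definition gr_eigenvalue :: "('c::field \<Rightarrow> 'v::ab_group_add \<Rightarrow> 'v) \<Rightarrow>
    (int \<Rightarrow> 'v set) \<Rightarrow> ('v \<Rightarrow> 'v) \<Rightarrow> int \<Rightarrow> 'c \<Rightarrow> bool" where
  "gr_eigenvalue sc M f i a \<longleftrightarrow> (\<exists>x\<in>M i. gr_class M i x \<noteq> gr_class M i 0 \<and>
     gr_map M f i (gr_class M i x) = gr_class M i (sc a x))"

definition monodromy_filtration :: "('c::field \<Rightarrow> 'v::ab_group_add \<Rightarrow> 'v) \<Rightarrow>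
    ('v \<Rightarrow> 'v) \<Rightarrow> (int \<Rightarrow> 'v set) \<Rightarrow> bool" where
  "monodromy_filtration sc N M \<longleftrightarrow>
     (\<forall>i. module.subspace sc (M i)) \<and> mono M \<and> (\<exists>i. M i = {0}) \<and> (\<exists>i. M i = UNIV) \<and>
     (\<forall>i. N ` M i \<subseteq> M (i - 2)) \<and>
     (\<forall>k::nat. bij_betw (gr_map M (N ^^ k) (- int k)) (gr M (int k)) (gr M (- int k)))"


section \<open>Weil--Deligne representations\<close>

type_synonym ('a, 'v) wd = "(('a \<Rightarrow> 'a) \<Rightarrow> 'v \<Rightarrow> 'v) \<times> ('v \<Rightarrow> 'v)"

definition wd_rep :: "('a::field \<Rightarrow> real) \<Rightarrow> 'a set \<Rightarrow>
    ('c::field \<Rightarrow> 'v::ab_group_add \<Rightarrow> 'v) \<Rightarrow> ('a, 'v) wd \<Rightarrow> bool" where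
  "wd_rep av K sc = (\<lambda>(r, N).
     r \<in> hom (weil_group av K) (GL sc) \<and>
     openin (weil_topology av K) (kernel (weil_group av K) (GL sc) r) \<and>
     nilpotent_map sc N \<and>
     (\<forall>\<sigma>\<in>carrier (weil_group av K). r \<sigma> \<circ> N \<circ> inv\<^bsub>GL sc\<^esub> (r \<sigma>) =
        (\<lambda>v. sc (of_nat (residue_card av K) powi (- weil_val av K \<sigma>)) (N v))))"

definition wd_twist :: "('c::field \<Rightarrow> 'v::ab_group_add \<Rightarrow> 'v) \<Rightarrow>
    (('a \<Rightarrow> 'a) \<Rightarrow> 'c) \<Rightarrow> ('a, 'v) wd \<Rightarrow> ('a, 'v) wd" where
  "wd_twist sc \<eta> = (\<lambda>(r, N). (\<lambda>\<sigma> v. sc (\<eta> \<sigma>) (r \<sigma> v), N))"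

definition wd_iso :: "('a::field \<Rightarrow> real) \<Rightarrow> 'a set \<Rightarrow>
    ('c::field \<Rightarrow> 'v::ab_group_add \<Rightarrow> 'v) \<Rightarrow> ('c \<Rightarrow> 'w::ab_group_add \<Rightarrow> 'w) \<Rightarrow>
    ('a, 'v) wd \<Rightarrow> ('a, 'w) wd \<Rightarrow> bool" where
  "wd_iso av K sc sc' = (\<lambda>(r, N) (r', N').
     \<exists>f. Vector_Spaces.linear sc sc' f \<and> bij f \<and>
       (\<forall>\<sigma>\<in>carrier (weil_group av K). f \<circ> r \<sigma> = r' \<sigma> \<circ> f) \<and> f \<circ> N = N' \<circ> f)"

definition frob_ss :: "('a::field \<Rightarrow> real) \<Rightarrow> 'a set \<Rightarrow> ('a \<Rightarrow> 'a) \<Rightarrow>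
    ('c::alg_closed_field \<Rightarrow> 'v::ab_group_add \<Rightarrow> 'v) \<Rightarrow> ('a, 'v) wd \<Rightarrow> ('a, 'v) wd" where
  "frob_ss av K \<phi> sc = (\<lambda>(r, N).
     (\<lambda>\<sigma>. r \<sigma> \<circ> (unipotent_part sc (r \<phi>) [^]\<^bsub>GL sc\<^esub> (- weil_val av K \<sigma>)), N))"

text \<open>
  The complex conjugates of \<open>a\<close> are the complex roots of its minimal polynomial over the
  rationals, which up to a unit is the irreducible polynomial vanishing at \<open>a\<close>.
\<close>

definition weil_number :: "nat \<Rightarrow> int \<Rightarrow> 'c::field_char_0 \<Rightarrow> bool" where
  "weil_number q m a \<longleftrightarrow> (\<exists>f::rat poly. irreducible f \<and> poly (map_poly of_rat f) a = 0 \<and>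
     (\<forall>z::complex. poly (map_poly of_rat f) z = 0 \<longrightarrow> cmod z = real q powr (real_of_int m / 2)))"

definition pure_of_weight :: "('a::field \<Rightarrow> real) \<Rightarrow> 'a set \<Rightarrow> ('a \<Rightarrow> 'a) \<Rightarrow>
    ('c::field_char_0 \<Rightarrow> 'v::ab_group_add \<Rightarrow> 'v) \<Rightarrow> int \<Rightarrow> ('a, 'v) wd \<Rightarrow> bool" where
  "pure_of_weight av K \<phi> sc w = (\<lambda>(r, N).
     \<exists>M. monodromy_filtration sc N M \<and>
       (\<forall>i a. gr_eigenvalue sc M (r \<phi>) i a \<longrightarrow> weil_number (residue_card av K) (w + i) a))"

text \<open>The normalized trace of a pure representation of weight \<open>w\<close>.\<close>

definition normalized_trace :: "('c::field \<Rightarrow> 'v::ab_group_add \<Rightarrow> 'v) \<Rightarrow> 'v set \<Rightarrow>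
    (('a \<Rightarrow> 'a) \<Rightarrow> 'c) \<Rightarrow> int \<Rightarrow> ('a, 'v) wd \<Rightarrow> ('a \<Rightarrow> 'a) \<Rightarrow> 'c" where
  "normalized_trace sc B \<psi> w R \<sigma> =
     lin_trace sc B (fst (wd_twist sc (\<lambda>\<tau>. \<psi> \<tau> powi (- w)) R) \<sigma>)"

end

theory Submission
  imports Defs "HOL-Computational_Algebra.Field_as_Ring" "HOL-Library.Function_Algebras"
    "HOL-Algebra.Sylow" "HOL-Algebra.FiniteProduct"
begin

text \<open>
  Inertia acts through a finite group, so some power \<open>\<phi> ^ m\<close> acts in a way commuting with all of
  \<open>W\<^sub>K\<close>, and then so does the unipotent part of the Frobenius. After Frobenius-semisimplification and
  twisting, both representations split into the eigenspaces of \<open>\<phi> ^ m\<close>, and on each of them \<open>W\<^sub>K\<close> acts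
  through a finite group up to an unramified character. Evaluating the equal traces on the cosets
  of \<open>\<phi> ^ m\<close> separates the eigenvalues, so corresponding eigenspaces have equal traces and are
  isomorphic by the theory of finite groups in characteristic zero.

  An algebraic number has at most one weight, also after raising to the power \<open>m\<close>, so by purity the
  eigenvalue \<open>c\<close> determines the degree \<open>k\<close> of the monodromy filtration, and \<open>N ^^ k\<close> is an isomorphism
  from the \<open>c\<close>-eigenspace to the \<open>c / q ^ (m * k)\<close>-eigenspace. Hence the \<open>N\<close>-structure is determined by
  the eigenspaces: an isomorphism is extended from the image of \<open>N\<close> to the primitive part, starting
  from the highest weight, and transported to negative weights by powers of \<open>N\<close>.
\<close>

section \<open>Weil numbers\<close>

text \<open>Eigenspaces of the Frobenius itself need not be stable under inertia, which forces the
  passage to its \<open>m\<close>-th power; the eigenvalues at hand are then powers of Weil numbers.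
  Weights are therefore phrased for powers (\<open>has_weight\<close>) and compared through common
  complex roots of rational polynomials. The exponent is a product of one exponent for each
  representation, so that a single element splits both. The whole twist is carried by the second
  representation, so both have weight \<open>w1\<close> when they are compared. Traces do not see
  \<open>N\<close>. They reach it in one place: an eigenspace of degree \<open>k \<ge> 0\<close> is
  the direct sum of its primitive part and the image under \<open>N\<close> of the eigenspace of
  degree \<open>k + 2\<close>, and \<open>N\<close> changes the action on the latter by a known
  unramified character. Hence the traces on eigenspaces determine those on primitive parts.
  Conversely the filtration is needed only to produce bijections \<open>N ^^ k\<close> between
  eigenspaces; after that, the argument is about eigenspaces alone.\<close>

abbreviation rpoly :: "rat poly \<Rightarrow> 'a::field_char_0 \<Rightarrow> 'a" where
  "rpoly f \<equiv> poly (map_poly of_rat f)"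

lemma rpoly_simps [simp]:
  fixes x :: "'a::field_char_0"
  shows rpoly_add: "rpoly (f + g) x = rpoly f x + rpoly g x"
    and rpoly_mult: "rpoly (f * g) x = rpoly f x * rpoly g x"
    and rpoly_pCons: "rpoly (pCons a f) x = of_rat a + x * rpoly f x"
    and rpoly_smult: "rpoly (smult a f) x = of_rat a * rpoly f x"
proof -
  show pC: "rpoly (pCons a f) x = of_rat a + x * rpoly f x" for a f
    by (simp add: map_poly_pCons)
  show ad: "rpoly (f + g) x = rpoly f x + rpoly g x" for f g
    by (induction f g rule: poly_induct2) (simp_all add: pC of_rat_add algebra_simps)
  show sm: "rpoly (smult a f) x = of_rat a * rpoly f x" for a f
    by (induction f) (simp_all add: pC of_rat_mult algebra_simps)
  show "rpoly (f * g) x = rpoly f x * rpoly g x" for f g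
    by (induction f) (simp_all add: pC ad sm algebra_simps)
qed

lemma rpoly_pcompose: "rpoly (pcompose f g) x = rpoly f (rpoly g (x::'a::field_char_0))"
  by (induction f) (simp_all add: pcompose_pCons)

lemma rpoly_monom [simp]: "rpoly (monom a n) x = of_rat a * (x::'a::field_char_0) ^ n"
  by (simp add: map_poly_monom poly_monom)

lemma map_poly_of_rat_eq_0 [simp]: "map_poly of_rat f = (0 :: 'a::field_char_0 poly) \<longleftrightarrow> f = 0"
  by (simp add: map_poly_eq_0_iff)

lemma degree_map_poly_of_rat [simp]: "degree (map_poly of_rat f :: 'a::field_char_0 poly) = degree f"
  by (simp add: degree_map_poly)

text \<open>The gcd of \<open>f\<close> and \<open>g\<close> is a polynomial combination of both, so
  it vanishes at \<open>a\<close>, is not constant, and has a complex root. This is how conjugates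
  are compared for elements of an arbitrary field of characteristic zero.\<close>

lemma common_complex_root:
  fixes a :: "'a::field_char_0"
  assumes "f \<noteq> 0" "rpoly f a = 0" "rpoly g a = 0"
  obtains z :: complex where "rpoly f z = 0" "rpoly g z = 0"
proof -
  define d where "d = gcd f g"
  obtain u v where uv: "u * f + v * g = d"
    unfolding d_def by (metis bezout_coefficients_fst_snd)
  have "d \<noteq> 0" using assms(1) by (simp add: d_def)
  have "rpoly d a = 0" unfolding uv[symmetric] using assms by simp
  have "degree d > 0"
  proof (rule ccontr)
    assume "\<not> degree d > 0"
    then obtain c where "d = [:c:]" by (metis degree_eq_zeroE gr0I)
    then show False using \<open>rpoly d a = 0\<close> \<open>d \<noteq> 0\<close> by simp
  qed
  then have "degree (map_poly of_rat d :: complex poly) > 0" by simp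
  then obtain z :: complex where z: "rpoly d z = 0"
    using alg_closed_imp_poly_has_root by blast
  obtain f' g' where "f = d * f'" "g = d * g'" unfolding d_def by (meson dvdE gcd_dvd1 gcd_dvd2)
  then show ?thesis using that[of z] z by simp
qed

text \<open>Extend \<open>c\<close> to a basis of the complex numbers over the rationals and send it
  to 1.\<close>

lemma rational_functional:
  fixes c :: complex
  assumes "c \<noteq> 0"
  obtains h :: "complex \<Rightarrow> rat" where "\<And>x y. h (x + y) = h x + h y" "\<And>r x. h (of_rat r * x) = r * h x"
    "h c \<noteq> 0"
proof -
  interpret V: vector_space "\<lambda>(r::rat) (x::complex). of_rat r * x"
    by unfold_locales (simp_all add: algebra_simps of_rat_add of_rat_mult)
  interpret R: vector_space "(*) :: rat \<Rightarrow> rat \<Rightarrow> rat"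
    by unfold_locales (simp_all add: algebra_simps)
  interpret P: vector_space_pair "\<lambda>(r::rat) (x::complex). of_rat r * x" "(*) :: rat \<Rightarrow> rat \<Rightarrow> rat" ..
  have "V.independent {c}" using assms by simp
  from P.linear_independent_extend[OF this, of "\<lambda>_. 1"] obtain h where
    h: "Vector_Spaces.linear (\<lambda>(r::rat) (x::complex). of_rat r * x) (*) h" "h c = 1" by auto
  show ?thesis
    by (rule that[of h]) (use h P.linear_add[OF h(1)] P.linear_scale[OF h(1)] in auto)
qed

text \<open>Apply to the coefficients of \<open>G\<close> a \<open>\<rat>\<close>-linear map \<open>\<complex> \<rightarrow> \<rat>\<close> that does not kill the leading one.\<close>

lemma rational_descent:
  fixes G :: "complex poly"
  assumes "G \<noteq> 0" "map_poly of_rat f dvd pcompose G (monom 1 n)" "n > 0"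
  obtains F :: "rat poly" where "F \<noteq> 0" "degree F \<le> degree G" "f dvd pcompose F (monom 1 n)"
proof -
  obtain h where h: "\<And>x y. h (x + y) = h x + h y" "\<And>r x. h (of_rat r * x) = r * h x"
    "h (lead_coeff G) \<noteq> 0" by (rule rational_functional[of "lead_coeff G"]) (use assms(1) in \<open>simp, blast\<close>)
  have h0: "h 0 = 0" using h(2)[of 0 0] by simp
  have had: "map_poly h (p + q) = map_poly h p + map_poly h q" for p q
    by (intro poly_eqI) (simp add: coeff_map_poly h0 h)
  have hpC: "map_poly h (pCons a p) = pCons (h a) (map_poly h p)" for a p
    by (simp add: map_poly_pCons h0)
  have hsm: "map_poly h (smult (of_rat r) p) = smult r (map_poly h p)" for r p
    by (intro poly_eqI) (simp add: coeff_map_poly h0 h)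
  \<comment> \<open>Applied to coefficients, \<open>h\<close> is linear over rational polynomials.
    So it keeps multiples of \<open>f\<close> and commutes with the substitution of
    \<open>X ^ n\<close>.\<close>
  have hmu: "map_poly h (map_poly of_rat f * p) = f * map_poly h p" for f p
    by (induction f) (simp_all add: map_poly_pCons had hsm hpC h0)
  have hmon: "map_poly h (monom 1 n * p) = monom 1 n * map_poly h p" for p
    using hmu[of "monom 1 n"] by (simp add: map_poly_monom)
  have hpc: "map_poly h (pcompose p (monom 1 n)) = pcompose (map_poly h p) (monom 1 n)" for p
    by (induction p) (simp_all add: pcompose_pCons had hpC hmon h0)
  show ?thesis
  proof (rule that[of "map_poly h G"])
    have "coeff (map_poly h G) (degree G) \<noteq> 0" using h(3) by (simp add: coeff_map_poly h0)
    then show "map_poly h G \<noteq> 0" by auto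
    show "degree (map_poly h G) \<le> degree G"
      by (rule degree_le) (simp add: coeff_map_poly h0 coeff_eq_0)
    from assms(2) obtain k where "pcompose G (monom 1 n) = map_poly of_rat f * k" by (auto elim: dvdE)
    from arg_cong[OF this, of "map_poly h"] show "f dvd pcompose (map_poly h G) (monom 1 n)"
      by (simp add: hmu hpc)
  qed
qed

text \<open>The roots of \<open>F\<close> of minimal degree with \<open>f(X) dvd F(X ^ n)\<close> are \<open>n\<close>-th powers of roots of \<open>f\<close>:
  any other root could be divided out over \<open>\<complex>\<close>, and descent would lower the degree.\<close>

lemma power_polynomial:
  fixes f :: "rat poly"
  assumes f: "f \<noteq> 0" and n: "n > 0"
  obtains F where "F \<noteq> 0" "\<And>x::'a::field_char_0. rpoly f x = 0 \<Longrightarrow> rpoly F (x ^ n) = 0"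
    "\<And>z::complex. rpoly F z = 0 \<Longrightarrow> \<exists>y. rpoly f y = 0 \<and> y ^ n = z"
proof -
  define fc :: "complex poly" where "fc = map_poly of_rat f"
  have fc0: "fc \<noteq> 0" using f by (simp add: fc_def)
  \<comment> \<open>Over the complex numbers the product of \<open>X - x ^ n\<close> over the roots
    \<open>x\<close> of \<open>f\<close>, with multiplicity, works; \<open>rational_descent\<close>
    makes it rational.\<close>
  have ex: "\<exists>F. F \<noteq> 0 \<and> f dvd pcompose F (monom 1 n)"
  proof -
    obtain A where A: "fc = smult (lead_coeff fc) (\<Prod>x\<in>#A. [:-x, 1:])"
      using alg_closed_imp_factorization[OF fc0] by blast
    define G where "G = (\<Prod>x\<in>#A. [:-(x ^ n), 1:])"
    have G0: "G \<noteq> 0" unfolding G_def by (auto simp: prod_mset_zero_iff)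
    have "(\<Prod>x\<in>#B. [:-x, 1:]) dvd pcompose (\<Prod>x\<in>#B. [:-(x ^ n), 1:]) (monom 1 n)" for B :: "complex multiset"
    proof (induction B)
      case (add x B)
      have "[:-x, 1:] dvd pcompose [:-(x ^ n), 1:] (monom 1 n)"
        by (simp add: poly_eq_0_iff_dvd[symmetric] poly_pcompose poly_monom)
      then have "[:-x, 1:] * (\<Prod>x\<in>#B. [:-x, 1:]) dvd
          pcompose [:-(x ^ n), 1:] (monom 1 n) * pcompose (\<Prod>x\<in>#B. [:-(x ^ n), 1:]) (monom 1 n)"
        using add by (rule mult_dvd_mono)
      then show ?case by (simp only: pcompose_mult image_mset_add_mset prod_mset.add_mset)
    qed simp
    then have "fc dvd pcompose G (monom 1 n)"
      unfolding G_def by (subst A) (use fc0 in \<open>simp add: smult_dvd_iff\<close>)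
    then have "map_poly of_rat f dvd pcompose G (monom 1 n)" unfolding fc_def .
    from rational_descent[OF G0 this n] show ?thesis by blast
  qed
  define P where "P d \<longleftrightarrow> (\<exists>F. F \<noteq> 0 \<and> f dvd pcompose F (monom 1 n) \<and> degree F = d)" for d
  have "P (LEAST d. P d)" by (rule LeastI_ex) (use ex in \<open>auto simp: P_def\<close>)
  then obtain F where F: "F \<noteq> 0" "f dvd pcompose F (monom 1 n)" "degree F = (LEAST d. P d)"
    by (auto simp: P_def)
  have min: "degree F \<le> degree F'" if "F' \<noteq> 0" "f dvd pcompose F' (monom 1 n)" for F'
    unfolding F(3) by (rule Least_le) (use that in \<open>auto simp: P_def\<close>)
  obtain k where k: "pcompose F (monom 1 n) = f * k" using F(2) by (auto elim: dvdE)
  show ?thesis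
  proof (rule that[OF F(1)])
    fix x :: 'a assume "rpoly f x = 0"
    have "rpoly F (x ^ n) = rpoly (pcompose F (monom 1 n)) x" by (simp add: rpoly_pcompose)
    then show "rpoly F (x ^ n) = 0" using \<open>rpoly f x = 0\<close> by (simp add: k)
  next
    fix z :: complex assume z: "rpoly F z = 0"
    show "\<exists>y. rpoly f y = 0 \<and> y ^ n = z"
    proof (rule ccontr)
      assume no: "\<not> ?thesis"
      define Fc :: "complex poly" where "Fc = map_poly of_rat F"
      have mpc: "map_poly of_rat (pcompose p (monom 1 n)) = pcompose (map_poly of_rat p) (monom 1 n :: complex poly)" for p
        by (rule poly_eq_poly_eq_iff[THEN iffD1], rule ext)
          (simp add: rpoly_pcompose poly_pcompose poly_monom)
      from z obtain G where G: "Fc = [:-z, 1:] * G" unfolding Fc_def poly_eq_0_iff_dvd by (auto elim: dvdE)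
      have "G \<noteq> 0" using G F(1) by (auto simp: Fc_def)
      \<comment> \<open>A common root \<open>y\<close> would be a root of \<open>f\<close> with
        \<open>y ^ n = z\<close>, against \<open>no\<close>. Hence the factor
        \<open>X ^ n - z\<close> can be cancelled from the multiple of \<open>f\<close>.\<close>
      have "coprime fc (pcompose [:-z, 1:] (monom 1 n))"
      proof (rule coprimeI)
        fix d assume d: "d dvd fc" "d dvd pcompose [:-z, 1:] (monom 1 n)"
        have "degree d = 0"
        proof (rule ccontr)
          assume "degree d \<noteq> 0"
          then obtain y where "poly d y = 0" using alg_closed_imp_poly_has_root[of d] by auto
          then have "poly fc y = 0" "poly (pcompose [:-z, 1:] (monom 1 n)) y = 0"
            using d by (auto elim!: dvdE)
          then show False using no by (auto simp: poly_pcompose poly_monom fc_def)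
        qed
        then show "is_unit d" using d(1) fc0 by (auto simp: is_unit_iff_degree)
      qed
      moreover have "fc dvd pcompose [:-z, 1:] (monom 1 n) * pcompose G (monom 1 n)"
        unfolding pcompose_mult[symmetric] G[symmetric] Fc_def mpc[symmetric] k
        by (rule dvdI[of _ _ "map_poly of_rat k"], rule poly_eq_poly_eq_iff[THEN iffD1], rule ext)
          (simp add: fc_def)
      ultimately have "map_poly of_rat f dvd pcompose G (monom 1 n)"
        unfolding fc_def by (simp only: coprime_dvd_mult_right_iff)
      from rational_descent[OF \<open>G \<noteq> 0\<close> this n] obtain F' where
        "F' \<noteq> 0" "degree F' \<le> degree G" "f dvd pcompose F' (monom 1 n)" .
      moreover have "degree F = Suc (degree G)"
      proof -
        have "degree F = degree Fc" by (simp add: Fc_def)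
        also have "\<dots> = Suc (degree G)" unfolding G using \<open>G \<noteq> 0\<close> by (subst degree_mult_eq) auto
        finally show ?thesis .
      qed
      ultimately show False using min[of F'] by simp
    qed
  qed
qed

text \<open>Unlike \<open>weil_number\<close>, this is visibly stable under extraction of roots, since it constrains only
  the conjugates of some power.\<close>

definition has_weight :: "nat \<Rightarrow> int \<Rightarrow> 'a::field_char_0 \<Rightarrow> bool" where
  "has_weight q m x \<longleftrightarrow> (\<exists>n>0. \<exists>F. F \<noteq> 0 \<and> rpoly F (x ^ n) = 0 \<and>
     (\<forall>z::complex. rpoly F z = 0 \<longrightarrow> cmod z = real q powr (real n * real_of_int m / 2)))"

lemma weil_number_has_weight: "weil_number q m a \<Longrightarrow> has_weight q m a"
  unfolding weil_number_def has_weight_def by (rule exI[of _ 1]) (auto simp: irreducible_def)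

text \<open>The exponent hidden in \<open>has_weight\<close> depends on the element. Passing to all
  its multiples allows two elements to be compared at a common exponent.\<close>

lemma has_weight_power:
  fixes x :: "'a::field_char_0"
  assumes "has_weight q m x" "q > 0"
  obtains n where "n > 0" "\<And>N. N > 0 \<Longrightarrow> \<exists>F. F \<noteq> 0 \<and> rpoly F (x ^ (n * N)) = 0 \<and>
     (\<forall>z::complex. rpoly F z = 0 \<longrightarrow> cmod z = real q powr (real (n * N) * real_of_int m / 2))"
proof -
  from assms obtain n F where n: "n > 0" and F: "F \<noteq> 0" "rpoly F (x ^ n) = 0"
    "\<And>z::complex. rpoly F z = 0 \<Longrightarrow> cmod z = real q powr (real n * real_of_int m / 2)"
    unfolding has_weight_def by blast
  show ?thesis
  proof (rule that[OF n])
    fix N :: nat assume N: "N > 0"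
    obtain G where G: "G \<noteq> 0" "\<And>x::'a. rpoly F x = 0 \<Longrightarrow> rpoly G (x ^ N) = 0"
      "\<And>z::complex. rpoly G z = 0 \<Longrightarrow> \<exists>y. rpoly F y = 0 \<and> y ^ N = z"
      by (rule power_polynomial[OF F(1) N, where ?'a='a]) blast
    have "cmod z = real q powr (real (n * N) * real_of_int m / 2)" if "rpoly G z = 0" for z :: complex
    proof -
      from G(3)[OF that] obtain y where y: "rpoly F y = 0" "y ^ N = z" by blast
      have "cmod z = cmod y ^ N" by (simp add: y(2)[symmetric] norm_power)
      also have "\<dots> = (real q powr (real n * real_of_int m / 2)) ^ N" using F(3)[OF y(1)] by simp
      also have "\<dots> = real q powr (real n * real_of_int m / 2 * real N)"
        using assms(2) by (simp add: powr_realpow[symmetric] powr_powr)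
      finally show ?thesis by (simp add: algebra_simps)
    qed
    then show "\<exists>F. F \<noteq> 0 \<and> rpoly F (x ^ (n * N)) = 0 \<and>
     (\<forall>z::complex. rpoly F z = 0 \<longrightarrow> cmod z = real q powr (real (n * N) * real_of_int m / 2))"
      using G(1) G(2)[OF F(2)] by (intro exI[of _ G]) (simp add: power_mult)
  qed
qed

text \<open>At a common exponent, \<open>x\<close> and \<open>y\<close> become one number killed by
  two rational polynomials. These share a complex root, whose absolute value is computed in both
  ways; \<open>q \<ge> 2\<close> allows the exponents to be compared.\<close>

lemma has_weight_unique:
  fixes x y :: "'a::field_char_0"
  assumes "has_weight q m x" "has_weight q m' y" "x ^ k = y ^ k" "k > 0" "q \<ge> 2"
  shows "m = m'"
proof -
  have q0: "q > 0" using assms(5) by simp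
  obtain n where n: "n > 0" "\<And>N. N > 0 \<Longrightarrow> \<exists>F. F \<noteq> 0 \<and> rpoly F (x ^ (n * N)) = 0 \<and>
     (\<forall>z::complex. rpoly F z = 0 \<longrightarrow> cmod z = real q powr (real (n * N) * real_of_int m / 2))"
    by (rule has_weight_power[OF assms(1) q0]) blast
  obtain n' where n': "n' > 0" "\<And>N. N > 0 \<Longrightarrow> \<exists>F. F \<noteq> 0 \<and> rpoly F (y ^ (n' * N)) = 0 \<and>
     (\<forall>z::complex. rpoly F z = 0 \<longrightarrow> cmod z = real q powr (real (n' * N) * real_of_int m' / 2))"
    by (rule has_weight_power[OF assms(2) q0]) blast
  have eq: "y ^ (n' * (n * k)) = x ^ (n * (n' * k))"
  proof -
    have "y ^ (n' * (n * k)) = (y ^ k) ^ (n * n')" by (simp add: power_mult[symmetric] mult_ac)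
    also have "\<dots> = x ^ (n * (n' * k))" unfolding assms(3)[symmetric] by (simp add: power_mult[symmetric] mult_ac)
    finally show ?thesis .
  qed
  obtain F where F: "F \<noteq> 0" "rpoly F (x ^ (n * (n' * k))) = 0"
    "\<And>z::complex. rpoly F z = 0 \<Longrightarrow> cmod z = real q powr (real (n * (n' * k)) * real_of_int m / 2)"
    using n(2)[of "n' * k"] n'(1) assms(4) by auto
  obtain F' where F': "F' \<noteq> 0" "rpoly F' (y ^ (n' * (n * k))) = 0"
    "\<And>z::complex. rpoly F' z = 0 \<Longrightarrow> cmod z = real q powr (real (n' * (n * k)) * real_of_int m' / 2)"
    using n'(2)[of "n * k"] n(1) assms(4) by auto
  obtain z :: complex where "rpoly F z = 0" "rpoly F' z = 0"
    using common_complex_root[OF F(1,2)] F'(2) unfolding eq by blast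
  then have "real q powr (real (n * (n' * k)) * real_of_int m / 2) =
      real q powr (real (n' * (n * k)) * real_of_int m' / 2)"
    using F(3) F'(3) by metis
  then have "real (n * (n' * k)) * real_of_int m / 2 = real (n' * (n * k)) * real_of_int m' / 2"
    by (subst (asm) powr_inj) (use assms(5) in auto)
  then have "real n * real n' * real k * real_of_int m = real n * real n' * real k * real_of_int m'"
    by (simp add: mult_ac)
  then show ?thesis using n(1) n'(1) assms(4) by auto
qed

lemma of_rat_power_int: "of_rat (x powi n) = (of_rat x :: 'a::field_char_0) powi n"
  by (simp add: power_int_def of_rat_power of_rat_inverse)

text \<open>After doubling the exponent, the factor \<open>(s powi j) ^ (n * 2)\<close> is the
  rational number \<open>q powi (j * n)\<close>, and rescaling the variable by a rational number
  keeps a polynomial rational.\<close>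

lemma has_weight_twist:
  fixes x s :: "'a::field_char_0"
  assumes "has_weight q m x" "s ^ 2 = of_nat q" "q > 0"
  shows "has_weight q (m + j) (s powi j * x)"
proof -
  obtain n where n: "n > 0" "\<exists>F. F \<noteq> 0 \<and> rpoly F (x ^ (n * 2)) = 0 \<and>
     (\<forall>z::complex. rpoly F z = 0 \<longrightarrow> cmod z = real q powr (real (n * 2) * real_of_int m / 2))"
    by (rule has_weight_power[OF assms(1,3)]) (metis zero_less_numeral)
  then obtain F where F: "F \<noteq> 0" "rpoly F (x ^ (n * 2)) = 0"
    "\<And>z::complex. rpoly F z = 0 \<Longrightarrow> cmod z = real q powr (real (n * 2) * real_of_int m / 2)" by blast
  define c :: rat where "c = of_nat q powi (j * int n)"
  have c0: "c \<noteq> 0" using assms(3) by (simp add: c_def)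
  define G where "G = pcompose F [:0, inverse c:]"
  have ev: "rpoly G z = rpoly F (z / of_rat c)" for z :: "'b::field_char_0"
    by (simp add: G_def rpoly_pcompose of_rat_inverse divide_inverse)
  have "(s powi j) ^ (n * 2) = (s ^ 2) powi (j * int n)"
    unfolding power_int_power power_int_power' by (simp add: mult_ac)
  then have "(s powi j * x) ^ (n * 2) = (s ^ 2) powi (j * int n) * x ^ (n * 2)"
    by (simp only: power_mult_distrib)
  also have "\<dots> = of_rat c * x ^ (n * 2)" by (simp only: assms(2) c_def of_rat_power_int of_rat_of_nat_eq)
  finally have pw: "(s powi j * x) ^ (n * 2) = of_rat c * x ^ (n * 2)" .
  have "cmod z = real q powr (real (n * 2) * real_of_int (m + j) / 2)" if "rpoly G z = 0" for z
  proof -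
    have "cmod (z / of_rat c) = real q powr (real (n * 2) * real_of_int m / 2)"
      using that F(3) unfolding ev by blast
    moreover have "cmod (of_rat c) = real q powr (real n * real_of_int j)"
      using assms(3) by (simp add: c_def of_rat_power_int norm_power_int powr_real_of_int'[symmetric] mult.commute)
    ultimately have "cmod z = real q powr (real n * real_of_int j) * real q powr (real (n * 2) * real_of_int m / 2)"
      using c0 assms(3) by (simp add: norm_divide divide_eq_eq mult.commute)
    then show ?thesis by (simp add: powr_add[symmetric] algebra_simps)
  qed
  moreover have "G \<noteq> 0"
    unfolding G_def using F(1) c0 by (simp add: pcompose_eq_0_iff)
  moreover have "rpoly G ((s powi j * x) ^ (n * 2)) = 0"
    using F(2) c0 by (simp add: ev pw)
  ultimately show ?thesis unfolding has_weight_def using n(1) by (intro exI[of _ "n * 2"]) auto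
qed

section \<open>Evaluation rules for linear maps with explicit scalar multiplications\<close>

lemma linear_addD: "Vector_Spaces.linear s1 s2 f \<Longrightarrow> f (x + y) = f x + f y"
  and linear_scaleD: "Vector_Spaces.linear s1 s2 f \<Longrightarrow> f (s1 c x) = s2 c (f x)"
  by (simp_all add: Vector_Spaces.linear_iff)

lemma linear_zeroD: "Vector_Spaces.linear s1 s2 f \<Longrightarrow> f 0 = 0"
  by (metis add_cancel_right_right linear_addD)

lemma linear_diffD: "Vector_Spaces.linear s1 s2 f \<Longrightarrow> f (x - y) = f x - f y"
  by (metis add_diff_cancel diff_add_cancel linear_addD)

lemma linear_sumD: "Vector_Spaces.linear s1 s2 f \<Longrightarrow> f (\<Sum>i\<in>I. g i) = (\<Sum>i\<in>I. f (g i))"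
  by (induction I rule: infinite_finite_induct) (simp_all add: linear_zeroD linear_addD)

lemmas linearD = linear_addD linear_scaleD linear_zeroD linear_diffD linear_sumD

lemma linear_funpow: "vector_space s \<Longrightarrow> Vector_Spaces.linear s s f \<Longrightarrow> Vector_Spaces.linear s s (f ^^ n)"
  by (induction n) (auto simp: Vector_Spaces.linear_iff)

section \<open>Comaximal polynomials\<close>

text \<open>The Bezout identity itself is the definition, because its two coefficients are what the
  later constructions work with.\<close>

definition comaximal :: "'a::comm_ring_1 \<Rightarrow> 'a \<Rightarrow> bool" where
  "comaximal a b \<longleftrightarrow> (\<exists>u v. u * a + v * b = 1)"

lemma comaximal_sym: "comaximal a b \<Longrightarrow> comaximal b a"
  unfolding comaximal_def by (metis add.commute)

lemma comaximal_mult: 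
  assumes "comaximal a b" "comaximal a c" shows "comaximal a (b * c)"
proof -
  from assms obtain u v u' v' where *: "u * a + v * b = 1" "u' * a + v' * c = 1"
    unfolding comaximal_def by blast
  have "(u * (u' * a + v' * c) + v * b * u') * a + (v * v') * (b * c) = (u * a + v * b) * (u' * a + v' * c)"
    by (simp add: algebra_simps)
  then show ?thesis unfolding comaximal_def * by (metis mult_1)
qed

lemma comaximal_power: "comaximal a b \<Longrightarrow> comaximal a (b ^ n)"
proof (induction n)
  case 0 show ?case unfolding comaximal_def by (intro exI[of _ 0] exI[of _ 1]) simp
qed (simp add: comaximal_mult)

lemma comaximal_prod: "(\<And>i. i \<in> I \<Longrightarrow> comaximal a (b i)) \<Longrightarrow> comaximal a (\<Prod>i\<in>I. b i)"
  using comaximal_power[of a _ 0]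
proof (induction I rule: infinite_finite_induct)
  case (insert i I)
  then show ?case by (simp add: comaximal_mult)
qed (simp_all add: comaximal_def, (rule exI[of _ 0], rule exI[of _ 1], simp)+)

lemma comaximal_linear:
  fixes c d :: "'a::field"
  assumes "c \<noteq> d" shows "comaximal ([:-c, 1:] ^ n) ([:-d, 1:] ^ m)"
proof -
  have "[:inverse (d - c):] * [:-c, 1:] + [:- inverse (d - c):] * [:-d, 1:] = (1 :: 'a poly)"
    using left_inverse[of "d - c"] assms by (simp add: one_pCons algebra_simps)
  then have "comaximal [:-c, 1:] [:-d, 1:]" unfolding comaximal_def by blast
  then show ?thesis by (intro comaximal_power comaximal_sym[OF comaximal_power[OF comaximal_sym]])
qed

lemma comaximal_dvd:
  assumes "comaximal a b" "a dvd p" "b dvd p" shows "a * b dvd p"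
proof -
  from assms(1) obtain u v where uv: "u * a + v * b = 1" unfolding comaximal_def by blast
  obtain k where k: "p = a * k" using assms(2) by (rule dvdE)
  obtain l where l: "p = b * l" using assms(3) by (rule dvdE)
  have "p = u * a * p + v * b * p" using arg_cong[OF uv, of "\<lambda>x. x * p"] by (simp add: algebra_simps)
  also have "u * a * p = a * b * (u * l)" by (subst l) (simp add: algebra_simps)
  also have "v * b * p = a * b * (v * k)" by (subst k) (simp add: algebra_simps)
  finally have "p = a * b * (u * l + v * k)" by (simp add: algebra_simps)
  then show ?thesis by (rule dvdI)
qed

lemma linear_powers_prod_dvd:
  fixes p :: "'a::field poly"
  assumes "finite C" "\<And>c. c \<in> C \<Longrightarrow> [:-c, 1:] ^ n dvd p"
  shows "(\<Prod>c\<in>C. [:-c, 1:] ^ n) dvd p"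
  using assms
proof (induction C)
  case (insert c C)
  have "comaximal ([:-c, 1:] ^ n) (\<Prod>c\<in>C. [:-c, 1:] ^ n)"
    using insert.hyps by (intro comaximal_prod comaximal_linear) auto
  then show ?case using insert by (simp add: comaximal_dvd)
qed simp

text \<open>A Chinese remainder statement. Exponent 1 yields the Lagrange polynomials, higher
  exponents the polynomials behind the Jordan decomposition.\<close>

lemma interpolation_mod_powers:
  fixes g :: "'a::field \<Rightarrow> 'a"
  assumes "finite C"
  shows "\<exists>h. \<forall>c\<in>C. [:-c, 1:] ^ n dvd h - [:g c:]"
  using assms
proof (induction C)
  case (insert c C)
  then obtain h where h: "\<And>d. d \<in> C \<Longrightarrow> [:-d, 1:] ^ n dvd h - [:g d:]" by blast
  define r where "r = (\<Prod>d\<in>C. [:-d, 1:] ^ n)"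
  have "comaximal ([:-c, 1:] ^ n) r"
    unfolding r_def using insert.hyps by (intro comaximal_prod comaximal_linear) auto
  then obtain u v where uv: "u * [:-c, 1:] ^ n + v * r = 1" unfolding comaximal_def by blast
  \<comment> \<open>\<open>v * r\<close> is 1 modulo the new factor and 0 modulo the old ones; for
    \<open>u * [:-c, 1:] ^ n\<close> it is the other way round.\<close>
  define k where "k = [:g c:] * (v * r) + h * (u * [:-c, 1:] ^ n)"
  have "k - [:g c:] = [:-c, 1:] ^ n * (u * (h - [:g c:]))"
    unfolding k_def using arg_cong[OF uv, of "\<lambda>x. [:g c:] * x"] by (simp add: algebra_simps)
  moreover have "[:-d, 1:] ^ n dvd k - [:g d:]" if "d \<in> C" for d
  proof -
    have "k - [:g d:] = (h - [:g d:]) + r * (v * ([:g c:] - h))"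
      unfolding k_def using arg_cong[OF uv, of "\<lambda>x. h * x"] by (simp add: algebra_simps)
    moreover have "[:-d, 1:] ^ n dvd r" unfolding r_def using insert.hyps(1) that by (rule dvd_prodI)
    ultimately show ?thesis using h[OF that] by (simp only: dvd_add dvd_mult2)
  qed
  ultimately show ?case by (intro exI[of _ k]) (auto simp: dvd_triv_left)
qed simp

section \<open>Polynomials in an endomorphism\<close>

locale vspace = vector_space scale
  for scale :: "'a::{alg_closed_field,field_char_0} \<Rightarrow> 'b::ab_group_add \<Rightarrow> 'b" (infixr "\<cdot>" 75)
begin

abbreviation lin :: "('b \<Rightarrow> 'b) \<Rightarrow> bool" where "lin \<equiv> Vector_Spaces.linear scale scale"

lemma linI: "(\<And>x y. f (x + y) = f x + f y) \<Longrightarrow> (\<And>c x. f (c \<cdot> x) = c \<cdot> f x) \<Longrightarrow> lin f"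
  using vector_space_axioms by (simp add: Vector_Spaces.linear_iff)

lemmas linD = linearD[where ?s1.0 = scale and ?s2.0 = scale]

lemma lin_id [simp]: "lin (\<lambda>x. x)" and lin_zero [simp]: "lin (\<lambda>x. 0)" and lin_scale [simp]: "lin (\<lambda>x. c \<cdot> x)"
  by (intro linI; simp add: algebra_simps)+

lemma lin_compose: "lin f \<Longrightarrow> lin g \<Longrightarrow> lin (\<lambda>x. f (g x))"
  and lin_add: "lin f \<Longrightarrow> lin g \<Longrightarrow> lin (\<lambda>x. f x + g x)"
  and lin_diff: "lin f \<Longrightarrow> lin g \<Longrightarrow> lin (\<lambda>x. f x - g x)"
  and lin_smult: "lin f \<Longrightarrow> lin (\<lambda>x. c \<cdot> f x)"
  by (intro linI; simp add: linD algebra_simps)+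

lemma lin_pow: "lin f \<Longrightarrow> lin (f ^^ n)"
  using vector_space_axioms by (rule linear_funpow)

lemma lin_sum: "(\<And>i. i \<in> I \<Longrightarrow> lin (f i)) \<Longrightarrow> lin (\<lambda>x. \<Sum>i\<in>I. f i x)"
  by (intro linI) (simp_all add: linD sum.distrib scale_sum_right)

lemma lin_eq_on_span:
  assumes "lin f" "lin g" "span S = UNIV" "\<And>x. x \<in> S \<Longrightarrow> f x = g x" shows "f = g"
proof
  fix x
  have "x \<in> span S" using assms(3) by simp
  then show "f x = g x" by (induction rule: span_induct_alt) (simp_all add: assms linD)
qed

text \<open>The action of the polynomial ring on the space through \<open>f\<close>. It is written
  out, since endomorphisms do not form a commutative ring in which \<open>poly\<close> could
  evaluate.\<close>

definition pev :: "'a poly \<Rightarrow> ('b \<Rightarrow> 'b) \<Rightarrow> 'b \<Rightarrow> 'b" where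
  "pev p f v = (\<Sum>i\<le>degree p. coeff p i \<cdot> (f ^^ i) v)"

lemma pev_upto: "degree p \<le> n \<Longrightarrow> pev p f v = (\<Sum>i\<le>n. coeff p i \<cdot> (f ^^ i) v)"
  unfolding pev_def by (rule sum.mono_neutral_left) (auto simp: coeff_eq_0)

lemma pev_0 [simp]: "pev 0 f v = 0"
  by (simp add: pev_def)

lemma pev_pCons [simp]: "pev (pCons a p) f v = a \<cdot> v + pev p f (f v)"
proof -
  have "pev (pCons a p) f v = (\<Sum>i\<le>Suc (degree p). coeff (pCons a p) i \<cdot> (f ^^ i) v)"
    by (rule pev_upto) (simp add: degree_pCons_le)
  also have "\<dots> = a \<cdot> v + (\<Sum>i\<le>degree p. coeff p i \<cdot> (f ^^ Suc i) v)"
    by (subst sum.atMost_Suc_shift) simp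
  also have "\<dots> = a \<cdot> v + pev p f (f v)" by (simp only: pev_def funpow_Suc_right o_apply)
  finally show ?thesis .
qed

lemma pev_add [simp]: "pev (p + q) f v = pev p f v + pev q f v"
  by (induction p q arbitrary: v rule: poly_induct2) (simp_all add: algebra_simps)

lemma pev_smult [simp]: "pev (smult a p) f v = a \<cdot> pev p f v"
  by (induction p arbitrary: v) (simp_all add: algebra_simps)

lemma pev_minus [simp]: "pev (- p) f v = - pev p f v"
  using pev_smult[of "-1" p f v] by simp

lemma pev_diff [simp]: "pev (p - q) f v = pev p f v - pev q f v"
  using pev_add[of p "- q" f v] by simp

lemma pev_1 [simp]: "pev 1 f v = v"
  by (simp add: one_pCons)

lemma lin_pev [simp]: "lin f \<Longrightarrow> lin (pev p f)"
proof (induction p)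
  case 0 show ?case by (intro linI) simp_all
next
  case (pCons a p)
  then show ?case by (intro linI) (simp_all add: linD algebra_simps)
qed

lemma pev_commute:
  assumes "lin g" "\<And>v. g (f v) = f (g v)" shows "pev p f (g v) = g (pev p f v)"
  using assms(1) by (induction p arbitrary: v) (simp_all add: linD assms(2)[symmetric])

lemma pev_mult: "lin f \<Longrightarrow> pev (p * q) f v = pev p f (pev q f v)"
proof (induction p arbitrary: v)
  case (pCons a p)
  then show ?case using pev_commute[of f f q] by simp
qed simp

lemma pev_mult_commute: "lin f \<Longrightarrow> pev p f (pev q f v) = pev q f (pev p f v)"
  by (simp add: pev_mult[symmetric] mult.commute)

lemma pev_monom [simp]: "pev (monom a n) f v = a \<cdot> (f ^^ n) v"
  by (induction n arbitrary: v) (simp_all add: monom_0 monom_Suc funpow_swap1)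

lemma pev_sum: "pev (\<Sum>i\<in>I. p i) f v = (\<Sum>i\<in>I. pev (p i) f v)"
  by (induction I rule: infinite_finite_induct) simp_all

lemma pev_dvd: "lin f \<Longrightarrow> p dvd q \<Longrightarrow> pev p f v = 0 \<Longrightarrow> pev q f v = 0"
  by (auto elim!: dvdE simp: mult.commute[of p] pev_mult linD)

lemma pev_eigen: "lin f \<Longrightarrow> f v = c \<cdot> v \<Longrightarrow> pev p f v = poly p c \<cdot> v"
  by (induction p) (simp_all add: linD[OF lin_pev] algebra_simps)

lemma pev_linear_power: "lin f \<Longrightarrow> pev ([:-c, 1:] ^ n) f v = ((\<lambda>x. f x - c \<cdot> x) ^^ n) v"
proof (induction n arbitrary: v)
  case (Suc n)
  have "pev ([:-c, 1:] ^ Suc n) f v = pev ([:-c, 1:] ^ n) f (pev [:-c, 1:] f v)"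
    using Suc.prems by (simp only: power_Suc2 pev_mult)
  also have "pev [:-c, 1:] f v = f v - c \<cdot> v" by simp
  finally show ?case using Suc by (simp add: funpow_Suc_right del: funpow.simps(2))
qed simp

text \<open>More iterates of \<open>v\<close> than a spanning set has elements are linearly
  dependent, and a dependence is an annihilating polynomial. Coinciding iterates are treated apart
  because a set of vectors would merge them.\<close>

lemma vector_annihilator:
  assumes "finite B" "span B = UNIV"
  shows "\<exists>p. p \<noteq> 0 \<and> pev p f v = 0"
proof (cases "inj_on (\<lambda>i. (f ^^ i) v) {..card B}")
  case False
  then obtain i j where ij: "i \<noteq> j" "(f ^^ i) v = (f ^^ j) v" by (auto simp: inj_on_def)
  have "monom (1::'a) i - monom 1 j \<noteq> 0"
    using ij(1) by (metis coeff_monom diff_0_right eq_iff_diff_eq_0 zero_neq_one)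
  then show ?thesis using ij(2) by (intro exI[of _ "monom 1 i - monom 1 j"]) simp
next
  case True
  let ?S = "(\<lambda>i. (f ^^ i) v) ` {..card B}"
  have "card ?S = Suc (card B)" using True by (simp add: card_image)
  then have "dependent ?S" using independent_span_bound[OF assms(1), of ?S] assms(2) by auto
  then obtain u where u: "\<exists>x\<in>?S. u x \<noteq> 0" "(\<Sum>x\<in>?S. u x \<cdot> x) = 0"
    by (subst (asm) dependent_finite) auto
  define p where "p = (\<Sum>i\<le>card B. monom (u ((f ^^ i) v)) i)"
  have "pev p f v = 0"
    using u(2) by (simp add: p_def pev_sum sum.reindex[OF True])
  moreover have "p \<noteq> 0"
  proof -
    from u(1) obtain i where "i \<le> card B" "u ((f ^^ i) v) \<noteq> 0" by auto
    then have "coeff p i \<noteq> 0" by (simp add: p_def coeff_sum)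
    then show ?thesis by auto
  qed
  ultimately show ?thesis by blast
qed

text \<open>The product of annihilators of the generators kills each generator, hence by linearity
  everything.\<close>

lemma annihilator:
  assumes "finite B" "span B = UNIV" "lin f"
  obtains p where "p \<noteq> 0" "\<And>v. pev p f v = 0"
proof -
  obtain p where p: "\<And>b. p b \<noteq> 0 \<and> pev (p b) f b = 0"
    using vector_annihilator[OF assms(1,2)] by metis
  define P where "P = (\<Prod>b\<in>B. p b)"
  have P0: "P \<noteq> 0" unfolding P_def using p assms(1) by simp
  have base: "pev P f b = 0" if "b \<in> B" for b
    by (rule pev_dvd[OF assms(3), of "p b"]) (use p that assms(1) in \<open>simp_all add: P_def dvd_prodI\<close>)
  have "pev P f v = 0" for v
  proof -
    have "v \<in> span B" using assms(2) by simp
    then show ?thesis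
    proof (induction rule: span_induct_alt)
      case (step c x y)
      then show ?case using base[of x] by (simp add: linD[OF lin_pev[OF assms(3)]])
    qed (simp add: linD[OF lin_pev[OF assms(3)]])
  qed
  then show ?thesis using that[of P] P0 by blast
qed

text \<open>One exponent for all roots is the shape that the interpolation lemma expects. The number
  of roots with multiplicity bounds it, and the successor ensures \<open>n > 0\<close> in every
  case.\<close>

lemma split_annihilator:
  assumes "finite B" "span B = UNIV" "lin f"
  obtains C n where "finite C" "n > 0" "\<And>v. pev (\<Prod>c\<in>C. [:-c, 1:] ^ n) f v = 0"
proof -
  obtain p where p: "p \<noteq> 0" "\<And>v. pev p f v = 0" using annihilator[OF assms] by blast
  obtain A where A: "p = smult (lead_coeff p) (\<Prod>x\<in>#A. [:-x, 1:])"
    using alg_closed_imp_factorization[OF p(1)] by blast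
  define n where "n = Suc (size A)"
  have "(\<Prod>x\<in>#A'. [:-x, 1:]) dvd (\<Prod>c\<in>set_mset A. [:-c, 1:]) ^ size A'" if "A' \<subseteq># A" for A' :: "'a multiset"
    using that
  proof (induction A')
    case (add x A')
    then have x: "x \<in># A" "A' \<subseteq># A" by (auto simp: insert_subset_eq_iff intro: subset_mset.order_trans[OF _ diff_subset_eq_self])
    have "[:-x, 1:] dvd (\<Prod>c\<in>set_mset A. [:-c, 1:])" using x(1) by (intro dvd_prodI) auto
    then show ?case using add.IH[OF x(2)] by (simp add: mult_dvd_mono del: mult_pCons_left)
  qed simp
  from this[of A] have "p dvd (\<Prod>c\<in>set_mset A. [:-c, 1:]) ^ size A"
    by (subst A) (use p(1) in \<open>simp add: smult_dvd_iff\<close>)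
  also have "\<dots> dvd (\<Prod>c\<in>set_mset A. [:-c, 1:]) ^ n" by (simp add: n_def le_imp_power_dvd)
  finally have "p dvd (\<Prod>c\<in>set_mset A. [:-c, 1:] ^ n)" by (simp add: prod_power_distrib)
  then show ?thesis using that[of "set_mset A" n] pev_dvd[OF assms(3) _ p(2)] by (simp add: n_def)
qed

end

section \<open>Spectral projections and the Jordan decomposition\<close>

lemma funpow_comp_commute:
  assumes "f \<circ> g = g \<circ> f" shows "(f ^^ m) \<circ> (g ^^ m) = (f \<circ> g) ^^ m"
proof (induction m)
  case (Suc m)
  have *: "f ((g ^^ m) x) = (g ^^ m) (f x)" for x
    by (induction m arbitrary: x) (use fun_cong[OF assms] in auto)
  show ?case
  proof
    fix x
    have "((f ^^ Suc m) \<circ> (g ^^ Suc m)) x = (f ^^ m) (f ((g ^^ m) (g x)))"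
      by (simp add: funpow_Suc_right del: funpow.simps(2))
    also have "\<dots> = ((f ^^ m) \<circ> (g ^^ m)) ((f \<circ> g) x)" by (simp add: *)
    also have "\<dots> = ((f \<circ> g) ^^ m) ((f \<circ> g) x)" unfolding Suc ..
    finally show "((f ^^ Suc m) \<circ> (g ^^ Suc m)) x = ((f \<circ> g) ^^ Suc m) x"
      by (simp add: funpow_Suc_right del: funpow.simps(2))
  qed
qed simp

text \<open>The polynomial \<open>h c\<close> is provided for every \<open>c\<close>: outside
  \<open>C\<close> it vanishes on all of \<open>C\<close> and so gives the zero projection. Later
  uses need not ask whether \<open>c\<close> is an eigenvalue.\<close>

lemma lagrange_polynomials:
  fixes C :: "'a::field set"
  assumes "finite C"
  obtains h where "\<And>c d. d \<in> C \<Longrightarrow> poly (h c) d = (if d = c then 1 else 0)"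
proof -
  have "\<exists>h. \<forall>d\<in>C. poly h d = (if d = c then 1 else 0)" for c
  proof -
    from interpolation_mod_powers[OF assms, of 1 "\<lambda>d. if d = c then 1 else 0"]
    obtain h where h: "\<And>d. d \<in> C \<Longrightarrow> [:-d, 1:] dvd h - [:if d = c then 1 else 0:]" by auto
    have "poly h d = (if d = c then 1 else 0)" if "d \<in> C" for d
      using h[OF that] by (auto simp: poly_eq_0_iff_dvd[symmetric])
    then show ?thesis by blast
  qed
  then obtain h where "\<And>c. \<forall>d\<in>C. poly (h c) d = (if d = c then 1 else 0)" by metis
  then show ?thesis using that[of h] by simp
qed

context vspace begin

definition eig :: "('b \<Rightarrow> 'b) \<Rightarrow> 'a \<Rightarrow> 'b set" where
  "eig f c = {v. f v = c \<cdot> v}"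

lemma eigD: "v \<in> eig f c \<Longrightarrow> f v = c \<cdot> v"
  by (simp add: eig_def)

lemma subspace_eig: "lin f \<Longrightarrow> subspace (eig f c)"
  by (rule subspaceI) (auto simp: eig_def linD algebra_simps)

lemma diagonalizable_lin: "diagonalizable scale f \<Longrightarrow> lin f"
  by (simp add: diagonalizable_def)

lemma diagonalizable_ext:
  assumes "diagonalizable scale t" "lin f" "lin g" "\<And>c x. x \<in> eig t c \<Longrightarrow> f x = g x"
  shows "f = g"
  by (rule lin_eq_on_span[where S = "{v. \<exists>c. t v = c \<cdot> v}"])
    (use assms in \<open>auto simp: diagonalizable_def eig_def\<close>)

lemma diagonalizable_ext_pair:
  assumes "diagonalizable scale t" "Vector_Spaces.linear scale s' f" "Vector_Spaces.linear scale s' g"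
    "\<And>c x. x \<in> eig t c \<Longrightarrow> f x = g x"
  shows "f x = g x"
proof -
  have "x \<in> span {v. \<exists>c. t v = c \<cdot> v}" using assms(1) by (simp add: diagonalizable_def)
  then show ?thesis
  proof (induction rule: span_induct_alt)
    case (step c x y)
    then obtain d where "x \<in> eig t d" by (auto simp: eig_def)
    from assms(4)[OF this] step show ?case
      by (simp add: linear_addD[OF assms(2)] linear_addD[OF assms(3)]
         linear_scaleD[OF assms(2)] linear_scaleD[OF assms(3)])
  qed (simp add: linear_zeroD[OF assms(2)] linear_zeroD[OF assms(3)])
qed

text \<open>The values of the Lagrange polynomials at a diagonalizable map are its spectral projections.\<close>

definition spectral :: "('b \<Rightarrow> 'b) \<Rightarrow> 'a set \<Rightarrow> ('a \<Rightarrow> 'a poly) \<Rightarrow> bool" where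
  "spectral t C h \<longleftrightarrow> diagonalizable scale t \<and> finite C \<and> (\<forall>c. c \<notin> C \<longrightarrow> eig t c = {0}) \<and>
     (\<forall>c d. d \<in> C \<longrightarrow> poly (h c) d = (if d = c then 1 else 0))"

context
  fixes t C h assumes sp: "spectral t C h"
begin

lemma spectral_diag: "diagonalizable scale t" and spectral_lin: "lin t" and spectral_finite: "finite C"
  and spectral_outside: "c \<notin> C \<Longrightarrow> eig t c = {0}"
  using sp by (auto simp: spectral_def diagonalizable_def)

lemma lin_spectral_proj: "lin (pev (h c) t)"
  by (simp add: spectral_lin)

lemma spectral_proj_eig: "x \<in> eig t d \<Longrightarrow> pev (h c) t x = (if d = c then x else 0)"
  using sp by (cases "d \<in> C") (auto simp: spectral_def pev_eigen[OF spectral_lin eigD] pev_eigen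
      linD[OF lin_spectral_proj] split: if_splits)

lemma spectral_proj_in: "pev (h c) t v \<in> eig t c"
proof -
  have "(\<lambda>v. t (pev (h c) t v)) = (\<lambda>v. c \<cdot> pev (h c) t v)"
  proof (rule diagonalizable_ext[OF spectral_diag])
    fix d x assume "x \<in> eig t d"
    then show "t (pev (h c) t x) = c \<cdot> pev (h c) t x"
      by (auto simp: spectral_proj_eig linD[OF spectral_lin] eigD)
  qed (rule lin_compose[OF spectral_lin lin_spectral_proj] lin_smult[OF lin_spectral_proj])+
  from fun_cong[OF this] show ?thesis by (simp add: eig_def)
qed

lemma spectral_proj_sum: "(\<Sum>c\<in>C. pev (h c) t v) = v"
proof -
  have "(\<lambda>v. \<Sum>c\<in>C. pev (h c) t v) = (\<lambda>v. v)"
  proof (rule diagonalizable_ext[OF spectral_diag])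
    fix d x assume x: "x \<in> eig t d"
    show "(\<Sum>c\<in>C. pev (h c) t x) = x"
    proof (cases "d \<in> C")
      case True
      then show ?thesis using x spectral_finite by (simp add: spectral_proj_eig sum.delta)
    next
      case False
      then show ?thesis using x spectral_outside[of d] by (simp add: linD[OF lin_spectral_proj])
    qed
  qed (rule lin_sum lin_spectral_proj lin_id)+
  then show ?thesis by (rule fun_cong)
qed

end

text \<open>Modulo an annihilator with simple roots the Lagrange polynomials add up to 1, and
  \<open>(X - c) * h c\<close> is 0. So every vector is a sum of eigenvectors.\<close>

lemma spectral_if_annihilated:
  assumes f: "lin f" and C: "finite C" and ann: "\<And>v. pev (\<Prod>c\<in>C. [:-c, 1:]) f v = 0"
  shows "diagonalizable scale f"
proof -
  obtain h where h: "\<And>c d. d \<in> C \<Longrightarrow> poly (h c) d = (if d = c then 1 else 0)"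
    using lagrange_polynomials[OF C] by blast
  have kill: "pev p f v = 0" if "\<And>c. c \<in> C \<Longrightarrow> poly p c = 0" for p v
  proof (rule pev_dvd[OF f _ ann])
    have "(\<Prod>c\<in>C. [:-c, 1:] ^ 1) dvd p"
      by (rule linear_powers_prod_dvd[OF C]) (use that in \<open>simp add: poly_eq_0_iff_dvd[symmetric]\<close>)
    then show "(\<Prod>c\<in>C. [:-c, 1:]) dvd p" by simp
  qed
  have "v \<in> span {v. \<exists>c. f v = c \<cdot> v}" for v
  proof -
    have "pev ([:-c, 1:] * h c) f v = 0" for c
      by (rule kill) (auto simp: h simp del: mult_pCons_left)
    then have "f (pev (h c) f v) = c \<cdot> pev (h c) f v" for c by (simp add: pev_mult[OF f] del: mult_pCons_left)
    then have "(\<Sum>c\<in>C. pev (h c) f v) \<in> span {v. \<exists>c. f v = c \<cdot> v}"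
      by (intro span_sum span_base) auto
    moreover have "pev ((\<Sum>c\<in>C. h c) - 1) f v = 0"
      by (rule kill) (simp add: poly_sum h C sum.delta)
    ultimately show ?thesis by (simp add: pev_sum)
  qed
  then show ?thesis using f by (auto simp: diagonalizable_def)
qed

lemma pev_pcompose: 
  assumes "lin f" shows "pev (pcompose p h) f v = pev p (pev h f) v"
proof (induction p)
  case (pCons a p)
  then show ?case using pev_commute[of "pev h f" "pev h f" p v] assms
    by (simp add: pcompose_pCons pev_mult)
qed simp

lemma pev_power: "lin f \<Longrightarrow> pev (p ^ n) f v = (pev p f ^^ n) v"
  by (induction n) (simp_all add: pev_mult)

lemma spectral_exists_on:
  assumes "diagonalizable scale t" "finite C" "\<And>c. c \<notin> C \<Longrightarrow> eig t c = {0}"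
    and "\<And>c d. d \<in> C \<Longrightarrow> poly (h c) d = (if d = c then 1 else 0)"
  shows "spectral t C h"
  using assms by (simp add: spectral_def)

lemma finite_eigenvalues:
  assumes fin: "\<exists>B. finite B \<and> span B = UNIV" and "lin t"
  shows "finite {c. eig t c \<noteq> {0}}"
proof -
  obtain B where "finite B" "span B = UNIV" using fin by blast
  from annihilator[OF this assms(2)] obtain p where p: "p \<noteq> 0" "\<And>v. pev p t v = 0" by blast
  have "poly p c = 0" if "eig t c \<noteq> {0}" for c
  proof -
    have "0 \<in> eig t c" using subspace_0[OF subspace_eig[OF assms(2)]] .
    with that obtain x where "x \<in> eig t c" "x \<noteq> 0" by blast
    then show ?thesis using pev_eigen[OF assms(2) eigD[OF \<open>x \<in> eig t c\<close>], of p] p(2)[of x] by simp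
  qed
  then have "{c. eig t c \<noteq> {0}} \<subseteq> {c. poly p c = 0}" by blast
  then show ?thesis using poly_roots_finite[OF p(1)] finite_subset by blast
qed

lemma spectral_exists:
  assumes fin: "\<exists>B. finite B \<and> span B = UNIV" and "diagonalizable scale t"
  shows "\<exists>C h. spectral t C h"
proof -
  have C: "finite {c. eig t c \<noteq> {0}}" using finite_eigenvalues[OF fin diagonalizable_lin[OF assms(2)]] .
  obtain h where "\<And>c d. d \<in> {c. eig t c \<noteq> {0}} \<Longrightarrow> poly (h c) d = (if d = c then 1 else 0)"
    by (rule lagrange_polynomials[OF C]) blast
  from spectral_exists_on[OF assms(2) C _ this] show ?thesis by blast
qed

section \<open>The multiplicative Jordan decomposition: existence, powers, functoriality\<close>

definition jordan :: "('b \<Rightarrow> 'b) \<Rightarrow> ('b \<Rightarrow> 'b) \<Rightarrow> ('b \<Rightarrow> 'b) \<Rightarrow> bool" where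
  "jordan f s u \<longleftrightarrow> nilpotent_map scale (\<lambda>v. u v - v) \<and> diagonalizable scale s \<and> s \<circ> u = f \<and> u \<circ> s = f"

lemma jordanD:
  assumes "jordan f s u"
  shows "lin s" "lin u" "lin f" "s (u v) = f v" "u (s v) = f v" "diagonalizable scale s"
proof -
  show s: "lin s" "diagonalizable scale s" and "s (u v) = f v" "u (s v) = f v"
    using assms by (auto simp: jordan_def diagonalizable_def fun_eq_iff)
  have "lin (\<lambda>v. u v - v)" using assms by (simp add: jordan_def nilpotent_map_def)
  from lin_add[OF this lin_id] show u: "lin u" by simp
  show "lin f" using lin_compose[OF s(1) u] assms by (auto simp: jordan_def o_def)
qed

text \<open>The eigenspaces of \<open>s\<close> are the generalized eigenspaces of \<open>f\<close>,
  so \<open>f\<close> alone determines \<open>s\<close>. Uniqueness and compatibility with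
  intertwining maps both rest on this.\<close>

lemma jordan_eig_iff:
  assumes fin: "\<exists>B. finite B \<and> span B = UNIV" and J: "jordan f s u"
  shows "v \<in> eig s c \<longleftrightarrow> (\<exists>n. pev ([:-c, 1:] ^ n) f v = 0)"
proof
  note lin = jordanD(1-3)[OF J]
  obtain n where n: "\<And>v. ((\<lambda>v. u v - v) ^^ n) v = 0"
    using J by (auto simp: jordan_def nilpotent_map_def)
  have nlin: "lin ((\<lambda>v. u v - v) ^^ k)" for k
    by (intro lin_pow lin_diff lin lin_id)
  have kill: "pev ([:-c, 1:] ^ n) f v = 0" if v: "v \<in> eig s c" for v c
  proof -
    \<comment> \<open>On this eigenspace \<open>f - c\<close> is \<open>c\<close> times the
      nilpotent map \<open>u - 1\<close>.\<close>
    have "((\<lambda>x. f x - c \<cdot> x) ^^ k) v = (c ^ k) \<cdot> ((\<lambda>v. u v - v) ^^ k) v" for k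
      using v
    proof (induction k arbitrary: v)
      case (Suc k)
      have "s (u v) = c \<cdot> u v" using jordanD(4,5)[OF J, of v] Suc.prems by (simp add: eig_def linD lin)
      then have "u v - v \<in> eig s c" using Suc.prems by (simp add: eig_def linD lin algebra_simps)
      moreover have "f v - c \<cdot> v = c \<cdot> (u v - v)"
        using jordanD(5)[OF J, of v] Suc.prems by (simp add: eig_def linD lin algebra_simps)
      ultimately have "((\<lambda>x. f x - c \<cdot> x) ^^ Suc k) v = ((\<lambda>x. f x - c \<cdot> x) ^^ k) (c \<cdot> (u v - v))"
        by (simp add: funpow_Suc_right del: funpow.simps(2))
      also have "\<dots> = c \<cdot> ((\<lambda>x. f x - c \<cdot> x) ^^ k) (u v - v)"
        using linD(2)[OF lin_pow[OF lin_diff[OF lin(3) lin_scale]]] by blast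
      also have "\<dots> = (c ^ Suc k) \<cdot> ((\<lambda>v. u v - v) ^^ Suc k) v"
        using Suc.IH[OF \<open>u v - v \<in> eig s c\<close>] by (simp add: funpow_Suc_right del: funpow.simps(2))
      finally show ?case .
    qed simp
    from this[of n] show ?thesis using n by (simp add: pev_linear_power[OF lin(3)])
  qed
  show "\<exists>n. pev ([:-c, 1:] ^ n) f v = 0" if "v \<in> eig s c" using kill[OF that] by blast
  show "v \<in> eig s c" if "\<exists>n. pev ([:-c, 1:] ^ n) f v = 0"
  proof -
    from that obtain m where m: "pev ([:-c, 1:] ^ m) f v = 0" by blast
    obtain C h where sp: "spectral s C h"
      using spectral_exists[OF fin jordanD(6)[OF J]] by blast
    note slin = lin_spectral_proj[OF sp]
    \<comment> \<open>The component in another eigenspace of \<open>s\<close> is killed by powers of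
      both \<open>f - c\<close> and \<open>f - d\<close>, and these powers are comaximal.\<close>
    have zero: "pev (h d) s v = 0" if "d \<noteq> c" for d
    proof -
      define y where "y = pev (h d) s v"
      have sf: "s (f x) = f (s x)" for x using jordanD(4,5)[OF J] by metis
      have "pev ([:-c, 1:] ^ m) f y = pev (h d) s (pev ([:-c, 1:] ^ m) f v)"
        unfolding y_def
        by (rule pev_commute[OF slin]) (rule pev_commute[where g = f and f = s, OF lin(3) sf[symmetric]])
      then have 1: "pev ([:-c, 1:] ^ m) f y = 0" by (simp add: m linD[OF slin])
      have 2: "pev ([:-d, 1:] ^ n) f y = 0"
        using kill[OF spectral_proj_in[OF sp, of d v]] by (simp add: y_def)
      obtain a b where "a * [:-c, 1:] ^ m + b * [:-d, 1:] ^ n = 1"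
        using comaximal_linear[of c d m n] \<open>d \<noteq> c\<close> unfolding comaximal_def by blast
      then have "y = pev (a * [:-c, 1:] ^ m + b * [:-d, 1:] ^ n) f y" by simp
      also have "\<dots> = 0" by (simp only: pev_add pev_mult[OF lin(3)] 1 2 linD[OF lin_pev[OF lin(3)]]) simp
      finally show ?thesis by (simp add: y_def)
    qed
    have "v = (\<Sum>d\<in>C. pev (h d) s v)" by (rule spectral_proj_sum[OF sp, symmetric])
    also have "\<dots> \<in> eig s c"
      using zero spectral_proj_in[OF sp, of c] 
      by (intro subspace_sum subspace_eig lin) (metis subspace_0[OF subspace_eig[OF lin(1)]])
    finally show ?thesis .
  qed
qed


text \<open>Both factors are polynomials in \<open>f\<close>: with \<open>h\<close> congruent to
  \<open>c\<close> and \<open>k\<close> to \<open>1 / c\<close> modulo \<open>(X - c) ^ n\<close>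
  for every root \<open>c\<close>, take \<open>s = h(f)\<close> and
  \<open>u = f k(f)\<close>.\<close>

lemma jordan_exists:
  assumes fin: "\<exists>B. finite B \<and> span B = UNIV" and f: "lin f" and inj: "inj f"
  shows "\<exists>s u. jordan f s u"
proof -
  obtain B where B: "finite B" "span B = UNIV" using fin by blast
  obtain C' n where C': "finite C'" "n > 0" "\<And>v. pev (\<Prod>c\<in>C'. [:-c, 1:] ^ n) f v = 0"
    using split_annihilator[OF B f] by blast
  \<comment> \<open>Since \<open>f\<close> is injective, a factor \<open>X ^ n\<close> can be
    cancelled from the annihilator; the remaining roots are invertible, as \<open>k\<close>
    requires.\<close>
  define C where "C = C' - {0}"
  define P where "P = (\<Prod>c\<in>C. [:-c, 1:] ^ n)"
  have C: "finite C" "0 \<notin> C" using C'(1) by (auto simp: C_def)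
  have P: "pev P f v = 0" for v
  proof (cases "0 \<in> C'")
    case True
    have "(\<Prod>c\<in>C'. [:-c, 1:] ^ n) = [:-0, 1:] ^ n * P"
      unfolding P_def C_def by (rule prod.remove[OF C'(1) True])
    then have "pev ([:-0, 1:] ^ n) f (pev P f v) = 0"
      using C'(3)[of v] by (simp only: pev_mult[OF f])
    then have "(f ^^ n) (pev P f v) = 0"
      unfolding pev_linear_power[OF f] by simp
    moreover have "inj (f ^^ n)" using inj by (rule inj_fn)
    ultimately show ?thesis using linD(3)[OF lin_pow[OF f]] by (metis injD)
  next
    case False
    then show ?thesis using C'(3)[of v] by (simp add: P_def C_def)
  qed
  have kill: "pev p f v = 0" if "\<And>c. c \<in> C \<Longrightarrow> [:-c, 1:] ^ n dvd p" for p v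
    by (rule pev_dvd[OF f _ P]) (use linear_powers_prod_dvd[OF C(1) that] in \<open>simp add: P_def\<close>)
  obtain h where h: "\<And>c. c \<in> C \<Longrightarrow> [:-c, 1:] ^ n dvd h - [:c:]"
    using interpolation_mod_powers[OF C(1), of n "\<lambda>c. c"] by blast
  obtain k where k: "\<And>c. c \<in> C \<Longrightarrow> [:-c, 1:] ^ n dvd k - [:inverse c:]"
    using interpolation_mod_powers[OF C(1), of n inverse] by blast
  define s where "s = pev h f"
  define u where "u = pev (k * [:0, 1:]) f"
  have lin: "lin s" "lin u" by (simp_all add: s_def u_def f)
  have su: "s (u v) = f v" for v
  proof -
    have "pev (h * (k * [:0, 1:]) - [:0, 1:]) f v = 0"
    proof (rule kill)
      fix c assume c: "c \<in> C"
      then have "c \<noteq> 0" using C(2) by auto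
      then have "h * (k * [:0, 1:]) - [:0, 1:] = (h - [:c:]) * (k * [:0, 1:]) + (k - [:inverse c:]) * [:0, c:]"
        by (simp add: algebra_simps)
      then show "[:-c, 1:] ^ n dvd h * (k * [:0, 1:]) - [:0, 1:]"
        using h[OF c] k[OF c] by (simp only: dvd_add dvd_mult2)
    qed
    then show ?thesis by (simp only: pev_diff pev_mult[OF f] s_def u_def) simp
  qed
  have us: "u (s v) = f v" for v
    using su[of v] pev_mult_commute[OF f] by (simp add: s_def u_def)
  have "diagonalizable scale s"
  proof (rule spectral_if_annihilated[OF lin(1) C(1)])
    fix v
    have "pev (pcompose (\<Prod>c\<in>C. [:-c, 1:]) h) f v = 0"
    proof (rule kill)
      fix c assume c: "c \<in> C"
      have "[:-c, 1:] dvd (\<Prod>c\<in>C. [:-c, 1:])" using C(1) c by (rule dvd_prodI)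
      then have "pcompose [:-c, 1:] h dvd pcompose (\<Prod>c\<in>C. [:-c, 1:]) h"
        by (auto elim!: dvdE simp: pcompose_mult simp del: mult_pCons_left pcompose_pCons)
      moreover have "pcompose [:-c, 1:] h = h - [:c:]" by (simp add: pcompose_pCons)
      ultimately have "h - [:c:] dvd pcompose (\<Prod>c\<in>C. [:-c, 1:]) h" by (simp only:)
      with h[OF c] show "[:-c, 1:] ^ n dvd pcompose (\<Prod>c\<in>C. [:-c, 1:]) h" by (rule dvd_trans)
    qed
    then show "pev (\<Prod>c\<in>C. [:-c, 1:]) s v = 0" by (simp add: pev_pcompose[OF f] s_def)
  qed
  moreover have "nilpotent_map scale (\<lambda>v. u v - v)"
  proof -
    have "((\<lambda>v. u v - v) ^^ n) v = 0" for v
    proof -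
      \<comment> \<open>\<open>k * X\<close> is 1 modulo each \<open>X - c\<close>, so the
        \<open>n\<close>-th power of \<open>k * X - 1\<close> is divisible by each
        \<open>(X - c) ^ n\<close>.\<close>
      have "pev ((k * [:0, 1:] - 1) ^ n) f v = 0"
      proof (rule kill)
        fix c assume c: "c \<in> C"
        then have c0: "c \<noteq> 0" using C(2) by auto
        have "[:-c, 1:] dvd [:-c, 1:] ^ n" using C'(2) by (intro dvd_power) simp
        then have "[:-c, 1:] dvd k - [:inverse c:]" using k[OF c] by (rule dvd_trans)
        moreover have "k * [:0, 1:] - 1 = (k - [:inverse c:]) * [:0, 1:] + [:-c, 1:] * [:inverse c:]"
          using c0 by (simp add: algebra_simps one_pCons)
        ultimately have "[:-c, 1:] dvd k * [:0, 1:] - 1" by (simp only: dvd_add dvd_mult2 dvd_triv_left)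
        then show "[:-c, 1:] ^ n dvd (k * [:0, 1:] - 1) ^ n" by (rule dvd_power_same)
      qed
      moreover have "pev (k * [:0, 1:] - 1) f = (\<lambda>v. u v - v)"
        by (rule ext) (simp only: pev_diff pev_1 u_def)
      ultimately show ?thesis by (simp only: pev_power[OF f])
    qed
    then show ?thesis using lin_diff[OF lin(2) lin_id] by (auto simp: nilpotent_map_def)
  qed
  ultimately show ?thesis using su us by (auto simp: jordan_def fun_eq_iff)
qed

lemma jordan_inj:
  assumes "jordan f s u" "inj f" shows "inj s" "inj u"
  using assms jordanD(4,5)[OF assms(1)] by (metis injI injD)+

text \<open>Eigenvectors of \<open>s\<close> are eigenvectors of \<open>s ^^ m\<close>, and
  \<open>X - 1\<close> divides \<open>X ^ m - 1\<close>, so \<open>u ^^ m\<close> is again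
  unipotent.\<close>

lemma jordan_funpow:
  assumes J: "jordan f s u" shows "jordan (f ^^ m) (s ^^ m) (u ^^ m)"
proof -
  note lin = jordanD(1-3)[OF J]
  have "{v. \<exists>c. s v = c \<cdot> v} \<subseteq> {v. \<exists>c. (s ^^ m) v = c \<cdot> v}"
  proof clarify
    fix v c assume "s v = c \<cdot> v"
    then have "(s ^^ m) v = c ^ m \<cdot> v" by (induction m) (simp_all add: linD lin mult.commute)
    then show "\<exists>c. (s ^^ m) v = c \<cdot> v" by blast
  qed
  then have "diagonalizable scale (s ^^ m)"
    using jordanD(6)[OF J] span_mono lin_pow[OF lin(1)] unfolding diagonalizable_def by blast
  moreover have "nilpotent_map scale (\<lambda>v. (u ^^ m) v - v)"
  proof -
    obtain n where n: "\<And>v. ((\<lambda>v. u v - v) ^^ n) v = 0"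
      using J by (auto simp: jordan_def nilpotent_map_def)
    have "[:-1, 1:] dvd monom (1::'a) m - 1" by (simp add: poly_eq_0_iff_dvd[symmetric] poly_monom)
    then have "[:-1, 1:] ^ n dvd (monom (1::'a) m - 1) ^ n" by (rule dvd_power_same)
    moreover have "pev ([:-1, 1:] ^ n) u v = 0" for v
      using n by (simp add: pev_linear_power[OF lin(2)] del: pev_pCons)
    ultimately have "pev ((monom 1 m - 1) ^ n) u v = 0" for v
      using pev_dvd[OF lin(2)] by blast
    moreover have "pev (monom 1 m - 1) u = (\<lambda>v. (u ^^ m) v - v)" by (rule ext) simp
    ultimately have "((\<lambda>v. (u ^^ m) v - v) ^^ n) v = 0" for v by (simp only: pev_power[OF lin(2)])
    then show ?thesis using lin_diff[OF lin_pow[OF lin(2)] lin_id] by (auto simp: nilpotent_map_def)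
  qed
  moreover have cm: "s \<circ> u = u \<circ> s" using J by (simp add: jordan_def)
  have "(s ^^ m) \<circ> (u ^^ m) = (s \<circ> u) ^^ m" "(u ^^ m) \<circ> (s ^^ m) = (s \<circ> u) ^^ m"
    using funpow_comp_commute[OF cm] funpow_comp_commute[OF cm[symmetric]] cm by simp_all
  ultimately show ?thesis using J by (simp add: jordan_def)
qed

text \<open>A scalar is absorbed by the semisimple factor. This serves the twist, and it lets
  \<open>N\<close> be seen as intertwining two maps with the same unipotent part.\<close>

lemma jordan_scale:
  assumes J: "jordan f s u" shows "jordan (\<lambda>v. c \<cdot> f v) (\<lambda>v. c \<cdot> s v) u"
proof -
  have "{v. \<exists>c. s v = c \<cdot> v} \<subseteq> {v. \<exists>d. c \<cdot> s v = d \<cdot> v}"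
  proof clarify
    fix v d assume "s v = d \<cdot> v"
    then have "c \<cdot> s v = (c * d) \<cdot> v" by simp
    then show "\<exists>d. c \<cdot> s v = d \<cdot> v" by blast
  qed
  then have "diagonalizable scale (\<lambda>v. c \<cdot> s v)"
    using jordanD(6)[OF J] span_mono lin_smult[OF jordanD(1)[OF J]] unfolding diagonalizable_def by blast
  then show ?thesis using J jordanD(4,5)[OF J] linD(2)[OF jordanD(2)[OF J]]
    by (auto simp: jordan_def fun_eq_iff)
qed

text \<open>With \<open>n = u - 1\<close> and \<open>F = n\<^sup>a (u g - g u) n\<^sup>b\<close> nonzero of maximal \<open>a + b\<close>, the maps \<open>n F\<close> and
  \<open>F n\<close> vanish, so \<open>n\<^sup>a (u\<^sup>m g - g u\<^sup>m) n\<^sup>b = m F\<close>.\<close>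

lemma unipotent_root_commute:
  assumes nil: "nilpotent_map scale (\<lambda>v. u v - v)" and u: "lin u" and g: "lin g"
    and m: "m > 0" and comm: "\<And>v. (u ^^ m) (g v) = g ((u ^^ m) v)"
  shows "u (g v) = g (u v)"
proof (rule ccontr)
  assume neq: "u (g v) \<noteq> g (u v)"
  define n where "n = (\<lambda>v. u v - v)"
  have n: "lin n" unfolding n_def by (intro lin_diff u lin_id)
  obtain N where N: "\<And>v. (n ^^ N) v = 0" using nil by (auto simp: nilpotent_map_def n_def)
  have N': "(n ^^ k) v = 0" if "k \<ge> N" for k v
  proof -
    have "(n ^^ k) v = (n ^^ (k - N)) ((n ^^ N) v)" using that by (metis comp_apply funpow_add le_add_diff_inverse2)
    then show ?thesis using N linD(3)[OF lin_pow[OF n]] by simp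
  qed
  have nu: "(n ^^ k) (u v) = u ((n ^^ k) v)" for k v
    by (induction k arbitrary: v) (simp_all add: n_def linD u)
  define E where "E = (\<lambda>v. u (g v) - g (u v))"
  have E: "lin E" unfolding E_def by (intro lin_diff lin_compose[OF u g] lin_compose[OF g u])
  define Q where "Q k \<longleftrightarrow> (\<exists>a b v. a + b = k \<and> (n ^^ a) (E ((n ^^ b) v)) \<noteq> 0)" for k
  have "Q 0" unfolding Q_def using neq by (intro exI[of _ 0] exI[of _ v]) (simp add: E_def)
  moreover have "k \<le> 2 * N" if "Q k" for k
  proof (rule ccontr)
    assume "\<not> k \<le> 2 * N"
    from that obtain a b v where ab: "a + b = k" "(n ^^ a) (E ((n ^^ b) v)) \<noteq> 0" by (auto simp: Q_def)
    then have "a \<ge> N \<or> b \<ge> N" using \<open>\<not> k \<le> 2 * N\<close> by arith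
    then show False using ab(2) N' linD(3)[OF E] linD(3)[OF lin_pow[OF n]] by auto
  qed
  ultimately obtain K where K: "Q K" "\<And>k. Q k \<Longrightarrow> k \<le> K"
    by (metis GreatestI_nat Greatest_le_nat)
  then obtain a b w where ab: "a + b = K" "(n ^^ a) (E ((n ^^ b) w)) \<noteq> 0" by (auto simp: Q_def)
  define F where "F = (\<lambda>v. (n ^^ a) (E ((n ^^ b) v)))"
  have max: "(n ^^ a') (E ((n ^^ b') v)) = 0" if "a' + b' = Suc K" for a' b' v
    using K(2)[of "Suc K"] that by (auto simp: Q_def)
  have F: "lin F" unfolding F_def by (rule lin_compose[OF lin_pow[OF n] lin_compose[OF E lin_pow[OF n]]])
  have uF: "u (F v) = F v" for v
    using max[of "Suc a" b v] ab(1) by (simp add: F_def n_def)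
  have "F (n v) = 0" for v
    using max[of a "Suc b" v] ab(1) by (simp add: F_def funpow_swap1)
  then have "F (u v - v) = 0" for v by (simp add: n_def)
  then have Fu: "F (u v) = F v" for v by (simp add: linD F)
  have Fum: "F ((u ^^ j) v) = F v" for j v by (induction j) (simp_all add: Fu)
  define D where "D j v = (n ^^ a) ((u ^^ j) (g ((n ^^ b) v)) - g ((u ^^ j) ((n ^^ b) v)))" for j v
  have num: "(n ^^ b) ((u ^^ j) v) = (u ^^ j) ((n ^^ b) v)" for j v
    by (induction j) (simp_all add: nu)
  have DF: "D j v = of_nat j \<cdot> F v" for j v
  proof (induction j)
    case 0 show ?case by (simp add: D_def linD lin_pow n)
  next
    case (Suc j)
    have "(u ^^ Suc j) (g ((n ^^ b) v)) - g ((u ^^ Suc j) ((n ^^ b) v))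
      = u ((u ^^ j) (g ((n ^^ b) v)) - g ((u ^^ j) ((n ^^ b) v))) + E ((u ^^ j) ((n ^^ b) v))"
      by (simp add: E_def linD u)
    then have "D (Suc j) v = u (D j v) + F ((u ^^ j) v)"
      unfolding D_def F_def by (simp only: linD(1)[OF lin_pow[OF n]] nu num)
    also have "\<dots> = of_nat (Suc j) \<cdot> F v" by (simp add: Suc Fum uF linD u algebra_simps)
    finally show ?case .
  qed
  have "D m w = 0" by (simp add: D_def comm linD lin_pow n)
  \<comment> \<open>Characteristic zero enters here: \<open>F w\<close> vanishes because
    \<open>m\<close> times it does.\<close>
  then have "F w = 0" using DF[of m w] m by simp
  then show False using ab(2) by (simp add: F_def)
qed

end

locale vspace_pair = v1: vspace s1 + v2: vspace s2
  for s1 :: "'a::{alg_closed_field,field_char_0} \<Rightarrow> 'b::ab_group_add \<Rightarrow> 'b"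
  and s2 :: "'a \<Rightarrow> 'c::ab_group_add \<Rightarrow> 'c"
begin

sublocale vector_space_pair s1 s2 ..

abbreviation hom :: "('b \<Rightarrow> 'c) \<Rightarrow> bool" where "hom \<equiv> Vector_Spaces.linear s1 s2"

lemmas homD = linearD[where ?s1.0 = s1 and ?s2.0 = s2]

lemma pev_intertwine:
  assumes "hom X" "\<And>v. X (f v) = f' (X v)" shows "X (v1.pev p f v) = v2.pev p f' (X v)"
  by (induction p arbitrary: v) (simp_all add: homD[OF assms(1)] assms(2))

text \<open>\<open>X\<close> carries generalized eigenvectors of \<open>f\<close> to generalized
  eigenvectors of \<open>f'\<close> for the same \<open>c\<close>. No injectivity of
  \<open>X\<close> enters, so \<open>X\<close> may be the nilpotent operator.\<close>

lemma jordan_intertwine: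
  assumes fin: "\<exists>B. finite B \<and> v1.span B = UNIV" "\<exists>B. finite B \<and> v2.span B = UNIV"
    and J: "v1.jordan f s u" "v2.jordan f' s' u'" and X: "hom X" "\<And>v. X (f v) = f' (X v)"
  shows "X (s v) = s' (X v)"
proof (rule v1.diagonalizable_ext_pair[OF v1.jordanD(6)[OF J(1)]])
  show "hom (\<lambda>v. X (s v))" "hom (\<lambda>v. s' (X v))"
    using Vector_Spaces.linear_compose[OF v1.jordanD(1)[OF J(1)] X(1)]
      Vector_Spaces.linear_compose[OF X(1) v2.jordanD(1)[OF J(2)]] by (simp_all add: o_def)
  fix c x assume x: "x \<in> v1.eig s c"
  obtain n where "v1.pev ([:-c, 1:] ^ n) f x = 0"
    using v1.jordan_eig_iff[OF fin(1) J(1), of x c] x by blast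
  then have "v2.pev ([:-c, 1:] ^ n) f' (X x) = 0"
    using pev_intertwine[where X = X and f = f and f' = f', OF X, of "[:-c, 1:] ^ n" x] by (simp add: homD[OF X(1)])
  then have "X x \<in> v2.eig s' c" using v2.jordan_eig_iff[OF fin(2) J(2)] by blast
  then show "X (s x) = s' (X x)" using x by (simp add: v1.eig_def v2.eig_def homD[OF X(1)])
qed

lemma jordan_intertwine_unipotent:
  assumes fin: "\<exists>B. finite B \<and> v1.span B = UNIV" "\<exists>B. finite B \<and> v2.span B = UNIV"
    and J: "v1.jordan f s u" "v2.jordan f' s' u'" and X: "hom X" "\<And>v. X (f v) = f' (X v)" and "inj f'"
  shows "X (u v) = u' (X v)"
proof -
  have "s' (X (u v)) = s' (u' (X v))"
    using jordan_intertwine[OF fin J X, of "u v"] v1.jordanD(4)[OF J(1)] v2.jordanD(4)[OF J(2)] X(2) by simp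
  then show ?thesis using v2.jordan_inj(1)[OF J(2) assms(7)] by (simp add: inj_eq)
qed

end

context vspace begin

text \<open>Uniqueness is the intertwining lemma applied to the identity map and two decompositions
  of the same \<open>f\<close>.\<close>

lemma unipotent_part_eq:
  assumes fin: "\<exists>B. finite B \<and> span B = UNIV" and J: "jordan f s u" and inj: "inj f"
  shows "unipotent_part scale f = u"
  unfolding unipotent_part_def
proof (rule the_equality)
  show "nilpotent_map scale (\<lambda>v. u v - v) \<and> (\<exists>s. diagonalizable scale s \<and> s \<circ> u = f \<and> u \<circ> s = f)"
    using J by (auto simp: jordan_def)
next
  fix u' assume "nilpotent_map scale (\<lambda>v. u' v - v) \<and> (\<exists>s. diagonalizable scale s \<and> s \<circ> u' = f \<and> u' \<circ> s = f)"
  then obtain s' where J': "jordan f s' u'" by (auto simp: jordan_def)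
  interpret vspace_pair scale scale ..
  show "u' = u"
    using jordan_intertwine_unipotent[OF fin fin J' J lin_id _ inj] by auto
qed

end

section \<open>Traces on subspaces\<close>

context vspace begin

definition basis_of :: "'b set \<Rightarrow> 'b set \<Rightarrow> bool" where
  "basis_of B X \<longleftrightarrow> finite B \<and> independent B \<and> span B = X"

lemma basis_ofD:
  assumes "basis_of B X"
  shows "finite B" "independent B" "span B = X" "b \<in> B \<Longrightarrow> b \<in> X" "subspace X"
  using assms span_base[of b B] subspace_span[of B] by (auto simp: basis_of_def)

lemma basis_of_expand: "basis_of B X \<Longrightarrow> x \<in> X \<Longrightarrow> (\<Sum>b\<in>B. representation B x b \<cdot> b) = x"
  by (rule sum_representation_eq) (auto simp: basis_of_def)

lemma representation_linsum:
  assumes "independent B" "\<And>i. i \<in> I \<Longrightarrow> v i \<in> span B"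
  shows "representation B (\<Sum>i\<in>I. c i \<cdot> v i) b = (\<Sum>i\<in>I. c i * representation B (v i) b)"
proof -
  have "representation B (\<Sum>i\<in>I. c i \<cdot> v i) b = (\<Sum>i\<in>I. representation B (c i \<cdot> v i) b)"
    using assms by (subst representation_sum) (auto intro: span_scale)
  also have "\<dots> = (\<Sum>i\<in>I. c i * representation B (v i) b)"
    using assms by (intro sum.cong refl) (subst representation_scale, auto)
  finally show ?thesis .
qed

lemma representation_lincomb:
  assumes "basis_of B X" "b \<in> B" shows "representation B (\<Sum>b\<in>B. u b \<cdot> b) b = u b"
proof -
  have "representation B (\<Sum>b\<in>B. u b \<cdot> b) b = (\<Sum>b'\<in>B. u b' * representation B b' b)"
    using basis_ofD(2)[OF assms(1)] by (rule representation_linsum) (rule span_base)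
  also have "\<dots> = (\<Sum>b'\<in>B. if b' = b then u b else 0)"
    by (rule sum.cong) (auto simp: representation_basis[OF basis_ofD(2)[OF assms(1)]])
  also have "\<dots> = u b" using assms basis_ofD(1) by simp
  finally show ?thesis .
qed

text \<open>Expanding \<open>f b\<close> through \<open>C\<close> and \<open>f c\<close> through
  \<open>B\<close> leads to the same double sum: the trace of a product of two matrices, taken in
  either order.\<close>

lemma trace_basis_independent:
  assumes B: "basis_of B X" and C: "basis_of C X" and f: "lin f" "\<And>x. x \<in> X \<Longrightarrow> f x \<in> X"
  shows "lin_trace scale B f = lin_trace scale C f"
proof -
  note BD = basis_ofD[OF B] and CD = basis_ofD[OF C]
  have 1: "representation B (f b) b = (\<Sum>c\<in>C. representation C (f b) c * representation B c b)" if "b \<in> B" for b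
  proof -
    have "representation B (f b) b = representation B (\<Sum>c\<in>C. representation C (f b) c \<cdot> c) b"
      using basis_of_expand[OF C, of "f b"] f(2) BD(4) that by simp
    also have "\<dots> = (\<Sum>c\<in>C. representation C (f b) c * representation B c b)"
      using BD(2) by (rule representation_linsum) (simp add: BD(3) CD(4))
    finally show ?thesis .
  qed
  have 2: "representation C (f c) c = (\<Sum>b\<in>B. representation B c b * representation C (f b) c)" if "c \<in> C" for c
  proof -
    have "f c = f (\<Sum>b\<in>B. representation B c b \<cdot> b)"
      using basis_of_expand[OF B, of c] CD(4) that by simp
    also have "\<dots> = (\<Sum>b\<in>B. representation B c b \<cdot> f b)" by (simp add: linD f(1))
    finally have "representation C (f c) c = representation C (\<Sum>b\<in>B. representation B c b \<cdot> f b) c" by simp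
    also have "\<dots> = (\<Sum>b\<in>B. representation B c b * representation C (f b) c)"
      using CD(2) by (rule representation_linsum) (simp add: CD(3) BD(4) f(2))
    finally show ?thesis .
  qed
  show ?thesis unfolding lin_trace_def
    by (simp add: 1 2) (subst sum.swap, simp add: mult.commute)
qed

text \<open>Maps are linear on the whole space and are traced on a subspace that they preserve. The
  chosen basis is then immaterial by \<open>trace_basis_independent\<close>.\<close>

definition tr :: "'b set \<Rightarrow> ('b \<Rightarrow> 'b) \<Rightarrow> 'a" where
  "tr X f = lin_trace scale (SOME B. basis_of B X) f"

lemma tr_eq:
  assumes "basis_of B X" "lin f" "\<And>x. x \<in> X \<Longrightarrow> f x \<in> X" shows "tr X f = lin_trace scale B f"
  unfolding tr_def
  by (rule trace_basis_independent[OF _ assms]) (metis assms(1) someI_ex)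

lemma tr_eq_sum:
  assumes "basis_of B X" "lin f" "\<And>x. x \<in> X \<Longrightarrow> f x \<in> X" shows "tr X f = (\<Sum>b\<in>B. representation B (f b) b)"
  using tr_eq[OF assms] by (simp add: lin_trace_def)

lemma tr_cong:
  assumes "basis_of B X" "lin f" "\<And>x. x \<in> X \<Longrightarrow> f x \<in> X" "lin g" "\<And>x. x \<in> X \<Longrightarrow> f x = g x"
  shows "tr X f = tr X g"
proof -
  have g: "g x \<in> X" if "x \<in> X" for x using assms(3,5) that by metis
  have "tr X f = (\<Sum>b\<in>B. representation B (f b) b)" by (rule tr_eq_sum[OF assms(1,2)]) (rule assms(3))
  also have "\<dots> = (\<Sum>b\<in>B. representation B (g b) b)"
    using basis_ofD(4)[OF assms(1)] assms(5) by (intro sum.cong) auto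
  also have "\<dots> = tr X g" by (rule tr_eq_sum[OF assms(1,4), symmetric]) (rule g)
  finally show ?thesis .
qed

lemma tr_sum:
  assumes B: "basis_of B X" and f: "\<And>i. i \<in> I \<Longrightarrow> lin (f i)" "\<And>i x. i \<in> I \<Longrightarrow> x \<in> X \<Longrightarrow> f i x \<in> X"
  shows "tr X (\<lambda>x. \<Sum>i\<in>I. f i x) = (\<Sum>i\<in>I. tr X (f i))"
proof -
  have "tr X (\<lambda>x. \<Sum>i\<in>I. f i x) = (\<Sum>b\<in>B. \<Sum>i\<in>I. representation B (f i b) b)"
    by (subst tr_eq_sum[OF B lin_sum[OF f(1)]])
      (use basis_ofD[OF B] f(2) in \<open>auto intro!: subspace_sum simp: representation_sum\<close>)
  also have "\<dots> = (\<Sum>i\<in>I. tr X (f i))"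
    by (subst sum.swap) (intro sum.cong refl, subst tr_eq_sum[OF B f], auto)
  finally show ?thesis .
qed

lemma tr_smult:
  assumes B: "basis_of B X" and f: "lin f" "\<And>x. x \<in> X \<Longrightarrow> f x \<in> X"
  shows "tr X (\<lambda>x. c \<cdot> f x) = c * tr X f"
  by (subst tr_eq_sum[OF B lin_smult[OF f(1)]])
    (use basis_ofD[OF B] f(2) in \<open>auto simp: tr_eq_sum[OF B f] representation_scale sum_distrib_left intro!: subspace_scale\<close>)

lemma tr_add:
  assumes B: "basis_of B X" and f: "lin f" "\<And>x. x \<in> X \<Longrightarrow> f x \<in> X" and g: "lin g" "\<And>x. x \<in> X \<Longrightarrow> g x \<in> X"
  shows "tr X (\<lambda>x. f x + g x) = tr X f + tr X g"
  by (subst tr_eq_sum[OF B lin_add[OF f(1) g(1)]])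
    (use basis_ofD[OF B] f(2) g(2) in \<open>auto simp: tr_eq_sum[OF B f] tr_eq_sum[OF B g] representation_add sum.distrib intro!: subspace_add\<close>)

lemma basis_exists_in:
  assumes "subspace X" "X \<subseteq> span F" "finite F" shows "\<exists>B. basis_of B X"
proof -
  obtain B where B: "B \<subseteq> X" "independent B" "X \<subseteq> span B"
    using maximal_independent_subset[of X] by metis
  have "finite B" using independent_span_bound[OF assms(3) B(2)] B(1) assms(2) by blast
  then show ?thesis using B span_subspace[OF B(1,3) assms(1)] by (auto simp: basis_of_def)
qed

lemma basis_extends:
  assumes C: "basis_of C Y" and "Y \<subseteq> X" and X: "basis_of F X"
  obtains D where "basis_of D X" "C \<subseteq> D"
proof -
  have "C \<subseteq> X" using basis_ofD(4)[OF C] assms(2) by blast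
  then obtain D where D: "C \<subseteq> D" "D \<subseteq> X" "independent D" "X \<subseteq> span D"
    using maximal_independent_subset_extend[of C X] basis_ofD(2)[OF C] by metis
  have "finite D" using independent_span_bound[OF basis_ofD(1)[OF X] D(3)] D(2) basis_ofD(3)[OF X] by blast
  then show ?thesis using that[of D] D span_subspace[OF D(2,4) basis_ofD(5)[OF X]] by (auto simp: basis_of_def)
qed

text \<open>In a basis of \<open>X\<close> that extends one of \<open>Y\<close>, the values of
  \<open>f\<close> have no coordinates at the added vectors.\<close>

lemma tr_restrict:
  assumes X: "basis_of B X" and Y: "subspace Y" "Y \<subseteq> X" and f: "lin f" "\<And>x. x \<in> X \<Longrightarrow> f x \<in> Y"
  shows "tr X f = tr Y f"
proof -
  obtain C where C: "basis_of C Y"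
    using basis_exists_in[OF Y(1), of B] Y(2) basis_ofD[OF X] by blast
  obtain D where D: "basis_of D X" "C \<subseteq> D" using basis_extends[OF C Y(2) X] by blast
  have "tr X f = (\<Sum>b\<in>D. representation D (f b) b)"
    by (rule tr_eq_sum[OF D(1) f(1)]) (use f(2) Y(2) in blast)
  also have "\<dots> = (\<Sum>b\<in>D. representation C (f b) b)"
  proof (rule sum.cong)
    fix b assume "b \<in> D"
    then have "f b \<in> span C" using f(2) basis_ofD(4)[OF D(1)] basis_ofD(3)[OF C] by blast
    then show "representation D (f b) b = representation C (f b) b"
      using representation_extend[OF basis_ofD(2)[OF D(1)] _ D(2)] by metis
  qed simp
  also have "\<dots> = (\<Sum>b\<in>C. representation C (f b) b)"
    using D basis_ofD(1)[OF D(1)] representation_ne_zero by (intro sum.mono_neutral_right) auto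
  also have "\<dots> = tr Y f"
    by (rule tr_eq_sum[OF C f(1), symmetric]) (use f(2) Y(2) in blast)
  finally show ?thesis .
qed

lemma lin_image_subspace: "lin f \<Longrightarrow> subspace X \<Longrightarrow> subspace (f ` X)"
  by (metis module_hom.subspace_image module_hom_iff_linear)

lemma tr_zero: "tr {0} f = 0"
proof -
  have "B = {}" if "basis_of B {0}" for B
    using basis_ofD(4)[OF that] basis_ofD(2)[OF that] dependent_zero by blast
  moreover have "basis_of {} {0}" by (simp add: basis_of_def independent_empty)
  ultimately have "(SOME B. basis_of B {0}) = {}" by (metis someI_ex)
  then show ?thesis by (simp add: tr_def lin_trace_def)
qed

text \<open>By \<open>tr_restrict\<close> the trace can be taken on the image of \<open>f\<close>,
  then on the image of \<open>f ^^ 2\<close>, and so on down to zero.\<close>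

lemma tr_nilpotent:
  assumes X: "basis_of B X" and f: "lin f" "\<And>x. x \<in> X \<Longrightarrow> f x \<in> X" and n: "\<And>x. x \<in> X \<Longrightarrow> (f ^^ n) x = 0"
  shows "tr X f = 0"
proof -
  have sub: "subspace ((f ^^ k) ` X)" "(f ^^ k) ` X \<subseteq> X" for k
    using lin_image_subspace[OF lin_pow[OF f(1)] basis_ofD(5)[OF X]]
    by (auto, induction k) (auto simp: f(2))
  have "tr X f = tr ((f ^^ k) ` X) f" for k
  proof (induction k)
    case (Suc k)
    obtain C where "basis_of C ((f ^^ k) ` X)"
      using basis_exists_in[OF sub(1), of k B] sub(2)[of k] basis_ofD[OF X] by blast
    then have "tr ((f ^^ k) ` X) f = tr ((f ^^ Suc k) ` X) f"
    proof (rule tr_restrict)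
      show "(f ^^ Suc k) ` X \<subseteq> (f ^^ k) ` X" using f(2) by (force simp: funpow_Suc_right simp del: funpow.simps(2))
    qed (use sub[of "Suc k"] f(1) in \<open>auto\<close>)
    then show ?case using Suc by simp
  qed simp
  from this[of n] have "tr X f = tr ((f ^^ n) ` X) f" .
  moreover have "(f ^^ n) ` X = {0}" using n subspace_0[OF basis_ofD(5)[OF X]] by (auto simp: image_iff)
  ultimately show ?thesis by (simp add: tr_zero)
qed

lemma tr_id:
  assumes "basis_of B X" "lin f" "\<And>x. x \<in> X \<Longrightarrow> f x = x" shows "tr X f = of_nat (card B)"
proof -
  have "tr X f = (\<Sum>b\<in>B. representation B (f b) b)" by (rule tr_eq_sum[OF assms(1,2)]) (simp add: assms(3))
  also have "\<dots> = (\<Sum>b\<in>B. 1)"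
    using assms(3) basis_ofD(2,4)[OF assms(1)] by (intro sum.cong) (auto simp: representation_basis)
  finally show ?thesis by simp
qed

text \<open>The trace of an idempotent is the dimension of its image, which in characteristic zero
  vanishes only for a zero image.\<close>

lemma tr_idempotent_eq_0:
  assumes X: "basis_of B X" and f: "lin f" "\<And>x. x \<in> X \<Longrightarrow> f x \<in> X" "\<And>x. x \<in> X \<Longrightarrow> f (f x) = f x"
    and "tr X f = 0" and x: "x \<in> X"
  shows "f x = 0"
proof -
  have Y: "subspace (f ` X)" "f ` X \<subseteq> X" using lin_image_subspace[OF f(1) basis_ofD(5)[OF X]] f(2) by auto
  obtain C where C: "basis_of C (f ` X)"
    using basis_exists_in[OF Y(1), of B] Y(2) basis_ofD[OF X] by blast
  have "tr X f = tr (f ` X) f" by (rule tr_restrict[OF X Y f(1)]) auto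
  also have "\<dots> = of_nat (card C)" by (rule tr_id[OF C f(1)]) (use f(3) in auto)
  finally have "C = {}" using assms(5) basis_ofD(1)[OF C] by simp
  then show ?thesis using basis_ofD(3)[OF C] x by auto
qed

section \<open>Complements, projections and additivity of the trace\<close>

lemma independent_Un:
  assumes C: "independent C" and D: "independent D" and "span C \<inter> span D = {0}"
  shows "independent (C \<union> D)"
proof -
  obtain B where B: "C \<subseteq> B" "B \<subseteq> C \<union> D" "independent B" "C \<union> D \<subseteq> span B"
    using maximal_independent_subset_extend[of C "C \<union> D"] C by blast
  have "D \<subseteq> B"
  proof
    fix d assume d: "d \<in> D"
    show "d \<in> B"
    proof (rule ccontr)
      assume "d \<notin> B"
      have "B = C \<union> (B \<inter> D)" using B by blast
      then have "d \<in> span (C \<union> (B \<inter> D))" using B(4) d by (metis Un_iff subsetD)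
      then obtain p z where pz: "d = p + z" "p \<in> span C" "z \<in> span (B \<inter> D)" by (auto simp: span_Un)
      have "z \<in> span D" using pz(3) span_mono[of "B \<inter> D" D] by blast
      then have "p \<in> span D" using pz(1) span_diff[OF span_base[OF d], of z] by simp
      then have "p = 0" using pz(2) assms(3) by blast
      then have "d \<in> span (D - {d})" using pz span_mono[of "B \<inter> D" "D - {d}"] \<open>d \<notin> B\<close> by auto
      then show False using D d by (auto simp: dependent_def)
    qed
  qed
  then have "B = C \<union> D" using B by blast
  then show ?thesis using B(3) by simp
qed

lemma projection_exists:
  assumes P: "subspace P" and Z: "subspace Z" and "P \<inter> Z = {0}"
  shows "\<exists>\<pi>. lin \<pi> \<and> (\<forall>x\<in>P. \<pi> x = x) \<and> (\<forall>z\<in>Z. \<pi> z = 0)"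
proof -
  interpret vector_space_pair scale scale ..
  obtain C where C: "C \<subseteq> P" "independent C" "P \<subseteq> span C" using maximal_independent_subset[of P] by metis
  obtain D where D: "D \<subseteq> Z" "independent D" "Z \<subseteq> span D" using maximal_independent_subset[of Z] by metis
  have PC: "span C = P" using span_subspace[OF C(1,3) P] .
  have ZD: "span D = Z" using span_subspace[OF D(1,3) Z] .
  have "independent (C \<union> D)" using independent_Un[OF C(2) D(2)] assms(3) PC ZD by simp
  from linear_independent_extend[OF this, of "\<lambda>b. if b \<in> C then b else 0"]
  obtain \<pi> where \<pi>: "lin \<pi>" "\<And>b. b \<in> C \<union> D \<Longrightarrow> \<pi> b = (if b \<in> C then b else 0)" by blast
  have "\<pi> x = x" if "x \<in> span C" for x
    using that by (induction rule: span_induct_alt) (use \<pi>(2) in \<open>auto simp: linD \<pi>(1)\<close>)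
  moreover have "\<pi> x = 0" if "x \<in> span D" for x
  proof -
    have "\<pi> b = 0" if "b \<in> D" for b
    proof (cases "b \<in> C")
      case True
      then have "b \<in> P \<inter> Z" using that C(1) D(1) by blast
      then show ?thesis using assms(3) linD(3)[OF \<pi>(1)] by simp
    qed (use \<pi>(2) that in auto)
    with that show ?thesis by (induction rule: span_induct_alt) (auto simp: linD \<pi>(1))
  qed
  ultimately show ?thesis using \<pi>(1) PC ZD by blast
qed

lemma tr_direct_sum:
  assumes X: "basis_of B X" and P: "subspace P" "P \<subseteq> X" and Z: "subspace Z" "Z \<subseteq> X" and "P \<inter> Z = {0}"
    and sum: "\<And>x. x \<in> X \<Longrightarrow> \<exists>p\<in>P. \<exists>z\<in>Z. x = p + z"
    and f: "lin f" "\<And>x. x \<in> P \<Longrightarrow> f x \<in> P" "\<And>x. x \<in> Z \<Longrightarrow> f x \<in> Z"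
  shows "tr X f = tr P f + tr Z f"
proof -
  obtain \<pi> where \<pi>: "lin \<pi>" "\<And>x. x \<in> P \<Longrightarrow> \<pi> x = x" "\<And>x. x \<in> Z \<Longrightarrow> \<pi> x = 0"
    using projection_exists[OF P(1) Z(1) assms(6)] by blast
  have in1: "\<pi> x \<in> P" and in2: "x - \<pi> x \<in> Z" if "x \<in> X" for x
    using sum[OF that] by (auto simp: linD \<pi>)
  have lf: "lin (\<lambda>x. f (\<pi> x))" "lin (\<lambda>x. f (x - \<pi> x))"
    by (rule lin_compose[OF f(1)], simp add: \<pi>, rule lin_compose[OF f(1)], rule lin_diff[OF lin_id \<pi>(1)])
  obtain C where C: "basis_of C P" using basis_exists_in[OF P(1), of B] P(2) basis_ofD[OF X] by blast
  obtain D where D: "basis_of D Z" using basis_exists_in[OF Z(1), of B] Z(2) basis_ofD[OF X] by blast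
  have "tr X f = tr X (\<lambda>x. f (\<pi> x) + f (x - \<pi> x))"
    using f(1) by (intro arg_cong[where f = "tr X"] ext) (simp add: linD)
  also have "\<dots> = tr X (\<lambda>x. f (\<pi> x)) + tr X (\<lambda>x. f (x - \<pi> x))"
    by (rule tr_add[OF X lf(1) _ lf(2)]) (use in1 in2 f P Z in blast)+
  also have "tr X (\<lambda>x. f (\<pi> x)) = tr P (\<lambda>x. f (\<pi> x))"
    by (rule tr_restrict[OF X P lf(1)]) (use in1 f in blast)
  also have "\<dots> = tr P f" by (rule tr_cong[OF C lf(1) _ f(1)]) (auto simp: \<pi> f)
  also have "tr X (\<lambda>x. f (x - \<pi> x)) = tr Z (\<lambda>x. f (x - \<pi> x))"
    by (rule tr_restrict[OF X Z lf(2)]) (use in2 f in blast)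
  also have "\<dots> = tr Z f" by (rule tr_cong[OF D lf(2) _ f(1)]) (auto simp: \<pi> f)
  finally show ?thesis .
qed

end

context vspace_pair begin

lemma hom_lin_compose: "hom f \<Longrightarrow> v1.lin t \<Longrightarrow> hom (\<lambda>x. f (t x))" and lin_hom_compose: "v2.lin h \<Longrightarrow> hom f \<Longrightarrow> hom (\<lambda>x. h (f x))"
  by (auto simp: Vector_Spaces.linear_iff)

lemma hom_add: "hom f \<Longrightarrow> hom g \<Longrightarrow> hom (\<lambda>x. f x + g x)"
  and hom_scale: "hom f \<Longrightarrow> hom (\<lambda>x. s2 c (f x))"
  by (auto simp: Vector_Spaces.linear_iff algebra_simps)

lemma hom_zero: "hom (\<lambda>x. 0)"
  using v1.vector_space_axioms v2.vector_space_axioms by (simp add: Vector_Spaces.linear_iff)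

lemma hom_sum: "(\<And>i. i \<in> I \<Longrightarrow> hom (f i)) \<Longrightarrow> hom (\<lambda>x. \<Sum>i\<in>I. f i x)"
  by (induction I rule: infinite_finite_induct) (auto intro: hom_zero hom_add)

lemma tr_transport:
  assumes X: "v1.basis_of B X" and h: "hom h" "inj_on h X" and f: "v1.lin f" "\<And>x. x \<in> X \<Longrightarrow> f x \<in> X"
    and g: "v2.lin g" and comm: "\<And>x. x \<in> X \<Longrightarrow> h (f x) = g (h x)"
  shows "v1.tr X f = v2.tr (h ` X) g"
proof -
  note BD = v1.basis_ofD[OF X]
  have inj: "inj_on h B" using h(2) BD(4) by (auto simp: inj_on_def)
  have "v2.span (h ` B) = h ` X" using linear_span_image[OF h(1)] BD(3) by simp
  moreover have "v2.independent (h ` B)"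
    using linear_independent_injective_image[OF h(1) BD(2)] h(2) BD(3) by simp
  ultimately have Y: "v2.basis_of (h ` B) (h ` X)" using BD(1) by (simp add: v2.basis_of_def)
  have "v2.tr (h ` X) g = (\<Sum>c\<in>h ` B. v2.representation (h ` B) (g c) c)"
    by (rule v2.tr_eq_sum[OF Y g]) (use comm f(2) in \<open>force\<close>)
  also have "\<dots> = (\<Sum>b\<in>B. v2.representation (h ` B) (h (f b)) (h b))"
    using BD(4) comm by (simp add: sum.reindex[OF inj])
  also have "\<dots> = (\<Sum>b\<in>B. v1.representation B (f b) b)"
  proof (rule sum.cong)
    fix b assume b: "b \<in> B"
    define u where "u c = v1.representation B (f b) (the_inv_into B h c)" for c
    have "h (f b) = h (\<Sum>b'\<in>B. s1 (v1.representation B (f b) b') b')"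
      using v1.basis_of_expand[OF X, of "f b"] f(2) BD(4) b by simp
    also have "\<dots> = (\<Sum>b'\<in>B. s2 (v1.representation B (f b) b') (h b'))" by (simp add: homD h(1))
    also have "\<dots> = (\<Sum>c\<in>h ` B. s2 (u c) c)"
      by (simp add: sum.reindex[OF inj] u_def the_inv_into_f_f[OF inj])
    finally have "v2.representation (h ` B) (h (f b)) (h b) = u (h b)"
      using v2.representation_lincomb[OF Y, of "h b" u] b by simp
    then show "v2.representation (h ` B) (h (f b)) (h b) = v1.representation B (f b) b"
      using b by (simp add: u_def the_inv_into_f_f[OF inj])
  qed simp
  also have "\<dots> = v1.tr X f" by (rule v1.tr_eq_sum[OF X f, symmetric])
  finally show ?thesis by simp
qed

end

text \<open>Matrix form of \<open>tr_idempotent_eq_0\<close>. The matrix acts on functions on the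
  index type; the trace is taken on those supported in the finite set \<open>I\<close>, where it
  makes sense for infinite types too.\<close>

lemma idempotent_kernel_trace:
  fixes K :: "'i \<Rightarrow> 'i \<Rightarrow> 'a::{alg_closed_field,field_char_0}"
  assumes I: "finite I" and idem: "\<And>i k. i \<in> I \<Longrightarrow> k \<in> I \<Longrightarrow> (\<Sum>j\<in>I. K i j * K j k) = K i k"
    and tr: "(\<Sum>i\<in>I. K i i) = 0" and ik: "i \<in> I" "k \<in> I"
  shows "K i k = 0"
proof -
  interpret F: vspace "\<lambda>(c::'a) (u::'i \<Rightarrow> 'a) i. c * u i"
    by unfold_locales (auto simp: algebra_simps)
  define e where "e i = (\<lambda>j. if j = i then 1 else 0 :: 'a)" for i :: 'i
  define B where "B = e ` I"
  define X where "X = {u :: 'i \<Rightarrow> 'a. \<forall>i. i \<notin> I \<longrightarrow> u i = 0}"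
  have inj: "inj_on e I" by (auto simp: inj_on_def e_def fun_eq_iff split: if_splits)
  have sum_apply: "(\<Sum>j\<in>J. g j) i = (\<Sum>j\<in>J. g j i)" for J and g :: "'j \<Rightarrow> 'i \<Rightarrow> 'a" and i
    by (induction J rule: infinite_finite_induct) auto
  have ex: "(\<Sum>i\<in>I. (\<lambda>j. u i * e i j)) = (\<lambda>j. if j \<in> I then u j else 0)" for u
    by (rule ext) (auto simp: sum_apply e_def if_distrib I sum.delta cong: if_cong)
  have indep: "F.independent B"
  proof (rule F.independent_if_scalars_zero)
    show "finite B" using I by (simp add: B_def)
    fix u x assume u: "(\<Sum>x\<in>B. (\<lambda>i. u x * x i)) = 0" and "x \<in> B"
    then obtain j where j: "j \<in> I" "x = e j" by (auto simp: B_def)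
    have "(\<Sum>i\<in>I. (\<lambda>j. u (e i) * e i j)) = 0" using u by (simp add: B_def sum.reindex[OF inj])
    from fun_cong[OF this, of j] show "u x = 0" using j unfolding ex by simp
  qed
  have sp: "F.span B = X"
  proof
    have "F.subspace X" by (rule F.subspaceI) (auto simp: X_def)
    then show "F.span B \<subseteq> X" by (intro F.span_minimal) (auto simp: B_def X_def e_def)
    show "X \<subseteq> F.span B"
    proof
      fix u assume "u \<in> X"
      then have "u = (\<Sum>i\<in>I. (\<lambda>j. u i * e i j))" unfolding ex by (auto simp: X_def fun_eq_iff)
      also have "\<dots> \<in> F.span B" by (intro F.span_sum F.span_scale F.span_base) (auto simp: B_def)
      finally show "u \<in> F.span B" .
    qed
  qed
  have B: "F.basis_of B X" using I indep sp by (simp add: F.basis_of_def B_def)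
  have rep: "F.representation B u (e i) = u i" if "u \<in> X" "i \<in> I" for u i
  proof -
    have "u = (\<Sum>i\<in>I. (\<lambda>j. u i * e i j))" unfolding ex using that by (auto simp: X_def fun_eq_iff)
    also have "\<dots> = (\<Sum>x\<in>B. (\<lambda>j. u (the_inv_into I e x) * x j))"
      by (simp add: B_def sum.reindex[OF inj] the_inv_into_f_f[OF inj])
    finally have "F.representation B u (e i) = u (the_inv_into I e (e i))"
      using F.representation_lincomb[OF B, of "e i" "\<lambda>x. u (the_inv_into I e x)"] that by (simp add: B_def)
    then show ?thesis using that by (simp add: the_inv_into_f_f[OF inj])
  qed
  define T where "T u = (\<lambda>i. if i \<in> I then (\<Sum>j\<in>I. K i j * u j) else 0)" for u :: "'i \<Rightarrow> 'a"
  have T: "F.lin T" by (intro F.linI) (auto simp: T_def fun_eq_iff algebra_simps sum.distrib sum_distrib_left)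
  have TX: "T u \<in> X" for u by (auto simp: T_def X_def)
  have Te: "T (e k) i = (if i \<in> I then K i k else 0)" if "k \<in> I" for i k
    using that I by (auto simp: T_def e_def if_distrib sum.delta cong: if_cong)
  have "F.tr X T = 0"
  proof -
    have "F.tr X T = (\<Sum>x\<in>B. F.representation B (T x) x)" by (rule F.tr_eq_sum[OF B T TX])
    also have "\<dots> = (\<Sum>i\<in>I. T (e i) i)" by (simp add: B_def sum.reindex[OF inj] rep[OF TX, unfolded B_def])
    also have "\<dots> = 0" using tr by (simp add: Te)
    finally show ?thesis .
  qed
  moreover have "T (T u) = T u" for u
  proof
    fix i
    show "T (T u) i = T u i"
    proof (cases "i \<in> I")
      case True
      have "T (T u) i = (\<Sum>j\<in>I. \<Sum>k\<in>I. K i j * K j k * u k)"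
        using True by (simp add: T_def sum_distrib_left mult.assoc)
      also have "\<dots> = (\<Sum>k\<in>I. (\<Sum>j\<in>I. K i j * K j k) * u k)"
        by (subst sum.swap) (simp add: sum_distrib_right)
      also have "\<dots> = T u i" using True idem by (simp add: T_def)
      finally show ?thesis .
    qed (simp add: T_def)
  qed
  ultimately have "T (e k) = 0"
    by (intro F.tr_idempotent_eq_0[OF B T TX]) (use ik in \<open>auto simp: X_def e_def\<close>)
  from fun_cong[OF this, of i] show ?thesis using Te[OF ik(2)] ik by simp
qed

section \<open>Representations with equal traces\<close>

context vspace begin

lemma basis_card_dim: "basis_of B X \<Longrightarrow> dim X = card B"
  by (metis basis_of_def dim_span_eq_card_independent)

lemma proper_subspace_dim:
  assumes X: "basis_of B X" and Y: "subspace Y" "Y \<subseteq> X" "Y \<noteq> X" shows "dim Y < dim X"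
proof -
  obtain C where C: "basis_of C Y"
    using basis_exists_in[OF Y(1), of B] Y(2) basis_ofD[OF X] by blast
  obtain D where D: "basis_of D X" "C \<subseteq> D" using basis_extends[OF C Y(2) X] by blast
  have "C \<noteq> D" using Y(3) basis_ofD(3)[OF C] basis_ofD(3)[OF D(1)] by blast
  then show ?thesis
    using D(2) basis_ofD(1)[OF D(1)] by (simp add: basis_card_dim[OF C] basis_card_dim[OF D(1)] psubset_card_mono)
qed

text \<open>Linearity is asked on the whole type, the group laws only on \<open>X\<close>.
  Restriction to a stable subspace thus needs no new type.\<close>

definition rep_on :: "('g, 'm) monoid_scheme \<Rightarrow> ('g \<Rightarrow> 'b \<Rightarrow> 'b) \<Rightarrow> 'b set \<Rightarrow> bool" where
  "rep_on G \<rho> X \<longleftrightarrow> (\<forall>g\<in>carrier G. lin (\<rho> g) \<and> (\<forall>x\<in>X. \<rho> g x \<in> X)) \<and>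
     (\<forall>g\<in>carrier G. \<forall>h\<in>carrier G. \<forall>x\<in>X. \<rho> (g \<otimes>\<^bsub>G\<^esub> h) x = \<rho> g (\<rho> h x)) \<and> (\<forall>x\<in>X. \<rho> \<one>\<^bsub>G\<^esub> x = x)"

lemma rep_onD:
  assumes "rep_on G \<rho> X"
  shows "g \<in> carrier G \<Longrightarrow> lin (\<rho> g)" "g \<in> carrier G \<Longrightarrow> x \<in> X \<Longrightarrow> \<rho> g x \<in> X"
    "g \<in> carrier G \<Longrightarrow> h \<in> carrier G \<Longrightarrow> x \<in> X \<Longrightarrow> \<rho> (g \<otimes>\<^bsub>G\<^esub> h) x = \<rho> g (\<rho> h x)"
    "x \<in> X \<Longrightarrow> \<rho> \<one>\<^bsub>G\<^esub> x = x"
  using assms by (auto simp: rep_on_def)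

lemma rep_on_subset:
  assumes "rep_on G \<rho> X" "Y \<subseteq> X" "\<And>g x. g \<in> carrier G \<Longrightarrow> x \<in> Y \<Longrightarrow> \<rho> g x \<in> Y"
  shows "rep_on G \<rho> Y"
  using assms unfolding rep_on_def by blast

end

context vspace_pair begin

definition equivariant :: "('g, 'm) monoid_scheme \<Rightarrow> ('g \<Rightarrow> 'b \<Rightarrow> 'b) \<Rightarrow> ('g \<Rightarrow> 'c \<Rightarrow> 'c) \<Rightarrow>
    'b set \<Rightarrow> 'c set \<Rightarrow> ('b \<Rightarrow> 'c) \<Rightarrow> bool" where
  "equivariant G \<rho>1 \<rho>2 X1 X2 f \<longleftrightarrow> hom f \<and> (\<forall>x\<in>X1. f x \<in> X2) \<and>
     (\<forall>g\<in>carrier G. \<forall>x\<in>X1. f (\<rho>1 g x) = \<rho>2 g (f x))"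

lemma equivariantD:
  assumes "equivariant G \<rho>1 \<rho>2 X1 X2 f"
  shows "hom f" "x \<in> X1 \<Longrightarrow> f x \<in> X2" "g \<in> carrier G \<Longrightarrow> x \<in> X1 \<Longrightarrow> f (\<rho>1 g x) = \<rho>2 g (f x)"
  using assms by (auto simp: equivariant_def)

text \<open>The averaging operator without division by the group order; only
  \<open>invariant_projection\<close> has to normalize it.\<close>

definition average :: "('g, 'm) monoid_scheme \<Rightarrow> ('g \<Rightarrow> 'b \<Rightarrow> 'b) \<Rightarrow> ('g \<Rightarrow> 'c \<Rightarrow> 'c) \<Rightarrow> ('b \<Rightarrow> 'c) \<Rightarrow> 'b \<Rightarrow> 'c" where
  "average G \<rho>1 \<rho>2 L x = (\<Sum>g\<in>carrier G. \<rho>2 g (L (\<rho>1 (inv\<^bsub>G\<^esub> g) x)))"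

lemma average_equivariant:
  fixes G (structure)
  assumes "group G" and X1: "v1.rep_on G \<rho>1 X1" and X2: "v2.rep_on G \<rho>2 X2" "v2.subspace X2"
    and L: "hom L" "\<And>x. x \<in> X1 \<Longrightarrow> L x \<in> X2"
  shows "equivariant G \<rho>1 \<rho>2 X1 X2 (average G \<rho>1 \<rho>2 L)"
proof -
  interpret group G by fact
  note D1 = v1.rep_onD[OF X1] and D2 = v2.rep_onD[OF X2(1)]
  have "hom (average G \<rho>1 \<rho>2 L)"
    unfolding average_def by (rule hom_sum, rule lin_hom_compose[OF D2(1)], assumption, rule hom_lin_compose[OF L(1) D1(1)], simp)
  moreover have "average G \<rho>1 \<rho>2 L x \<in> X2" if "x \<in> X1" for x
    unfolding average_def using that by (intro v2.subspace_sum[OF X2(2)] D2(2) L(2) D1(2)) auto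
  moreover have "average G \<rho>1 \<rho>2 L (\<rho>1 h x) = \<rho>2 h (average G \<rho>1 \<rho>2 L x)" if h: "h \<in> carrier G" and x: "x \<in> X1" for h x
  proof -
    have bij: "bij_betw (\<lambda>g. h \<otimes> g) (carrier G) (carrier G)"
      by (rule bij_betwI[where g = "\<lambda>g. inv h \<otimes> g"]) (auto simp: h m_assoc[symmetric])
    have "average G \<rho>1 \<rho>2 L (\<rho>1 h x) = (\<Sum>g\<in>carrier G. \<rho>2 (h \<otimes> g) (L (\<rho>1 (inv (h \<otimes> g)) (\<rho>1 h x))))"
      unfolding average_def by (rule sum.reindex_bij_betw[OF bij, symmetric])
    also have "\<dots> = (\<Sum>g\<in>carrier G. \<rho>2 h (\<rho>2 g (L (\<rho>1 (inv g) x))))"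
    proof (rule sum.cong)
      fix g assume g: "g \<in> carrier G"
      have "\<rho>1 (inv (h \<otimes> g)) (\<rho>1 h x) = \<rho>1 (inv (h \<otimes> g) \<otimes> h) x" using D1(3) g h x by simp
      also have "inv (h \<otimes> g) \<otimes> h = inv g" using g h by (simp add: inv_mult_group m_assoc)
      finally show "\<rho>2 (h \<otimes> g) (L (\<rho>1 (inv (h \<otimes> g)) (\<rho>1 h x))) = \<rho>2 h (\<rho>2 g (L (\<rho>1 (inv g) x)))"
        using D2(3)[OF h g L(2)[OF D1(2)[OF inv_closed[OF g] x]]] by simp
    qed simp
    also have "\<dots> = \<rho>2 h (average G \<rho>1 \<rho>2 L x)"
      unfolding average_def by (simp add: v2.linD D2(1) h)
    finally show ?thesis .
  qed
  ultimately show ?thesis by (simp add: equivariant_def)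
qed

end

context vspace begin

text \<open>Maschke's theorem: any linear projection onto \<open>Y\<close> becomes equivariant by
  averaging and stays the identity on \<open>Y\<close>, since the group order is invertible.\<close>

lemma invariant_projection:
  fixes G (structure)
  assumes "group G" "finite (carrier G)" and X: "basis_of B X" "rep_on G \<rho> X" and Y: "subspace Y" "Y \<subseteq> X"
    and inv: "\<And>g y. g \<in> carrier G \<Longrightarrow> y \<in> Y \<Longrightarrow> \<rho> g y \<in> Y"
  shows "\<exists>\<pi>. lin \<pi> \<and> (\<forall>x\<in>X. \<pi> x \<in> Y) \<and> (\<forall>y\<in>Y. \<pi> y = y) \<and>
    (\<forall>g\<in>carrier G. \<forall>x\<in>X. \<pi> (\<rho> g x) = \<rho> g (\<pi> x))"
proof -
  interpret group G by fact
  interpret P: vspace_pair scale scale ..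
  note D = rep_onD[OF X(2)]
  have RY: "rep_on G \<rho> Y" using rep_on_subset[OF X(2) Y(2) inv] .
  obtain C where C: "basis_of C Y"
    using basis_exists_in[OF Y(1), of B] Y(2) basis_ofD[OF X(1)] by blast
  obtain E where E: "basis_of E X" "C \<subseteq> E" using basis_extends[OF C Y(2) X(1)] by blast
  obtain p where p: "lin p" "\<And>b. b \<in> E \<Longrightarrow> p b = (if b \<in> C then b else 0)"
    using P.linear_independent_extend[OF basis_ofD(2)[OF E(1)], of "\<lambda>b. if b \<in> C then b else 0"] by blast
  have pY: "p y = y" if "y \<in> Y" for y
  proof -
    have "y \<in> span C" using that basis_ofD(3)[OF C] by simp
    then show ?thesis by (induction rule: span_induct_alt) (use p(2) E(2) in \<open>auto simp: linD p(1)\<close>)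
  qed
  have pX: "p x \<in> Y" if "x \<in> X" for x
  proof -
    have "x \<in> span E" using that basis_ofD(3)[OF E(1)] by simp
    then show ?thesis
    proof (induction rule: span_induct_alt)
      case (step c b y)
      then show ?case using p(2)[of b] basis_ofD(4)[OF C, of b] Y(1)
        by (auto simp: linD p(1) subspace_add subspace_scale subspace_0)
    qed (simp add: linD p(1) subspace_0 Y(1))
  qed
  define a where "a = P.average G \<rho> \<rho> p"
  define \<pi> where "\<pi> x = inverse (of_nat (card (carrier G))) \<cdot> a x" for x
  have n0: "of_nat (card (carrier G)) \<noteq> (0::'a)"
    using assms(2) one_closed by (auto simp: card_eq_0_iff)
  have "P.equivariant G \<rho> \<rho> X Y a"
    unfolding a_def by (rule P.average_equivariant[OF assms(1) X(2) RY Y(1) p(1)]) (rule pX)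
  note AD = P.equivariantD[OF this]
  show ?thesis
  proof (intro exI[of _ \<pi>] conjI ballI)
    show "lin \<pi>" unfolding \<pi>_def by (rule lin_smult[OF AD(1)])
    show "\<pi> x \<in> Y" if "x \<in> X" for x using AD(2)[OF that] Y(1) by (simp add: \<pi>_def subspace_scale)
    show "\<pi> (\<rho> g x) = \<rho> g (\<pi> x)" if "g \<in> carrier G" "x \<in> X" for g x
      using AD(3)[OF that] D(1)[OF that(1)] by (simp add: \<pi>_def linD)
    show "\<pi> y = y" if "y \<in> Y" for y
    proof -
      have "\<rho> g (p (\<rho> (inv g) y)) = y" if g: "g \<in> carrier G" for g
      proof -
        have "p (\<rho> (inv g) y) = \<rho> (inv g) y" using inv[of "inv g" y] g \<open>y \<in> Y\<close> by (simp add: pY)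
        moreover have "\<rho> g (\<rho> (inv g) y) = y"
          using D(3)[of g "inv g" y] D(4)[of y] g \<open>y \<in> Y\<close> Y(2) by auto
        ultimately show ?thesis by simp
      qed
      then have "a y = of_nat (card (carrier G)) \<cdot> y"
        by (simp add: a_def P.average_def sum_constant_scale del: sum_constant)
      then show ?thesis using n0 by (simp add: \<pi>_def)
    qed
  qed
qed

text \<open>Up to the group order, the sum is the trace of the averaging projector on the
  endomorphisms of \<open>X\<close>. If it vanished, the projector would be zero, but it fixes the
  identity endomorphism.\<close>

lemma trace_product_sum_nonzero:
  fixes G (structure)
  assumes "group G" "finite (carrier G)" and X: "basis_of B X" "rep_on G \<rho> X" and "B \<noteq> {}"
  shows "(\<Sum>g\<in>carrier G. tr X (\<rho> (inv\<^bsub>G\<^esub> g)) * tr X (\<rho> g)) \<noteq> 0"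
proof
  assume zero: "(\<Sum>g\<in>carrier G. tr X (\<rho> (inv\<^bsub>G\<^esub> g)) * tr X (\<rho> g)) = 0"
  interpret group G by fact
  note D = rep_onD[OF X(2)] and BD = basis_ofD[OF X(1)]
  define A where "A g x y = representation B (\<rho> g y) x" for g x y
  have A_one: "A \<one> x y = (if x = y then 1 else 0)" if "y \<in> B" for x y
    using that by (simp add: A_def D(4) BD(4) representation_basis[OF BD(2)])
  have A_mult: "A (g \<otimes> h) x y = (\<Sum>z\<in>B. A g x z * A h z y)"
    if "g \<in> carrier G" "h \<in> carrier G" "y \<in> B" for g h x y
  proof -
    have "\<rho> (g \<otimes> h) y = \<rho> g (\<Sum>z\<in>B. A h z y \<cdot> z)"
      using that basis_of_expand[OF X(1), of "\<rho> h y"] D(2)[of h y] BD(4) by (simp add: A_def D(3))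
    also have "\<dots> = (\<Sum>z\<in>B. A h z y \<cdot> \<rho> g z)" using D(1)[OF that(1)] by (simp add: linD)
    finally have "A (g \<otimes> h) x y = (\<Sum>z\<in>B. A h z y * representation B (\<rho> g z) x)"
      unfolding A_def using BD D(2)[OF that(1)] by (simp add: representation_linsum)
    then show ?thesis by (simp add: A_def mult.commute)
  qed
  have A_tr: "tr X (\<rho> g) = (\<Sum>b\<in>B. A g b b)" if "g \<in> carrier G" for g
    unfolding A_def by (rule tr_eq_sum[OF X(1) D(1)[OF that]]) (rule D(2)[OF that])
  define N where "N = (of_nat (card (carrier G)) :: 'a)"
  have N0: "N \<noteq> 0" using assms(2) one_closed by (auto simp: N_def card_eq_0_iff)
  \<comment> \<open>The matrix of the map sending an endomorphism to the mean of its conjugates by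
    the \<open>\<rho> g\<close>, with matrix positions as indices.\<close>
  define K where "K = (\<lambda>(b, b') (d, d'). inverse N * (\<Sum>g\<in>carrier G. A g b' d' * A (inv g) d b))"
  have K0: "K (b, b') (d, d') = 0" if "b \<in> B" "b' \<in> B" "d \<in> B" "d' \<in> B" for b b' d d'
  proof (rule idempotent_kernel_trace[where I = "B \<times> B" and K = K])
    show "finite (B \<times> B)" using BD(1) by simp
    show "(\<Sum>j\<in>B \<times> B. K i j * K j k) = K i k" if "i \<in> B \<times> B" "k \<in> B \<times> B" for i k
    proof -
      obtain b b' e e' where ik: "i = (b, b')" "k = (e, e')" "b \<in> B" "b' \<in> B" "e \<in> B" "e' \<in> B"
        using \<open>i \<in> B \<times> B\<close> \<open>k \<in> B \<times> B\<close> by (elim SigmaE) blast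
      have "(\<Sum>j\<in>B \<times> B. K i j * K j k) = (\<Sum>d\<in>B. \<Sum>d'\<in>B. K (b, b') (d, d') * K (d, d') (e, e'))"
        by (simp add: ik(1,2) sum.cartesian_product)
      also have "\<dots> = (\<Sum>d\<in>B. \<Sum>d'\<in>B. inverse N * inverse N *
          (\<Sum>g\<in>carrier G. \<Sum>h\<in>carrier G. (A g b' d' * A h d' e') * (A (inv h) e d * A (inv g) d b)))"
      proof (intro sum.cong refl)
        fix d d'
        have "K (b, b') (d, d') * K (d, d') (e, e') = inverse N * inverse N *
          ((\<Sum>g\<in>carrier G. A g b' d' * A (inv g) d b) * (\<Sum>h\<in>carrier G. A h d' e' * A (inv h) e d))"
          by (simp add: K_def)
        also have "(\<Sum>g\<in>carrier G. A g b' d' * A (inv g) d b) * (\<Sum>h\<in>carrier G. A h d' e' * A (inv h) e d)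
          = (\<Sum>g\<in>carrier G. \<Sum>h\<in>carrier G. (A g b' d' * A h d' e') * (A (inv h) e d * A (inv g) d b))"
          unfolding sum_product by (intro sum.cong refl) (simp add: mult_ac)
        finally show "K (b, b') (d, d') * K (d, d') (e, e') = inverse N * inverse N *
          (\<Sum>g\<in>carrier G. \<Sum>h\<in>carrier G. (A g b' d' * A h d' e') * (A (inv h) e d * A (inv g) d b))" .
      qed
      also have "\<dots> = inverse N * inverse N * (\<Sum>d\<in>B. \<Sum>d'\<in>B.
          (\<Sum>g\<in>carrier G. \<Sum>h\<in>carrier G. (A g b' d' * A h d' e') * (A (inv h) e d * A (inv g) d b)))"
        by (simp add: sum_distrib_left)
      also have "(\<Sum>d\<in>B. \<Sum>d'\<in>B.
          (\<Sum>g\<in>carrier G. \<Sum>h\<in>carrier G. (A g b' d' * A h d' e') * (A (inv h) e d * A (inv g) d b)))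
        = (\<Sum>g\<in>carrier G. \<Sum>h\<in>carrier G. \<Sum>d\<in>B. \<Sum>d'\<in>B. (A g b' d' * A h d' e') * (A (inv h) e d * A (inv g) d b))"
        by (simp add: sum.swap[of _ "carrier G" B])
      also have "\<dots> = (\<Sum>g\<in>carrier G. \<Sum>h\<in>carrier G. A (g \<otimes> h) b' e' * A (inv (g \<otimes> h)) e b)"
      proof (intro sum.cong refl)
        fix g h assume "g \<in> carrier G" "h \<in> carrier G"
        then show "(\<Sum>d\<in>B. \<Sum>d'\<in>B. (A g b' d' * A h d' e') * (A (inv h) e d * A (inv g) d b)) =
            A (g \<otimes> h) b' e' * A (inv (g \<otimes> h)) e b"
          by (simp add: A_mult ik inv_mult_group sum_product mult_ac) (rule sum.swap)
      qed
      also have "\<dots> = (\<Sum>g\<in>carrier G. \<Sum>h\<in>carrier G. A h b' e' * A (inv h) e b)"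
      proof (rule sum.cong[OF refl])
        fix g assume g: "g \<in> carrier G"
        have "bij_betw (\<lambda>h. g \<otimes> h) (carrier G) (carrier G)"
          by (rule bij_betwI[where g = "\<lambda>h. inv g \<otimes> h"]) (auto simp: g m_assoc[symmetric])
        then show "(\<Sum>h\<in>carrier G. A (g \<otimes> h) b' e' * A (inv (g \<otimes> h)) e b) = (\<Sum>h\<in>carrier G. A h b' e' * A (inv h) e b)"
          by (rule sum.reindex_bij_betw)
      qed
      also have "\<dots> = N * (\<Sum>h\<in>carrier G. A h b' e' * A (inv h) e b)" by (simp add: N_def)
      finally show ?thesis using N0 by (simp add: K_def ik)
    qed
    have "(\<Sum>i\<in>B \<times> B. K i i) = (\<Sum>b\<in>B. \<Sum>b'\<in>B. K (b, b') (b, b'))" by (simp add: sum.cartesian_product)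
    also have "\<dots> = inverse N * (\<Sum>b\<in>B. \<Sum>b'\<in>B. \<Sum>g\<in>carrier G. A g b' b' * A (inv g) b b)"
      by (simp add: K_def sum_distrib_left)
    also have "(\<Sum>b\<in>B. \<Sum>b'\<in>B. \<Sum>g\<in>carrier G. A g b' b' * A (inv g) b b) =
        (\<Sum>g\<in>carrier G. \<Sum>b\<in>B. \<Sum>b'\<in>B. A g b' b' * A (inv g) b b)"
      by (simp add: sum.swap[of _ "carrier G" B])
    also have "\<dots> = (\<Sum>g\<in>carrier G. tr X (\<rho> (inv g)) * tr X (\<rho> g))"
      by (intro sum.cong refl) (simp add: A_tr sum_product, intro sum.cong refl, rule mult.commute)
    finally show "(\<Sum>i\<in>B \<times> B. K i i) = 0" using zero by simp
  qed (use that in auto)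
  obtain b where b: "b \<in> B" using assms(5) by blast
  \<comment> \<open>The diagonal entry at \<open>b\<close> of the averaged identity endomorphism,
    which must be 1.\<close>
  have "0 = (\<Sum>d\<in>B. K (b, b) (d, d))" using K0 b by simp
  also have "\<dots> = inverse N * (\<Sum>g\<in>carrier G. \<Sum>d\<in>B. A g b d * A (inv g) d b)"
    by (simp add: K_def sum_distrib_left) (rule sum.swap)
  also have "(\<Sum>g\<in>carrier G. \<Sum>d\<in>B. A g b d * A (inv g) d b) = (\<Sum>g\<in>carrier G. 1)"
    by (intro sum.cong refl) (use b in \<open>simp add: A_mult[symmetric] A_one\<close>)
  also have "inverse N * (\<Sum>g\<in>carrier G. 1) = 1" using N0 by (simp add: N_def)
  finally show False by simp
qed

end

context vspace_pair begin

text \<open>If all averages of elementary maps vanished, adding up their coordinates would give that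
  the sum of \<open>tr (\<rho>1 (inv g)) * tr (\<rho>2 g)\<close> is zero. By equality of traces
  this contradicts \<open>trace_product_sum_nonzero\<close>.\<close>

lemma equivariant_nonzero_exists:
  fixes G (structure)
  assumes "group G" "finite (carrier G)"
    and X1: "v1.basis_of B1 X1" "v1.rep_on G \<rho>1 X1" and X2: "v2.basis_of B2 X2" "v2.rep_on G \<rho>2 X2"
    and tr: "\<And>g. g \<in> carrier G \<Longrightarrow> v1.tr X1 (\<rho>1 g) = v2.tr X2 (\<rho>2 g)" and "B1 \<noteq> {}"
  obtains f x where "equivariant G \<rho>1 \<rho>2 X1 X2 f" "x \<in> X1" "f x \<noteq> 0"
proof (rule ccontr)
  assume "\<not> thesis"
  with that have none: "f x = 0" if "equivariant G \<rho>1 \<rho>2 X1 X2 f" "x \<in> X1" for f x using that by blast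
  interpret group G by fact
  note D1 = v1.rep_onD[OF X1(2)] and D2 = v2.rep_onD[OF X2(2)]
    and BD1 = v1.basis_ofD[OF X1(1)] and BD2 = v2.basis_ofD[OF X2(1)]
  have "(\<Sum>g\<in>carrier G. v1.representation B1 (\<rho>1 (inv g) b) b * v2.representation B2 (\<rho>2 g c) c) = 0"
    if b: "b \<in> B1" and c: "c \<in> B2" for b c
  proof -
    \<comment> \<open>The elementary map from the \<open>b\<close>-line to the
      \<open>c\<close>-line. The \<open>c\<close>-coordinate of its average at \<open>b\<close> is a
      sum of products of diagonal entries.\<close>
    obtain L where L: "hom L" "\<And>x. x \<in> B1 \<Longrightarrow> L x = (if x = b then c else 0)"
      using linear_independent_extend[OF BD1(2), of "\<lambda>x. if x = b then c else 0"] by blast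
    have Lx: "L x = s2 (v1.representation B1 x b) c" if "x \<in> X1" for x
    proof -
      have "L x = L (\<Sum>d\<in>B1. s1 (v1.representation B1 x d) d)" using v1.basis_of_expand[OF X1(1) that] by simp
      also have "\<dots> = (\<Sum>d\<in>B1. if d = b then s2 (v1.representation B1 x b) c else 0)"
        by (simp add: homD L(1)) (intro sum.cong refl, simp add: L(2))
      also have "\<dots> = s2 (v1.representation B1 x b) c" using b BD1(1) by simp
      finally show ?thesis .
    qed
    have LX: "L x \<in> X2" if "x \<in> X1" for x
      using Lx[OF that] BD2(4)[OF c] BD2(5) by (simp add: v2.subspace_scale)
    have "0 = v2.representation B2 (average G \<rho>1 \<rho>2 L b) c"
      using none[OF average_equivariant[OF assms(1) X1(2) X2(2) BD2(5) L(1) LX] BD1(4)[OF b]]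
      by (simp add: v2.representation_zero)
    also have "average G \<rho>1 \<rho>2 L b = (\<Sum>g\<in>carrier G. s2 (v1.representation B1 (\<rho>1 (inv g) b) b) (\<rho>2 g c))"
      unfolding average_def
    proof (intro sum.cong refl)
      fix g assume g: "g \<in> carrier G"
      show "\<rho>2 g (L (\<rho>1 (inv g) b)) = s2 (v1.representation B1 (\<rho>1 (inv g) b) b) (\<rho>2 g c)"
        using Lx[OF D1(2)[OF inv_closed[OF g] BD1(4)[OF b]]] D2(1)[OF g] by (simp add: v2.linD)
    qed
    also have "v2.representation B2 \<dots> c = (\<Sum>g\<in>carrier G. v1.representation B1 (\<rho>1 (inv g) b) b * v2.representation B2 (\<rho>2 g c) c)"
      using BD2 D2(2) c by (simp add: v2.representation_linsum)
    finally show ?thesis by simp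
  qed
  then have "0 = (\<Sum>b\<in>B1. \<Sum>c\<in>B2. \<Sum>g\<in>carrier G. v1.representation B1 (\<rho>1 (inv g) b) b * v2.representation B2 (\<rho>2 g c) c)"
    by simp
  also have "\<dots> = (\<Sum>g\<in>carrier G. \<Sum>b\<in>B1. \<Sum>c\<in>B2. v1.representation B1 (\<rho>1 (inv g) b) b * v2.representation B2 (\<rho>2 g c) c)"
    by (subst sum.swap[of _ "carrier G" B2], subst sum.swap[of _ "carrier G" B1]) simp
  also have "\<dots> = (\<Sum>g\<in>carrier G. v1.tr X1 (\<rho>1 (inv g)) * v1.tr X1 (\<rho>1 g))"
  proof (intro sum.cong refl)
    fix g assume g: "g \<in> carrier G"
    have "v1.tr X1 (\<rho>1 (inv g)) = (\<Sum>b\<in>B1. v1.representation B1 (\<rho>1 (inv g) b) b)"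
      using v1.tr_eq_sum[OF X1(1) D1(1) D1(2)] g by simp
    moreover have "v1.tr X1 (\<rho>1 g) = (\<Sum>c\<in>B2. v2.representation B2 (\<rho>2 g c) c)"
      using v2.tr_eq_sum[OF X2(1) D2(1) D2(2)] g tr[OF g] by simp
    ultimately show "(\<Sum>b\<in>B1. \<Sum>c\<in>B2. v1.representation B1 (\<rho>1 (inv g) b) b * v2.representation B2 (\<rho>2 g c) c)
        = v1.tr X1 (\<rho>1 (inv g)) * v1.tr X1 (\<rho>1 g)" by (simp add: sum_product)
  qed
  finally show False using v1.trace_product_sum_nonzero[OF assms(1,2) X1 assms(8)] by simp
qed


text \<open>Induction on the dimension replaces the decomposition into irreducibles: a nonzero
  equivariant \<open>h\<close> identifies a complement of its kernel with its image, and what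
  remains on both sides again has equal traces.\<close>

theorem finite_group_equal_traces:
  fixes G (structure)
  assumes G: "group G" "finite (carrier G)"
    and X1: "v1.basis_of B1 X1" "v1.rep_on G \<rho>1 X1" and X2: "v2.basis_of B2 X2" "v2.rep_on G \<rho>2 X2"
    and tr: "\<And>g. g \<in> carrier G \<Longrightarrow> v1.tr X1 (\<rho>1 g) = v2.tr X2 (\<rho>2 g)"
  shows "\<exists>f. equivariant G \<rho>1 \<rho>2 X1 X2 f \<and> bij_betw f X1 X2"
  using X1 X2 tr
proof (induction "v1.dim X1" arbitrary: X1 X2 B1 B2 rule: less_induct)
  case less
  note X1 = less.prems(1,2) and X2 = less.prems(3,4) and tr = less.prems(5)
  interpret group G by fact
  note D1 = v1.rep_onD[OF X1(2)] and D2 = v2.rep_onD[OF X2(2)]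
    and BD1 = v1.basis_ofD[OF X1(1)] and BD2 = v2.basis_ofD[OF X2(1)]
  show ?case
  proof (cases "B1 = {}")
    case True
    then have X10: "X1 = {0}" using BD1(3) by simp
    \<comment> \<open>The trace at the identity is the dimension, so a zero \<open>X1\<close> forces
      a zero \<open>X2\<close>.\<close>
    have "v2.tr X2 (\<rho>2 \<one>) = of_nat (card B2)"
      by (rule v2.tr_id[OF X2(1) D2(1)[OF one_closed]]) (rule D2(4))
    moreover have "v1.tr X1 (\<rho>1 \<one>) = 0" unfolding X10 by (rule v1.tr_zero)
    ultimately have "B2 = {}" using tr[OF one_closed] BD2(1) by simp
    then have X20: "X2 = {0}" using BD2(3) by simp
    have "equivariant G \<rho>1 \<rho>2 X1 X2 (\<lambda>x. 0)"
      using hom_zero D2(1) by (simp add: equivariant_def X20 v2.linD)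
    then show ?thesis by (intro exI[of _ "\<lambda>x. 0"]) (simp add: X10 X20 bij_betw_def)
  next
    case False
    obtain h x0 where h: "equivariant G \<rho>1 \<rho>2 X1 X2 h" and x0: "x0 \<in> X1" "h x0 \<noteq> 0"
      by (rule equivariant_nonzero_exists[OF G X1 X2 tr False])
    note hD = equivariantD[OF h]
    define K where "K = {x \<in> X1. h x = 0}"
    have K: "v1.subspace K" "K \<subseteq> X1"
      using BD1(5) by (auto simp: K_def homD hD(1) intro!: v1.subspaceI
          intro: v1.subspace_0 v1.subspace_add v1.subspace_scale)
    have Kinv: "\<rho>1 g x \<in> K" if "g \<in> carrier G" "x \<in> K" for g x
      using that D1(2) hD(3) D2(1) by (simp add: K_def v2.linD)
    have "\<exists>\<pi>. v1.lin \<pi> \<and> (\<forall>x\<in>X1. \<pi> x \<in> K) \<and> (\<forall>y\<in>K. \<pi> y = y) \<and>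
        (\<forall>g\<in>carrier G. \<forall>x\<in>X1. \<pi> (\<rho>1 g x) = \<rho>1 g (\<pi> x))"
      by (rule v1.invariant_projection[OF G X1 K]) (rule Kinv)
    then obtain p where p: "v1.lin p" "\<And>x. x \<in> X1 \<Longrightarrow> p x \<in> K" "\<And>x. x \<in> K \<Longrightarrow> p x = x"
      "\<And>g x. g \<in> carrier G \<Longrightarrow> x \<in> X1 \<Longrightarrow> p (\<rho>1 g x) = \<rho>1 g (p x)"
      by blast
    define Y where "Y = h ` X1"
    have Y: "v2.subspace Y" "Y \<subseteq> X2"
      unfolding Y_def using linear_subspace_image[OF hD(1) BD1(5)] hD(2) by auto
    have Yinv: "\<rho>2 g y \<in> Y" if "g \<in> carrier G" "y \<in> Y" for g y
      using that D1(2) hD(3) by (force simp: Y_def)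
    have "\<exists>\<pi>. v2.lin \<pi> \<and> (\<forall>x\<in>X2. \<pi> x \<in> Y) \<and> (\<forall>y\<in>Y. \<pi> y = y) \<and>
        (\<forall>g\<in>carrier G. \<forall>x\<in>X2. \<pi> (\<rho>2 g x) = \<rho>2 g (\<pi> x))"
      by (rule v2.invariant_projection[OF G X2 Y]) (rule Yinv)
    then obtain r where r: "v2.lin r" "\<And>y. y \<in> X2 \<Longrightarrow> r y \<in> Y" "\<And>y. y \<in> Y \<Longrightarrow> r y = y"
      "\<And>g y. g \<in> carrier G \<Longrightarrow> y \<in> X2 \<Longrightarrow> r (\<rho>2 g y) = \<rho>2 g (r y)"
      by blast
    define C where "C = {x \<in> X1. p x = 0}"
    define D where "D = {y \<in> X2. r y = 0}"
    have C: "v1.subspace C" "C \<subseteq> X1"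
      using BD1(5) by (auto simp: C_def v1.linD p(1) intro!: v1.subspaceI
          intro: v1.subspace_0 v1.subspace_add v1.subspace_scale)
    have D: "v2.subspace D" "D \<subseteq> X2"
      using BD2(5) by (auto simp: D_def v2.linD r(1) intro!: v2.subspaceI
          intro: v2.subspace_0 v2.subspace_add v2.subspace_scale)
    have Cinv: "\<rho>1 g x \<in> C" if "g \<in> carrier G" "x \<in> C" for g x
      using that D1 p(4) by (simp add: C_def v1.linD)
    have Dinv: "\<rho>2 g y \<in> D" if "g \<in> carrier G" "y \<in> D" for g y
      using that D2 r(4) by (simp add: D_def v2.linD)
    have KC: "K \<inter> C = {0}" using p(3) v1.subspace_0[OF K(1)] v1.subspace_0[OF C(1)] by (auto simp: C_def)
    have YD: "Y \<inter> D = {0}" using r(3) v2.subspace_0[OF Y(1)] v2.subspace_0[OF D(1)] by (auto simp: D_def)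
    have splitX: "x - p x \<in> C" if "x \<in> X1" for x
      using p(2)[OF that] p(3)[OF p(2)[OF that]] K(2) that BD1(5)
      by (auto simp: C_def v1.linD p(1) intro: v1.subspace_diff)
    have splitY: "y - r y \<in> D" if "y \<in> X2" for y
      using r(2)[OF that] r(3)[OF r(2)[OF that]] Y(2) that BD2(5)
      by (auto simp: D_def v2.linD r(1) intro: v2.subspace_diff)
    have hx: "h (x - p x) = h x" if "x \<in> X1" for x
      using p(2)[OF that] by (simp add: homD hD(1) K_def)
    have hC: "h ` C = Y"
    proof
      show "h ` C \<subseteq> Y" using C(2) by (auto simp: Y_def)
      show "Y \<subseteq> h ` C" using hx splitX unfolding Y_def by (metis image_eqI image_subsetI)
    qed
    have injC: "inj_on h C"
    proof (rule inj_onI)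
      fix x y assume xy: "x \<in> C" "y \<in> C" "h x = h y"
      then have "x - y \<in> C" "x - y \<in> K"
        using v1.subspace_diff[OF C(1)] C(2) by (auto simp: K_def homD hD(1))
      then have "x - y \<in> K \<inter> C" by blast
      then show "x = y" unfolding KC by simp
    qed
    obtain BK where BK: "v1.basis_of BK K"
      using v1.basis_exists_in[OF K(1), of B1] K(2) BD1 by blast
    obtain BC where BC: "v1.basis_of BC C"
      using v1.basis_exists_in[OF C(1), of B1] C(2) BD1 by blast
    obtain BDD where BDD: "v2.basis_of BDD D"
      using v2.basis_exists_in[OF D(1), of B2] D(2) BD2 by blast
    \<comment> \<open>The traces on \<open>C\<close> and on \<open>Y\<close> cancel, because
      \<open>h\<close> is an equivariant bijection between them.\<close>
    have "v1.tr K (\<rho>1 g) = v2.tr D (\<rho>2 g)" if g: "g \<in> carrier G" for g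
    proof -
      have "v1.tr X1 (\<rho>1 g) = v1.tr K (\<rho>1 g) + v1.tr C (\<rho>1 g)"
      proof (rule v1.tr_direct_sum[OF X1(1) K C KC _ D1(1)[OF g] Kinv[OF g] Cinv[OF g]])
        fix x assume "x \<in> X1"
        then show "\<exists>p\<in>K. \<exists>z\<in>C. x = p + z" using p(2) splitX
          by (intro bexI[of _ "p x"] bexI[of _ "x - p x"]) auto
      qed
      moreover have "v2.tr X2 (\<rho>2 g) = v2.tr Y (\<rho>2 g) + v2.tr D (\<rho>2 g)"
      proof (rule v2.tr_direct_sum[OF X2(1) Y D YD _ D2(1)[OF g] Yinv[OF g] Dinv[OF g]])
        fix x assume "x \<in> X2"
        then show "\<exists>p\<in>Y. \<exists>z\<in>D. x = p + z" using r(2) splitY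
          by (intro bexI[of _ "r x"] bexI[of _ "x - r x"]) auto
      qed
      moreover have "v1.tr C (\<rho>1 g) = v2.tr Y (\<rho>2 g)"
        unfolding hC[symmetric]
        by (rule tr_transport[OF BC hD(1) injC D1(1)[OF g] Cinv[OF g] D2(1)[OF g]])
          (use hD(3)[OF g] C(2) in blast)+
      ultimately show ?thesis using tr[OF g] by simp
    qed
    moreover have "v1.dim K < v1.dim X1"
      by (rule v1.proper_subspace_dim[OF X1(1) K]) (use x0 in \<open>auto simp: K_def\<close>)
    moreover have "v1.rep_on G \<rho>1 K" by (rule v1.rep_on_subset[OF X1(2) K(2) Kinv])
    moreover have "v2.rep_on G \<rho>2 D" by (rule v2.rep_on_subset[OF X2(2) D(2) Dinv])
    ultimately obtain f where f: "equivariant G \<rho>1 \<rho>2 K D f" "bij_betw f K D"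
      using less.hyps[OF _ BK _ BDD] by blast
    note fD = equivariantD[OF f(1)]
    \<comment> \<open>\<open>h\<close> vanishes on \<open>K\<close> and \<open>p\<close> on
      \<open>C\<close>, so \<open>F\<close> is \<open>f\<close> from \<open>K\<close> to
      \<open>D\<close> and \<open>h\<close> from \<open>C\<close> to \<open>Y\<close>.\<close>
    define F where "F x = f (p x) + h x" for x
    have FX: "F x \<in> X2" if "x \<in> X1" for x
      using fD(2)[OF p(2)[OF that]] D(2) hD(2)[OF that] BD2(5) by (auto simp: F_def intro: v2.subspace_add)
    have "equivariant G \<rho>1 \<rho>2 X1 X2 F"
    proof -
      have "hom F" unfolding F_def by (rule hom_add[OF hom_lin_compose[OF fD(1) p(1)] hD(1)])
      moreover have "F (\<rho>1 g x) = \<rho>2 g (F x)" if "g \<in> carrier G" "x \<in> X1" for g x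
        using that p(2,4) fD(3) hD(3) D2(1) by (simp add: F_def v2.linD)
      ultimately show ?thesis using FX by (simp add: equivariant_def)
    qed
    moreover have "bij_betw F X1 X2"
    proof (rule bij_betw_imageI)
      show "inj_on F X1"
      proof (rule inj_onI)
        fix x y assume xy: "x \<in> X1" "y \<in> X1" "F x = F y"
        define z where "z = x - y"
        have z: "z \<in> X1" using xy BD1(5) by (simp add: z_def v1.subspace_diff)
        have "f (p z) + h z = 0"
          using xy(3) by (simp add: z_def F_def homD fD(1) hD(1) v1.linD p(1) algebra_simps)
        then have eq: "f (p z) = - h z" by (simp add: eq_neg_iff_add_eq_0)
        have "f (p z) \<in> D" using fD(2) p(2) z by blast
        moreover have "- h z \<in> Y" using z Y(1) by (auto simp: Y_def intro: v2.subspace_neg)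
        ultimately have "f (p z) \<in> Y \<inter> D" using eq by simp
        then have "f (p z) = 0" unfolding YD by simp
        then have "h z = 0" using eq by simp
        then have "z \<in> K" using z by (simp add: K_def)
        then have "p z = z" by (rule p(3))
        moreover have "p z = 0"
          using \<open>f (p z) = 0\<close> f(2) p(2)[OF z] homD(3)[OF fD(1)] v1.subspace_0[OF K(1)]
          by (auto simp: bij_betw_def inj_on_def)
        ultimately show "x = y" by (simp add: z_def)
      qed
      show "F ` X1 = X2"
      proof
        show "F ` X1 \<subseteq> X2" using FX by blast
        show "X2 \<subseteq> F ` X1"
        proof
          fix y assume y: "y \<in> X2"
          obtain x where x: "x \<in> X1" "h x = r y" using r(2)[OF y] by (auto simp: Y_def)
          obtain k where k: "k \<in> K" "f k = y - r y"
            using splitY[OF y] f(2) by (auto simp: bij_betw_def)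
          define z where "z = (x - p x) + k"
          have z: "z \<in> X1" using splitX[OF x(1)] k(1) C(2) K(2) BD1(5) by (auto simp: z_def intro: v1.subspace_add)
          have "p z = k" using splitX[OF x(1)] p(3)[OF k(1)] by (simp add: z_def v1.linD p(1) C_def)
          moreover have "h z = r y" using hx[OF x(1)] k(1) x(2) by (simp add: z_def homD hD(1) K_def)
          ultimately have "F z = y" using k(2) by (simp add: F_def)
          then show "y \<in> F ` X1" using z by blast
        qed
      qed
    qed
    ultimately show ?thesis by blast
  qed
qed

text \<open>Both actions factor through the quotient of \<open>W\<close> by the elements trivial on
  \<open>X1\<close> and on \<open>X2\<close>. Finiteness of the joint image makes this quotient
  finite.\<close>

theorem finite_image_equal_traces:
  fixes W (structure)
  assumes W: "group W"
    and X1: "v1.basis_of B1 X1" "v1.rep_on W \<rho>1 X1" and X2: "v2.basis_of B2 X2" "v2.rep_on W \<rho>2 X2"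
    and fin: "finite ((\<lambda>w. (restrict (\<rho>1 w) X1, restrict (\<rho>2 w) X2)) ` carrier W)"
    and tr: "\<And>w. w \<in> carrier W \<Longrightarrow> v1.tr X1 (\<rho>1 w) = v2.tr X2 (\<rho>2 w)"
  shows "\<exists>f. equivariant W \<rho>1 \<rho>2 X1 X2 f \<and> bij_betw f X1 X2"
proof -
  interpret group W by fact
  note D1 = v1.rep_onD[OF X1(2)] and D2 = v2.rep_onD[OF X2(2)]
  define H where "H = {w \<in> carrier W. (\<forall>x\<in>X1. \<rho>1 w x = x) \<and> (\<forall>x\<in>X2. \<rho>2 w x = x)}"
  have inv1: "\<rho>1 (inv w) (\<rho>1 w x) = x" "\<rho>1 w (\<rho>1 (inv w) x) = x" if "w \<in> carrier W" "x \<in> X1" for w x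
    using that D1(3)[of "inv w" w x] D1(3)[of w "inv w" x] D1(4) by simp_all
  have inv2: "\<rho>2 (inv w) (\<rho>2 w x) = x" "\<rho>2 w (\<rho>2 (inv w) x) = x" if "w \<in> carrier W" "x \<in> X2" for w x
    using that D2(3)[of "inv w" w x] D2(3)[of w "inv w" x] D2(4) by simp_all
  have "subgroup H W"
  proof
    show "inv w \<in> H" if "w \<in> H" for w
      using that inv1(1) inv2(1) by (force simp: H_def)
  qed (auto simp: H_def D1 D2)
  moreover have "w \<otimes> h \<otimes> inv w \<in> H" if "w \<in> carrier W" "h \<in> H" for w h
    using that by (auto simp: H_def D1 D2 inv1 inv2)
  ultimately have N: "H \<lhd> W" unfolding normal_inv_iff by blast
  interpret normal H W by fact
  define G where "G = W Mod H"
  have G: "group G" unfolding G_def by (rule factorgroup_is_group)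
  have same: "\<rho>1 w x = \<rho>1 w' x" "\<rho>2 w y = \<rho>2 w' y"
    if "w \<in> carrier W" "w' \<in> H #> w" "x \<in> X1" "y \<in> X2" for w w' x y
  proof -
    define h where "h = w' \<otimes> inv w"
    have w': "w' \<in> carrier W" by (rule subsetD[OF r_coset_subset_G[OF subset that(1)] that(2)])
    have h: "h \<in> H" "w' = h \<otimes> w"
      using rcos_module_imp[OF W that(1,2)] w' that(1) by (simp_all add: h_def m_assoc)
    have hW: "h \<in> carrier W" by (rule subsetD[OF subset h(1)])
    have hid: "\<And>x. x \<in> X1 \<Longrightarrow> \<rho>1 h x = x" "\<And>x. x \<in> X2 \<Longrightarrow> \<rho>2 h x = x"
      using h(1) unfolding H_def by blast+
    show "\<rho>1 w x = \<rho>1 w' x"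
      unfolding h(2) D1(3)[OF hW that(1,3)] by (rule hid(1)[OF D1(2)[OF that(1,3)], symmetric])
    show "\<rho>2 w y = \<rho>2 w' y"
      unfolding h(2) D2(3)[OF hW that(1,4)] by (rule hid(2)[OF D2(2)[OF that(1,4)], symmetric])
  qed
  \<comment> \<open>A representative of each coset turns the action of \<open>W\<close> into one of
    the quotient; by \<open>same\<close> its choice does not matter on \<open>X1\<close> and
    \<open>X2\<close>.\<close>
  define c where "c S = (SOME w. w \<in> S)" for S :: "'d set"
  have c: "c (H #> w) \<in> H #> w" if "w \<in> carrier W" for w
    unfolding c_def using rcos_self[OF that subgroup_axioms] by (rule someI)
  have Gcar: "carrier G = (\<lambda>w. H #> w) ` carrier W" by (simp add: G_def carrier_FactGroup)
  have cW: "c (H #> w) \<in> carrier W" if "w \<in> carrier W" for w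
    using c[OF that] that r_coset_subset_G[OF subset] by blast
  have c1: "\<rho>1 (c (H #> w)) x = \<rho>1 w x" if "w \<in> carrier W" "x \<in> X1" for w x
    using same(1)[OF that(1) c[OF that(1)] that(2) v2.subspace_0[OF v2.basis_ofD(5)[OF X2(1)]]] by simp
  have c2: "\<rho>2 (c (H #> w)) x = \<rho>2 w x" if "w \<in> carrier W" "x \<in> X2" for w x
    using same(2)[OF that(1) c[OF that(1)] v1.subspace_0[OF v1.basis_ofD(5)[OF X1(1)]] that(2)] by simp
  have "finite (carrier G)"
  proof -
    define F where "F w = (restrict (\<rho>1 w) X1, restrict (\<rho>2 w) X2)" for w
    have FH: "H #> w = H #> w'" if "w \<in> carrier W" "w' \<in> carrier W" "F w = F w'" for w w'
    proof -
      have e: "\<rho>1 w x = \<rho>1 w' x" if "x \<in> X1" for x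
        using \<open>F w = F w'\<close> that by (auto simp: F_def restrict_def fun_eq_iff split: if_splits)
      have e': "\<rho>2 w x = \<rho>2 w' x" if "x \<in> X2" for x
        using \<open>F w = F w'\<close> that by (auto simp: F_def restrict_def fun_eq_iff split: if_splits)
      note iw = inv_closed[OF that(2)]
      have "\<rho>1 (w \<otimes> inv w') x = x" if "x \<in> X1" for x
        unfolding D1(3)[OF \<open>w \<in> carrier W\<close> iw that] e[OF D1(2)[OF iw that]]
        by (rule inv1(2)[OF \<open>w' \<in> carrier W\<close> that])
      moreover have "\<rho>2 (w \<otimes> inv w') x = x" if "x \<in> X2" for x
        unfolding D2(3)[OF \<open>w \<in> carrier W\<close> iw that] e'[OF D2(2)[OF iw that]]
        by (rule inv2(2)[OF \<open>w' \<in> carrier W\<close> that])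
      moreover have "w \<otimes> inv w' \<in> carrier W" by (rule monoid.m_closed[OF is_monoid that(1) iw])
      ultimately have "w \<otimes> inv w' \<in> H" unfolding H_def by blast
      then have "w \<in> H #> w'" by (rule rcos_module_rev[OF W that(2,1)])
      then show ?thesis by (rule repr_independence[OF _ that(2) subgroup_axioms, symmetric])
    qed
    then have some: "H #> (SOME v. v \<in> carrier W \<and> F v = F w) = H #> w" if "w \<in> carrier W" for w
    proof -
      have "(SOME v. v \<in> carrier W \<and> F v = F w) \<in> carrier W \<and> F (SOME v. v \<in> carrier W \<and> F v = F w) = F w"
        by (rule someI[of _ w]) (simp add: that)
      from this[THEN conjunct1] that this[THEN conjunct2] show ?thesis by (rule FH)
    qed
    have "(\<lambda>w. H #> w) ` carrier W \<subseteq> (\<lambda>y. H #> (SOME w. w \<in> carrier W \<and> F w = y)) ` F ` carrier W"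
    proof (intro image_subsetI)
      fix w assume w: "w \<in> carrier W"
      show "H #> w \<in> (\<lambda>y. H #> (SOME w. w \<in> carrier W \<and> F w = y)) ` F ` carrier W"
        using some[OF w] w
        by (intro rev_image_eqI[of "F w"]) simp_all
    qed
    then show ?thesis unfolding Gcar using fin finite_subset unfolding F_def by blast
  qed
  moreover have "v1.rep_on G (\<lambda>S. \<rho>1 (c S)) X1"
    unfolding v1.rep_on_def Gcar
  proof (intro conjI ballI; (elim imageE; hypsubst)?)
    fix w w' x assume "w \<in> carrier W" "w' \<in> carrier W" "x \<in> X1"
    then show "\<rho>1 (c ((H #> w) \<otimes>\<^bsub>G\<^esub> (H #> w'))) x = \<rho>1 (c (H #> w)) (\<rho>1 (c (H #> w')) x)"
      by (simp add: G_def rcos_sum c1 D1)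
  next
    fix x assume "x \<in> X1"
    have "H = H #> \<one>" using subset by simp
    then show "\<rho>1 (c \<one>\<^bsub>G\<^esub>) x = x" using c1[of \<one> x] \<open>x \<in> X1\<close> by (simp add: G_def D1)
  qed (simp_all add: cW D1)
  moreover have "v2.rep_on G (\<lambda>S. \<rho>2 (c S)) X2"
    unfolding v2.rep_on_def Gcar
  proof (intro conjI ballI; (elim imageE; hypsubst)?)
    fix w w' x assume "w \<in> carrier W" "w' \<in> carrier W" "x \<in> X2"
    then show "\<rho>2 (c ((H #> w) \<otimes>\<^bsub>G\<^esub> (H #> w'))) x = \<rho>2 (c (H #> w)) (\<rho>2 (c (H #> w')) x)"
      by (simp add: G_def rcos_sum c2 D2)
  next
    fix x assume "x \<in> X2"
    have "H = H #> \<one>" using subset by simp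
    then show "\<rho>2 (c \<one>\<^bsub>G\<^esub>) x = x" using c2[of \<one> x] \<open>x \<in> X2\<close> by (simp add: G_def D2)
  qed (simp_all add: cW D2)
  moreover have "v1.tr X1 (\<rho>1 (c S)) = v2.tr X2 (\<rho>2 (c S))" if "S \<in> carrier G" for S
    using that cW tr by (auto simp: Gcar)
  ultimately obtain f where f: "equivariant G (\<lambda>S. \<rho>1 (c S)) (\<lambda>S. \<rho>2 (c S)) X1 X2 f" "bij_betw f X1 X2"
    using finite_group_equal_traces[OF G _ X1(1) _ X2(1)] by blast
  have "equivariant W \<rho>1 \<rho>2 X1 X2 f"
    unfolding equivariant_def
  proof (intro conjI ballI)
    fix w x assume "w \<in> carrier W" "x \<in> X1"
    then show "f (\<rho>1 w x) = \<rho>2 w (f x)"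
      using equivariantD(3)[OF f(1), of "H #> w" x] equivariantD(2)[OF f(1), of x] c1 c2 by (simp add: Gcar)
  qed (use equivariantD[OF f(1)] in auto)
  then show ?thesis using f(2) by blast
qed

end

section \<open>Pure representations with nilpotent operator\<close>

context vspace begin

lemma primitive_decomposition:
  assumes N: "lin N" and E': "subspace E'" and NE: "\<And>x. x \<in> E' \<Longrightarrow> N x \<in> E"
    and bij: "bij_betw (N ^^ Suc n) E' F" and NF: "\<And>x. x \<in> E \<Longrightarrow> (N ^^ n) x \<in> F"
  shows "inj_on N E'" "{x \<in> E. (N ^^ n) x = 0} \<inter> N ` E' \<subseteq> {0}"
    "x \<in> E \<Longrightarrow> \<exists>y\<in>E'. (N ^^ n) (x - N y) = 0"
proof -
  note lp = lin_pow[OF N]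
  have inj: "x = y" if "x \<in> E'" "y \<in> E'" "(N ^^ Suc n) x = (N ^^ Suc n) y" for x y
    using bij that by (auto simp: bij_betw_def inj_on_def simp del: funpow.simps)
  show "inj_on N E'"
    by (rule inj_onI) (rule inj, auto simp: funpow_Suc_right simp del: funpow.simps(2))
  show "{x \<in> E. (N ^^ n) x = 0} \<inter> N ` E' \<subseteq> {0}"
  proof clarsimp
    fix y assume "y \<in> E'" "(N ^^ n) (N y) = 0"
    then have "y = 0" using inj[of y 0] subspace_0[OF E']
      by (simp add: funpow_Suc_right linD[OF lp] linD[OF N] del: funpow.simps(2))
    then show "N y = 0" by (simp add: linD[OF N])
  qed
  assume "x \<in> E"
  then have "(N ^^ n) x \<in> (N ^^ Suc n) ` E'" using NF bij by (simp add: bij_betw_def del: funpow.simps)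
  then obtain y where "y \<in> E'" "(N ^^ n) x = (N ^^ Suc n) y" by blast
  then have "(N ^^ n) (x - N y) = 0" by (simp add: linD[OF lp] funpow_Suc_right del: funpow.simps(2))
  with \<open>y \<in> E'\<close> show "\<exists>y\<in>E'. (N ^^ n) (x - N y) = 0" by blast
qed

end

text \<open>What remains of purity once the filtration is forgotten. Here \<open>\<tau>\<close>
  stands for the power of Frobenius, \<open>Wt k c\<close> says that eigenvalue \<open>c\<close>
  belongs to degree \<open>k\<close>, and \<open>pure\<close> is the monodromy isomorphism between
  eigenspaces.\<close>

locale pure_rep = vspace scale + group W
  for scale :: "'a::{alg_closed_field,field_char_0} \<Rightarrow> 'b::ab_group_add \<Rightarrow> 'b" (infixr "\<cdot>" 75)
  and W :: "('g, 'm) monoid_scheme" (structure) +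
  fixes R :: "'g \<Rightarrow> 'b \<Rightarrow> 'b" and N :: "'b \<Rightarrow> 'b" and v :: "'g \<Rightarrow> int" and q :: 'a and \<tau> :: 'g
    and Wt :: "int \<Rightarrow> 'a \<Rightarrow> bool"
  assumes fin: "\<exists>B. finite B \<and> span B = UNIV"
    and R: "rep_on W R UNIV" and N: "lin N" and q0: "q \<noteq> 0"
    and v: "\<And>x y. x \<in> carrier W \<Longrightarrow> y \<in> carrier W \<Longrightarrow> v (x \<otimes> y) = v x + v y"
    and NR: "\<And>w x. w \<in> carrier W \<Longrightarrow> R w (N x) = q powi (- v w) \<cdot> N (R w x)"
    and \<tau>: "\<tau> \<in> carrier W" "v \<tau> > 0"
    and comm: "\<And>w x. w \<in> carrier W \<Longrightarrow> R \<tau> (R w x) = R w (R \<tau> x)"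
    and diag: "diagonalizable scale (R \<tau>)"
    and Wt_ex: "\<And>c. eig (R \<tau>) c \<noteq> {0} \<Longrightarrow> \<exists>k. Wt k c"
    and Wt_unique: "\<And>k k' c. Wt k c \<Longrightarrow> Wt k' c \<Longrightarrow> k = k'"
    and Wt_shift: "\<And>k c. Wt (k + 2) (q powi v \<tau> * c) \<longleftrightarrow> Wt k c"
    and pure: "\<And>k c. Wt (int k) c \<Longrightarrow>
      bij_betw (N ^^ k) (eig (R \<tau>) c) (eig (R \<tau>) (c / (q powi v \<tau>) ^ k))"
begin

definition Q where "Q = q powi v \<tau>"
definition E where "E c = eig (R \<tau>) c"

lemma Q0: "Q \<noteq> 0" using q0 by (simp add: Q_def)

lemma Wt_mult: "Wt k c \<Longrightarrow> Wt (k + 2) (Q * c)" and Wt_div: "Wt k c \<Longrightarrow> Wt (k - 2) (c / Q)"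
  using Wt_shift[of k c] Wt_shift[of "k - 2" "c / Q"] Q0 q0 by (simp_all add: Q_def)

lemma Wt_mult_power: "Wt k c \<Longrightarrow> Wt (k + 2 * int j) (Q ^ j * c)"
proof (induction j)
  case (Suc j)
  from Wt_mult[OF Suc.IH[OF Suc.prems]] show ?case by (simp add: algebra_simps)
qed simp

lemma RD: "w \<in> carrier W \<Longrightarrow> lin (R w)"
  "w \<in> carrier W \<Longrightarrow> w' \<in> carrier W \<Longrightarrow> R (w \<otimes> w') x = R w (R w' x)" "R \<one> x = x"
  using rep_onD[OF R] by auto

lemma linR: "w \<in> carrier W \<Longrightarrow> lin (R w)" by (rule RD(1))

lemma subspace_E: "subspace (E c)"
  unfolding E_def by (rule subspace_eig[OF linR[OF \<tau>(1)]])

lemma zero_E: "0 \<in> E c"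
  by (rule subspace_0[OF subspace_E])

lemma basis_sub: assumes "subspace X" shows "\<exists>B. basis_of B X"
  using fin basis_exists_in[OF assms] by auto

lemma R_E: "w \<in> carrier W \<Longrightarrow> x \<in> E c \<Longrightarrow> R w x \<in> E c"
  using comm[of w x] linR[of w] by (simp add: E_def eig_def linD)

lemma N_E: "x \<in> E c \<Longrightarrow> N x \<in> E (c / Q)"
  using NR[OF \<tau>(1), of x] by (simp add: E_def eig_def linD N Q_def power_int_minus field_simps)

lemma N_E': "x \<in> E (Q * c) \<Longrightarrow> N x \<in> E c"
  using N_E[of x "Q * c"] Q0 by simp

lemma Npow_E: "x \<in> E c \<Longrightarrow> (N ^^ j) x \<in> E (c / Q ^ j)"
proof (induction j)
  case (Suc j)
  from N_E[OF Suc.IH[OF Suc.prems]] show ?case by (simp add: field_simps)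
qed simp

lemma NR_pow: "w \<in> carrier W \<Longrightarrow> R w ((N ^^ j) x) = (q powi (- v w)) ^ j \<cdot> (N ^^ j) (R w x)"
  by (induction j) (simp_all add: NR linD N)

lemma bij_E: "Wt (int k) c \<Longrightarrow> bij_betw (N ^^ k) (E c) (E (c / Q ^ k))"
  using pure by (simp add: E_def Q_def)

lemma R_inj: "w \<in> carrier W \<Longrightarrow> R w x = 0 \<Longrightarrow> x = 0"
  using RD(2)[of "inv w" w x] RD(3)[of x] linD(3)[OF linR[of "inv w"]] by simp

lemma E_zero: "E 0 = {0}"
  using R_inj[OF \<tau>(1)] linD(3)[OF linR[OF \<tau>(1)]] by (auto simp: E_def eig_def)

text \<open>The primitive part of the eigenspace, in weight \<open>k\<close>.\<close>

definition P where "P k c = {x \<in> E c. (N ^^ Suc k) x = 0}"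

lemma subspace_P: "subspace (P k c)"
  unfolding P_def using subspace_E[of c] linD[OF lin_pow[OF N, of "Suc k"]]
  by (intro subspaceI) (auto intro: subspace_add subspace_scale zero_E simp del: funpow.simps)

lemma R_P: "w \<in> carrier W \<Longrightarrow> x \<in> P k c \<Longrightarrow> R w x \<in> P k c"
proof -
  assume w: "w \<in> carrier W" and x: "x \<in> P k c"
  have "(q powi (- v w)) ^ Suc k \<cdot> (N ^^ Suc k) (R w x) = 0"
    using NR_pow[OF w, of "Suc k" x] x linD(3)[OF linR[OF w]] by (simp add: P_def del: funpow.simps power_Suc)
  then show ?thesis using x w q0 by (simp add: P_def R_E del: funpow.simps power_Suc)
qed

lemma primitive:
  assumes "Wt (int k) c"
  shows "inj_on N (E (Q * c))" "P k c \<inter> N ` E (Q * c) = {0}"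
    "x \<in> E c \<Longrightarrow> \<exists>y\<in>E (Q * c). x - N y \<in> P k c"
proof -
  \<comment> \<open>The eigenvalue \<open>Q * c\<close> lies in degree \<open>k + 2\<close>, from
    where \<open>N ^^ (k + 2)\<close> is bijective. So the decomposition is used with
    \<open>n = Suc k\<close>.\<close>
  have "Wt (int (Suc (Suc k))) (Q * c)" using Wt_mult[OF assms] by (simp add: algebra_simps)
  from bij_E[OF this] have b: "bij_betw (N ^^ Suc (Suc k)) (E (Q * c)) (E (c / Q ^ Suc k))"
    using Q0 by (simp add: field_simps)
  note PD = primitive_decomposition[OF N subspace_E N_E' b Npow_E, of c]
  show "inj_on N (E (Q * c))" using PD(1) by blast
  have "P k c \<inter> N ` E (Q * c) \<subseteq> {0}" using PD(2) unfolding P_def by blast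
  moreover have "0 \<in> P k c" by (rule subspace_0[OF subspace_P])
  moreover have "0 \<in> N ` E (Q * c)" using zero_E linD(3)[OF N] by (metis image_eqI)
  ultimately show "P k c \<inter> N ` E (Q * c) = {0}" by blast
  show "\<exists>y\<in>E (Q * c). x - N y \<in> P k c" if x: "x \<in> E c"
  proof -
    from PD(3)[OF _ _ x] obtain y where y: "y \<in> E (Q * c)" "(N ^^ Suc k) (x - N y) = 0" by blast
    then show ?thesis using subspace_diff[OF subspace_E x N_E'[OF y(1)]] by (auto simp: P_def simp del: funpow.simps)
  qed
qed

lemma trace_P:
  assumes "Wt (int k) c" and w: "w \<in> carrier W"
  shows "tr (P k c) (R w) = tr (E c) (R w) - q powi (- v w) * tr (E (Q * c)) (R w)"
proof -
  interpret S: vspace_pair scale scale ..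
  obtain B where B: "basis_of B (E c)" using basis_sub[OF subspace_E] by blast
  obtain B' where B': "basis_of B' (E (Q * c))" using basis_sub[OF subspace_E] by blast
  have Z: "subspace (N ` E (Q * c))" by (rule lin_image_subspace[OF N subspace_E])
  have "tr (E c) (R w) = tr (P k c) (R w) + tr (N ` E (Q * c)) (R w)"
  proof (rule tr_direct_sum[OF B subspace_P _ Z _ primitive(2)[OF assms(1)] _ linR[OF w]])
    show "P k c \<subseteq> E c" by (auto simp: P_def)
    show "N ` E (Q * c) \<subseteq> E c" using N_E' by blast
    show "\<exists>p\<in>P k c. \<exists>z\<in>N ` E (Q * c). x = p + z" if "x \<in> E c" for x
    proof -
      obtain y where "y \<in> E (Q * c)" "x - N y \<in> P k c" using primitive(3)[OF assms(1) \<open>x \<in> E c\<close>] by blast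
      then show ?thesis by (intro bexI[of _ "x - N y"] bexI[of _ "N y"]) auto
    qed
    show "R w x \<in> P k c" if "x \<in> P k c" for x using R_P[OF w that] .
    show "R w z \<in> N ` E (Q * c)" if "z \<in> N ` E (Q * c)" for z
    proof -
      from that obtain y where y: "y \<in> E (Q * c)" "z = N y" by blast
      have "R w z = N (q powi (- v w) \<cdot> R w y)" unfolding y(2) by (simp add: NR[OF w] linD N)
      then show ?thesis using subspace_scale[OF subspace_E R_E[OF w y(1)]] by blast
    qed
  qed
  moreover have "tr (E (Q * c)) (\<lambda>x. q powi (- v w) \<cdot> R w x) = tr (N ` E (Q * c)) (R w)"
  proof (rule S.tr_transport[OF B' N primitive(1)[OF assms(1)] lin_smult[OF linR[OF w]] _ linR[OF w]])
    show "q powi (- v w) \<cdot> R w x \<in> E (Q * c)" if "x \<in> E (Q * c)" for x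
      by (rule subspace_scale[OF subspace_E R_E[OF w that]])
    show "N (q powi (- v w) \<cdot> R w x) = R w (N x)" for x by (simp add: NR[OF w] linD N)
  qed
  moreover have "tr (E (Q * c)) (\<lambda>x. q powi (- v w) \<cdot> R w x) = q powi (- v w) * tr (E (Q * c)) (R w)"
    by (rule tr_smult[OF B' linR[OF w]]) (rule R_E[OF w])
  ultimately show ?thesis by simp
qed

end

text \<open>Finiteness of the joint image is asked on each level set of \<open>v\<close>, since
  powers of Frobenius may have infinitely many images.\<close>

locale pure_pair = vspace_pair s1 s2 + A: pure_rep s1 W R1 N1 v q \<tau> Wt + B: pure_rep s2 W R2 N2 v q \<tau> Wt
  for s1 :: "'a::{alg_closed_field,field_char_0} \<Rightarrow> 'b::ab_group_add \<Rightarrow> 'b"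
  and s2 :: "'a \<Rightarrow> 'c::ab_group_add \<Rightarrow> 'c"
  and W :: "('g, 'm) monoid_scheme" (structure) and R1 N1 v q \<tau> Wt R2 N2 +
  assumes finite_image: "\<And>n. finite ((\<lambda>w. (R1 w, R2 w)) ` {w \<in> carrier W. v w = n})"
    and traces: "\<And>w. w \<in> carrier W \<Longrightarrow> v1.tr UNIV (R1 w) = v2.tr UNIV (R2 w)"
begin

abbreviation Q where "Q \<equiv> A.Q"
abbreviation E1 where "E1 \<equiv> A.E"
abbreviation E2 where "E2 \<equiv> B.E"

abbreviation iso_on :: "'b set \<Rightarrow> 'c set \<Rightarrow> ('b \<Rightarrow> 'c) \<Rightarrow> bool" where
  "iso_on X1 X2 f \<equiv> equivariant W R1 R2 X1 X2 f \<and> bij_betw f X1 X2"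

lemma v_one: "v \<one> = 0"
  using A.v[of \<one> \<one>] by simp

lemma v_inv: "w \<in> carrier W \<Longrightarrow> v (inv w) = - v w"
  using A.v[of w "inv w"] v_one by simp

lemma v_pow: "w \<in> carrier W \<Longrightarrow> v (w [^] (n::nat)) = int n * v w"
  by (induction n) (simp_all add: v_one A.v algebra_simps)

lemma v_int_pow: "w \<in> carrier W \<Longrightarrow> v (w [^] (n::int)) = n * v w"
  by (cases n rule: int_cases2) (simp_all add: int_pow_int A.int_pow_neg v_inv v_pow)

text \<open>On the \<open>c\<close>-eigenspace of \<open>\<tau>\<close>, dividing by the unramified character with value \<open>c\<close> at \<open>\<tau>\<close>
  leaves a representation with finite image.\<close>

lemma iso_on_eigenspaces:
  assumes X1: "v1.subspace X1" "X1 \<subseteq> E1 c" "\<And>w x. w \<in> carrier W \<Longrightarrow> x \<in> X1 \<Longrightarrow> R1 w x \<in> X1"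
    and X2: "v2.subspace X2" "X2 \<subseteq> E2 c" "\<And>w x. w \<in> carrier W \<Longrightarrow> x \<in> X2 \<Longrightarrow> R2 w x \<in> X2"
    and tr: "\<And>w. w \<in> carrier W \<Longrightarrow> v1.tr X1 (R1 w) = v2.tr X2 (R2 w)"
  shows "\<exists>f. iso_on X1 X2 f"
proof (cases "c = 0")
  case True
  then have "X1 = {0}" "X2 = {0}"
    using X1 X2 A.E_zero B.E_zero v1.subspace_0[OF X1(1)] v2.subspace_0[OF X2(1)] by auto
  moreover have "R2 w 0 = 0" if "w \<in> carrier W" for w using B.linR[OF that] by (simp add: v2.linD)
  ultimately show ?thesis using hom_zero
    by (intro exI[of _ "\<lambda>x. 0"]) (auto simp: equivariant_def bij_betw_def)
next
  case False
  define m where "m = nat (v \<tau>)"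
  have m: "m > 0" "v \<tau> = int m" using A.\<tau>(2) by (auto simp: m_def)
  \<comment> \<open>The unramified character is \<open>d powi v w\<close>; it takes the value
    \<open>c\<close> at \<open>\<tau>\<close> because \<open>v \<tau> = m\<close>.\<close>
  obtain d where d: "d ^ m = c" using nth_root_exists[OF m(1)] by blast
  have d0: "d \<noteq> 0" using d False m(1) by auto
  define r1 where "r1 w x = s1 (d powi (- v w)) (R1 w x)" for w x
  define r2 where "r2 w x = s2 (d powi (- v w)) (R2 w x)" for w x
  have dadd: "d powi (- v (w \<otimes> w')) = d powi (- v w) * d powi (- v w')"
    if "w \<in> carrier W" "w' \<in> carrier W" for w w'
    using d0 that by (simp add: A.v flip: power_int_add)
  have rep1: "v1.rep_on W r1 X1"
    unfolding v1.rep_on_def r1_def using X1 A.linR A.RD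
    by (auto simp: dadd v_one v1.linD intro: v1.lin_smult v1.subspace_scale)
  have rep2: "v2.rep_on W r2 X2"
    unfolding v2.rep_on_def r2_def using X2 B.linR B.RD
    by (auto simp: dadd v_one v2.linD intro: v2.lin_smult v2.subspace_scale)
  obtain B1 where B1: "v1.basis_of B1 X1" using A.basis_sub[OF X1(1)] by blast
  obtain B2 where B2: "v2.basis_of B2 X2" using B.basis_sub[OF X2(1)] by blast
  have "v1.tr X1 (r1 w) = v2.tr X2 (r2 w)" if w: "w \<in> carrier W" for w
  proof -
    have "v1.tr X1 (r1 w) = d powi (- v w) * v1.tr X1 (R1 w)"
      unfolding r1_def by (rule v1.tr_smult[OF B1 A.linR[OF w]]) (rule X1(3)[OF w])
    moreover have "v2.tr X2 (r2 w) = d powi (- v w) * v2.tr X2 (R2 w)"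
      unfolding r2_def by (rule v2.tr_smult[OF B2 B.linR[OF w]]) (rule X2(3)[OF w])
    ultimately show ?thesis using tr[OF w] by simp
  qed
  moreover have "finite ((\<lambda>w. (restrict (r1 w) X1, restrict (r2 w) X2)) ` carrier W)"
  proof -
    define G where "G = (\<lambda>(n, f1, f2). (restrict (\<lambda>x. s1 (d powi (- n)) (f1 x)) X1, restrict (\<lambda>x. s2 (d powi (- n)) (f2 x)) X2))"
    define S where "S = (\<Union>n\<in>{0..<int m}. {n} \<times> (\<lambda>w. (R1 w, R2 w)) ` {w \<in> carrier W. v w = n})"
    have "finite S" unfolding S_def using finite_image by auto
    moreover have "(\<lambda>w. (restrict (r1 w) X1, restrict (r2 w) X2)) ` carrier W \<subseteq> G ` S"
    proof (intro image_subsetI)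
      fix w assume w: "w \<in> carrier W"
      \<comment> \<open>Powers of \<open>\<tau>\<close> act trivially after the twist, so
        \<open>w\<close> may be replaced by \<open>u\<close> with \<open>0 \<le> v u < m\<close>;
        that leaves finitely many levels.\<close>
      define a where "a = v w div int m"
      define u where "u = w \<otimes> \<tau> [^] (- a)"
      have u: "u \<in> carrier W" using w A.\<tau>(1) by (simp add: u_def)
      have wu: "w = u \<otimes> \<tau> [^] a"
        using w A.\<tau>(1) by (simp add: u_def A.m_assoc A.int_pow_mult[symmetric])
      have "v u = v w mod int m"
        using w A.\<tau>(1) by (simp add: u_def A.v v_int_pow m(2) a_def minus_div_mult_eq_mod)
      then have vu: "v u \<in> {0..<int m}" using m(1) by simp
      have vw: "v w = v u + a * int m" using u A.\<tau>(1) by (subst wu) (simp add: A.v v_int_pow m(2))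
      have dm: "d powi (- v w) * c powi a = d powi (- v u)"
        using d0 by (simp add: vw d[symmetric] power_int_power flip: power_int_add)
      have T1: "R1 (\<tau> [^] (n::nat)) x = s1 (c ^ n) x" if "x \<in> X1" for n x
        using that X1(2) A.RD A.\<tau>(1) A.linR[OF A.\<tau>(1)]
        by (induction n) (auto simp: A.E_def v1.eig_def v1.linD A.comm mult.commute A.nat_pow_Suc2 simp del: A.nat_pow_Suc)
      have T2: "R2 (\<tau> [^] (n::nat)) x = s2 (c ^ n) x" if "x \<in> X2" for n x
        using that X2(2) B.RD A.\<tau>(1) B.linR[OF A.\<tau>(1)]
        by (induction n) (auto simp: B.E_def v2.eig_def v2.linD B.comm mult.commute A.nat_pow_Suc2 simp del: A.nat_pow_Suc)
      have I1: "R1 (\<tau> [^] a) x = s1 (c powi a) x" if "x \<in> X1" for x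
      proof (cases a rule: int_cases2)
        case (nonneg n) then show ?thesis using T1[OF that] by (simp add: int_pow_int)
      next
        case (nonpos n)
        have "R1 (\<tau> [^] a) (R1 (\<tau> [^] n) x) = x"
          using A.RD(2)[of "\<tau> [^] a" "\<tau> [^] n" x] A.RD(3) A.\<tau>(1) by (simp add: nonpos A.int_pow_neg int_pow_int)
        then have "s1 (c ^ n) (R1 (\<tau> [^] a) x) = x"
          using T1[OF that, of n] v1.linD(2)[OF A.linR[of "\<tau> [^] a"]] A.\<tau>(1) by simp
        then have "s1 (inverse (c ^ n)) (s1 (c ^ n) (R1 (\<tau> [^] a) x)) = s1 (inverse (c ^ n)) x" by simp
        then show ?thesis using False by (simp add: nonpos power_int_minus)
      qed
      have I2: "R2 (\<tau> [^] a) x = s2 (c powi a) x" if "x \<in> X2" for x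
      proof (cases a rule: int_cases2)
        case (nonneg n) then show ?thesis using T2[OF that] by (simp add: int_pow_int)
      next
        case (nonpos n)
        have "R2 (\<tau> [^] a) (R2 (\<tau> [^] n) x) = x"
          using B.RD(2)[of "\<tau> [^] a" "\<tau> [^] n" x] B.RD(3) A.\<tau>(1) by (simp add: nonpos A.int_pow_neg int_pow_int)
        then have "s2 (c ^ n) (R2 (\<tau> [^] a) x) = x"
          using T2[OF that, of n] v2.linD(2)[OF B.linR[of "\<tau> [^] a"]] A.\<tau>(1) by simp
        then have "s2 (inverse (c ^ n)) (s2 (c ^ n) (R2 (\<tau> [^] a) x)) = s2 (inverse (c ^ n)) x" by simp
        then show ?thesis using False by (simp add: nonpos power_int_minus)
      qed
      have "r1 w x = r1 u x" if "x \<in> X1" for x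
      proof -
        have "R1 w x = s1 (c powi a) (R1 u x)"
          using A.RD(2)[OF u, of "\<tau> [^] a" x] I1[OF that] A.\<tau>(1) A.linR[OF u] by (simp add: wu[symmetric] v1.linD)
        then show ?thesis by (simp add: r1_def dm)
      qed
      moreover have "r2 w x = r2 u x" if "x \<in> X2" for x
      proof -
        have "R2 w x = s2 (c powi a) (R2 u x)"
          using B.RD(2)[OF u, of "\<tau> [^] a" x] I2[OF that] A.\<tau>(1) B.linR[OF u] by (simp add: wu[symmetric] v2.linD)
        then show ?thesis by (simp add: r2_def dm)
      qed
      ultimately have "(restrict (r1 w) X1, restrict (r2 w) X2) = G (v u, R1 u, R2 u)"
        by (auto simp: G_def r1_def r2_def restrict_def fun_eq_iff)
      moreover have "(v u, R1 u, R2 u) \<in> S" unfolding S_def using u vu by auto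
      ultimately show "(restrict (r1 w) X1, restrict (r2 w) X2) \<in> G ` S" by (rule image_eqI)
    qed
    ultimately show ?thesis by (rule finite_surj)
  qed
  ultimately obtain f where f: "equivariant W r1 r2 X1 X2 f" "bij_betw f X1 X2"
    using finite_image_equal_traces[OF A.group_axioms B1 rep1 B2 rep2] by blast
  have "f (R1 w x) = R2 w (f x)" if "w \<in> carrier W" "x \<in> X1" for w x
    using equivariantD(3)[OF f(1) that] d0 by (simp add: r1_def r2_def homD equivariantD(1)[OF f(1)])
  then have "equivariant W R1 R2 X1 X2 f" using equivariantD[OF f(1)] by (simp add: equivariant_def)
  then show ?thesis using f(2) by blast
qed

definition spec where "spec = {c. E1 c \<noteq> {0}} \<union> {c. E2 c \<noteq> {0}}"

lemma finite_spec: "finite spec"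
  unfolding spec_def A.E_def B.E_def
  using v1.finite_eigenvalues[OF A.fin A.linR[OF A.\<tau>(1)]] v2.finite_eigenvalues[OF B.fin B.linR[OF A.\<tau>(1)]] by simp

text \<open>The eigenvalues of both sides are put into one set, so that the same polynomials give
  the projections of both; the trace comparison needs a common polynomial.\<close>

lemma spectral_polys: obtains h where "v1.spectral (R1 \<tau>) spec h" "v2.spectral (R2 \<tau>) spec h"
proof -
  obtain h :: "'a \<Rightarrow> 'a poly" where h: "\<And>c d. d \<in> spec \<Longrightarrow> poly (h c) d = (if d = c then 1 else 0)"
    by (rule lagrange_polynomials[OF finite_spec]) blast
  show ?thesis
    by (rule that[OF v1.spectral_exists_on[OF A.diag finite_spec _ h] v2.spectral_exists_on[OF B.diag finite_spec _ h]])
      (auto simp: spec_def A.E_def B.E_def)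
qed

text \<open>Composed with a polynomial in \<open>\<tau>\<close>, the action of \<open>w\<close> is a
  linear combination of the actions of \<open>w \<otimes> \<tau> [^] i\<close>, with the same
  coefficients on both sides.\<close>

lemma trace_spectral:
  assumes w: "w \<in> carrier W"
  shows "v1.tr UNIV (\<lambda>x. R1 w (v1.pev p (R1 \<tau>) x)) = v2.tr UNIV (\<lambda>x. R2 w (v2.pev p (R2 \<tau>) x))"
proof -
  obtain B1 where B1: "v1.basis_of B1 UNIV" using A.basis_sub[OF v1.subspace_UNIV] by blast
  obtain B2 where B2: "v2.basis_of B2 UNIV" using B.basis_sub[OF v2.subspace_UNIV] by blast
  have wt: "w \<otimes> \<tau> [^] i \<in> carrier W" for i :: nat using w A.\<tau>(1) by simp
  have p1: "(R1 \<tau> ^^ i) x = R1 (\<tau> [^] i) x" for i x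
    using A.RD A.\<tau>(1) by (induction i) (simp_all add: A.comm)
  have p2: "(R2 \<tau> ^^ i) x = R2 (\<tau> [^] i) x" for i x
    using B.RD A.\<tau>(1) by (induction i) (simp_all add: B.comm)
  have "v1.tr UNIV (\<lambda>x. R1 w (v1.pev p (R1 \<tau>) x)) = v1.tr UNIV (\<lambda>x. \<Sum>i\<le>degree p. s1 (coeff p i) (R1 (w \<otimes> \<tau> [^] i) x))"
    using A.linR[OF w] A.RD(2)[OF w] A.\<tau>(1) by (simp add: v1.pev_def v1.linD p1)
  also have "\<dots> = (\<Sum>i\<le>degree p. coeff p i * v1.tr UNIV (R1 (w \<otimes> \<tau> [^] i)))"
    by (subst v1.tr_sum[OF B1]) (auto intro!: v1.lin_smult A.linR wt sum.cong v1.tr_smult[OF B1])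
  also have "\<dots> = (\<Sum>i\<le>degree p. coeff p i * v2.tr UNIV (R2 (w \<otimes> \<tau> [^] i)))"
    using traces[OF wt] by simp
  also have "\<dots> = v2.tr UNIV (\<lambda>x. \<Sum>i\<le>degree p. s2 (coeff p i) (R2 (w \<otimes> \<tau> [^] i) x))"
    by (subst v2.tr_sum[OF B2]) (auto intro!: v2.lin_smult B.linR wt sum.cong v2.tr_smult[OF B2, symmetric])
  also have "\<dots> = v2.tr UNIV (\<lambda>x. R2 w (v2.pev p (R2 \<tau>) x))"
    using B.linR[OF w] B.RD(2)[OF w] A.\<tau>(1) by (simp add: v2.pev_def v2.linD p2)
  finally show ?thesis .
qed

text \<open>The trace on an eigenspace is the total trace after composition with its projection, to
  which \<open>trace_spectral\<close> applies.\<close>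

lemma trace_E:
  assumes w: "w \<in> carrier W"
  shows "v1.tr (E1 c) (R1 w) = v2.tr (E2 c) (R2 w)"
proof -
  obtain h where h: "v1.spectral (R1 \<tau>) spec h" "v2.spectral (R2 \<tau>) spec h" by (rule spectral_polys)
  obtain B1 where B1: "v1.basis_of B1 UNIV" using A.basis_sub[OF v1.subspace_UNIV] by blast
  obtain B2 where B2: "v2.basis_of B2 UNIV" using B.basis_sub[OF v2.subspace_UNIV] by blast
  obtain C1 where C1: "v1.basis_of C1 (E1 c)" using A.basis_sub[OF A.subspace_E] by blast
  obtain C2 where C2: "v2.basis_of C2 (E2 c)" using B.basis_sub[OF B.subspace_E] by blast
  note l1 = v1.lin_compose[OF A.linR[OF w] v1.lin_spectral_proj[OF h(1)], of c]
    and l2 = v2.lin_compose[OF B.linR[OF w] v2.lin_spectral_proj[OF h(2)], of c]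
  have i1: "R1 w (v1.pev (h c) (R1 \<tau>) x) \<in> E1 c" for x
    using A.R_E[OF w] v1.spectral_proj_in[OF h(1)] by (simp add: A.E_def)
  have i2: "R2 w (v2.pev (h c) (R2 \<tau>) x) \<in> E2 c" for x
    using B.R_E[OF w] v2.spectral_proj_in[OF h(2)] by (simp add: B.E_def)
  have "v1.tr (E1 c) (R1 w) = v1.tr (E1 c) (\<lambda>x. R1 w (v1.pev (h c) (R1 \<tau>) x))"
    by (rule v1.tr_cong[OF C1 A.linR[OF w] _ l1])
      (use A.R_E[OF w] v1.spectral_proj_eig[OF h(1)] in \<open>auto simp: A.E_def\<close>)
  also have "\<dots> = v1.tr UNIV (\<lambda>x. R1 w (v1.pev (h c) (R1 \<tau>) x))"
    by (rule v1.tr_restrict[OF B1 A.subspace_E _ l1, symmetric]) (use i1 in auto)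
  also have "\<dots> = v2.tr UNIV (\<lambda>x. R2 w (v2.pev (h c) (R2 \<tau>) x))" by (rule trace_spectral[OF w])
  also have "\<dots> = v2.tr (E2 c) (\<lambda>x. R2 w (v2.pev (h c) (R2 \<tau>) x))"
    by (rule v2.tr_restrict[OF B2 B.subspace_E _ l2]) (use i2 in auto)
  also have "\<dots> = v2.tr (E2 c) (R2 w)"
    by (rule v2.tr_cong[OF C2 l2 _ B.linR[OF w]])
      (use i2 B.R_E[OF w] v2.spectral_proj_eig[OF h(2)] in \<open>auto simp: B.E_def\<close>)
  finally show ?thesis .
qed

lemma primitive_iso:
  assumes "Wt (int k) c" shows "\<exists>f. iso_on (A.P k c) (B.P k c) f"
proof (rule iso_on_eigenspaces)
  show "v1.subspace (A.P k c)" "v2.subspace (B.P k c)" by (rule A.subspace_P B.subspace_P)+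
  show "R1 w x \<in> A.P k c" if "w \<in> carrier W" "x \<in> A.P k c" for w x using A.R_P that .
  show "R2 w x \<in> B.P k c" if "w \<in> carrier W" "x \<in> B.P k c" for w x using B.R_P that .
  show "A.P k c \<subseteq> E1 c" "B.P k c \<subseteq> E2 c" by (auto simp: A.P_def B.P_def)
  show "v1.tr (A.P k c) (R1 w) = v2.tr (B.P k c) (R2 w)" if "w \<in> carrier W" for w
    unfolding A.trace_P[OF assms that] B.trace_P[OF assms that] trace_E[OF that] ..
qed

end

section \<open>Gluing isomorphisms of eigenspaces compatibly with the nilpotent operators\<close>

context pure_pair begin

lemma iso_onD:
  assumes "iso_on X1 X2 f"
  shows "hom f" "x \<in> X1 \<Longrightarrow> f x \<in> X2" "w \<in> carrier W \<Longrightarrow> x \<in> X1 \<Longrightarrow> f (R1 w x) = R2 w (f x)"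
    "bij_betw f X1 X2"
  using assms equivariantD[of W R1 R2 X1 X2 f] by auto

lemma iso_on_eq_0: "iso_on X1 X2 f \<Longrightarrow> v1.subspace X1 \<Longrightarrow> x \<in> X1 \<Longrightarrow> f x = 0 \<Longrightarrow> x = 0"
  using homD(3)[OF iso_onD(1)] v1.subspace_0[of X1] by (metis bij_betw_def inj_on_eq_iff)

text \<open>On the primitive part any isomorphism will do; on the image of \<open>N1\<close> the map
  is forced by \<open>f'\<close>. The last conclusion records that the kernel of
  \<open>N1 ^^ Suc k\<close> is respected, which negative degrees will need.\<close>

lemma iso_on_step:
  assumes c: "Wt (int k) c" and f': "iso_on (E1 (Q * c)) (E2 (Q * c)) f'"
  shows "\<exists>f. iso_on (E1 c) (E2 c) f \<and> (\<forall>x\<in>E1 (Q * c). f (N1 x) = N2 (f' x)) \<and>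
    (\<forall>x\<in>E1 c. (N1 ^^ Suc k) x = 0 \<longrightarrow> (N2 ^^ Suc k) (f x) = 0)"
proof -
  obtain p where p: "iso_on (A.P k c) (B.P k c) p" using primitive_iso[OF c] by blast
  note pD = iso_onD[OF p] and fD = iso_onD[OF f']
  interpret S: vspace_pair s1 s1 ..
  \<comment> \<open>A left inverse of \<open>N1\<close> on the higher eigenspace, linear on the
    whole space. With the projection \<open>\<pi>\<close> it makes the glued map a globally linear
    formula.\<close>
  obtain g where g: "v1.lin g" "\<And>x. x \<in> E1 (Q * c) \<Longrightarrow> g (N1 x) = x"
    using S.linear_exists_left_inverse_on[OF A.N A.subspace_E A.primitive(1)[OF c]] by blast
  have Z: "v1.subspace (N1 ` E1 (Q * c))" by (rule v1.lin_image_subspace[OF A.N A.subspace_E])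
  obtain \<pi> where \<pi>: "v1.lin \<pi>" "\<And>x. x \<in> A.P k c \<Longrightarrow> \<pi> x = x" "\<And>y. y \<in> E1 (Q * c) \<Longrightarrow> \<pi> (N1 y) = 0"
    using v1.projection_exists[OF A.subspace_P Z A.primitive(2)[OF c]] by blast
  define z where "z x = N2 (f' (g x))" for x
  have z: "hom z" unfolding z_def
    by (rule lin_hom_compose[OF B.N hom_lin_compose[OF fD(1) g(1)]])
  define f where "f x = p (\<pi> x) + z (x - \<pi> x)" for x
  have f: "hom f" unfolding f_def
    by (rule hom_add[OF hom_lin_compose[OF pD(1) \<pi>(1)] hom_lin_compose[OF z v1.lin_diff[OF v1.lin_id \<pi>(1)]]])
  have fP: "f x = p x" if "x \<in> A.P k c" for x
    using \<pi>(2)[OF that] by (simp add: f_def homD(3)[OF z])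
  have fN: "f (N1 y) = N2 (f' y)" if "y \<in> E1 (Q * c)" for y
    using \<pi>(3)[OF that] g(2)[OF that] by (simp add: f_def z_def homD(3)[OF pD(1)])
  have split: "\<exists>a\<in>A.P k c. \<exists>y\<in>E1 (Q * c). x = a + N1 y" if x: "x \<in> E1 c" for x
  proof -
    obtain y where "y \<in> E1 (Q * c)" "x - N1 y \<in> A.P k c" using A.primitive(3)[OF c x] by blast
    then show ?thesis by (intro bexI[of _ "x - N1 y"] bexI[of _ y]) auto
  qed
  have PE: "A.P k c \<subseteq> E1 c" "B.P k c \<subseteq> E2 c" by (auto simp: A.P_def B.P_def)
  have fE: "f x \<in> E2 c" if x: "x \<in> E1 c" for x
  proof -
    obtain a y where ay: "a \<in> A.P k c" "y \<in> E1 (Q * c)" "x = a + N1 y" using split[OF x] by blast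
    have "f x = p a + N2 (f' y)" unfolding ay(3) by (simp add: homD(1)[OF f] fP[OF ay(1)] fN[OF ay(2)])
    moreover have "p a \<in> E2 c" using pD(2)[OF ay(1)] PE(2) by blast
    moreover have "N2 (f' y) \<in> E2 c" by (rule B.N_E'[OF fD(2)[OF ay(2)]])
    ultimately show ?thesis by (simp add: v2.subspace_add[OF B.subspace_E])
  qed
  have "f (R1 w x) = R2 w (f x)" if w: "w \<in> carrier W" and x: "x \<in> E1 c" for w x
  proof -
    obtain a y where ay: "a \<in> A.P k c" "y \<in> E1 (Q * c)" "x = a + N1 y" using split[OF x] by blast
    have "f (R1 w x) = f (R1 w a) + s2 (q powi (- v w)) (f (N1 (R1 w y)))"
      unfolding ay(3) by (simp add: v1.linD(1)[OF A.linR[OF w]] A.NR[OF w] homD(1,2)[OF f])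
    also have "\<dots> = R2 w (p a) + s2 (q powi (- v w)) (N2 (R2 w (f' y)))"
      using fP[OF A.R_P[OF w ay(1)]] pD(3)[OF w ay(1)] fN[OF A.R_E[OF w ay(2)]] fD(3)[OF w ay(2)] by simp
    also have "\<dots> = R2 w (f x)"
      unfolding ay(3) using fP[OF ay(1)] fN[OF ay(2)] by (simp add: homD(1)[OF f] v2.linD(1)[OF B.linR[OF w]] B.NR[OF w])
    finally show ?thesis .
  qed
  then have eq: "equivariant W R1 R2 (E1 c) (E2 c) f" using f fE by (simp add: equivariant_def)
  have "bij_betw f (E1 c) (E2 c)"
  proof (rule bij_betw_imageI)
    show "inj_on f (E1 c)"
    proof (rule inj_onI)
      fix x x' assume xx: "x \<in> E1 c" "x' \<in> E1 c" "f x = f x'"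
      have d: "x - x' \<in> E1 c" using v1.subspace_diff[OF A.subspace_E xx(1,2)] .
      have f0: "f (x - x') = 0" using xx(3) by (simp add: homD(4)[OF f])
      obtain a y where ay: "a \<in> A.P k c" "y \<in> E1 (Q * c)" "x - x' = a + N1 y" using split[OF d] by blast
      have sum: "p a + N2 (f' y) = 0"
        using f0 unfolding ay(3) by (simp add: homD(1)[OF f] fP[OF ay(1)] fN[OF ay(2)])
      then have "p a = N2 (- f' y)" by (simp add: v2.linD(4)[OF B.N, of 0, simplified] v2.linD(3)[OF B.N] eq_neg_iff_add_eq_0)
      moreover have "- f' y \<in> E2 (Q * c)" by (rule v2.subspace_neg[OF B.subspace_E fD(2)[OF ay(2)]])
      ultimately have "p a \<in> B.P k c \<inter> N2 ` E2 (Q * c)" using pD(2)[OF ay(1)] by blast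
      then have pa: "p a = 0" unfolding B.primitive(2)[OF c] by simp
      then have a0: "a = 0" by (rule iso_on_eq_0[OF p A.subspace_P ay(1)])
      have "N2 (f' y) = N2 0" using sum pa by (simp add: v2.linD(3)[OF B.N])
      then have "f' y = 0" using B.primitive(1)[OF c] fD(2)[OF ay(2)] B.zero_E by (auto dest: inj_onD)
      then have "y = 0" by (rule iso_on_eq_0[OF f' A.subspace_E ay(2)])
      then show "x = x'" using ay(3) a0 by (simp add: v1.linD(3)[OF A.N])
    qed
    show "f ` E1 c = E2 c"
    proof
      show "f ` E1 c \<subseteq> E2 c" using fE by blast
      show "E2 c \<subseteq> f ` E1 c"
      proof
        fix y assume y: "y \<in> E2 c"
        obtain b where b: "b \<in> E2 (Q * c)" "y - N2 b \<in> B.P k c" using B.primitive(3)[OF c y] by blast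
        obtain a where a: "a \<in> A.P k c" "p a = y - N2 b" using pD(4) b(2) by (metis bij_betw_def imageE)
        obtain x where x: "x \<in> E1 (Q * c)" "f' x = b" using fD(4) b(1) by (metis bij_betw_def imageE)
        have "f (a + N1 x) = y" using a(2) x(2) by (simp add: homD(1)[OF f] fP[OF a(1)] fN[OF x(1)])
        moreover have "a + N1 x \<in> E1 c"
          using v1.subspace_add[OF A.subspace_E _ A.N_E'[OF x(1)]] a(1) PE(1) by blast
        ultimately show "y \<in> f ` E1 c" by blast
      qed
    qed
  qed
  moreover have "(N2 ^^ Suc k) (f x) = 0" if "x \<in> E1 c" "(N1 ^^ Suc k) x = 0" for x
  proof -
    have "x \<in> A.P k c" using that by (simp add: A.P_def)
    then show ?thesis using fP pD(2) by (simp add: B.P_def)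
  qed
  ultimately show ?thesis using eq fN by (intro exI[of _ f]) simp
qed

text \<open>Compatible isomorphisms are constructed by descending induction on the weight.\<close>

definition compatible :: "('a \<Rightarrow> 'b \<Rightarrow> 'c) \<Rightarrow> nat \<Rightarrow> 'a \<Rightarrow> bool" where
  "compatible g k c \<longleftrightarrow> iso_on (E1 c) (E2 c) (g c) \<and> (\<forall>x\<in>E1 (Q * c). g c (N1 x) = N2 (g (Q * c) x)) \<and>
    (\<forall>x\<in>E1 c. (N1 ^^ Suc k) x = 0 \<longrightarrow> (N2 ^^ Suc k) (g c x) = 0)"

text \<open>Induction on the number of steps after which multiplication of \<open>c\<close> by
  \<open>Q\<close> leaves the spectrum. One family \<open>g\<close> must serve all \<open>c\<close>
  at once, since compatibility at \<open>c\<close> refers to its value at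
  \<open>Q * c\<close>.\<close>

lemma compatible_bounded:
  "\<exists>g. \<forall>c k. Wt (int k) c \<and> (\<forall>j\<ge>n. E1 (Q ^ j * c) = {0} \<and> E2 (Q ^ j * c) = {0}) \<longrightarrow> compatible g k c"
proof (induction n)
  case 0
  have "compatible (\<lambda>_ _. 0) k c" if "\<forall>j\<ge>0. E1 (Q ^ j * c) = {0} \<and> E2 (Q ^ j * c) = {0}" for k c
  proof -
    have E: "E1 c = {0}" "E2 c = {0}" using spec[OF that, of 0] by simp_all
    have "iso_on (E1 c) (E2 c) (\<lambda>_. 0)"
      using hom_zero v2.linD(3)[OF B.linR] by (auto simp: E equivariant_def bij_betw_def)
    then show ?thesis by (simp add: compatible_def v2.linD(3)[OF B.N] v2.linD(3)[OF v2.lin_pow[OF B.N]] del: funpow.simps)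
  qed
  then show ?case by (intro exI[of _ "\<lambda>_ _. 0"] allI impI) (elim conjE)
next
  case (Suc n)
  define D where "D n c \<longleftrightarrow> (\<forall>j\<ge>n. E1 (Q ^ j * c) = {0} \<and> E2 (Q ^ j * c) = {0})" for n c
  from Suc.IH obtain g where IH: "\<forall>c k. Wt (int k) c \<and> D n c \<longrightarrow> compatible g k c"
    unfolding D_def ..
  have g: "compatible g k c" if "Wt (int k) c" "D n c" for c k using IH that by simp
  have DQ: "D n (Q * c)" if "D (Suc n) c" for c
    unfolding D_def
  proof (intro allI impI)
    fix j assume "n \<le> j"
    then show "E1 (Q ^ j * (Q * c)) = {0} \<and> E2 (Q ^ j * (Q * c)) = {0}"
      using that[unfolded D_def, rule_format, of "Suc j"] by (simp add: mult.assoc mult.left_commute)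
  qed
  define F where "F k c f \<longleftrightarrow> iso_on (E1 c) (E2 c) f \<and> (\<forall>x\<in>E1 (Q * c). f (N1 x) = N2 (g (Q * c) x)) \<and>
    (\<forall>x\<in>E1 c. (N1 ^^ Suc k) x = 0 \<longrightarrow> (N2 ^^ Suc k) (f x) = 0)" for k c f
  have ex: "\<exists>f. F k c f" if "Wt (int k) c" "D (Suc n) c" for k c
  proof -
    have "Wt (int (k + 2)) (Q * c)" using A.Wt_mult[OF that(1)] by (simp add: add.commute)
    from g[OF this DQ[OF that(2)]] have "iso_on (E1 (Q * c)) (E2 (Q * c)) (g (Q * c))"
      by (simp add: compatible_def)
    from iso_on_step[OF that(1) this] show ?thesis unfolding F_def .
  qed
  \<comment> \<open>Earlier values are kept, so \<open>g' (Q * c)\<close> is still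
    \<open>g (Q * c)\<close>. The chosen map cannot mention \<open>k\<close>, but \<open>k\<close>
    is determined by \<open>c\<close>.\<close>
  define g' where "g' c = (if D n c then g c else (SOME f. \<exists>k. Wt (int k) c \<and> F k c f))" for c
  have "compatible g' k c" if c: "Wt (int k) c" "D (Suc n) c" for k c
  proof -
    have gQ: "g' (Q * c) = g (Q * c)" using DQ[OF c(2)] by (simp add: g'_def)
    have "F k c (g' c)"
    proof (cases "D n c")
      case True
      then show ?thesis using g[OF c(1) True] by (simp add: F_def g'_def compatible_def)
    next
      case False
      obtain f where "F k c f" using ex[OF c] by blast
      then obtain k' where k': "Wt (int k') c" "F k' c (g' c)"
        using False someI[of "\<lambda>f. \<exists>k. Wt (int k) c \<and> F k c f" f] c(1) unfolding g'_def by auto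
      have "k' = k" using A.Wt_unique[OF c(1) k'(1)] by simp
      then show ?thesis using k'(2) by simp
    qed
    then show ?thesis unfolding compatible_def gQ F_def .
  qed
  then have "\<forall>c k. Wt (int k) c \<and> D (Suc n) c \<longrightarrow> compatible g' k c" by simp
  then show ?case unfolding D_def by (rule exI[of _ g'])
qed

lemma spec_Wt: "c \<in> spec \<Longrightarrow> \<exists>k. Wt k c"
proof -
  assume "c \<in> spec"
  then have "v1.eig (R1 \<tau>) c \<noteq> {0} \<or> v2.eig (R2 \<tau>) c \<noteq> {0}"
    by (simp add: spec_def A.E_def B.E_def)
  then show ?thesis by (rule disjE) (rule A.Wt_ex, assumption, rule B.Wt_ex, assumption)
qed

text \<open>The eigenvalue \<open>Q ^ j * c\<close> would lie in degree \<open>k + 2 * j\<close>,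
  and only finitely many degrees occur; hence one bound serves all \<open>c\<close> of nonnegative
  degree.\<close>

lemma compatible_exists: "\<exists>g. \<forall>c k. Wt (int k) c \<longrightarrow> compatible g k c"
proof -
  obtain wt where wt: "\<And>c. c \<in> spec \<Longrightarrow> Wt (wt c) c"
    using spec_Wt by metis
  \<comment> \<open>\<open>n\<close> exceeds every occurring degree; the inserted 0 keeps
    \<open>Max\<close> meaningful when \<open>spec\<close> is empty.\<close>
  define n where "n = Suc (nat (Max (insert 0 (wt ` spec))))"
  have bound: "wt c < int n" if "c \<in> spec" for c
  proof -
    have "wt c \<le> Max (insert 0 (wt ` spec))" by (rule Max_ge) (use finite_spec that in auto)
    then show ?thesis by (simp add: n_def)
  qed
  have "E1 (Q ^ j * c) = {0} \<and> E2 (Q ^ j * c) = {0}" if c: "Wt (int k) c" and j: "j \<ge> n" for k c j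
  proof (rule ccontr)
    assume "\<not> ?thesis"
    then have s: "Q ^ j * c \<in> spec" by (auto simp: spec_def)
    have "wt (Q ^ j * c) = int k + 2 * int j" by (rule A.Wt_unique[OF wt[OF s] A.Wt_mult_power[OF c]])
    then show False using bound[OF s] j by simp
  qed
  then have vanish: "\<forall>j\<ge>n. E1 (Q ^ j * c) = {0} \<and> E2 (Q ^ j * c) = {0}" if "Wt (int k) c" for c k
    using that by (intro allI impI)
  from compatible_bounded[of n] obtain g where
    g: "\<forall>c k. Wt (int k) c \<and> (\<forall>j\<ge>n. E1 (Q ^ j * c) = {0} \<and> E2 (Q ^ j * c) = {0}) \<longrightarrow> compatible g k c" ..
  show ?thesis
  proof (intro exI[of _ g] allI impI)
    fix c k assume "Wt (int k) c"
    with vanish[OF this] g[rule_format, of k c] show "compatible g k c" by (intro g[rule_format] conjI)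
  qed
qed

text \<open>In degree \<open>- a\<close> the map is forced: it is the one in degree
  \<open>a\<close>, conjugated by the bijections \<open>N1 ^^ a\<close> and
  \<open>N2 ^^ a\<close>.\<close>

lemma iso_eigenspaces:
  "\<exists>f. \<forall>c k. Wt k c \<longrightarrow> iso_on (E1 c) (E2 c) (f c) \<and> (\<forall>x\<in>E1 c. f (c / Q) (N1 x) = N2 (f c x))"
proof -
  obtain g where g: "\<And>c k. Wt (int k) c \<Longrightarrow> compatible g k c" using compatible_exists by blast
  \<comment> \<open>For \<open>k \<ge> 0\<close> the exponent \<open>nat (- k)\<close> is 0, and the
    middle clause follows from \<open>f = g c\<close>.\<close>
  have ex: "\<exists>f. iso_on (E1 c) (E2 c) f \<and> (\<forall>x\<in>E1 (Q ^ nat (- k) * c). f ((N1 ^^ nat (- k)) x) = (N2 ^^ nat (- k)) (g (Q ^ nat (- k) * c) x)) \<and>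
      (k \<ge> 0 \<longrightarrow> f = g c)"
    if c: "Wt k c" for k c
  proof (cases "k \<ge> 0")
    case True
    then have "compatible g (nat k) c" using g c by simp
    then show ?thesis using True by (intro exI[of _ "g c"]) (simp add: compatible_def)
  next
    case False
    define a where "a = nat (- k)"
    define u where "u = Q ^ a * c"
    have a: "k = - int a" using False by (simp add: a_def)
    have u: "Wt (int a) u" using A.Wt_mult_power[OF c, of a] by (simp add: a u_def)
    have uc: "u / Q ^ a = c" using A.Q0 by (simp add: u_def)
    have iso: "iso_on (E1 u) (E2 u) (g u)" using g[OF u] by (simp add: compatible_def)
    note iD = iso_onD[OF iso]
    have b1: "bij_betw (N1 ^^ a) (E1 u) (E1 c)" using A.bij_E[OF u] by (simp add: uc)
    have b2: "bij_betw (N2 ^^ a) (E2 u) (E2 c)" using B.bij_E[OF u] by (simp add: uc)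
    interpret S: vspace_pair s1 s1 ..
    obtain l where l: "v1.lin l" "\<And>x. x \<in> E1 u \<Longrightarrow> l ((N1 ^^ a) x) = x"
      using S.linear_exists_left_inverse_on[OF v1.lin_pow[OF A.N] A.subspace_E bij_betw_imp_inj_on[OF b1]] by blast
    define f where "f x = (N2 ^^ a) (g u (l x))" for x
    have f: "hom f" unfolding f_def
      by (rule lin_hom_compose[OF v2.lin_pow[OF B.N] hom_lin_compose[OF iD(1) l(1)]])
    have fN: "f ((N1 ^^ a) x) = (N2 ^^ a) (g u x)" if "x \<in> E1 u" for x by (simp add: f_def l(2)[OF that])
    have pre: "\<exists>y\<in>E1 u. x = (N1 ^^ a) y" if "x \<in> E1 c" for x
      using that b1 by (auto simp: bij_betw_def)
    have "equivariant W R1 R2 (E1 c) (E2 c) f"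
      unfolding equivariant_def
    proof (intro conjI ballI f)
      fix x assume "x \<in> E1 c"
      then obtain y where y: "y \<in> E1 u" "x = (N1 ^^ a) y" using pre by blast
      then show "f x \<in> E2 c" using fN[OF y(1)] iD(2)[OF y(1)] b2 by (auto simp: bij_betw_def)
    next
      fix w x assume w: "w \<in> carrier W" and "x \<in> E1 c"
      then obtain y where y: "y \<in> E1 u" "x = (N1 ^^ a) y" using pre by blast
      show "f (R1 w x) = R2 w (f x)"
        unfolding y(2) fN[OF y(1)] A.NR_pow[OF w] B.NR_pow[OF w]
        by (simp add: homD(2)[OF f] fN[OF A.R_E[OF w y(1)]] iD(3)[OF w y(1)])
    qed
    moreover have "bij_betw f (E1 c) (E2 c)"
    proof -
      have "bij_betw ((N2 ^^ a) \<circ> g u \<circ> the_inv_into (E1 u) (N1 ^^ a)) (E1 c) (E2 c)"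
        by (rule bij_betw_trans[OF bij_betw_the_inv_into[OF b1] bij_betw_trans[OF iD(4) b2], unfolded o_assoc])
      moreover have "((N2 ^^ a) \<circ> g u \<circ> the_inv_into (E1 u) (N1 ^^ a)) x = f x" if "x \<in> E1 c" for x
      proof -
        obtain y where y: "y \<in> E1 u" "x = (N1 ^^ a) y" using pre[OF \<open>x \<in> E1 c\<close>] by blast
        show ?thesis unfolding y(2) fN[OF y(1)]
          by (simp add: the_inv_into_f_f[OF bij_betw_imp_inj_on[OF b1] y(1)])
      qed
      ultimately show ?thesis using bij_betw_cong by blast
    qed
    ultimately show ?thesis using fN False unfolding a_def[symmetric] u_def[symmetric]
      by (intro exI[of _ f]) simp
  qed
  define P where "P k c f \<longleftrightarrow> iso_on (E1 c) (E2 c) f \<and> (\<forall>x\<in>E1 (Q ^ nat (- k) * c). f ((N1 ^^ nat (- k)) x) = (N2 ^^ nat (- k)) (g (Q ^ nat (- k) * c) x)) \<and>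
      (k \<ge> 0 \<longrightarrow> f = g c)" for k c f
  have "\<exists>f. \<forall>k. Wt k c \<longrightarrow> P k c f" for c
  proof (cases "\<exists>k. Wt k c")
    case True
    then obtain k where k: "Wt k c" by blast
    from ex[OF this] obtain f where "P k c f" unfolding P_def by blast
    then show ?thesis using A.Wt_unique[OF k] by blast
  qed blast
  then obtain f where f: "\<And>c k. Wt k c \<Longrightarrow> P k c (f c)" by metis
  have "f (c / Q) (N1 x) = N2 (f c x)" if c: "Wt k c" and x: "x \<in> E1 c" for c k x
  proof -
    have c': "Wt (k - 2) (c / Q)" by (rule A.Wt_div[OF c])
    have Qc: "Q * (c / Q) = c" using A.Q0 by simp
    \<comment> \<open>\<open>N1\<close> lowers the degree by 2: it stays nonnegative, or passes from
      1 to -1 where the definition of \<open>f\<close> is the claim, or starts at a degree that is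
      at most 0.\<close>
    consider "k \<ge> 2" | "k = 1" | "k \<le> 0" by linarith
    then show ?thesis
    proof cases
      case 1
      have "compatible g (nat (k - 2)) (c / Q)" using g[of "nat (k - 2)" "c / Q"] c' 1 by simp
      moreover have "f c = g c" "f (c / Q) = g (c / Q)" using f[OF c] f[OF c'] 1 by (simp_all add: P_def)
      ultimately show ?thesis using x unfolding compatible_def Qc by simp
    next
      case 2
      have "f c = g c" using f[OF c] 2 by (simp add: P_def)
      then show ?thesis using f[OF c'] x 2 Qc by (simp add: P_def)
    next
      case 3
      define a where "a = nat (- k)"
      define u where "u = Q ^ a * c"
      have a: "k = - int a" using 3 by (simp add: a_def)
      have u: "Wt (int a) u" using A.Wt_mult_power[OF c, of a] by (simp add: a u_def)
      have uc: "u / Q ^ a = c" using A.Q0 by (simp add: u_def)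
      have uQ: "Wt (int (a + 2)) (Q * u)" using A.Wt_mult[OF u] by (simp add: add.commute)
      have uQc: "Q ^ (a + 2) * (c / Q) = Q * u" using A.Q0 by (simp add: u_def field_simps)
      have uQc': "(Q * u) / Q ^ (a + 2) = c / Q" using A.Q0 by (simp add: u_def field_simps)
      have b1: "bij_betw (N1 ^^ a) (E1 u) (E1 c)" using A.bij_E[OF u] by (simp add: uc)
      have b2: "bij_betw (N1 ^^ (a + 2)) (E1 (Q * u)) (E1 (c / Q))" using A.bij_E[OF uQ] unfolding uQc' .
      obtain y where y: "y \<in> E1 u" "x = (N1 ^^ a) y" using x b1 by (metis bij_betw_def imageE)
      obtain z where z: "z \<in> E1 (Q * u)" "N1 x = (N1 ^^ (a + 2)) z"
        using A.N_E[OF x] b2 by (metis bij_betw_def imageE)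
      have comp: "compatible g a u" by (rule g[OF u])
      have gu: "hom (g u)" using comp by (simp add: compatible_def equivariant_def)
      have nk: "nat (- (k - 2)) = a + 2" by (simp add: a)
      have "f (c / Q) (N1 x) = (N2 ^^ (a + 2)) (g (Q * u) z)"
        using f[OF c'] z(1) unfolding P_def nk uQc z(2) by blast
      also have "\<dots> = (N2 ^^ Suc a) (N2 (g (Q * u) z))" by (simp add: funpow_swap1)
      also have "N2 (g (Q * u) z) = g u (N1 z)" using comp z(1) by (simp add: compatible_def)
      \<comment> \<open>\<open>y\<close> and \<open>N1 z\<close> may differ, but
        \<open>N1 ^^ Suc a\<close> kills the difference. The third clause of
        \<open>compatible\<close> says that \<open>g u\<close> respects this kernel.\<close>
      also have "(N2 ^^ Suc a) (g u (N1 z)) = (N2 ^^ Suc a) (g u y)"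
      proof -
        have d: "y - N1 z \<in> E1 u" by (rule v1.subspace_diff[OF A.subspace_E y(1) A.N_E'[OF z(1)]])
        have "(N1 ^^ Suc a) (y - N1 z) = N1 x - (N1 ^^ (a + 2)) z"
          by (simp add: v1.linD(4)[OF v1.lin_pow[OF A.N]] v1.linD(4)[OF A.N] y(2) funpow_swap1)
        then have "(N1 ^^ Suc a) (y - N1 z) = 0" using z(2) by simp
        then have "(N2 ^^ Suc a) (g u (y - N1 z)) = 0" using comp d unfolding compatible_def by blast
        then show ?thesis by (simp add: homD(4)[OF gu] v2.linD(4)[OF v2.lin_pow[OF B.N, of "Suc a"]] del: funpow.simps)
      qed
      also have "\<dots> = N2 ((N2 ^^ a) (g u y))" by simp
      also have "(N2 ^^ a) (g u y) = f c x"
        using f[OF c] y unfolding P_def a_def[symmetric] u_def[symmetric] by simp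
      finally show ?thesis .
    qed
  qed
  then show ?thesis using f by (intro exI[of _ f]) (auto simp: P_def)
qed

text \<open>The maps on eigenspaces are summed over the spectral projections. If
  \<open>c / Q\<close> is no eigenvalue, then \<open>N1\<close> kills the eigenspace of
  \<open>c\<close> and nothing has to match there.\<close>

theorem pure_isomorphism:
  "\<exists>f. hom f \<and> bij f \<and> (\<forall>w\<in>carrier W. \<forall>x. f (R1 w x) = R2 w (f x)) \<and> (\<forall>x. f (N1 x) = N2 (f x))"
proof -
  obtain f where f: "\<And>c k. Wt k c \<Longrightarrow> iso_on (E1 c) (E2 c) (f c)"
    "\<And>c k x. Wt k c \<Longrightarrow> x \<in> E1 c \<Longrightarrow> f (c / Q) (N1 x) = N2 (f c x)"
    using iso_eigenspaces by blast
  obtain h where h: "v1.spectral (R1 \<tau>) spec h" "v2.spectral (R2 \<tau>) spec h" by (rule spectral_polys)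
  define \<pi> where "\<pi> c = v1.pev (h c) (R1 \<tau>)" for c
  note wt = spec_Wt
  have iso: "iso_on (E1 c) (E2 c) (f c)" if "c \<in> spec" for c using f(1) wt[OF that] by blast
  define F where "F x = (\<Sum>c\<in>spec. f c (\<pi> c x))" for x
  have F: "hom F" unfolding F_def \<pi>_def
    by (intro hom_sum hom_lin_compose[OF iso_onD(1)[OF iso] v1.lin_spectral_proj[OF h(1)]])
  have FE: "F x = f c x" if c: "c \<in> spec" and x: "x \<in> E1 c" for c x
  proof -
    have "F x = (\<Sum>d\<in>spec. if d = c then f c x else 0)"
      unfolding F_def \<pi>_def
      using x v1.spectral_proj_eig[OF h(1)] homD(3)[OF iso_onD(1)[OF iso]]
      by (intro sum.cong) (auto simp: A.E_def)
    then show ?thesis using c finite_spec by simp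
  qed
  have E0: "x = 0" if "c \<notin> spec" "x \<in> E1 c" for c x using that by (auto simp: spec_def)
  have FR: "F (R1 w x) = R2 w (F x)" if w: "w \<in> carrier W" for w x
  proof (rule v1.diagonalizable_ext_pair[OF A.diag hom_lin_compose[OF F A.linR[OF w]] lin_hom_compose[OF B.linR[OF w] F]])
    fix c x assume "x \<in> v1.eig (R1 \<tau>) c"
    then have x: "x \<in> E1 c" by (simp add: A.E_def)
    show "F (R1 w x) = R2 w (F x)"
    proof (cases "c \<in> spec")
      case True
      then show ?thesis using FE[OF True x] FE[OF True A.R_E[OF w x]] iso_onD(3)[OF iso[OF True] w x] by simp
    qed (use E0[OF _ x] v1.linD(3)[OF A.linR[OF w]] v2.linD(3)[OF B.linR[OF w]] homD(3)[OF F] in simp)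
  qed
  have FN: "F (N1 x) = N2 (F x)" for x
  proof (rule v1.diagonalizable_ext_pair[OF A.diag hom_lin_compose[OF F A.N] lin_hom_compose[OF B.N F]])
    fix c x assume "x \<in> v1.eig (R1 \<tau>) c"
    then have x: "x \<in> E1 c" by (simp add: A.E_def)
    show "F (N1 x) = N2 (F x)"
    proof (cases "c \<in> spec")
      case True
      then obtain k where k: "Wt k c" using wt by blast
      have "F (N1 x) = f (c / Q) (N1 x)"
      proof (cases "c / Q \<in> spec")
        case True
        then show ?thesis using FE A.N_E[OF x] by blast
      next
        case False
        then have "N1 x = 0" using E0 A.N_E[OF x] by blast
        then show ?thesis using homD(3)[OF F] homD(3)[OF iso_onD(1)[OF f(1)[OF A.Wt_div[OF k]]]] by simp
      qed
      then show ?thesis using f(2)[OF k x] FE[OF True x] by simp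
    qed (use E0[OF _ x] v1.linD(3)[OF A.N] v2.linD(3)[OF B.N] homD(3)[OF F] in simp)
  qed
  have "inj F"
  proof (rule injI)
    fix x y assume "F x = F y"
    then have F0: "F (x - y) = 0" by (simp add: homD(4)[OF F])
    have "\<pi> c (x - y) = 0" if c: "c \<in> spec" for c
    proof -
      have in1: "\<pi> c (x - y) \<in> E1 c" using v1.spectral_proj_in[OF h(1)] by (simp add: \<pi>_def A.E_def)
      have "f c (\<pi> c (x - y)) = F (\<pi> c (x - y))" using FE[OF c in1] by simp
      \<comment> \<open>\<open>F\<close> intertwines \<open>\<tau>\<close>, hence all polynomials in
        it, and so it respects spectral projections.\<close>
      also have "\<dots> = v2.pev (h c) (R2 \<tau>) (F (x - y))"
        unfolding \<pi>_def by (rule pev_intertwine[where f = "R1 \<tau>" and f' = "R2 \<tau>", OF F FR[OF A.\<tau>(1)]])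
      also have "\<dots> = 0" by (simp add: F0 v2.linD(3)[OF v2.lin_spectral_proj[OF h(2)]])
      finally show ?thesis by (rule iso_on_eq_0[OF iso[OF c] A.subspace_E in1])
    qed
    then have "(\<Sum>c\<in>spec. \<pi> c (x - y)) = 0" by simp
    then have "x - y = 0" unfolding \<pi>_def v1.spectral_proj_sum[OF h(1)] .
    then show "x = y" by simp
  qed
  moreover have "surj F"
  proof (rule surjI)
    fix y
    have "\<exists>x\<in>E1 c. f c x = v2.pev (h c) (R2 \<tau>) y" if "c \<in> spec" for c
    proof -
      have "v2.pev (h c) (R2 \<tau>) y \<in> E2 c" using v2.spectral_proj_in[OF h(2)] by (simp add: B.E_def)
      then show ?thesis using iso_onD(4)[OF iso[OF that]] by (metis bij_betw_def imageE)
    qed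
    then obtain x where x: "\<And>c. c \<in> spec \<Longrightarrow> x c \<in> E1 c \<and> f c (x c) = v2.pev (h c) (R2 \<tau>) y" by metis
    have "F (\<Sum>c\<in>spec. x c) = (\<Sum>c\<in>spec. F (x c))" by (rule homD(5)[OF F])
    also have "\<dots> = (\<Sum>c\<in>spec. v2.pev (h c) (R2 \<tau>) y)" using x FE by (intro sum.cong) auto
    also have "\<dots> = y" by (rule v2.spectral_proj_sum[OF h(2)])
    finally have "\<exists>x. F x = y" by blast
    then show "F (SOME x. F x = y) = y" by (rule someI_ex)
  qed
  ultimately show ?thesis using F FR FN by (intro exI[of _ F]) (simp add: bij_def)
qed

end

section \<open>The monodromy filtration\<close>

text \<open>\<open>\<Phi>\<close> is left open, because both the Frobenius and its scalar multiple
  from the twist are needed with the same filtration.\<close>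

locale filtered = vspace scale
  for scale :: "'a::{alg_closed_field,field_char_0} \<Rightarrow> 'b::ab_group_add \<Rightarrow> 'b" (infixr "\<cdot>" 75) +
  fixes N :: "'b \<Rightarrow> 'b" and M :: "int \<Rightarrow> 'b set" and \<Phi> :: "'b \<Rightarrow> 'b" and r :: 'a
  assumes fin: "\<exists>B. finite B \<and> span B = UNIV"
    and N: "lin N" and \<Phi>: "lin \<Phi>" and filt: "monodromy_filtration scale N M"
    and \<Phi>N: "\<And>x. \<Phi> (N x) = r \<cdot> N (\<Phi> x)" and r0: "r \<noteq> 0"
begin

lemma subspace_M: "subspace (M i)" and mono_M: "i \<le> j \<Longrightarrow> M i \<subseteq> M j"
  and M_bot: "\<exists>i. M i = {0}" and M_top: "\<exists>i. M i = UNIV" and N_image_M: "N ` M i \<subseteq> M (i - 2)"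
  and gr_bij: "bij_betw (gr_map M (N ^^ k) (- int k)) (gr M (int k)) (gr M (- int k))"
  using filt by (auto simp: monodromy_filtration_def mono_def)

lemma N_M: "x \<in> M i \<Longrightarrow> N x \<in> M (i - 2)"
  using N_image_M by blast

lemma Npow_M: "x \<in> M i \<Longrightarrow> (N ^^ k) x \<in> M (i - 2 * int k)"
proof (induction k)
  case (Suc k)
  from N_M[OF Suc.IH[OF Suc.prems]] show ?case by (simp add: algebra_simps)
qed simp

lemma gr_class_eq: "gr_class M i x = gr_class M i y \<longleftrightarrow> x - y \<in> M (i - 1)"
proof
  assume "gr_class M i x = gr_class M i y"
  moreover have "x \<in> gr_class M i x"
    using subspace_0[OF subspace_M] by (auto simp: gr_class_def intro: image_eqI[of _ _ 0])
  ultimately show "x - y \<in> M (i - 1)" by (auto simp: gr_class_def)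
next
  assume *: "x - y \<in> M (i - 1)"
  have "x + m \<in> (\<lambda>z. y + z) ` M (i - 1)" if "m \<in> M (i - 1)" for m
    using subspace_add[OF subspace_M * that] by (intro image_eqI[of _ _ "(x - y) + m"]) auto
  moreover have "y + m \<in> (\<lambda>z. x + z) ` M (i - 1)" if "m \<in> M (i - 1)" for m
    using subspace_diff[OF subspace_M that *] by (intro image_eqI[of _ _ "m - (x - y)"]) auto
  ultimately show "gr_class M i x = gr_class M i y" by (auto simp: gr_class_def)
qed

lemma gr_map_class:
  assumes f: "lin f" "\<And>x. x \<in> M (i - 1) \<Longrightarrow> f x \<in> M (j - 1)"
  shows "gr_map M f j (gr_class M i x) = gr_class M j (f x)"
proof -
  have "gr_class M j (f y) = gr_class M j (f x)" if "y \<in> gr_class M i x" for y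
  proof -
    from that obtain m where "m \<in> M (i - 1)" "y = x + m" by (auto simp: gr_class_def)
    then show ?thesis using f(2)[of m] by (simp add: gr_class_eq linD[OF f(1)])
  qed
  moreover have "gr_class M i x \<noteq> {}" using subspace_0[OF subspace_M] by (auto simp: gr_class_def)
  ultimately show ?thesis unfolding gr_map_def by blast
qed

lemma N_gr_map: "gr_map M (N ^^ k) (- int k) (gr_class M (int k) x) = gr_class M (- int k) ((N ^^ k) x)"
proof (rule gr_map_class[OF lin_pow[OF N]])
  fix x assume "x \<in> M (int k - 1)"
  moreover have "int k - 1 - 2 * int k = - int k - 1" by simp
  ultimately show "(N ^^ k) x \<in> M (- int k - 1)" using Npow_M[of x "int k - 1" k] by metis
qed

text \<open>This and the next lemma restate the monodromy isomorphism of graded pieces for elements,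
  so that cosets disappear from the arguments.\<close>

lemma gr_inj:
  assumes x: "x \<in> M (int k)" and "(N ^^ k) x \<in> M (- int k - 1)" shows "x \<in> M (int k - 1)"
proof -
  have "gr_class M (- int k) ((N ^^ k) x) = gr_class M (- int k) ((N ^^ k) 0)"
    using assms(2) by (simp add: gr_class_eq linD[OF lin_pow[OF N]])
  then have "gr_map M (N ^^ k) (- int k) (gr_class M (int k) x) = gr_map M (N ^^ k) (- int k) (gr_class M (int k) 0)"
    by (simp add: N_gr_map)
  moreover have "gr_class M (int k) x \<in> gr M (int k)" "gr_class M (int k) 0 \<in> gr M (int k)"
    using x subspace_0[OF subspace_M] by (auto simp: gr_def)
  ultimately have "gr_class M (int k) x = gr_class M (int k) 0"
    using gr_bij[of k] by (auto simp: bij_betw_def dest: inj_onD)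
  then show ?thesis by (simp add: gr_class_eq)
qed

lemma gr_surj:
  assumes y: "y \<in> M (- int k)" shows "\<exists>x\<in>M (int k). y - (N ^^ k) x \<in> M (- int k - 1)"
proof -
  have "gr_class M (- int k) y \<in> gr M (- int k)" using y by (simp add: gr_def)
  then have "gr_class M (- int k) y \<in> gr_map M (N ^^ k) (- int k) ` gr M (int k)"
    using gr_bij[of k] by (simp only: bij_betw_def)
  then obtain x where "x \<in> M (int k)" "gr_class M (- int k) y = gr_class M (- int k) ((N ^^ k) x)"
    by (auto simp: gr_def N_gr_map)
  then show ?thesis using gr_class_eq by metis
qed

text \<open>Surjectivity on the graded piece leaves an error in the next lower step; it is corrected
  by the same argument there, until the filtration is zero.\<close>

lemma M_minus: "\<exists>x\<in>M (int k). y = (N ^^ k) x" if "y \<in> M (- int k)"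
proof -
  obtain b where b: "M b = {0}" using M_bot by blast
  define K where "K = nat (- b)"
  have K: "M (- int j) = {0}" if "j \<ge> K" for j
  proof -
    have "M (- int j) \<subseteq> M b" by (rule mono_M) (use that in \<open>simp add: K_def\<close>)
    then show ?thesis using b subspace_0[OF subspace_M, of "- int j"] by blast
  qed
  have "\<exists>x\<in>M (int k). y = (N ^^ k) x" if "K \<le> k + n" "y \<in> M (- int k)" for n k y
    using that
  proof (induction n arbitrary: k y)
    case 0
    then show ?case using K[of k] subspace_0[OF subspace_M] linD(3)[OF lin_pow[OF N]] by (intro bexI[of _ 0]) auto
  next
    case (Suc n)
    obtain x where x: "x \<in> M (int k)" "y - (N ^^ k) x \<in> M (- int k - 1)" using gr_surj[OF Suc.prems(2)] by blast
    moreover have "- int k - 1 = - int (Suc k)" by simp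
    ultimately have "y - (N ^^ k) x \<in> M (- int (Suc k))" by (simp only:)
    then obtain z where z: "z \<in> M (int (Suc k))" "y - (N ^^ k) x = (N ^^ Suc k) z"
      using Suc.IH[of "Suc k"] Suc.prems(1) by auto
    have "N z \<in> M (int k)" using N_M[OF z(1)] mono_M[of "int (Suc k) - 2" "int k"] by auto
    moreover have "y = (N ^^ k) (x + N z)"
      using z(2) by (simp add: linD[OF lin_pow[OF N]] funpow_swap1 algebra_simps)
    ultimately show ?case using x(1) subspace_add[OF subspace_M] by blast
  qed
  from this[of k K y] that show ?thesis by simp
qed

text \<open>An element of degree above \<open>k\<close> killed by \<open>N ^^ Suc k\<close> is also
  killed by the power belonging to its own degree, so injectivity on graded pieces lowers the degree
  step by step.\<close>

lemma ker_M:
  assumes "(N ^^ Suc k) x = 0" shows "x \<in> M (int k)"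
proof -
  obtain t where t: "M t = UNIV" using M_top by blast
  have "x \<in> M (int k)" if "x \<in> M (int k + int n)" for n
    using that
  proof (induction n)
    case (Suc n)
    have "(N ^^ (Suc k + n)) x = (N ^^ n) ((N ^^ Suc k) x)"
      by (subst add.commute) (simp only: funpow_add o_apply)
    then have "(N ^^ (Suc k + n)) x = 0" using assms by (simp add: linD[OF lin_pow[OF N]])
    then have "x \<in> M (int (Suc k + n) - 1)"
      using Suc.prems subspace_0[OF subspace_M] by (intro gr_inj) (simp_all add: algebra_simps del: funpow.simps)
    then show ?case using Suc.IH by (simp add: algebra_simps)
  qed simp
  moreover have "t \<le> int k + int (nat (t - int k))" by simp
  from mono_M[OF this] have "x \<in> M (int k + int (nat (t - int k)))" unfolding t by blast
  ultimately show ?thesis by blast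
qed

text \<open>\<open>(N ^^ Suc k) x\<close> lies in degree \<open>- (k + 2)\<close>, hence by
  \<open>M_minus\<close> is \<open>N ^^ (k + 2)\<close> of some \<open>y\<close>. So
  \<open>M k\<close> is generated by the kernel of \<open>N ^^ Suc k\<close> and \<open>N\<close> of
  \<open>M (k + 2)\<close>.\<close>

lemma M_plus:
  assumes x: "x \<in> M (int k)" shows "\<exists>y\<in>M (int k + 2). (N ^^ Suc k) (x - N y) = 0"
proof -
  have "(N ^^ Suc k) x \<in> M (- int (k + 2))" using Npow_M[OF x, of "Suc k"] by (simp add: algebra_simps del: funpow.simps)
  then obtain y where "y \<in> M (int (k + 2))" "(N ^^ Suc k) x = (N ^^ (k + 2)) y" using M_minus by blast
  then show ?thesis by (intro bexI[of _ y]) (auto simp: linD[OF lin_pow[OF N]] linD[OF N] funpow_swap1 algebra_simps)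
qed

lemma Phi_Npow: "\<Phi> ((N ^^ k) x) = r ^ k \<cdot> (N ^^ k) (\<Phi> x)"
  by (induction k) (simp_all add: \<Phi>N linD[OF N])

text \<open>\<open>M_plus\<close>, \<open>ker_M\<close> and \<open>M_minus\<close> describe the
  filtration through \<open>N\<close> alone, descending from the top and then passing to negative
  degrees; \<open>\<Phi>\<close> commutes with \<open>N\<close> up to a scalar and respects each
  step.\<close>

lemma Phi_M: "x \<in> M i \<Longrightarrow> \<Phi> x \<in> M i"
proof -
  obtain t where t: "M t = UNIV" using M_top by blast
  have T: "M j = UNIV" if "j \<ge> t" for j using mono_M[OF that] t by auto
  have nonneg: "\<Phi> x \<in> M (int k)" if "int k + int n \<ge> t" "x \<in> M (int k)" for n k x
    using that
  proof (induction n arbitrary: k x rule: less_induct)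
    case (less n)
    show ?case
    proof (cases "int k \<ge> t")
      case False
      obtain y where y: "y \<in> M (int k + 2)" "(N ^^ Suc k) (x - N y) = 0" using M_plus[OF less.prems(2)] by blast
      have "\<Phi> y \<in> M (int (k + 2))"
        by (rule less.IH[of "n - 1"]) (use False less.prems(1) y(1) in \<open>auto simp: algebra_simps\<close>)
      then have "N (\<Phi> y) \<in> M (int k)" using N_M[of "\<Phi> y" "int (k + 2)"] by simp
      then have "\<Phi> (N y) \<in> M (int k)" by (simp add: \<Phi>N subspace_scale[OF subspace_M])
      moreover have "\<Phi> (x - N y) \<in> M (int k)"
      proof -
        have "r ^ Suc k \<cdot> (N ^^ Suc k) (\<Phi> (x - N y)) = \<Phi> 0"
          unfolding Phi_Npow[symmetric] y(2) ..
        then have "(N ^^ Suc k) (\<Phi> (x - N y)) = 0" using r0 by (simp add: linD(3)[OF \<Phi>] del: funpow.simps power_Suc)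
        then show ?thesis by (rule ker_M)
      qed
      ultimately have "\<Phi> (x - N y) + \<Phi> (N y) \<in> M (int k)" by (intro subspace_add[OF subspace_M])
      then show ?thesis by (simp add: linD(4)[OF \<Phi>])
    qed (use T in simp)
  qed
  assume x: "x \<in> M i"
  show "\<Phi> x \<in> M i"
  proof (cases "i \<ge> 0")
    case True
    then show ?thesis using nonneg[of "nat i" "nat t" x] x by simp
  next
    case False
    define k where "k = nat (- i)"
    have i: "i = - int k" using False by (simp add: k_def)
    obtain y where y: "y \<in> M (int k)" "x = (N ^^ k) y" using M_minus x unfolding i by blast
    have "\<Phi> y \<in> M (int k)" by (rule nonneg[of k "nat t"]) (use y(1) in auto)
    from Npow_M[OF this, of k] show ?thesis unfolding y(2) Phi_Npow i by (simp add: subspace_scale[OF subspace_M])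
  qed
qed

lemma gr_eigenvalueI:
  assumes "x \<in> M i" "x \<notin> M (i - 1)" "\<Phi> x - a \<cdot> x \<in> M (i - 1)"
  shows "gr_eigenvalue scale M \<Phi> i a"
  unfolding gr_eigenvalue_def
  using assms by (intro bexI[of _ x]) (auto simp: gr_class_eq gr_map_class[OF \<Phi> Phi_M])

text \<open>Linear factors of \<open>p\<close> are stripped one at a time: either
  \<open>\<Phi> - a\<close> lowers the degree of \<open>x\<close>, and \<open>a\<close> is an
  eigenvalue on the graded piece, or it gives a vector of the same exact degree killed by a shorter
  polynomial.\<close>

lemma gr_eigenvalue_exists:
  assumes "p \<noteq> 0" "pev p \<Phi> x = 0" "x \<in> M i" "x \<notin> M (i - 1)"
  shows "\<exists>a. poly p a = 0 \<and> gr_eigenvalue scale M \<Phi> i a"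
  using assms
proof (induction "degree p" arbitrary: p x)
  case 0
  then obtain a where "p = [:a:]" "a \<noteq> 0" by (metis degree_eq_zeroE pCons_0_0)
  then have "x = 0" using 0 by simp
  then show ?case using 0 subspace_0[OF subspace_M] by blast
next
  case (Suc n)
  then obtain a where a: "poly p a = 0" using alg_closed_imp_poly_has_root[of p] by (metis zero_less_Suc)
  then obtain p' where p': "p = [:-a, 1:] * p'" by (auto simp: poly_eq_0_iff_dvd elim: dvdE)
  have "p' \<noteq> 0" using Suc.prems(1) p' by auto
  have "degree p = Suc (degree p')" unfolding p' using \<open>p' \<noteq> 0\<close> by (subst degree_mult_eq) auto
  then have deg: "n = degree p'" using Suc.hyps(2) by simp
  define z where "z = \<Phi> x - a \<cdot> x"
  show ?case
  proof (cases "z \<in> M (i - 1)")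
    case True
    then show ?thesis using gr_eigenvalueI[OF Suc.prems(3,4)] a unfolding z_def by blast
  next
    case False
    have "z \<in> M i" unfolding z_def
      using subspace_diff[OF subspace_M Phi_M[OF Suc.prems(3)] subspace_scale[OF subspace_M Suc.prems(3)]] .
    moreover have "pev p' \<Phi> z = 0"
    proof -
      have "z = pev [:-a, 1:] \<Phi> x" by (simp add: z_def)
      then have "pev p' \<Phi> z = pev (p' * [:-a, 1:]) \<Phi> x" by (simp only: pev_mult[OF \<Phi>])
      then show ?thesis using Suc.prems(2) by (simp only: p' mult.commute)
    qed
    ultimately obtain b where "poly p' b = 0" "gr_eigenvalue scale M \<Phi> i b"
      using Suc.hyps(1)[OF deg \<open>p' \<noteq> 0\<close>] False by blast
    then show ?thesis by (auto simp: p')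
  qed
qed

end

text \<open>The bridge from the filtration to eigenspaces of \<open>T\<close>, the
  \<open>m\<close>-th power of the semisimple part, whose eigenvalue belonging to \<open>a\<close>
  is \<open>a ^ m\<close>.\<close>

locale pure_filtered = filtered scale N M \<Phi> r
  for scale :: "'a::{alg_closed_field,field_char_0} \<Rightarrow> 'b::ab_group_add \<Rightarrow> 'b" (infixr "\<cdot>" 75)
    and N M \<Phi> r +
  fixes S U T :: "'b \<Rightarrow> 'b" and m :: nat and Q :: 'a and Wt :: "int \<Rightarrow> 'a \<Rightarrow> bool"
  assumes J: "jordan \<Phi> S U" and m: "m > 0" and T: "T = S ^^ m"
    and TN: "\<And>x. T (N x) = inverse Q \<cdot> N (T x)" and Q0: "Q \<noteq> 0"
    and weight: "\<And>i a. gr_eigenvalue scale M \<Phi> i a \<Longrightarrow> Wt i (a ^ m)"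
    and Wt_unique: "\<And>i j c. Wt i c \<Longrightarrow> Wt j c \<Longrightarrow> i = j"
    and Wt_div: "\<And>i c. Wt i c \<Longrightarrow> Wt (i - 2) (c / Q)"
begin

lemma linT: "lin T" unfolding T by (rule lin_pow[OF jordanD(1)[OF J]])

lemma diagT: "diagonalizable scale T"
  unfolding T by (rule jordanD(6)[OF jordan_funpow[OF J]])

text \<open>Let \<open>i\<close> be the exact degree of \<open>x\<close>. As \<open>x\<close> is a
  generalized eigenvector of \<open>\<Phi> ^^ m\<close>, some eigenvalue of \<open>\<Phi>\<close> on
  the graded piece of degree \<open>i\<close> is an \<open>m\<close>-th root of \<open>c\<close>, so
  \<open>c\<close> has weight \<open>i\<close>.\<close>

lemma eig_weight:
  assumes x: "x \<in> eig T c" "x \<noteq> 0"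
  obtains i where "x \<in> M i" "x \<notin> M (i - 1)" "Wt i c"
proof -
  obtain b where b: "M b = {0}" using M_bot by blast
  obtain t where t: "M t = UNIV" using M_top by blast
  have "t \<le> b + int (nat (t - b))" by simp
  from mono_M[OF this] have "x \<in> M (b + int (nat (t - b)))" unfolding t by blast
  then have ex: "\<exists>n. x \<in> M (b + int n)" by blast
  define n where "n = (LEAST n. x \<in> M (b + int n))"
  have n: "x \<in> M (b + int n)" unfolding n_def by (rule LeastI_ex[OF ex])
  have "n \<noteq> 0" using n b x(2) by (metis add.right_neutral of_nat_0 singletonD)
  have n': "x \<notin> M (b + int n - 1)"
  proof
    assume "x \<in> M (b + int n - 1)"
    then have "x \<in> M (b + int (n - 1))" using \<open>n \<noteq> 0\<close> by (simp add: of_nat_diff algebra_simps)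
    then have "n \<le> n - 1" unfolding n_def by (rule Least_le)
    then show False using \<open>n \<noteq> 0\<close> by simp
  qed
  obtain l where l: "pev ([:-c, 1:] ^ l) (\<Phi> ^^ m) x = 0"
    using jordan_eig_iff[OF fin jordan_funpow[OF J, of m], of x c] x(1) unfolding T by blast
  \<comment> \<open>This is \<open>(X ^ m - c) ^ l\<close>; every root of it is an
    \<open>m\<close>-th root of \<open>c\<close>.\<close>
  define p where "p = pcompose ([:-c, 1:] ^ l) (monom 1 m)"
  have ev: "poly p a = (a ^ m - c) ^ l" for a by (simp add: p_def poly_pcompose poly_monom)
  have "pev (monom 1 m) \<Phi> = \<Phi> ^^ m" by (rule ext) simp
  then have "pev p \<Phi> x = 0" using l by (simp add: p_def pev_pcompose[OF \<Phi>])
  moreover have "p \<noteq> 0"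
  proof
    assume "p = 0"
    then have "([:-c, 1:] ^ l :: 'a poly) = 0" unfolding p_def
      by (subst (asm) pcompose_eq_0_iff) (use m in \<open>auto simp: degree_monom_eq\<close>)
    then show False by simp
  qed
  ultimately obtain a where "poly p a = 0" "gr_eigenvalue scale M \<Phi> (b + int n) a"
    using gr_eigenvalue_exists[OF _ _ n n'] by blast
  then have "Wt (b + int n) c" using weight[of "b + int n" a] by (simp add: ev)
  then show ?thesis by (rule that[OF n n'])
qed

lemma Wt_ex: "eig T c \<noteq> {0} \<Longrightarrow> \<exists>k. Wt k c"
  using subspace_0[OF subspace_eig[OF linT], of c] eig_weight[of _ c] by blast

text \<open>With the next lemma: every nonzero vector of the eigenspace has exact degree
  \<open>k\<close>, so that eigenspaces split the filtration.\<close>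

lemma eig_in_M: "Wt k c \<Longrightarrow> x \<in> eig T c \<Longrightarrow> x \<in> M k"
  by (cases "x = 0") (auto intro: subspace_0[OF subspace_M] elim!: eig_weight dest: Wt_unique)

lemma eig_M_zero: "Wt k c \<Longrightarrow> x \<in> eig T c \<Longrightarrow> x \<in> M (k - 1) \<Longrightarrow> x = 0"
  by (rule ccontr, erule eig_weight, assumption) (metis Wt_unique)

lemma N_eig: "x \<in> eig T c \<Longrightarrow> (N ^^ k) x \<in> eig T (c / Q ^ k)"
proof (induction k)
  case (Suc k)
  from Suc.IH[OF Suc.prems] show ?case by (simp add: eig_def TN linD N field_simps)
qed simp

text \<open>Injectivity comes from the graded piece, because an eigenvector of too low degree is
  zero. For surjectivity a preimage from \<open>M_minus\<close> is projected to the
  eigenspace.\<close>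

lemma pure_bij:
  assumes c: "Wt (int k) c" shows "bij_betw (N ^^ k) (eig T c) (eig T (c / Q ^ k))"
proof (rule bij_betw_imageI)
  show "inj_on (N ^^ k) (eig T c)"
  proof (rule inj_onI)
    fix x y assume xy: "x \<in> eig T c" "y \<in> eig T c" "(N ^^ k) x = (N ^^ k) y"
    have d: "x - y \<in> eig T c" by (rule subspace_diff[OF subspace_eig[OF linT] xy(1,2)])
    have "(N ^^ k) (x - y) = 0" using xy(3) by (simp add: linD[OF lin_pow[OF N]])
    then have "x - y \<in> M (int k - 1)"
      using gr_inj[OF eig_in_M[OF c d]] subspace_0[OF subspace_M] by simp
    then have "x - y = 0" by (rule eig_M_zero[OF c d])
    then show "x = y" by simp
  qed
  show "(N ^^ k) ` eig T c = eig T (c / Q ^ k)"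
  proof
    show "(N ^^ k) ` eig T c \<subseteq> eig T (c / Q ^ k)" using N_eig by blast
    show "eig T (c / Q ^ k) \<subseteq> (N ^^ k) ` eig T c"
    proof
      fix y assume y: "y \<in> eig T (c / Q ^ k)"
      have "Wt (int k - 2 * int j) (c / Q ^ j)" for j
      proof (induction j)
        case (Suc j)
        from Wt_div[OF Suc] show ?case by (simp add: field_simps)
      qed (use c in simp)
      from this[of k] have "Wt (- int k) (c / Q ^ k)" by simp
      then have "y \<in> M (- int k)" using y by (rule eig_in_M)
      then obtain x where x: "y = (N ^^ k) x" using M_minus by blast
      obtain C h where sp: "spectral T C h" using spectral_exists[OF fin diagT] by blast
      define \<pi> where "\<pi> d = pev (h d) T" for d
      have p: "\<pi> d z \<in> eig T d" for d z unfolding \<pi>_def by (rule spectral_proj_in[OF sp])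
      have pl: "lin (\<pi> d)" for d unfolding \<pi>_def by (rule lin_spectral_proj[OF sp])
      have "y = (N ^^ k) (\<Sum>d\<in>C. \<pi> d x)" unfolding x \<pi>_def spectral_proj_sum[OF sp] ..
      also have "\<dots> = (\<Sum>d\<in>C. (N ^^ k) (\<pi> d x))" by (rule linD(5)[OF lin_pow[OF N]])
      finally have ysum: "y = (\<Sum>d\<in>C. (N ^^ k) (\<pi> d x))" .
      have "y = \<pi> (c / Q ^ k) y" using spectral_proj_eig[OF sp y] by (simp add: \<pi>_def)
      also have "\<dots> = (\<Sum>d\<in>C. \<pi> (c / Q ^ k) ((N ^^ k) (\<pi> d x)))" by (subst ysum) (rule linD(5)[OF pl])
      \<comment> \<open>\<open>N ^^ k\<close> moves the eigenvalue \<open>d\<close> to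
        \<open>d / Q ^ k\<close>, and distinct \<open>d\<close> stay distinct, so only the component
        at \<open>c\<close> survives.\<close>
      also have "\<dots> = (\<Sum>d\<in>C. if d = c then (N ^^ k) (\<pi> c x) else 0)"
        using spectral_proj_eig[OF sp N_eig[OF p]] Q0 by (intro sum.cong) (auto simp: \<pi>_def)
      also have "\<dots> \<in> (N ^^ k) ` eig T c"
        using spectral_finite[OF sp] p subspace_0[OF subspace_eig[OF linT]] linD(3)[OF lin_pow[OF N]]
        by (auto intro: image_eqI[of _ _ 0])
      finally show "y \<in> (N ^^ k) ` eig T c" .
    qed
  qed
qed

end

section \<open>Groups generated by a coset of a normalizing element\<close>

text \<open>\<open>I\<close> is assumed to be normalized by \<open>f\<close> only, so
  \<open>G Mod I\<close> need not be a group. Powers and inverses of the coset of \<open>f\<close>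
  are computed by hand inside the normalizer \<open>M\<close>.\<close>

lemma (in group) cyclic_cosets:
  assumes I: "subgroup I G" and f: "f \<in> carrier G"
    and nrm: "\<forall>i\<in>I. f \<otimes> i \<otimes> inv f \<in> I" "\<forall>i\<in>I. inv f \<otimes> i \<otimes> f \<in> I"
  defines "W \<equiv> {s \<in> carrier G. \<exists>n::int. s \<in> I #> f [^] n}"
  shows "(I #> f) [^]\<^bsub>G Mod I\<^esub> (n::int) = I #> f [^] n"
    and "generate (G Mod I) {I #> f} = range (\<lambda>n::int. I #> f [^] n)"
    and "subgroup W G"
    and "s \<in> I #> f [^] n \<Longrightarrow> t \<in> I #> f [^] m \<Longrightarrow> s \<otimes> t \<in> I #> f [^] (n + m :: int)"
proof -
  interpret I: subgroup I G by fact
  define M where "M = {g \<in> carrier G. \<forall>i\<in>I. g \<otimes> i \<otimes> inv g \<in> I \<and> inv g \<otimes> i \<otimes> g \<in> I}"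
  have Ic: "i \<in> carrier G" if "i \<in> I" for i using that by (rule I.mem_carrier)
  have Mc: "g \<in> carrier G" if "g \<in> M" for g using that by (simp add: M_def)
  have M1: "g \<otimes> i \<otimes> inv g \<in> I" "inv g \<otimes> i \<otimes> g \<in> I" if "g \<in> M" "i \<in> I" for g i
    using that by (simp_all add: M_def)
  have M_mult: "g \<otimes> h \<in> M" if g: "g \<in> M" and h: "h \<in> M" for g h
  proof -
    have e: "(g \<otimes> h) \<otimes> i \<otimes> inv (g \<otimes> h) = g \<otimes> (h \<otimes> i \<otimes> inv h) \<otimes> inv g"
      "inv (g \<otimes> h) \<otimes> i \<otimes> (g \<otimes> h) = inv h \<otimes> (inv g \<otimes> i \<otimes> g) \<otimes> h" if "i \<in> I" for i
      using Mc[OF g] Mc[OF h] Ic[OF that] by (simp_all add: m_assoc inv_mult_group)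
    have "(g \<otimes> h) \<otimes> i \<otimes> inv (g \<otimes> h) \<in> I" "inv (g \<otimes> h) \<otimes> i \<otimes> (g \<otimes> h) \<in> I" if "i \<in> I" for i
      unfolding e[OF that] by (intro M1 g h that)+
    then show ?thesis unfolding M_def using m_closed[OF Mc[OF g] Mc[OF h]] by blast
  qed
  have M_inv: "inv g \<in> M" if "g \<in> M" for g using that by (simp add: M_def)
  have M_one: "\<one> \<in> M" using Ic by (simp add: M_def)
  have fM: "f \<in> M" using f nrm by (simp add: M_def)
  have M_pow: "f [^] (n::nat) \<in> M" for n by (induction n) (simp_all add: M_one M_mult fM)
  have M_int_pow: "f [^] (n::int) \<in> M" for n
    by (cases n rule: int_cases2) (simp_all add: int_pow_int int_pow_neg[OF f] M_pow M_inv)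
  have memI: "x \<in> I #> g \<longleftrightarrow> (\<exists>i\<in>I. x = i \<otimes> g)" for x g by (simp add: r_coset_def)
  have memM: "x \<in> I #> g \<otimes> h" if "g \<in> M" "h \<in> carrier G" "a \<in> I #> g" "b \<in> I #> h" "x = a \<otimes> b" for x a b g h
  proof -
    obtain i j where ij: "i \<in> I" "a = i \<otimes> g" "j \<in> I" "b = j \<otimes> h" using \<open>a \<in> I #> g\<close> \<open>b \<in> I #> h\<close> unfolding memI by metis
    have "x = (i \<otimes> (g \<otimes> j \<otimes> inv g)) \<otimes> (g \<otimes> h)"
      using ij Ic Mc[OF that(1)] that(2,5) by (simp add: m_assoc inv_solve_left)
    then show ?thesis unfolding memI using ij(1) M1(1)[OF that(1) ij(3)] by (metis I.m_closed)
  qed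
  have mult: "(I #> g) <#> (I #> h) = I #> (g \<otimes> h)" if g: "g \<in> M" and h: "h \<in> carrier G" for g h
  proof
    show "(I #> g) <#> (I #> h) \<subseteq> I #> (g \<otimes> h)" unfolding set_mult_def using memM[OF g h] by auto
    show "I #> (g \<otimes> h) \<subseteq> (I #> g) <#> (I #> h)"
    proof
      fix x assume "x \<in> I #> (g \<otimes> h)"
      then obtain i where i: "i \<in> I" "x = i \<otimes> (g \<otimes> h)" unfolding memI by blast
      have "x = (i \<otimes> g) \<otimes> (\<one> \<otimes> h)" using i Ic Mc[OF g] h by (simp add: m_assoc)
      moreover have "i \<otimes> g \<in> I #> g" "\<one> \<otimes> h \<in> I #> h" using i unfolding memI by auto
      ultimately show "x \<in> (I #> g) <#> (I #> h)" unfolding set_mult_def by blast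
    qed
  qed
  have I1: "I #> \<one> = I" using Ic by (intro coset_mult_one) blast
  \<comment> \<open>The inverse in \<open>G Mod I\<close> is a definite description over all cosets,
    so uniqueness is checked for cosets of arbitrary elements of \<open>G\<close>.\<close>
  have invQ: "inv\<^bsub>G Mod I\<^esub> (I #> g) = I #> inv g" if g: "g \<in> M" for g
    unfolding m_inv_def[of "G Mod I"] one_FactGroup mult_FactGroup carrier_FactGroup
  proof (rule the_equality)
    show "I #> inv g \<in> (\<lambda>x. I #> x) ` carrier G \<and> (I #> g) <#> (I #> inv g) = I \<and> (I #> inv g) <#> (I #> g) = I"
      using Mc[OF g] mult[OF g, of "inv g"] mult[OF M_inv[OF g] Mc[OF g]] by (simp add: I1)
  next
    fix y assume "y \<in> (\<lambda>x. I #> x) ` carrier G \<and> (I #> g) <#> y = I \<and> y <#> (I #> g) = I"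
    then obtain h where h: "h \<in> carrier G" "y = I #> h" "(I #> g) <#> (I #> h) = I" by blast
    have "g \<otimes> h \<in> I" using mult[OF g h(1)] h(3) rcos_self[OF m_closed[OF Mc[OF g] h(1)] I] by simp
    then have "inv g \<otimes> (g \<otimes> h) \<otimes> g \<in> I" by (rule M1(2)[OF g])
    then have "h \<otimes> g \<in> I" using Mc[OF g] h(1) by (simp add: m_assoc[symmetric])
    then have "h \<in> I #> inv g" unfolding memI
      using Mc[OF g] h(1) by (intro bexI[of _ "h \<otimes> g"]) (simp_all add: m_assoc)
    then show "y = I #> inv g" unfolding h(2) using repr_independence[OF _ inv_closed[OF Mc[OF g]] I] by simp
  qed
  have npow: "rec_nat I (\<lambda>u b. b <#> (I #> f)) n = I #> f [^] n" for n :: nat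
    by (induction n) (simp_all add: I1 mult M_pow f)
  show "(I #> f) [^]\<^bsub>G Mod I\<^esub> n = I #> f [^] n"
  proof (cases "n < 0")
    case True
    have "f [^] n = inv (f [^] nat (- n))"
      using True int_pow_neg[OF f, of "- n"] by (simp add: pow_nat)
    then show ?thesis using True by (simp add: int_pow_def[of "G Mod I"] npow invQ M_pow M_int_pow)
  next
    case False
    then show ?thesis by (simp add: int_pow_def[of "G Mod I"] npow pow_nat)
  qed
  have add: "(I #> f [^] n) <#> (I #> f [^] m) = I #> f [^] (n + m)" for n m :: int
    by (simp add: mult M_int_pow f int_pow_mult)
  show "generate (G Mod I) {I #> f} = range (\<lambda>n::int. I #> f [^] n)"
  proof
    show "generate (G Mod I) {I #> f} \<subseteq> range (\<lambda>n::int. I #> f [^] n)"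
    proof
      fix x assume "x \<in> generate (G Mod I) {I #> f}"
      then show "x \<in> range (\<lambda>n::int. I #> f [^] n)"
      proof induction
        case one show ?case by (intro image_eqI[of _ _ 0]) (simp_all add: I1)
      next
        case (incl h) then show ?case using f by (intro image_eqI[of _ _ 1]) simp_all
      next
        case (inv h) then show ?case using f by (intro image_eqI[of _ _ "-1"]) (simp_all add: invQ fM int_pow_neg)
      next
        case (eng h1 h2)
        then obtain n m where "h1 = I #> f [^] (n::int)" "h2 = I #> f [^] (m::int)" by blast
        then show ?case by (intro image_eqI[of _ _ "n + m"]) (simp_all add: add)
      qed
    qed
    have nat: "I #> f [^] (n::nat) \<in> generate (G Mod I) {I #> f}" for n
    proof (induction n)
      case 0 show ?case using generate.one[of "G Mod I"] by (simp add: I1)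
    next
      case (Suc n)
      from generate.eng[OF this generate.incl[of "I #> f"]] show ?case by (simp add: mult M_pow f)
    qed
    have neg: "I #> inv (f [^] (n::nat)) \<in> generate (G Mod I) {I #> f}" for n
    proof (induction n)
      case 0 show ?case using generate.one[of "G Mod I"] by (simp add: I1)
    next
      case (Suc n)
      have "I #> inv f \<in> generate (G Mod I) {I #> f}" using generate.inv[of "I #> f" "{I #> f}" "G Mod I"] by (simp add: invQ fM)
      from generate.eng[OF this Suc] show ?case
        using f by (simp add: mult M_inv fM inv_mult_group)
    qed
    show "range (\<lambda>n::int. I #> f [^] n) \<subseteq> generate (G Mod I) {I #> f}"
    proof (intro image_subsetI)
      fix n :: int
      show "I #> f [^] n \<in> generate (G Mod I) {I #> f}"
        by (cases n rule: int_cases2) (simp_all add: int_pow_int int_pow_neg[OF f] nat neg)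
    qed
  qed
  have memadd: "s \<otimes> t \<in> I #> f [^] (n + m)" if "s \<in> I #> f [^] n" "t \<in> I #> f [^] m" for s t and n m :: int
    using memM[OF M_int_pow int_pow_closed[OF f] that refl] f by (simp add: int_pow_mult)
  then show "s \<in> I #> f [^] n \<Longrightarrow> t \<in> I #> f [^] m \<Longrightarrow> s \<otimes> t \<in> I #> f [^] (n + m)" .
  show "subgroup W G"
  proof
    show "W \<subseteq> carrier G" by (auto simp: W_def)
    show "s \<otimes> t \<in> W" if "s \<in> W" "t \<in> W" for s t using that memadd by (auto simp: W_def) blast
    show "\<one> \<in> W" unfolding W_def memI by (auto intro!: exI[of _ 0] bexI[of _ \<one>])
    show "inv s \<in> W" if "s \<in> W" for s
    proof -
      have sG: "s \<in> carrier G" using that by (simp add: W_def)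
      obtain n :: int where "s \<in> I #> f [^] n" using \<open>s \<in> W\<close> unfolding W_def by blast
      then obtain i where s: "i \<in> I" "s = i \<otimes> f [^] n" unfolding memI by blast
      define g where "g = f [^] n"
      have g: "g \<in> M" "inv g = f [^] (- n)" by (simp_all add: g_def M_int_pow int_pow_neg f)
      have "inv s = (inv g \<otimes> inv i \<otimes> g) \<otimes> inv g"
        unfolding s(2) g_def[symmetric] using Mc[OF g(1)] Ic[OF s(1)] by (simp add: inv_mult_group m_assoc)
      then have "inv s \<in> I #> f [^] (- n)" unfolding memI g(2)[symmetric] using M1(2)[OF g(1) I.m_inv_closed[OF s(1)]] by blast
      then show ?thesis using sG unfolding W_def by blast
    qed
  qed
qed

section \<open>The residue field\<close>

locale nonarch =
  fixes av :: "'k::field_char_0 \<Rightarrow> real" and l :: nat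
  assumes nonarch: "nonarch_abs av" and l: "prime l" and av_l: "av (of_nat l) < 1"
    and av_nat: "\<And>n::nat. av (of_nat n) \<le> 1"
begin

lemma av_nonneg: "0 \<le> av x" and av_eq_0 [simp]: "av x = 0 \<longleftrightarrow> x = 0" and av_mult: "av (x * y) = av x * av y"
  and av_add: "av (x + y) \<le> max (av x) (av y)"
  using nonarch by (auto simp: nonarch_abs_def)

lemma av_zero [simp]: "av 0 = 0" by simp

lemma av_one [simp]: "av 1 = 1"
  using av_mult[of 1 1] av_eq_0[of 1] by simp

lemma av_power: "av (x ^ n) = av x ^ n"
  by (induction n) (simp_all add: av_mult)

lemma av_minus [simp]: "av (- x) = av x"
proof -
  have "av (-1) ^ 2 = 1" using av_power[of "-1" 2] by simp
  then have "av (-1) = 1" using av_nonneg[of "-1"] by (simp add: power2_eq_1_iff)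
  then show ?thesis using av_mult[of "-1" x] by simp
qed

lemma av_diff: "av (x - y) \<le> max (av x) (av y)"
  using av_add[of x "- y"] by simp

lemma av_inverse: "av (inverse x) = inverse (av x)"
proof (cases "x = 0")
  case False
  then have "av x * av (inverse x) = 1" by (simp add: av_mult[symmetric])
  then show ?thesis using False by (simp add: field_simps)
qed simp

lemma av_sum_less: "finite I \<Longrightarrow> (\<And>i. i \<in> I \<Longrightarrow> av (f i) < 1) \<Longrightarrow> av (\<Sum>i\<in>I. f i) < 1"
proof (induction I rule: finite_induct)
  case (insert i I)
  then have "max (av (f i)) (av (sum f I)) < 1" by simp
  with av_add have "av (f i + sum f I) < 1" by (rule le_less_trans)
  then show ?case using insert.hyps by simp
qed simp

lemma av_add_less: "av x < 1 \<Longrightarrow> av y < 1 \<Longrightarrow> av (x + y) < 1"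
  and av_add_le: "av x \<le> 1 \<Longrightarrow> av y \<le> 1 \<Longrightarrow> av (x + y) \<le> 1"
  and av_diff_le: "av x \<le> 1 \<Longrightarrow> av y \<le> 1 \<Longrightarrow> av (x - y) \<le> 1"
  and av_diff_less: "av x < 1 \<Longrightarrow> av y < 1 \<Longrightarrow> av (x - y) < 1"
  using av_add[of x y] av_diff[of x y] by simp_all

lemma av_mult_less: "av x < 1 \<Longrightarrow> av y \<le> 1 \<Longrightarrow> av (x * y) < 1"
  using mult_left_le[of "av y" "av x"] av_nonneg[of x] by (simp add: av_mult)

lemma av_power_le: "av x \<le> 1 \<Longrightarrow> av (x ^ n) \<le> 1"
  by (simp add: av_power power_le_one av_nonneg)

lemma av_power_less_iff: "n > 0 \<Longrightarrow> av (x ^ n) < 1 \<longleftrightarrow> av x < 1"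
  using av_nonneg[of x] by (simp add: av_power power_less_one_iff)

lemma congruent_power: "av x \<le> 1 \<Longrightarrow> av y \<le> 1 \<Longrightarrow> av (x - y) < 1 \<Longrightarrow> av (x ^ n - y ^ n) < 1"
proof (induction n)
  case (Suc n)
  have "x ^ Suc n - y ^ Suc n = (x ^ n - y ^ n) * x + (x - y) * y ^ n" by (simp add: algebra_simps)
  then show ?case using Suc av_power_le by (simp add: av_add_less av_mult_less)
qed simp

text \<open>The inner binomial coefficients are divisible by \<open>l\<close>, which has absolute
  value below 1.\<close>

lemma frobenius_additive_prime:
  assumes x: "av x \<le> 1" and y: "av y \<le> 1" shows "av ((x + y) ^ l - x ^ l - y ^ l) < 1"
proof -
  have l0: "l > 0" using l prime_gt_0_nat by blast
  have "(x + y) ^ l = (\<Sum>k\<le>l. of_nat (l choose k) * x ^ k * y ^ (l - k))" by (rule binomial_ring)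
  also have "{..l} = insert 0 (insert l {1..<l})" using l0 by auto
  also have "(\<Sum>k\<in>insert 0 (insert l {1..<l}). of_nat (l choose k) * x ^ k * y ^ (l - k)) =
      y ^ l + (x ^ l + (\<Sum>k\<in>{1..<l}. of_nat (l choose k) * x ^ k * y ^ (l - k)))"
    using l0 by (subst sum.insert; (subst sum.insert)?) auto
  finally have "(x + y) ^ l - x ^ l - y ^ l = (\<Sum>k\<in>{1..<l}. of_nat (l choose k) * x ^ k * y ^ (l - k))" by simp
  also have "av \<dots> < 1"
  proof (rule av_sum_less)
    fix k assume k: "k \<in> {1..<l}"
    then have "l dvd (l choose k)" using dvd_choose_prime[of k l] l by auto
    then obtain j where "l choose k = l * j" by blast
    then have "av (of_nat (l choose k)) < 1" using av_mult_less[OF av_l av_nat, of j] by simp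
    then show "av (of_nat (l choose k) * x ^ k * y ^ (l - k)) < 1"
      by (intro av_mult_less av_power_le x y)
  qed simp
  finally show ?thesis .
qed

lemma frobenius_additive:
  assumes x: "av x \<le> 1" and y: "av y \<le> 1" shows "av ((x + y) ^ (l ^ n) - x ^ (l ^ n) - y ^ (l ^ n)) < 1"
proof (induction n)
  case (Suc n)
  define a b where "a = x ^ (l ^ n)" and "b = y ^ (l ^ n)"
  have ab: "av a \<le> 1" "av b \<le> 1" using x y by (simp_all add: a_def b_def av_power_le)
  have "av (((x + y) ^ (l ^ n)) ^ l - (a + b) ^ l) < 1"
    by (rule congruent_power) (use Suc in \<open>simp_all add: a_def b_def av_power_le av_add_le x y algebra_simps\<close>)
  from av_add_less[OF this frobenius_additive_prime[OF ab]]
  have "av (((x + y) ^ (l ^ n)) ^ l - a ^ l - b ^ l) < 1" by (simp add: algebra_simps)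
  then show ?case by (simp add: a_def b_def power_mult[symmetric] mult.commute)
qed simp

text \<open>Additivity applied to \<open>(x - y) + y\<close> puts a power of \<open>x - y\<close>,
  hence \<open>x - y\<close> itself, into the maximal ideal. This is what makes two lifts of
  Frobenius differ by inertia.\<close>

lemma frobenius_injective:
  assumes "av x \<le> 1" "av y \<le> 1" "av (x ^ (l ^ n) - y ^ (l ^ n)) < 1" shows "av (x - y) < 1"
proof -
  have l0: "l ^ n > 0" using l prime_gt_0_nat by simp
  have "av (x - y) \<le> 1" using assms by (simp add: av_diff_le)
  then have "av (((x - y) + y) ^ (l ^ n) - (x - y) ^ (l ^ n) - y ^ (l ^ n)) < 1"
    using assms(2) by (intro frobenius_additive)
  then have "av (x ^ (l ^ n) - (x - y) ^ (l ^ n) - y ^ (l ^ n)) < 1" by simp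
  from av_diff_less[OF assms(3) this] have "av ((x - y) ^ (l ^ n)) < 1" by simp
  then show ?thesis using l0 by (simp add: av_power_less_iff)
qed

text \<open>The additive residue group is killed by \<open>l\<close>. Another prime dividing its
  order would give, by Sylow, a nontrivial element killed by two coprime numbers. A nonzero
  cardinality means that the group is finite.\<close>

lemma residue_card_prime_power:
  assumes K: "subfield_set K" and fin: "residue_card av K \<noteq> 0"
  shows "\<exists>n. residue_card av K = l ^ n"
proof -
  define A :: "'k monoid" where "A = \<lparr>carrier = {x \<in> K. av x \<le> 1}, mult = (+), one = 0\<rparr>"
  define H where "H = {x \<in> K. av x < 1}"
  note KD = K[unfolded subfield_set_def]
  have A: "comm_group A"
  proof (rule comm_groupI)
    show "\<exists>y\<in>carrier A. y \<otimes>\<^bsub>A\<^esub> x = \<one>\<^bsub>A\<^esub>" if "x \<in> carrier A" for x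
      using that KD by (intro bexI[of _ "- x"]) (auto simp: A_def)
  qed (use KD in \<open>auto simp: A_def av_add_le algebra_simps\<close>)
  interpret A: comm_group A by fact
  have inv: "inv\<^bsub>A\<^esub> x = - x" if "x \<in> carrier A" for x
    by (rule A.inv_equality) (use that KD in \<open>auto simp: A_def\<close>)
  have H: "subgroup H A"
    by unfold_locales (use KD inv in \<open>auto simp: A_def H_def av_add_less\<close>)
  interpret normal H A by (rule A.subgroup_imp_normal[OF H])
  define Q where "Q = A Mod H"
  interpret Q: group Q unfolding Q_def by (rule factorgroup_is_group)
  define rel where "rel = {(x, y). x \<in> K \<and> y \<in> K \<and> av x \<le> 1 \<and> av y \<le> 1 \<and> av (x - y) < 1}"
  have coset: "rel `` {x} = H #>\<^bsub>A\<^esub> x" if "x \<in> carrier A" for x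
  proof
    show "rel `` {x} \<subseteq> H #>\<^bsub>A\<^esub> x"
    proof
      fix y assume "y \<in> rel `` {x}"
      then have y: "y \<in> K" "av (x - y) < 1" by (auto simp: rel_def)
      have "y - x \<in> K" using KD y(1) that by (metis (no_types, lifting) A_def add_uminus_conv_diff mem_Collect_eq partial_object.select_convs(1))
      moreover have "av (y - x) < 1" using y(2) av_minus[of "x - y"] by simp
      ultimately show "y \<in> H #>\<^bsub>A\<^esub> x" by (auto simp: r_coset_def A_def H_def intro!: bexI[of _ "y - x"])
    qed
    show "H #>\<^bsub>A\<^esub> x \<subseteq> rel `` {x}"
      using that KD by (auto simp: r_coset_def A_def H_def rel_def intro: av_add_le less_imp_le)
  qed
  have "carrier Q = {x \<in> K. av x \<le> 1} // rel"
    unfolding Q_def carrier_FactGroup quotient_def using coset by (auto simp: A_def)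
  then have card: "order Q = residue_card av K" by (simp add: order_def residue_card_def rel_def)
  have Qfin: "finite (carrier Q)" using fin card unfolding order_def by (metis card.infinite)
  have expo: "X [^]\<^bsub>Q\<^esub> l = \<one>\<^bsub>Q\<^esub>" if "X \<in> carrier Q" for X
  proof -
    obtain x where x: "x \<in> carrier A" "X = H #>\<^bsub>A\<^esub> x" using \<open>X \<in> carrier Q\<close> unfolding Q_def carrier_FactGroup by blast
    have pw: "x [^]\<^bsub>A\<^esub> (n::nat) = of_nat n * x" for n
      by (induction n) (simp_all add: A_def algebra_simps)
    have "X [^]\<^bsub>Q\<^esub> l = H #>\<^bsub>A\<^esub> (x [^]\<^bsub>A\<^esub> l)"
      unfolding Q_def x(2) by (rule FactGroup_pow[OF x(1)])
    also have "x [^]\<^bsub>A\<^esub> l \<in> H"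
    proof -
      have "x [^]\<^bsub>A\<^esub> l \<in> carrier A" using x(1) by simp
      then show ?thesis using av_mult_less[OF av_l, of x] x(1) unfolding pw by (simp add: A_def H_def)
    qed
    then have "H #>\<^bsub>A\<^esub> (x [^]\<^bsub>A\<^esub> l) = H" by (rule rcos_const[OF A.is_group])
    finally show ?thesis by (simp add: Q_def)
  qed
  have only: "p = l" if p: "prime p" "p dvd residue_card av K" for p
  proof (rule ccontr)
    assume "p \<noteq> l"
    obtain m where "order Q = p ^ 1 * m" using p(2) card by auto
    from sylow_thm[OF p(1) Q.is_group this Qfin] obtain P where P: "subgroup P Q" "card P = p" by auto
    interpret P: subgroup P Q by fact
    have "card P > 1" using P(2) prime_gt_1_nat[OF p(1)] by simp
    then have "P \<noteq> {\<one>\<^bsub>Q\<^esub>}" by auto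
    then obtain X where X: "X \<in> P" "X \<noteq> \<one>\<^bsub>Q\<^esub>" using P.one_closed by blast
    have XQ: "X \<in> carrier Q" using X(1) by (rule P.mem_carrier)
    interpret PG: group "Q\<lparr>carrier := P\<rparr>" by (rule P.subgroup_is_group[OF Q.is_group])
    interpret PG: comm_group "Q\<lparr>carrier := P\<rparr>"
    proof (rule PG.group_comm_groupI)
      fix x y assume "x \<in> carrier (Q\<lparr>carrier := P\<rparr>)" "y \<in> carrier (Q\<lparr>carrier := P\<rparr>)"
      then show "x \<otimes>\<^bsub>Q\<lparr>carrier := P\<rparr>\<^esub> y = y \<otimes>\<^bsub>Q\<lparr>carrier := P\<rparr>\<^esub> x"
        using comm_groupE(4)[OF A.abelian_FactGroup[OF H], of x y] P.mem_carrier by (simp add: Q_def)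
    qed
    have "finite P" using P(2) prime_gt_0_nat[OF p(1)] by (intro card_ge_0_finite) simp
    then have "X [^]\<^bsub>Q\<lparr>carrier := P\<rparr>\<^esub> card P = \<one>\<^bsub>Q\<^esub>"
      using PG.power_order_eq_one[of X] X(1) by simp
    then have Xp: "X [^]\<^bsub>Q\<^esub> int p = \<one>\<^bsub>Q\<^esub>" using P(2) by (simp add: int_pow_int Q.nat_pow_consistent[symmetric])
    have Xl: "X [^]\<^bsub>Q\<^esub> int l = \<one>\<^bsub>Q\<^esub>" using expo[OF XQ] by (simp add: int_pow_int)
    have "coprime p l" using \<open>p \<noteq> l\<close> p(1) l by (simp add: primes_coprime)
    then have "gcd (int p) (int l) = 1" by simp
    then obtain a b where "a * int p + b * int l = 1" using bezout_int[of "int p" "int l"] by auto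
    then have "X [^]\<^bsub>Q\<^esub> (1::int) = X [^]\<^bsub>Q\<^esub> (int p * a + int l * b)" by (simp add: mult.commute)
    also have "\<dots> = (X [^]\<^bsub>Q\<^esub> int p) [^]\<^bsub>Q\<^esub> a \<otimes>\<^bsub>Q\<^esub> (X [^]\<^bsub>Q\<^esub> int l) [^]\<^bsub>Q\<^esub> b"
      using XQ by (simp add: Q.int_pow_mult Q.int_pow_pow)
    also have "\<dots> = \<one>\<^bsub>Q\<^esub>" by (simp add: Xp Xl)
    finally show False using X(2) XQ by simp
  qed
  obtain m where m: "residue_card av K = l ^ multiplicity l (residue_card av K) * m" "\<not> l dvd m"
    using multiplicity_decompose'[of "residue_card av K" l] fin l by (metis not_prime_unit)
  have "m = 1"
  proof (rule ccontr)
    assume "m \<noteq> 1"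
    then obtain p where "prime p" "p dvd m" using prime_factor_nat by blast
    then show False using only[of p] m by (metis dvd_mult)
  qed
  then show ?thesis using m(1) by auto
qed

end

section \<open>The Weil group\<close>

locale weil_setting =
  fixes av :: "'k::{alg_closed_field,field_char_0} \<Rightarrow> real" and Ql K :: "'k set" and l :: nat and \<phi> :: "'k \<Rightarrow> 'k"
  assumes l: "prime l" and Ql: "padic_closure l Ql av" and K: "finite_extension Ql K" and \<phi>: "\<phi> \<in> geom_frob av K"
begin

sublocale nonarch av l
proof
  show "nonarch_abs av" "prime l" using Ql l by (auto simp: padic_closure_def)
  then have na: "av 0 = 0" "\<And>x y. av (x + y) \<le> max (av x) (av y)" "\<And>x y. av (x * y) = av x * av y"
    "av 1 \<noteq> 0" "\<And>x. 0 \<le> av x"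
    by (auto simp: nonarch_abs_def)
  have av1: "av 1 = 1" using na(3)[of 1 1] na(4) by simp
  show "av (of_nat n) \<le> 1" for n
  proof (induction n)
    case (Suc n)
    then show ?case using na(2)[of 1 "of_nat n"] av1 by simp
  qed (simp add: na)
  have "\<forall>x. av (of_rat x) = padic_abs l x" using Ql unfolding padic_closure_def by blast
  then have "av (of_rat (of_nat l)) = padic_abs l (of_nat l)" by (rule spec)
  moreover have "quotient_of (of_nat l) = (int l, 1)"
    using quotient_of_int[of "int l"] by simp
  moreover have "multiplicity (int l) (int l) = 1"
    using l by (intro multiplicity_self) (auto simp: prime_gt_0_nat dest: prime_gt_1_nat)
  ultimately have "av (of_nat l) = inverse (real l)"
    using l prime_gt_0_nat[OF l] by (simp add: padic_abs_def power_int_minus)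
  then show "av (of_nat l) < 1" using prime_gt_1_nat[OF l] by (simp add: inverse_less_1_iff)
qed

abbreviation G where "G \<equiv> galois_group K"
abbreviation I where "I \<equiv> inertia av K"
abbreviation W where "W \<equiv> weil_group av K"
abbreviation val where "val \<equiv> weil_val av K"
definition q where "q = residue_card av K"

lemma G_simps: "\<sigma> \<otimes>\<^bsub>G\<^esub> \<tau> = \<sigma> \<circ> \<tau>" "\<one>\<^bsub>G\<^esub> = id"
  by (simp_all add: galois_group_def)

lemma in_G: "\<sigma> \<in> carrier G \<longleftrightarrow> bij \<sigma> \<and> (\<forall>x y. \<sigma> (x + y) = \<sigma> x + \<sigma> y) \<and>
       (\<forall>x y. \<sigma> (x * y) = \<sigma> x * \<sigma> y) \<and> (\<forall>x\<in>K. \<sigma> x = x)"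
  by (simp add: galois_group_def)

lemma GD:
  assumes "\<sigma> \<in> carrier G"
  shows "bij \<sigma>" "\<sigma> (x + y) = \<sigma> x + \<sigma> y" "\<sigma> (x * y) = \<sigma> x * \<sigma> y" "z \<in> K \<Longrightarrow> \<sigma> z = z" "\<sigma> 0 = 0"
    "\<sigma> 1 = 1" "\<sigma> (x - y) = \<sigma> x - \<sigma> y" "\<sigma> (x ^ n) = \<sigma> x ^ n" "\<sigma> (inverse x) = inverse (\<sigma> x)" "\<sigma> x = 0 \<longleftrightarrow> x = 0"
proof -
  show b: "bij \<sigma>" and a: "\<And>x y. \<sigma> (x + y) = \<sigma> x + \<sigma> y" and m: "\<And>x y. \<sigma> (x * y) = \<sigma> x * \<sigma> y"
    and f: "z \<in> K \<Longrightarrow> \<sigma> z = z"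
    using assms by (auto simp: in_G)
  show z: "\<sigma> 0 = 0" using a[of 0 0] by simp
  show z': "\<sigma> x = 0 \<longleftrightarrow> x = 0" for x using z b by (metis bij_pointE)
  show o: "\<sigma> 1 = 1" using m[of 1 1] z'[of 1] by simp
  show "\<sigma> (x - y) = \<sigma> x - \<sigma> y" using a[of "x - y" y] by simp
  show "\<sigma> (x ^ n) = \<sigma> x ^ n" by (induction n) (simp_all add: o m)
  show "\<sigma> (inverse x) = inverse (\<sigma> x)"
  proof (cases "x = 0")
    case False
    then have "\<sigma> x * \<sigma> (inverse x) = 1" using m[of x "inverse x"] o by simp
    then show ?thesis by (metis inverse_unique)
  qed (simp add: z)
qed

lemma inv_in_G: "\<sigma> \<in> carrier G \<Longrightarrow> inv_into UNIV \<sigma> \<in> carrier G"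
proof -
  assume s: "\<sigma> \<in> carrier G"
  note D = GD[OF s]
  have e: "\<sigma> (inv_into UNIV \<sigma> x) = x" for x using D(1) by (simp add: bij_is_surj surj_f_inv_f)
  have i: "inv_into UNIV \<sigma> x = y \<longleftrightarrow> x = \<sigma> y" for x y using D(1) by (metis bij_inv_eq_iff)
  show ?thesis unfolding in_G i using D(4) by (auto simp: D(2,3) e bij_imp_bij_inv D(1) i)
qed

lemma group_G: "group G"
proof (rule groupI)
  show "\<exists>y\<in>carrier G. y \<otimes>\<^bsub>G\<^esub> x = \<one>\<^bsub>G\<^esub>" if "x \<in> carrier G" for x
    using inv_in_G[OF that] GD(1)[OF that] by (intro bexI[of _ "inv_into UNIV x"]) (simp_all add: G_simps bij_is_inj)
qed (auto simp: G_simps in_G bij_comp o_assoc)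

sublocale G: group G by (rule group_G)

lemma inv_G: "\<sigma> \<in> carrier G \<Longrightarrow> (inv\<^bsub>G\<^esub> \<sigma>) (\<sigma> x) = x" "\<sigma> \<in> carrier G \<Longrightarrow> \<sigma> ((inv\<^bsub>G\<^esub> \<sigma>) x) = x"
  using G.l_inv[of \<sigma>] G.r_inv[of \<sigma>] by (auto simp: G_simps fun_eq_iff)

text \<open>Invariance of the maximal ideal of the valuation ring; \<open>preserves_le\<close>
  deduces that of the ring. For inertia and for lifts of Frobenius it follows from their defining
  congruences.\<close>

definition preserves where "preserves \<sigma> \<longleftrightarrow> \<sigma> \<in> carrier G \<and> (\<forall>x. av (\<sigma> x) < 1 \<longleftrightarrow> av x < 1)"

lemma preserves_less: "preserves \<sigma> \<Longrightarrow> av (\<sigma> x) < 1 \<longleftrightarrow> av x < 1"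
  by (simp add: preserves_def)

lemma preserves_le: assumes "preserves \<sigma>" shows "av (\<sigma> x) \<le> 1 \<longleftrightarrow> av x \<le> 1"
proof (cases "x = 0")
  case False
  have s: "\<sigma> \<in> carrier G" using assms by (simp add: preserves_def)
  have "av y \<le> 1 \<longleftrightarrow> \<not> av (inverse y) < 1" if "y \<noteq> 0" for y
    using that av_nonneg[of y] by (simp add: av_inverse inverse_less_1_iff) (metis av_eq_0 less_eq_real_def not_less)
  then show ?thesis using False preserves_less[OF assms, of "inverse x"] GD(9,10)[OF s] by auto
qed (use assms GD(5)[of \<sigma>] in \<open>simp add: preserves_def\<close>)

lemma preservesI:
  assumes s: "\<sigma> \<in> carrier G" and "\<And>x. av x < 1 \<Longrightarrow> av (\<sigma> x) < 1" "\<And>x. av x = 1 \<Longrightarrow> av (\<sigma> x) \<ge> 1"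
  shows "preserves \<sigma>"
  unfolding preserves_def
proof (intro conjI s allI iffI assms(2))
  fix x assume *: "av (\<sigma> x) < 1"
  show "av x < 1"
  proof (rule ccontr)
    assume "\<not> av x < 1"
    then consider "av x = 1" | "av x > 1" by linarith
    then show False
    proof cases
      case 1 then show ?thesis using assms(3) * by force
    next
      case 2
      then have "x \<noteq> 0" by auto
      have "av (inverse x) < 1" using 2 by (simp add: av_inverse inverse_less_1_iff)
      then have "av (inverse (\<sigma> x)) < 1" using assms(2) GD(9)[OF s] by metis
      with * have "av (\<sigma> x) * av (inverse (\<sigma> x)) < 1 * 1"
        using av_nonneg by (intro mult_strict_mono') auto
      moreover have "av (\<sigma> x) * av (inverse (\<sigma> x)) = 1"
        using \<open>x \<noteq> 0\<close> GD(10)[OF s] by (simp add: av_mult[symmetric])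
      ultimately show ?thesis by simp
    qed
  qed
qed

lemma inertiaD: "\<sigma> \<in> I \<Longrightarrow> \<sigma> \<in> carrier G" "\<sigma> \<in> I \<Longrightarrow> av x \<le> 1 \<Longrightarrow> av (\<sigma> x - x) < 1"
  by (auto simp: inertia_def)

lemma inertia_preserves: assumes "\<sigma> \<in> I" shows "preserves \<sigma>"
proof (rule preservesI[OF inertiaD(1)[OF assms]])
  show "av (\<sigma> x) < 1" if "av x < 1" for x
    using av_add_less[OF inertiaD(2)[OF assms, of x] that] that by simp
  show "av (\<sigma> x) \<ge> 1" if "av x = 1" for x
  proof (rule ccontr)
    assume "\<not> av (\<sigma> x) \<ge> 1"
    then have "av (\<sigma> x) < 1" by simp
    from av_diff_less[OF this inertiaD(2)[OF assms, of x]] show False using that by simp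
  qed
qed

text \<open>An infinite residue field would have \<open>card\<close> equal to 0, and then the
  Frobenius congruence at \<open>x = 0\<close> would say that 1 lies in the maximal ideal.\<close>

lemma q0: "q \<noteq> 0"
proof
  assume "q = 0"
  have "\<forall>x. av x \<le> 1 \<longrightarrow> av (\<phi> x ^ residue_card av K - x) < 1" using \<phi> by (simp add: geom_frob_def)
  from this[rule_format, of 0] \<open>q = 0\<close> show False by (simp add: q_def)
qed

lemma subfield_K: "subfield_set K" and Ql_K: "Ql \<subseteq> K"
  using K by (auto simp: finite_extension_def)

lemma q_prime_power: "\<exists>n. q = l ^ n"
  unfolding q_def by (rule residue_card_prime_power[OF subfield_K]) (use q0 in \<open>simp add: q_def\<close>)

lemma q_ge_2: "q \<ge> 2"
proof (rule ccontr)
  assume "\<not> q \<ge> 2"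
  then have "q = 1" using q0 by linarith
  define r where "r = {(x, y). x \<in> K \<and> y \<in> K \<and> av x \<le> 1 \<and> av y \<le> 1 \<and> av (x - y) < 1}"
  have "card ({x\<in>K. av x \<le> 1} // r) = 1" using \<open>q = 1\<close> by (simp add: q_def residue_card_def r_def)
  then obtain X where X: "{x\<in>K. av x \<le> 1} // r = {X}" by (rule card_1_singletonE)
  have K01: "0 \<in> K" "1 \<in> K" using subfield_K by (auto simp: subfield_set_def)
  have "r `` {0} \<in> {X}" "r `` {1} \<in> {X}" unfolding X[symmetric] using K01 by (auto intro: quotientI)
  then have "r `` {0} = r `` {1}" by simp
  moreover have "1 \<in> r `` {1}" using K01 by (simp add: r_def)
  ultimately have "1 \<in> r `` {0}" by simp
  then show False by (simp add: r_def)
qed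

lemma phi_G: "\<phi> \<in> carrier G" and phi_frob: "av x \<le> 1 \<Longrightarrow> av (\<phi> x ^ q - x) < 1"
  using \<phi> by (auto simp: geom_frob_def q_def)

lemma phi_preserves: "preserves \<phi>"
proof (rule preservesI[OF phi_G])
  show "av (\<phi> x) < 1" if "av x < 1" for x
  proof -
    have "av (\<phi> x ^ q) < 1" using av_add_less[OF phi_frob[of x] that] that by simp
    then show ?thesis using q0 by (simp add: av_power_less_iff)
  qed
  show "av (\<phi> x) \<ge> 1" if "av x = 1" for x
  proof (rule ccontr)
    assume "\<not> av (\<phi> x) \<ge> 1"
    then have "av (\<phi> x ^ q) < 1" using q0 by (simp add: av_power_less_iff)
    from av_diff_less[OF this phi_frob[of x]] show False using that by simp
  qed
qed

lemma subgroup_I: "subgroup I G"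
proof
  show "I \<subseteq> carrier G" using inertiaD(1) by blast
  show "\<one>\<^bsub>G\<^esub> \<in> I" using G.one_closed by (simp add: inertia_def G_simps)
  show "\<sigma> \<otimes>\<^bsub>G\<^esub> \<tau> \<in> I" if "\<sigma> \<in> I" "\<tau> \<in> I" for \<sigma> \<tau>
  proof -
    have "av (\<sigma> (\<tau> x) - x) < 1" if "av x \<le> 1" for x
      using av_add_less[OF inertiaD(2)[OF \<open>\<sigma> \<in> I\<close>, of "\<tau> x"] inertiaD(2)[OF \<open>\<tau> \<in> I\<close> that]]
        preserves_le[OF inertia_preserves[OF \<open>\<tau> \<in> I\<close>]] that by simp
    then show ?thesis using G.m_closed[OF inertiaD(1)[OF that(1)] inertiaD(1)[OF that(2)]] by (simp add: inertia_def G_simps)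
  qed
  show "inv\<^bsub>G\<^esub> \<sigma> \<in> I" if "\<sigma> \<in> I" for \<sigma>
  proof -
    have "av ((inv\<^bsub>G\<^esub> \<sigma>) x - x) < 1" if "av x \<le> 1" for x
    proof -
      define y where "y = (inv\<^bsub>G\<^esub> \<sigma>) x"
      have x: "x = \<sigma> y" using inv_G(2)[OF inertiaD(1)[OF \<open>\<sigma> \<in> I\<close>]] by (simp add: y_def)
      then have "av y \<le> 1" using preserves_le[OF inertia_preserves[OF \<open>\<sigma> \<in> I\<close>]] that by simp
      then have "av (\<sigma> y - y) < 1" by (rule inertiaD(2)[OF \<open>\<sigma> \<in> I\<close>])
      moreover have "y - x = - (\<sigma> y - y)" using x by simp
      ultimately have "av (y - x) < 1" by (simp only: av_minus)
      then show ?thesis unfolding y_def .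
    qed
    then show ?thesis using G.inv_closed[OF inertiaD(1)[OF that]] by (simp add: inertia_def)
  qed
qed

lemma conj_inertia:
  assumes s: "preserves \<sigma>" and t: "\<tau> \<in> I"
  shows "\<sigma> \<otimes>\<^bsub>G\<^esub> \<tau> \<otimes>\<^bsub>G\<^esub> inv\<^bsub>G\<^esub> \<sigma> \<in> I" "inv\<^bsub>G\<^esub> \<sigma> \<otimes>\<^bsub>G\<^esub> \<tau> \<otimes>\<^bsub>G\<^esub> \<sigma> \<in> I"
proof -
  have sG: "\<sigma> \<in> carrier G" using s by (simp add: preserves_def)
  have tG: "\<tau> \<in> carrier G" by (rule inertiaD(1)[OF t])
  have "av (\<sigma> (\<tau> ((inv\<^bsub>G\<^esub> \<sigma>) x)) - x) < 1" if "av x \<le> 1" for x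
  proof -
    define y where "y = (inv\<^bsub>G\<^esub> \<sigma>) x"
    have x: "x = \<sigma> y" using inv_G(2)[OF sG] by (simp add: y_def)
    then have "av (\<tau> y - y) < 1" using inertiaD(2)[OF t] preserves_le[OF s] that by simp
    then have "av (\<sigma> (\<tau> y - y)) < 1" using preserves_less[OF s] by simp
    then show ?thesis by (simp add: GD(7)[OF sG] inv_G(2)[OF sG] y_def)
  qed
  then show "\<sigma> \<otimes>\<^bsub>G\<^esub> \<tau> \<otimes>\<^bsub>G\<^esub> inv\<^bsub>G\<^esub> \<sigma> \<in> I"
    using G.m_closed[OF G.m_closed[OF sG tG] G.inv_closed[OF sG]] by (simp add: inertia_def G_simps)
  have "av ((inv\<^bsub>G\<^esub> \<sigma>) (\<tau> (\<sigma> x)) - x) < 1" if "av x \<le> 1" for x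
  proof -
    have "av (\<tau> (\<sigma> x) - \<sigma> x) < 1" using inertiaD(2)[OF t] preserves_le[OF s] that by simp
    moreover have "\<tau> (\<sigma> x) - \<sigma> x = \<sigma> ((inv\<^bsub>G\<^esub> \<sigma>) (\<tau> (\<sigma> x)) - x)" by (simp add: GD(7)[OF sG] inv_G(2)[OF sG])
    ultimately show ?thesis using preserves_less[OF s] by simp
  qed
  then show "inv\<^bsub>G\<^esub> \<sigma> \<otimes>\<^bsub>G\<^esub> \<tau> \<otimes>\<^bsub>G\<^esub> \<sigma> \<in> I"
    using G.m_closed[OF G.m_closed[OF G.inv_closed[OF sG] tG] sG] by (simp add: inertia_def G_simps)
qed

lemma conj_phi_inertia:
  "\<forall>i\<in>I. \<phi> \<otimes>\<^bsub>G\<^esub> i \<otimes>\<^bsub>G\<^esub> inv\<^bsub>G\<^esub> \<phi> \<in> I" "\<forall>i\<in>I. inv\<^bsub>G\<^esub> \<phi> \<otimes>\<^bsub>G\<^esub> i \<otimes>\<^bsub>G\<^esub> \<phi> \<in> I"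
  using conj_inertia[OF phi_preserves] by blast+

lemmas cyclic = G.cyclic_cosets[OF subgroup_I phi_G conj_phi_inertia]

text \<open>Two lifts have congruent \<open>q\<close>-th powers at every integral element, and
  \<open>frobenius_injective\<close> removes the power, \<open>q\<close> being a power of
  \<open>l\<close>.\<close>

lemma geom_frob_coset: "geom_frob av K = I #>\<^bsub>G\<^esub> \<phi>"
proof
  show "geom_frob av K \<subseteq> I #>\<^bsub>G\<^esub> \<phi>"
  proof
    fix \<sigma> assume "\<sigma> \<in> geom_frob av K"
    then have s: "\<sigma> \<in> carrier G" "\<And>x. av x \<le> 1 \<Longrightarrow> av (\<sigma> x ^ q - x) < 1" by (auto simp: geom_frob_def q_def)
    interpret S: weil_setting av Ql K l \<sigma> by unfold_locales (use l Ql K \<open>\<sigma> \<in> geom_frob av K\<close> in auto)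
    obtain n where n: "q = l ^ n" using q_prime_power by blast
    have "av (\<sigma> ((inv\<^bsub>G\<^esub> \<phi>) y) - y) < 1" if "av y \<le> 1" for y
    proof -
      define x where "x = (inv\<^bsub>G\<^esub> \<phi>) y"
      have y: "y = \<phi> x" using inv_G(2)[OF phi_G] by (simp add: x_def)
      then have x: "av x \<le> 1" using preserves_le[OF phi_preserves] that by simp
      have "av ((\<sigma> x ^ q - x) - (\<phi> x ^ q - x)) < 1" by (rule av_diff_less[OF s(2)[OF x] phi_frob[OF x]])
      then have "av (\<sigma> x ^ (l ^ n) - \<phi> x ^ (l ^ n)) < 1" by (simp add: n)
      then have "av (\<sigma> x - \<phi> x) < 1"
        by (rule frobenius_injective[rotated 2]) (use x preserves_le[OF phi_preserves] preserves_le[OF S.phi_preserves] in simp_all)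
      then show ?thesis unfolding x_def[symmetric] using y by simp
    qed
    then have "\<sigma> \<otimes>\<^bsub>G\<^esub> inv\<^bsub>G\<^esub> \<phi> \<in> I"
      using G.m_closed[OF s(1) G.inv_closed[OF phi_G]] by (simp add: inertia_def G_simps)
    moreover have "\<sigma> = (\<sigma> \<otimes>\<^bsub>G\<^esub> inv\<^bsub>G\<^esub> \<phi>) \<otimes>\<^bsub>G\<^esub> \<phi>" using s(1) phi_G by (simp add: G.m_assoc)
    ultimately show "\<sigma> \<in> I #>\<^bsub>G\<^esub> \<phi>" unfolding r_coset_def by blast
  qed
  show "I #>\<^bsub>G\<^esub> \<phi> \<subseteq> geom_frob av K"
  proof
    fix \<sigma> assume "\<sigma> \<in> I #>\<^bsub>G\<^esub> \<phi>"
    then obtain i where i: "i \<in> I" "\<sigma> = i \<circ> \<phi>" by (auto simp: r_coset_def G_simps)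
    have "av (i (\<phi> x) ^ q - x) < 1" if x: "av x \<le> 1" for x
    proof -
      have px: "av (\<phi> x) \<le> 1" using preserves_le[OF phi_preserves] x by simp
      have "av (i (\<phi> x) ^ q - \<phi> x ^ q) < 1"
        by (rule congruent_power) (use px inertiaD(2)[OF i(1) px] preserves_le[OF inertia_preserves[OF i(1)]] in simp_all)
      from av_add_less[OF this phi_frob[OF x]] show ?thesis by simp
    qed
    moreover have "\<sigma> \<in> carrier G" using G.m_closed[OF inertiaD(1)[OF i(1)] phi_G] by (simp add: i(2) G_simps)
    ultimately show "\<sigma> \<in> geom_frob av K" by (simp add: geom_frob_def q_def i(2))
  qed
qed

text \<open>A root of \<open>X ^ (q ^ n) = X + 1\<close> is integral. If \<open>\<phi> [^] n\<close>
  were in inertia, \<open>x ^ (q ^ n) - x\<close> would lie in the maximal ideal, but it is 1. Hence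
  \<open>weil_val\<close> is well defined.\<close>

lemma phi_power_not_inertia:
  assumes "n > 0" shows "\<phi> [^]\<^bsub>G\<^esub> (n::nat) \<notin> I"
proof
  assume I: "\<phi> [^]\<^bsub>G\<^esub> n \<in> I"
  define N where "N = q ^ n"
  have N: "N \<ge> 2" using q_ge_2 assms self_le_power[of q n] by (simp add: N_def)
  have "degree (monom 1 N + - [:1, 1:] :: 'k poly) = N"
    using N by (subst degree_add_eq_left) (simp_all add: degree_monom_eq)
  then have "degree (monom 1 N - [:1, 1:] :: 'k poly) = N" by (simp only: diff_conv_add_uminus)
  then have "0 < degree (monom 1 N - [:1, 1:] :: 'k poly)" using N by linarith
  from alg_closed_imp_poly_has_root[OF this] obtain x :: 'k where "poly (monom 1 N - [:1, 1:]) x = 0" by blast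
  then have x: "x ^ N = x + 1" by (simp add: poly_monom algebra_simps)
  have x1: "av x \<le> 1"
  proof (rule ccontr)
    assume "\<not> av x \<le> 1"
    then have gt: "av x > 1" by simp
    have "av x ^ 1 < av x ^ N" by (rule power_strict_increasing) (use gt N in auto)
    moreover have "av x ^ N \<le> av x" using av_add[of x 1] gt by (simp add: av_power[symmetric] x)
    ultimately show False by simp
  qed
  have "av ((\<phi> [^]\<^bsub>G\<^esub> k) y ^ (q ^ k) - y) < 1" if "av y \<le> 1" for k y
  proof (induction k)
    case 0 show ?case by (simp add: G_simps)
  next
    case (Suc k)
    have "preserves (\<phi> [^]\<^bsub>G\<^esub> k)" for k :: nat
    proof (induction k)
      case 0 show ?case using G.one_closed by (simp add: preserves_def G_simps id_def)
    next
      case (Suc k)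
      then show ?case using phi_preserves G.m_closed by (simp add: preserves_def G_simps comp_def)
    qed
    define z where "z = (\<phi> [^]\<^bsub>G\<^esub> k) y"
    have z: "av z \<le> 1" unfolding z_def using preserves_le[OF \<open>preserves (\<phi> [^]\<^bsub>G\<^esub> k)\<close>] that by simp
    have "av ((\<phi> z ^ q) ^ (q ^ k) - z ^ (q ^ k)) < 1"
      by (rule congruent_power) (use z phi_frob[OF z] preserves_le[OF phi_preserves] in \<open>simp_all add: av_power_le\<close>)
    from av_add_less[OF this Suc[folded z_def]] have "av ((\<phi> z ^ q) ^ (q ^ k) - y) < 1" by simp
    moreover have "(\<phi> [^]\<^bsub>G\<^esub> Suc k) y = \<phi> z" unfolding z_def by (subst G.nat_pow_Suc2[OF phi_G]) (simp add: G_simps)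
    ultimately show ?case by (simp add: power_mult[symmetric])
  qed
  from this[OF x1, of n] have 1: "av ((\<phi> [^]\<^bsub>G\<^esub> n) x ^ N - x) < 1" by (simp add: N_def)
  have "av ((\<phi> [^]\<^bsub>G\<^esub> n) x ^ N - x ^ N) < 1"
    by (rule congruent_power) (use x1 inertiaD(2)[OF I x1] preserves_le[OF inertia_preserves[OF I]] in simp_all)
  from av_diff_less[OF 1 this] have "av (x ^ N - x) < 1" by simp
  then show False by (simp add: x)
qed

lemma coset_phi_unique:
  assumes "I #>\<^bsub>G\<^esub> \<phi> [^]\<^bsub>G\<^esub> (n::int) = I #>\<^bsub>G\<^esub> \<phi> [^]\<^bsub>G\<^esub> (m::int)" shows "n = m"
proof -
  have in_I: "\<phi> [^]\<^bsub>G\<^esub> (n - m) \<in> I" if "I #>\<^bsub>G\<^esub> \<phi> [^]\<^bsub>G\<^esub> n = I #>\<^bsub>G\<^esub> \<phi> [^]\<^bsub>G\<^esub> m" for n m :: int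
  proof -
    have "\<phi> [^]\<^bsub>G\<^esub> n \<in> I #>\<^bsub>G\<^esub> \<phi> [^]\<^bsub>G\<^esub> m"
      using G.rcos_self[OF G.int_pow_closed[OF phi_G] subgroup_I, of n] that by simp
    then have "\<phi> [^]\<^bsub>G\<^esub> n \<otimes>\<^bsub>G\<^esub> inv\<^bsub>G\<^esub> (\<phi> [^]\<^bsub>G\<^esub> m) \<in> I"
      by (rule subgroup.rcos_module_imp[OF subgroup_I group_G G.int_pow_closed[OF phi_G]])
    then show ?thesis by (simp add: G.int_pow_diff phi_G)
  qed
  have False if "n < m" "I #>\<^bsub>G\<^esub> \<phi> [^]\<^bsub>G\<^esub> n = I #>\<^bsub>G\<^esub> \<phi> [^]\<^bsub>G\<^esub> m" for n m :: int
  proof -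
    have "\<phi> [^]\<^bsub>G\<^esub> (m - n) \<in> I" by (rule in_I) (use that in simp)
    then have "\<phi> [^]\<^bsub>G\<^esub> nat (m - n) \<in> I" using that(1) by (simp add: pow_nat)
    then show False using phi_power_not_inertia[of "nat (m - n)"] that(1) by simp
  qed
  from this[of n m] this[of m n] assms show ?thesis by (metis linorder_neqE)
qed

lemma coset_eq_iff: "\<sigma> \<in> carrier G \<Longrightarrow> I #>\<^bsub>G\<^esub> \<sigma> = I #>\<^bsub>G\<^esub> \<phi> [^]\<^bsub>G\<^esub> (n::int) \<longleftrightarrow> \<sigma> \<in> I #>\<^bsub>G\<^esub> \<phi> [^]\<^bsub>G\<^esub> n"
  using G.rcos_self[OF _ subgroup_I, of \<sigma>] G.repr_independence[OF _ G.int_pow_closed[OF phi_G] subgroup_I, of \<sigma> n] by auto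

lemma W_carrier: "carrier W = {\<sigma> \<in> carrier G. \<exists>n::int. \<sigma> \<in> I #>\<^bsub>G\<^esub> \<phi> [^]\<^bsub>G\<^esub> n}"
  unfolding weil_group_def geom_frob_coset cyclic(2) using coset_eq_iff by auto

lemma subgroup_W: "subgroup (carrier W) G"
  unfolding W_carrier by (rule cyclic(3))

lemma group_W: "group W"
  using G.subgroup_imp_group[OF subgroup_W] by (simp add: weil_group_def)

sublocale W: group W by (rule group_W)

lemma W_simps: "\<sigma> \<otimes>\<^bsub>W\<^esub> \<tau> = \<sigma> \<circ> \<tau>" "\<one>\<^bsub>W\<^esub> = id"
  by (simp_all add: weil_group_def G_simps)

lemma W_mult: "\<sigma> \<otimes>\<^bsub>W\<^esub> \<tau> = \<sigma> \<otimes>\<^bsub>G\<^esub> \<tau>"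
  by (simp add: weil_group_def)

lemma val_eq: "\<sigma> \<in> carrier G \<Longrightarrow> \<sigma> \<in> I #>\<^bsub>G\<^esub> \<phi> [^]\<^bsub>G\<^esub> n \<Longrightarrow> val \<sigma> = n"
  unfolding weil_val_def geom_frob_coset cyclic(1)
proof (rule the_equality)
  assume s: "\<sigma> \<in> carrier G" "\<sigma> \<in> I #>\<^bsub>G\<^esub> \<phi> [^]\<^bsub>G\<^esub> n"
  show e: "I #>\<^bsub>G\<^esub> \<sigma> = I #>\<^bsub>G\<^esub> \<phi> [^]\<^bsub>G\<^esub> n" using coset_eq_iff[OF s(1)] s(2) by blast
  show "m = n" if "I #>\<^bsub>G\<^esub> \<sigma> = I #>\<^bsub>G\<^esub> \<phi> [^]\<^bsub>G\<^esub> m" for m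
    by (rule coset_phi_unique) (use that e in simp)
qed

lemma val_mem: "\<sigma> \<in> carrier W \<Longrightarrow> \<sigma> \<in> I #>\<^bsub>G\<^esub> \<phi> [^]\<^bsub>G\<^esub> val \<sigma>"
  using val_eq by (auto simp: W_carrier)

lemma W_in_G: "\<sigma> \<in> carrier W \<Longrightarrow> \<sigma> \<in> carrier G"
  by (simp add: W_carrier)

lemma val_mult: "\<sigma> \<in> carrier W \<Longrightarrow> \<tau> \<in> carrier W \<Longrightarrow> val (\<sigma> \<otimes>\<^bsub>W\<^esub> \<tau>) = val \<sigma> + val \<tau>"
proof -
  assume st: "\<sigma> \<in> carrier W" "\<tau> \<in> carrier W"
  show ?thesis unfolding W_mult
    by (rule val_eq[OF G.m_closed[OF W_in_G[OF st(1)] W_in_G[OF st(2)]] cyclic(4)[OF val_mem[OF st(1)] val_mem[OF st(2)]]])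
qed

lemma phi_W: "\<phi> \<in> carrier W" and val_phi: "val \<phi> = 1"
proof -
  have *: "\<phi> \<in> I #>\<^bsub>G\<^esub> \<phi> [^]\<^bsub>G\<^esub> (1::int)" using G.rcos_self[OF phi_G subgroup_I] phi_G by simp
  then show "\<phi> \<in> carrier W" unfolding W_carrier using phi_G by blast
  show "val \<phi> = 1" by (rule val_eq[OF phi_G *])
qed

lemma coset_zero: "I #>\<^bsub>G\<^esub> \<phi> [^]\<^bsub>G\<^esub> (0::int) = I"
  by (simp add: G.coset_mult_one subgroup.subset[OF subgroup_I])

lemma inertia_W: assumes "\<sigma> \<in> I" shows "\<sigma> \<in> carrier W" and val_inertia: "val \<sigma> = 0"
proof -
  have *: "\<sigma> \<in> I #>\<^bsub>G\<^esub> \<phi> [^]\<^bsub>G\<^esub> (0::int)" unfolding coset_zero by (rule assms)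
  show "\<sigma> \<in> carrier W" unfolding W_carrier using inertiaD(1)[OF assms] * by blast
  show "val \<sigma> = 0" by (rule val_eq[OF inertiaD(1)[OF assms] *])
qed

text \<open>For a basic open set, \<open>E\<close> consists of generators of \<open>L\<close> over
  \<open>K\<close>: an inertia element fixing them fixes \<open>L\<close>. Intersections take unions
  of such sets.\<close>

lemma weil_open:
  assumes "openin (weil_topology av K) U" "x \<in> U"
  shows "\<exists>E. finite E \<and> (\<forall>\<tau>\<in>I. (\<forall>e\<in>E. \<tau> e = e) \<longrightarrow> x \<circ> \<tau> \<in> U)"
  using assms(1)[unfolded weil_topology_def openin_topology_generated_by_iff] assms(2)
proof (induction arbitrary: x)
  case (Int a b)
  have "x \<in> a" "x \<in> b" using Int.prems by auto
  from Int.IH(1)[OF this(1)] Int.IH(2)[OF this(2)] obtain E E' where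
    E: "finite E" "\<forall>\<tau>\<in>I. (\<forall>e\<in>E. \<tau> e = e) \<longrightarrow> x \<circ> \<tau> \<in> a"
    "finite E'" "\<forall>\<tau>\<in>I. (\<forall>e\<in>E'. \<tau> e = e) \<longrightarrow> x \<circ> \<tau> \<in> b" by (elim exE conjE) blast
  show ?case
  proof (intro exI[of _ "E \<union> E'"] conjI ballI impI IntI)
    show "finite (E \<union> E')" using E(1,3) by simp
  qed (use E(2,4) in blast)+
next
  case (UN \<K>)
  then obtain k where k: "k \<in> \<K>" "x \<in> k" by blast
  from UN.IH[OF k] obtain E where E: "finite E" "\<forall>\<tau>\<in>I. (\<forall>e\<in>E. \<tau> e = e) \<longrightarrow> x \<circ> \<tau> \<in> k"
    by (elim exE conjE)
  show ?case
  proof (intro exI[of _ E] conjI ballI impI UnionI[OF k(1)])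
  qed (use E in blast)+
next
  case (Basis s)
  then obtain \<sigma> L where s: "s = \<sigma> <#\<^bsub>G\<^esub> (I \<inter> carrier (galois_group L))" "finite_extension K L" by blast
  then obtain B where B: "finite B" "B \<subseteq> L" "\<And>y. y \<in> L \<Longrightarrow> \<exists>c. (\<forall>b\<in>B. c b \<in> K) \<and> y = (\<Sum>b\<in>B. c b * b)"
    unfolding finite_extension_def by blast
  obtain \<tau>0 where t0: "\<tau>0 \<in> I" "\<tau>0 \<in> carrier (galois_group L)" "x = \<sigma> \<circ> \<tau>0"
    using Basis.prems s(1) by (auto simp: l_coset_def G_simps)
  have "x \<circ> \<tau> \<in> s" if t: "\<tau> \<in> I" "\<forall>e\<in>B. \<tau> e = e" for \<tau>
  proof -
    note D = GD[OF inertiaD(1)[OF t(1)]]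
    have "\<tau> y = y" if "y \<in> L" for y
    proof -
      obtain c where c: "\<forall>b\<in>B. c b \<in> K" "y = (\<Sum>b\<in>B. c b * b)" using B(3)[OF \<open>y \<in> L\<close>] by blast
      have "\<tau> (\<Sum>b\<in>B'. c b * b) = (\<Sum>b\<in>B'. \<tau> (c b * b))" for B' :: "'k set"
        by (induction B' rule: infinite_finite_induct) (simp_all add: D(2,5))
      then have "\<tau> y = (\<Sum>b\<in>B. \<tau> (c b * b))" by (simp add: c(2))
      also have "\<dots> = (\<Sum>b\<in>B. c b * b)" using c(1) t(2) by (intro sum.cong) (simp_all add: D(3,4))
      finally show ?thesis by (simp add: c(2))
    qed
    then have "\<tau>0 \<circ> \<tau> \<in> carrier (galois_group L)"
      using t0(2) D(1-3) by (auto simp: galois_group_def bij_comp)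
    moreover have "\<tau>0 \<circ> \<tau> \<in> I" using subgroup.m_closed[OF subgroup_I t0(1) t(1)] by (simp add: G_simps)
    ultimately show ?thesis unfolding s(1) l_coset_def
      by (auto simp: G_simps t0(3) o_assoc[symmetric] intro!: bexI[of _ "\<tau>0 \<circ> \<tau>"])
  qed
  then show ?case using B(1) by blast
qed simp

text \<open>An inertia element sends each \<open>e\<close> to a root of a polynomial that kills
  \<open>e\<close>; its coefficients lie in \<open>Ql\<close> and hence are fixed.\<close>

lemma finite_inertia_restrict:
  assumes "finite E" shows "finite ((\<lambda>\<tau>. restrict \<tau> E) ` I)"
proof -
  have "\<exists>f. f \<noteq> 0 \<and> (\<forall>i. coeff f i \<in> Ql) \<and> poly f e = 0" for e
    using Ql by (auto simp: padic_closure_def algebraic_over_def)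
  then obtain f where f: "\<And>e. f e \<noteq> 0" "\<And>e i. coeff (f e) i \<in> Ql" "\<And>e. poly (f e) e = 0" by metis
  have "(\<lambda>\<tau>. restrict \<tau> E) ` I \<subseteq> (\<Pi>\<^sub>E e\<in>E. {x. poly (f e) x = 0})"
  proof (intro image_subsetI)
    fix \<tau> assume t: "\<tau> \<in> I"
    note D = GD[OF inertiaD(1)[OF t]]
    have "poly (f e) (\<tau> e) = 0" for e
    proof -
      have sum: "\<tau> (\<Sum>i\<in>J. h i) = (\<Sum>i\<in>J. \<tau> (h i))" for J :: "nat set" and h
        by (induction J rule: infinite_finite_induct) (simp_all add: D(2,5))
      have "poly (f e) (\<tau> e) = \<tau> (poly (f e) e)"
        unfolding poly_altdef sum using f(2) Ql_K by (intro sum.cong) (auto simp: D(3,8) D(4)[OF subsetD[OF Ql_K f(2)]])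
      then show ?thesis using f(3) D(5) by simp
    qed
    then show "restrict \<tau> E \<in> (\<Pi>\<^sub>E e\<in>E. {x. poly (f e) x = 0})" by auto
  qed
  moreover have "finite (\<Pi>\<^sub>E e\<in>E. {x. poly (f e) x = 0})"
    using assms f(1) by (intro finite_PiE) (auto simp: poly_roots_finite)
  ultimately show ?thesis by (rule finite_subset)
qed

text \<open>By \<open>weil_open\<close>, \<open>r\<close> depends only on the restriction to a
  finite set \<open>E\<close>, and there are finitely many restrictions.\<close>

lemma finite_inertia_image:
  assumes "openin (weil_topology av K) U" "id \<in> U"
    and "\<And>\<sigma> \<tau>. \<sigma> \<in> I \<Longrightarrow> \<tau> \<in> I \<Longrightarrow> inv\<^bsub>G\<^esub> \<sigma> \<otimes>\<^bsub>G\<^esub> \<tau> \<in> U \<Longrightarrow> r \<sigma> = r \<tau>"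
  shows "finite (r ` I)"
proof -
  obtain E where E: "finite E" "\<And>\<tau>. \<tau> \<in> I \<Longrightarrow> (\<forall>e\<in>E. \<tau> e = e) \<Longrightarrow> \<tau> \<in> U"
    using weil_open[OF assms(1,2)] by auto
  have eq: "r \<sigma> = r \<tau>" if st: "\<sigma> \<in> I" "\<tau> \<in> I" "restrict \<sigma> E = restrict \<tau> E" for \<sigma> \<tau>
  proof (rule assms(3)[OF st(1,2) E(2)])
    show "inv\<^bsub>G\<^esub> \<sigma> \<otimes>\<^bsub>G\<^esub> \<tau> \<in> I"
      by (rule subgroup.m_closed[OF subgroup_I subgroup.m_inv_closed[OF subgroup_I st(1)] st(2)])
    show "\<forall>e\<in>E. (inv\<^bsub>G\<^esub> \<sigma> \<otimes>\<^bsub>G\<^esub> \<tau>) e = e"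
    proof
      fix e assume e: "e \<in> E"
      have "\<tau> e = \<sigma> e" using fun_cong[OF st(3), of e] e by simp
      then show "(inv\<^bsub>G\<^esub> \<sigma> \<otimes>\<^bsub>G\<^esub> \<tau>) e = e" using inv_G(1)[OF inertiaD(1)[OF st(1)]] by (simp add: G_simps)
    qed
  qed
  have "r ` I \<subseteq> (\<lambda>g. r (SOME \<tau>. \<tau> \<in> I \<and> restrict \<tau> E = g)) ` (\<lambda>\<tau>. restrict \<tau> E) ` I"
  proof (intro image_subsetI)
    fix \<sigma> assume s: "\<sigma> \<in> I"
    have "(SOME \<tau>. \<tau> \<in> I \<and> restrict \<tau> E = restrict \<sigma> E) \<in> I \<and> restrict (SOME \<tau>. \<tau> \<in> I \<and> restrict \<tau> E = restrict \<sigma> E) E = restrict \<sigma> E"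
      by (rule someI[of _ \<sigma>]) (simp add: s)
    then have "r \<sigma> = r (SOME \<tau>. \<tau> \<in> I \<and> restrict \<tau> E = restrict \<sigma> E)" by (intro eq s) simp_all
    then show "r \<sigma> \<in> (\<lambda>g. r (SOME \<tau>. \<tau> \<in> I \<and> restrict \<tau> E = g)) ` (\<lambda>\<tau>. restrict \<tau> E) ` I"
      using s by blast
  qed
  then show ?thesis using finite_inertia_restrict[OF E(1)] finite_subset by blast
qed

end

section \<open>Frobenius-semisimplification\<close>

text \<open>Conjugations by the powers of \<open>x\<close> are self-maps of a finite set, so two of
  them coincide; the difference of the exponents is \<open>m\<close>.\<close>

lemma (in group) finite_conjugation_commute:
  assumes A: "finite A" "A \<subseteq> carrier G" and x: "x \<in> carrier G" and conj: "\<And>a. a \<in> A \<Longrightarrow> x \<otimes> a \<otimes> inv x \<in> A"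
  shows "\<exists>m>0. \<forall>a\<in>A. x [^] (m::nat) \<otimes> a = a \<otimes> x [^] m"
proof -
  define c where "c k a = x [^] (k::nat) \<otimes> a \<otimes> inv (x [^] k)" for k a
  have add: "c (k + n) a = c k (c n a)" if "a \<in> carrier G" for k n a
    using that x by (simp add: c_def nat_pow_mult[symmetric] inv_mult_group m_assoc)
  have cA: "c k a \<in> A" if "a \<in> A" for k a
  proof (induction k)
    case 0
    then show ?case using that A(2) by (auto simp: c_def)
  next
    case (Suc k)
    have "c (1 + k) a = x \<otimes> c k a \<otimes> inv x" using add[of a 1 k] that A(2) x by (auto simp: c_def)
    then show ?case using conj[OF Suc] by simp
  qed
  have "range (\<lambda>k. restrict (c k) A) \<subseteq> A \<rightarrow>\<^sub>E A" using cA by auto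
  then have "finite (range (\<lambda>k. restrict (c k) A))" by (rule finite_subset) (intro finite_PiE A)
  then have "\<not> inj (\<lambda>k. restrict (c k) A)" by (metis finite_imageD infinite_UNIV_nat)
  then obtain i' j' where ij': "i' \<noteq> j'" "restrict (c i') A = restrict (c j') A" unfolding inj_def by blast
  define i j where "i = min i' j'" and "j = max i' j'"
  have ij: "i < j" "restrict (c i) A = restrict (c j) A"
    using ij' by (cases "i' < j'"; simp add: i_def j_def min_def max_def)+
  have "x [^] (j - i) \<otimes> a = a \<otimes> x [^] (j - i)" if a: "a \<in> A" for a
  proof -
    have aG: "a \<in> carrier G" using a A(2) by blast
    have cG: "c k a \<in> carrier G" for k using aG x by (simp add: c_def)
    have "c i a = c j a" using fun_cong[OF ij(2), of a] a by simp
    also have "\<dots> = c i (c (j - i) a)" using add[OF aG, of i "j - i"] ij(1) by simp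
    finally have "a = c (j - i) a" unfolding c_def[of i]
      using aG cG x by (simp add: inv_mult_group)
    then have "a \<otimes> x [^] (j - i) = c (j - i) a \<otimes> x [^] (j - i)" by simp
    then show ?thesis using aG x by (simp add: c_def m_assoc)
  qed
  then show ?thesis using ij(1) by (intro exI[of _ "j - i"]) simp
qed

section \<open>The general linear group and traces in the presence of a unipotent factor\<close>

context vspace begin

lemma GL_simps: "f \<in> carrier (GL scale) \<longleftrightarrow> lin f \<and> bij f" "f \<otimes>\<^bsub>GL scale\<^esub> g = f \<circ> g" "\<one>\<^bsub>GL scale\<^esub> = id"
  by (simp_all add: GL_def)

lemma group_GL: "group (GL scale)"
proof (rule groupI)
  fix f assume f: "f \<in> carrier (GL scale)"
  then have b: "bij f" and l: "lin f" by (simp_all add: GL_simps)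
  have e: "f (inv_into UNIV f x) = x" for x using b by (simp add: bij_is_surj surj_f_inv_f)
  have "lin (inv_into UNIV f)"
    by (intro linI) (use b linD(1,2)[OF l] e in \<open>metis bij_inv_eq_iff\<close>)+
  then show "\<exists>g\<in>carrier (GL scale). g \<otimes>\<^bsub>GL scale\<^esub> f = \<one>\<^bsub>GL scale\<^esub>"
    using b by (intro bexI[of _ "inv_into UNIV f"]) (simp_all add: GL_simps bij_is_inj bij_imp_bij_inv)
next
  show "f \<otimes>\<^bsub>GL scale\<^esub> g \<in> carrier (GL scale)" if "f \<in> carrier (GL scale)" "g \<in> carrier (GL scale)" for f g
    using that lin_compose[of f g] bij_comp[of g f] by (simp add: GL_simps comp_def)
qed (auto simp: GL_simps o_assoc id_def bij_id[unfolded id_def])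

sublocale GL: group "GL scale" by (rule group_GL)

lemma GL_inv:
  assumes "f \<in> carrier (GL scale)"
  shows "(inv\<^bsub>GL scale\<^esub> f) (f x) = x" "f ((inv\<^bsub>GL scale\<^esub> f) x) = x"
  using GL.l_inv[OF assms] GL.r_inv[OF assms] by (simp_all add: GL_simps fun_eq_iff)

lemma GL_pow: "f [^]\<^bsub>GL scale\<^esub> (n::nat) = f ^^ n"
  by (induction n) (simp_all add: GL_simps funpow_Suc_right del: funpow.simps(2))

lemma GL_int_pow_commute:
  assumes g: "g \<in> carrier (GL scale)" and "\<And>x. X (g x) = g (X x)"
  shows "X ((g [^]\<^bsub>GL scale\<^esub> (n::int)) x) = (g [^]\<^bsub>GL scale\<^esub> n) (X x)"
proof -
  have nat: "X ((g [^]\<^bsub>GL scale\<^esub> k) x) = (g [^]\<^bsub>GL scale\<^esub> k) (X x)" for k :: nat and x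
    by (induction k arbitrary: x) (simp_all add: GL_simps assms(2))
  show ?thesis
  proof (cases n rule: int_cases2)
    case (nonpos k)
    let ?h = "g [^]\<^bsub>GL scale\<^esub> k"
    have h: "?h \<in> carrier (GL scale)" using g by simp
    have "X ((inv\<^bsub>GL scale\<^esub> ?h) x) = (inv\<^bsub>GL scale\<^esub> ?h) (?h (X ((inv\<^bsub>GL scale\<^esub> ?h) x)))"
      by (simp add: GL_inv[OF h])
    also have "\<dots> = (inv\<^bsub>GL scale\<^esub> ?h) (X x)" by (simp add: nat[symmetric] GL_inv[OF h])
    finally show ?thesis by (simp add: nonpos GL.int_pow_neg_int[OF g])
  qed (simp add: int_pow_int nat)
qed

text \<open>\<open>g u\<close> is \<open>g\<close> plus \<open>g (u - 1)\<close>, and the second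
  summand is nilpotent because \<open>g\<close> commutes with \<open>u\<close>.\<close>

lemma tr_unipotent:
  assumes B: "basis_of B UNIV" and g: "lin g" and u: "lin u" "nilpotent_map scale (\<lambda>v. u v - v)"
    and comm: "\<And>x. u (g x) = g (u x)"
  shows "tr UNIV (\<lambda>x. g (u x)) = tr UNIV g"
proof -
  obtain n where n: "\<And>v. ((\<lambda>v. u v - v) ^^ n) v = 0" using u(2) by (auto simp: nilpotent_map_def)
  define D where "D x = g (u x - x)" for x
  have uu: "lin (\<lambda>x. u x - x)" by (rule lin_diff[OF u(1) lin_id])
  have D: "lin D" unfolding D_def by (rule lin_compose[OF g uu])
  have "(D ^^ k) x = (g ^^ k) (((\<lambda>v. u v - v) ^^ k) x)" for k x
  proof (induction k arbitrary: x)
    case (Suc k)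
    have c: "(g ^^ j) (u x - x) = u ((g ^^ j) x) - (g ^^ j) x" for j x
      by (induction j arbitrary: x) (simp_all add: linD[OF g] comm)
    have gD: "g (((\<lambda>v. u v - v) ^^ j) x) = ((\<lambda>v. u v - v) ^^ j) (g x)" for j x
      by (induction j arbitrary: x) (simp_all add: linD[OF g] comm[symmetric])
    show ?case unfolding funpow_Suc_right o_apply Suc.IH unfolding D_def by (simp only: gD)
  qed simp
  then have "(D ^^ n) x = 0" for x by (simp add: n linD[OF lin_pow[OF g]])
  then have 0: "tr UNIV D = 0" by (intro tr_nilpotent[OF B D]) simp_all
  have "tr UNIV (\<lambda>x. g (u x)) = tr UNIV (\<lambda>x. D x + g x)" by (simp add: D_def linD[OF g])
  also have "\<dots> = tr UNIV g" using tr_add[OF B D _ g] 0 by simp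
  finally show ?thesis .
qed

end

text \<open>By \<open>val_mem\<close> an element of the Weil group is an inertia element times a
  power of \<open>\<phi>\<close>, possibly a negative one.\<close>

lemma (in weil_setting) weil_generated:
  assumes w: "w \<in> carrier W" and "\<And>i. i \<in> I \<Longrightarrow> P i" "P \<phi>"
    and mult: "\<And>x y. x \<in> carrier W \<Longrightarrow> y \<in> carrier W \<Longrightarrow> P x \<Longrightarrow> P y \<Longrightarrow> P (x \<otimes>\<^bsub>W\<^esub> y)"
    and inv: "\<And>x. x \<in> carrier W \<Longrightarrow> P x \<Longrightarrow> P (inv\<^bsub>W\<^esub> x)"
  shows "P w"
proof -
  obtain i where i: "i \<in> I" "w = i \<otimes>\<^bsub>G\<^esub> \<phi> [^]\<^bsub>G\<^esub> val w" using val_mem[OF w] by (auto simp: r_coset_def)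
  have "W = G\<lparr>carrier := carrier W\<rparr>" by (simp add: weil_group_def)
  then have e: "w = i \<otimes>\<^bsub>W\<^esub> \<phi> [^]\<^bsub>W\<^esub> val w"
    using i(2) G.int_pow_consistent[OF subgroup_W phi_W, of "val w"] by (simp add: W_mult)
  have "P (i \<otimes>\<^bsub>W\<^esub> inv\<^bsub>W\<^esub> i)" using assms(2)[OF i(1)] inertia_W(1)[OF i(1)] by (intro mult inv) simp_all
  then have one: "P \<one>\<^bsub>W\<^esub>" using W.r_inv[OF inertia_W(1)[OF i(1)]] by simp
  have nat: "P (\<phi> [^]\<^bsub>W\<^esub> n)" for n :: nat
    by (induction n) (use one mult phi_W assms(3) in auto)
  have "P (\<phi> [^]\<^bsub>W\<^esub> n)" for n :: int
    by (cases n rule: int_cases2) (simp_all add: int_pow_int W.int_pow_neg_int phi_W nat inv)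
  then show ?thesis using mult[OF inertia_W(1)[OF i(1)] W.int_pow_closed[OF phi_W] assms(2)[OF i(1)]] e by metis
qed


text \<open>One locale covers both sides of the theorem: \<open>j\<close> is the exponent of the
  twist, 0 for the first representation and \<open>w1 - w2\<close> for the second.\<close>

locale weil_rep = vspace scale + weil_setting av Ql K l \<phi>
  for scale :: "'a::{alg_closed_field,field_char_0} \<Rightarrow> 'b::ab_group_add \<Rightarrow> 'b" (infixr "\<cdot>" 75)
  and av :: "'k::{alg_closed_field,field_char_0} \<Rightarrow> real" and Ql K :: "'k set" and l :: nat and \<phi> :: "'k \<Rightarrow> 'k" +
  fixes B :: "'b set" and \<rho> :: "('k \<Rightarrow> 'k) \<Rightarrow> 'b \<Rightarrow> 'b" and N :: "'b \<Rightarrow> 'b" and \<psi> :: "('k \<Rightarrow> 'k) \<Rightarrow> 'a"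
    and s :: 'a and j w :: int
  assumes B: "basis_of B UNIV" and wd: "wd_rep av K scale (\<rho>, N)"
    and \<psi>: "unramified_char av K \<psi>" and \<psi>_phi: "\<psi> \<phi> = s" and s: "s ^ 2 = of_nat q"
    and pure: "pure_of_weight av K \<phi> scale w (\<rho>, N)"
begin

lemma fin: "\<exists>B. finite B \<and> span B = UNIV"
  using B by (auto simp: basis_of_def)

lemma s0: "s \<noteq> 0" and Q0: "(of_nat q :: 'a) \<noteq> 0" and q_gt_0: "q > 0"
  using s q_ge_2 by auto

sublocale \<rho>: group_hom W "GL scale" \<rho>
  using wd by unfold_locales (simp add: wd_rep_def)

lemma rho_GL: "x \<in> carrier W \<Longrightarrow> \<rho> x \<in> carrier (GL scale)"
  by (rule \<rho>.hom_closed)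

lemma rho: "x \<in> carrier W \<Longrightarrow> lin (\<rho> x)" "x \<in> carrier W \<Longrightarrow> bij (\<rho> x)"
  using rho_GL by (simp_all add: GL_simps)

lemma rho_mult: "x \<in> carrier W \<Longrightarrow> y \<in> carrier W \<Longrightarrow> \<rho> (x \<otimes>\<^bsub>W\<^esub> y) = \<rho> x \<circ> \<rho> y"
  by (simp add: GL_simps)

lemma N: "lin N"
  using wd by (simp add: wd_rep_def nilpotent_map_def)

lemma rho_N:
  assumes x: "x \<in> carrier W" shows "\<rho> x (N v) = of_nat q powi (- val x) \<cdot> N (\<rho> x v)"
proof -
  have "\<rho> x \<circ> N \<circ> inv\<^bsub>GL scale\<^esub> (\<rho> x) = (\<lambda>v. (of_nat q powi (- val x)) \<cdot> N v)"
    using wd x by (simp add: wd_rep_def q_def)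
  from fun_cong[OF this, of "\<rho> x v"] show ?thesis by (simp add: GL_inv[OF rho_GL[OF x]])
qed

lemma finite_rho_inertia: "finite (\<rho> ` I)"
proof (rule finite_inertia_image)
  show "openin (weil_topology av K) (kernel W (GL scale) \<rho>)" using wd by (simp add: wd_rep_def)
  show "id \<in> kernel W (GL scale) \<rho>"
    using W.one_closed \<rho>.hom_one by (simp add: kernel_def W_simps)
  fix x y assume xy: "x \<in> I" "y \<in> I" "inv\<^bsub>G\<^esub> x \<otimes>\<^bsub>G\<^esub> y \<in> kernel W (GL scale) \<rho>"
  let ?z = "inv\<^bsub>G\<^esub> x \<otimes>\<^bsub>G\<^esub> y"
  have z: "?z \<in> carrier W" "\<rho> ?z = id" using xy(3) by (simp_all add: kernel_def GL_simps)
  have "y = x \<otimes>\<^bsub>W\<^esub> ?z"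
    using inertiaD(1)[OF xy(1)] inertiaD(1)[OF xy(2)] by (simp add: W_mult G.m_assoc[symmetric])
  then have "\<rho> y = \<rho> (x \<otimes>\<^bsub>W\<^esub> ?z)" by simp
  then show "\<rho> x = \<rho> y" using rho_mult[OF inertia_W(1)[OF xy(1)] z(1)] z(2) by simp
qed

lemma commute_all:
  assumes x: "x \<in> carrier W" and "\<And>i v. i \<in> I \<Longrightarrow> X (\<rho> i v) = \<rho> i (X v)" "\<And>v. X (\<rho> \<phi> v) = \<rho> \<phi> (X v)"
  shows "X (\<rho> x v) = \<rho> x (X v)"
proof -
  have "\<forall>v. X (\<rho> x v) = \<rho> x (X v)"
    using x
  proof (rule weil_generated)
    fix y assume y: "y \<in> carrier W" "\<forall>v. X (\<rho> y v) = \<rho> y (X v)"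
    note inv = GL_inv[OF rho_GL[OF y(1)]]
    show "\<forall>v. X (\<rho> (inv\<^bsub>W\<^esub> y) v) = \<rho> (inv\<^bsub>W\<^esub> y) (X v)"
    proof
      fix v
      let ?z = "inv\<^bsub>GL scale\<^esub> (\<rho> y)"
      have "X (?z v) = ?z (\<rho> y (X (?z v)))" by (simp add: inv)
      also have "\<dots> = ?z (X v)" by (simp add: y(2)[rule_format, symmetric] inv)
      finally show "X (\<rho> (inv\<^bsub>W\<^esub> y) v) = \<rho> (inv\<^bsub>W\<^esub> y) (X v)" by (simp add: y(1))
    qed
  qed (use assms(2,3) in \<open>auto simp: rho_mult simp del: \<rho>.hom_mult\<close>)
  then show ?thesis by blast
qed

definition "U = unipotent_part scale (\<rho> \<phi>)"
definition "S = (SOME S. jordan (\<rho> \<phi>) S U)"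

lemma jordan_phi: "jordan (\<rho> \<phi>) S U"
proof -
  have inj: "inj (\<rho> \<phi>)" using rho(2)[OF phi_W] by (rule bij_is_inj)
  obtain S' U' where J: "jordan (\<rho> \<phi>) S' U'" using jordan_exists[OF fin rho(1)[OF phi_W] inj] by blast
  have "U = U'" unfolding U_def by (rule unipotent_part_eq[OF fin J inj])
  then show ?thesis unfolding S_def using J by (metis someI_ex)
qed

lemmas SU = jordanD[OF jordan_phi]

lemma U_GL: "U \<in> carrier (GL scale)"
proof -
  have "inj U" using jordan_inj(2)[OF jordan_phi bij_is_inj[OF rho(2)[OF phi_W]]] .
  moreover have "surj U"
  proof (rule surjI)
    show "U (S ((inv\<^bsub>GL scale\<^esub> (\<rho> \<phi>)) x)) = x" for x by (simp add: SU(5) GL_inv[OF rho_GL[OF phi_W]])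
  qed
  ultimately show ?thesis using SU(2) by (simp add: GL_simps bij_def)
qed

text \<open>\<open>\<phi>\<close> normalizes inertia and so permutes its finite image by
  conjugation. A power that acts trivially commutes with inertia and with \<open>\<phi>\<close>,
  hence with everything.\<close>

lemma inertia_commute_exists: "\<exists>m>0. \<forall>x\<in>carrier W. \<forall>v. (\<rho> \<phi> ^^ m) (\<rho> x v) = \<rho> x ((\<rho> \<phi> ^^ m) v)"
proof -
  have "\<exists>m>0. \<forall>a\<in>\<rho> ` I. \<rho> \<phi> [^]\<^bsub>GL scale\<^esub> (m::nat) \<otimes>\<^bsub>GL scale\<^esub> a = a \<otimes>\<^bsub>GL scale\<^esub> \<rho> \<phi> [^]\<^bsub>GL scale\<^esub> m"
  proof (rule GL.finite_conjugation_commute[OF finite_rho_inertia _ rho_GL[OF phi_W]])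
    show "\<rho> ` I \<subseteq> carrier (GL scale)" using rho_GL inertia_W(1) by blast
    fix a assume "a \<in> \<rho> ` I"
    then obtain i where i: "i \<in> I" "a = \<rho> i" by blast
    let ?i = "\<phi> \<otimes>\<^bsub>G\<^esub> i \<otimes>\<^bsub>G\<^esub> inv\<^bsub>G\<^esub> \<phi>"
    have iI: "?i \<in> I" using conj_phi_inertia(1) i(1) by blast
    have "?i \<otimes>\<^bsub>W\<^esub> \<phi> = \<phi> \<otimes>\<^bsub>W\<^esub> i"
      using inertiaD(1)[OF i(1)] phi_G by (simp add: W_mult G.m_assoc)
    then have "\<rho> (?i \<otimes>\<^bsub>W\<^esub> \<phi>) = \<rho> (\<phi> \<otimes>\<^bsub>W\<^esub> i)" by simp
    then have "\<rho> ?i \<otimes>\<^bsub>GL scale\<^esub> \<rho> \<phi> = \<rho> \<phi> \<otimes>\<^bsub>GL scale\<^esub> a"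
      using inertia_W(1)[OF iI] inertia_W(1)[OF i(1)] phi_W by (simp add: i(2))
    then have "\<rho> \<phi> \<otimes>\<^bsub>GL scale\<^esub> a \<otimes>\<^bsub>GL scale\<^esub> inv\<^bsub>GL scale\<^esub> (\<rho> \<phi>) = \<rho> ?i"
      using rho_GL[OF inertia_W(1)[OF iI]] rho_GL[OF phi_W] by (metis GL.inv_solve_right' GL.m_closed)
    then show "\<rho> \<phi> \<otimes>\<^bsub>GL scale\<^esub> a \<otimes>\<^bsub>GL scale\<^esub> inv\<^bsub>GL scale\<^esub> (\<rho> \<phi>) \<in> \<rho> ` I" using iI by simp
  qed
  then obtain m where m: "m > 0" "\<forall>i\<in>I. (\<rho> \<phi> ^^ m) \<circ> \<rho> i = \<rho> i \<circ> (\<rho> \<phi> ^^ m)" unfolding GL_pow GL_simps by blast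
  have "(\<rho> \<phi> ^^ m) (\<rho> x v) = \<rho> x ((\<rho> \<phi> ^^ m) v)" if "x \<in> carrier W" for x v
  proof (rule commute_all[OF that])
    show "(\<rho> \<phi> ^^ m) (\<rho> i v) = \<rho> i ((\<rho> \<phi> ^^ m) v)" if "i \<in> I" for i v
      using m(2) that by (auto simp: fun_eq_iff)
  qed (simp add: funpow_swap1)
  then show ?thesis using m(1) by blast
qed

text \<open>\<open>U ^^ m\<close> is the unipotent part of a central map, hence commutes with
  \<open>\<rho> x\<close>; \<open>unipotent_root_commute\<close> brings this down to
  \<open>U\<close>. It is why Frobenius-semisimplification gives a representation.\<close>

lemma U_rho: assumes x: "x \<in> carrier W" shows "U (\<rho> x v) = \<rho> x (U v)"
proof -
  interpret vspace_pair scale scale ..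
  obtain m where m: "m > 0" "\<forall>x\<in>carrier W. \<forall>v. (\<rho> \<phi> ^^ m) (\<rho> x v) = \<rho> x ((\<rho> \<phi> ^^ m) v)"
    using inertia_commute_exists by blast
  note J = jordan_funpow[OF jordan_phi, of m]
  have inj: "inj (\<rho> \<phi> ^^ m)" using rho(2)[OF phi_W] by (intro bij_is_inj bij_betw_funpow)
  show ?thesis
  proof (rule unipotent_root_commute[OF _ SU(2) rho(1)[OF x] m(1)])
    show "nilpotent_map scale (\<lambda>v. U v - v)" using jordan_phi by (simp add: jordan_def)
    show "(U ^^ m) (\<rho> x v) = \<rho> x ((U ^^ m) v)" for v
      by (rule jordan_intertwine_unipotent[OF fin fin J J rho(1)[OF x] _ inj, symmetric]) (use m(2) x in simp)
  qed
qed

text \<open>\<open>N\<close> intertwines \<open>\<rho> \<phi>\<close> with \<open>q\<close> times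
  \<open>\<rho> \<phi>\<close>, and both have the unipotent part \<open>U\<close>.\<close>

lemma N_U: "N (U v) = U (N v)"
proof -
  interpret vspace_pair scale scale ..
  have inj: "inj (\<lambda>v. of_nat q \<cdot> \<rho> \<phi> v)"
    using rho(2)[OF phi_W] Q0 by (auto simp: inj_def bij_def)
  show ?thesis
    by (rule jordan_intertwine_unipotent[OF fin fin jordan_phi jordan_scale[OF jordan_phi, of "of_nat q"] N _ inj])
      (use Q0 in \<open>simp add: rho_N phi_W val_phi power_int_minus\<close>)
qed

lemma psi_mult: "x \<in> carrier W \<Longrightarrow> y \<in> carrier W \<Longrightarrow> \<psi> (x \<otimes>\<^bsub>W\<^esub> y) = \<psi> x * \<psi> y"
  and psi_0: "x \<in> carrier W \<Longrightarrow> \<psi> x \<noteq> 0" and psi_inertia: "i \<in> I \<Longrightarrow> \<psi> i = 1"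
  using \<psi> by (auto simp: unramified_char_def hom_def Pi_iff)

lemma psi_one: "\<psi> \<one>\<^bsub>W\<^esub> = 1"
  using psi_mult[OF W.one_closed W.one_closed] psi_0[OF W.one_closed] by simp

lemma psi_pow: "\<psi> (\<phi> [^]\<^bsub>W\<^esub> (n::nat)) = s ^ n"
  by (induction n) (simp_all add: psi_one psi_mult phi_W \<psi>_phi)

lemma val_pow: "val (\<phi> [^]\<^bsub>W\<^esub> (n::nat)) = int n"
proof (induction n)
  case 0
  have "val (\<one>\<^bsub>W\<^esub> \<otimes>\<^bsub>W\<^esub> \<one>\<^bsub>W\<^esub>) = val \<one>\<^bsub>W\<^esub> + val \<one>\<^bsub>W\<^esub>" by (rule val_mult) simp_all
  then show ?case by simp
qed (simp add: val_mult phi_W val_phi)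

abbreviation Up :: "int \<Rightarrow> 'b \<Rightarrow> 'b" where "Up n \<equiv> U [^]\<^bsub>GL scale\<^esub> n"

definition R :: "('k \<Rightarrow> 'k) \<Rightarrow> 'b \<Rightarrow> 'b" where
  "R x v = \<psi> x powi j \<cdot> \<rho> x (Up (- val x) v)"

lemma twist_frob_ss: "wd_twist scale (\<lambda>\<sigma>. \<psi> \<sigma> powi j) (frob_ss av K \<phi> scale (\<rho>, N)) = (R, N)"
  by (simp add: wd_twist_def frob_ss_def R_def[abs_def] U_def fun_eq_iff)

lemma Up_GL: "Up n \<in> carrier (GL scale)"
  using U_GL by simp

lemma lin_Up: "lin (Up n)"
  using Up_GL by (simp add: GL_simps)

lemma Up_add: "Up (n + m) v = Up n (Up m v)"
  using fun_cong[OF GL.int_pow_mult[OF U_GL, of n m]] by (simp add: GL_simps)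

lemma Up_nat: "Up (int n) = U ^^ n"
  by (simp add: int_pow_int GL_pow)

lemma Up_rho: "x \<in> carrier W \<Longrightarrow> Up n (\<rho> x v) = \<rho> x (Up n v)"
  by (rule GL_int_pow_commute[OF U_GL, symmetric]) (simp add: U_rho)

lemma Up_N: "Up n (N v) = N (Up n v)"
  by (rule GL_int_pow_commute[OF U_GL, symmetric]) (simp add: N_U)

lemma lin_R: assumes "x \<in> carrier W" shows "lin (R x)"
  unfolding R_def[abs_def] by (rule lin_smult[OF lin_compose[OF rho(1)[OF assms] lin_Up]])

lemma R_mult:
  assumes x: "x \<in> carrier W" and y: "y \<in> carrier W" shows "R (x \<otimes>\<^bsub>W\<^esub> y) v = R x (R y v)"
proof -
  have "R x (R y v) = \<psi> x powi j \<cdot> \<psi> y powi j \<cdot> \<rho> x (Up (- val x) (\<rho> y (Up (- val y) v)))"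
    by (simp add: R_def linD[OF rho(1)[OF x]] linD[OF lin_Up])
  also have "\<dots> = (\<psi> x * \<psi> y) powi j \<cdot> \<rho> x (\<rho> y (Up (- val x + - val y) v))"
    unfolding Up_add Up_rho[OF y] by (simp add: power_int_mult_distrib)
  also have "\<dots> = R (x \<otimes>\<^bsub>W\<^esub> y) v"
    using x y by (simp add: R_def psi_mult rho_mult val_mult algebra_simps del: \<rho>.hom_mult)
  finally show ?thesis by simp
qed

lemma R_one: "R \<one>\<^bsub>W\<^esub> v = v"
proof -
  have "val \<one>\<^bsub>W\<^esub> = 0" using val_pow[of 0] by simp
  then show ?thesis by (simp add: R_def psi_one GL_simps)
qed

lemma rep_R: "rep_on W R UNIV"
  by (simp add: rep_on_def lin_R R_mult R_one)

lemma R_N: assumes "x \<in> carrier W" shows "R x (N v) = of_nat q powi (- val x) \<cdot> N (R x v)"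
  by (simp add: R_def Up_N rho_N[OF assms] linD[OF N] mult.commute)

lemma R_inertia: "i \<in> I \<Longrightarrow> R i = \<rho> i"
  by (rule ext) (simp add: R_def psi_inertia val_inertia GL_simps)

lemma finite_R_inertia: "finite (R ` I)"
  using finite_rho_inertia R_inertia by (metis image_cong)

text \<open>Powers of \<open>U\<close> commute with the rest and do not change the trace. The sign
  of \<open>val x\<close> decides on which side of \<open>tr_unipotent\<close> the power
  stands.\<close>

lemma tr_R: assumes x: "x \<in> carrier W" shows "tr UNIV (R x) = \<psi> x powi j * tr UNIV (\<rho> x)"
proof -
  define g where "g v = \<rho> x (Up (- val x) v)" for v
  have g: "lin g" unfolding g_def[abs_def] by (rule lin_compose[OF rho(1)[OF x] lin_Up])
  have u: "nilpotent_map scale (\<lambda>v. (U ^^ n) v - v)" "lin (U ^^ n)" for n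
    using jordan_funpow[OF jordan_phi, of n] lin_pow[OF SU(2)] by (auto simp: jordan_def)
  have "tr UNIV g = tr UNIV (\<rho> x)"
  proof (cases "val x \<ge> 0")
    case True
    have Up: "U ^^ nat (val x) = Up (val x)" using Up_nat[of "nat (val x)"] True by simp
    have "tr UNIV (\<lambda>v. g ((U ^^ nat (val x)) v)) = tr UNIV g"
    proof (rule tr_unipotent[OF B g u(2,1)])
      show "(U ^^ nat (val x)) (g v) = g ((U ^^ nat (val x)) v)" for v
        unfolding Up g_def Up_rho[OF x] Up_add[symmetric] by (simp add: add.commute)
    qed
    moreover have "g ((U ^^ nat (val x)) v) = \<rho> x v" for v
      unfolding Up g_def Up_add[symmetric] by (simp add: GL_simps)
    ultimately show ?thesis by simp
  next
    case False
    then have Up: "Up (- val x) = U ^^ nat (- val x)" using Up_nat[of "nat (- val x)"] by simp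
    show ?thesis unfolding g_def[abs_def] Up
      by (rule tr_unipotent[OF B rho(1)[OF x] u(2,1)]) (simp add: Up[symmetric] Up_rho[OF x])
  qed
  moreover have "R x = (\<lambda>v. \<psi> x powi j \<cdot> g v)" by (simp add: R_def g_def fun_eq_iff)
  ultimately show ?thesis using tr_smult[OF B g, of "\<psi> x powi j"] by simp
qed

text \<open>The twist by \<open>\<psi> powi j\<close> shifts all weights by \<open>j\<close>.\<close>

definition wt :: "nat \<Rightarrow> int \<Rightarrow> 'a \<Rightarrow> bool" where
  "wt m k c \<longleftrightarrow> (\<exists>a. a ^ m = c \<and> has_weight q (w + j + k) a)"

lemma wt_unique: "m > 0 \<Longrightarrow> wt m k c \<Longrightarrow> wt m k' c \<Longrightarrow> k = k'"
  unfolding wt_def using has_weight_unique[of q "w + j + k" _ "w + j + k'" _ m] q_ge_2 by force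

lemma s_powi_2: "s powi (2 * i) = of_nat q powi i"
  using s by (simp add: power_int_mult)

lemma wt_shift: assumes "wt m k c" shows "wt m (k + 2 * i) ((of_nat q powi i) ^ m * c)"
proof -
  obtain a where a: "a ^ m = c" "has_weight q (w + j + k) a" using assms unfolding wt_def by blast
  have "has_weight q (w + j + k + 2 * i) (of_nat q powi i * a)"
    using has_weight_twist[OF a(2) s q_gt_0, of "2 * i"] by (simp only: s_powi_2)
  then show ?thesis unfolding wt_def using a(1)
    by (intro exI[of _ "of_nat q powi i * a"]) (simp add: power_mult_distrib add.assoc)
qed

end

text \<open>The exponent is a parameter because both representations must use the same one;
  \<open>M\<close> is the filtration witnessing purity.\<close>

locale weil_rep_power = weil_rep +
  fixes m :: nat and M
  assumes m: "m > 0" and comm: "\<And>x v. x \<in> carrier W \<Longrightarrow> (\<rho> \<phi> ^^ m) (\<rho> x v) = \<rho> x ((\<rho> \<phi> ^^ m) v)"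
    and filt: "monodromy_filtration scale N M"
    and weil: "\<And>i a. gr_eigenvalue scale M (\<rho> \<phi>) i a \<Longrightarrow> weil_number q (w + i) a"
begin

definition "t = \<phi> [^]\<^bsub>W\<^esub> m"
definition "c = s powi j"
abbreviation \<Phi> where "\<Phi> v \<equiv> c \<cdot> \<rho> \<phi> v"
abbreviation T where "T \<equiv> (\<lambda>v. c \<cdot> S v) ^^ m"

lemma t: "t \<in> carrier W" "val t = int m"
  unfolding t_def using phi_W val_pow by simp_all

lemma c0: "c \<noteq> 0"
  using s0 by (simp add: c_def)

lemma jordan_Phi: "jordan \<Phi> (\<lambda>v. c \<cdot> S v) U"
  by (rule jordan_scale[OF jordan_phi])

lemma smult_funpow: "lin f \<Longrightarrow> ((\<lambda>v. a \<cdot> f v) ^^ n) v = a ^ n \<cdot> (f ^^ n) v"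
  by (induction n) (simp_all add: linD)

text \<open>\<open>R t\<close> carries \<open>U\<close> to the power \<open>- m\<close>, which
  cancels the unipotent part of the \<open>m\<close>-th power of Frobenius. What is left is a power
  of the semisimple part, hence diagonalizable.\<close>

lemma R_t: "R t = T"
proof
  fix v
  have "\<rho> t = \<rho> \<phi> ^^ m" unfolding t_def by (simp add: phi_W \<rho>.hom_nat_pow GL_pow)
  then have "R t v = c ^ m \<cdot> (\<rho> \<phi> ^^ m) (Up (- int m) v)"
    using t(2) psi_pow[of m] by (simp add: R_def t_def c_def power_int_power power_int_power' mult.commute)
  also have "\<dots> = c ^ m \<cdot> (S ^^ m) (Up (int m) (Up (- int m) v))"
    by (simp only: Up_nat jordanD(4)[OF jordan_funpow[OF jordan_phi]])
  also have "\<dots> = T v" by (simp add: Up_add[symmetric] smult_funpow SU(1)) (simp add: GL_simps)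
  finally show "R t v = T v" .
qed

sublocale filtered scale N M \<Phi> "inverse (of_nat q)"
  using fin N lin_smult[OF SU(3)] filt Q0
  by (intro filtered.intro vspace_axioms filtered_axioms.intro)
    (simp_all add: rho_N phi_W val_phi linD[OF N] power_int_minus mult.commute)

text \<open>Dividing by \<open>c\<close> gives an eigenvalue of the original Frobenius on the same
  graded piece, whose weight is known; multiplying back by \<open>c = s powi j\<close> adds
  \<open>j\<close>.\<close>

lemma gr_eigenvalue_twist:
  assumes "gr_eigenvalue scale M \<Phi> i a" shows "has_weight q (w + j + i) a"
proof -
  interpret F: filtered scale N M "\<rho> \<phi>" "inverse (of_nat q)"
    using fin N SU(3) filt Q0
    by (intro filtered.intro vspace_axioms filtered_axioms.intro) (simp_all add: rho_N phi_W val_phi power_int_minus)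
  obtain x where x: "x \<in> M i" "gr_class M i x \<noteq> gr_class M i 0" "gr_map M \<Phi> i (gr_class M i x) = gr_class M i (a \<cdot> x)"
    using assms unfolding gr_eigenvalue_def by blast
  have "\<Phi> x - a \<cdot> x \<in> M (i - 1)"
  proof -
    have "gr_map M \<Phi> i (gr_class M i x) = gr_class M i (\<Phi> x)"
      by (rule gr_map_class[OF jordanD(3)[OF jordan_Phi]]) (rule Phi_M)
    then have "gr_class M i (\<Phi> x) = gr_class M i (a \<cdot> x)" using x(3) by metis
    then show ?thesis unfolding gr_class_eq .
  qed
  then have "inverse c \<cdot> (\<Phi> x - a \<cdot> x) \<in> M (i - 1)" by (rule subspace_scale[OF subspace_M])
  then have "\<rho> \<phi> x - (inverse c * a) \<cdot> x \<in> M (i - 1)" using c0 by (simp add: scale_right_diff_distrib)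
  then have "gr_eigenvalue scale M (\<rho> \<phi>) i (inverse c * a)"
    using x(1,2) by (intro F.gr_eigenvalueI) (simp_all add: gr_class_eq)
  from has_weight_twist[OF weil_number_has_weight[OF weil[OF this]] s q_gt_0, of j]
  show ?thesis using c0 by (simp add: c_def[symmetric] mult.assoc[symmetric] add.commute add.left_commute)
qed

lemma T_N: "T (N v) = inverse (of_nat q ^ m) \<cdot> N (T v)"
  using R_N[OF t(1), of v] by (simp add: R_t t(2) power_int_minus)

sublocale pure_filtered scale N M \<Phi> "inverse (of_nat q)" "\<lambda>v. c \<cdot> S v" U T m "of_nat q ^ m" "wt m"
proof
  show "wt m i (a ^ m)" if "gr_eigenvalue scale M \<Phi> i a" for i a
    unfolding wt_def using gr_eigenvalue_twist[OF that] by blast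
  show "wt m (i - 2) (c / of_nat q ^ m)" if "wt m i c" for i c
    using wt_shift[OF that, of "-1"] by (simp add: power_int_minus divide_inverse mult.commute power_inverse)
qed (use jordan_Phi m T_N Q0 wt_unique[OF m] in auto)

text \<open>The \<open>m\<close>-th power of \<open>\<Phi>\<close> commutes with \<open>R x\<close>
  by the choice of \<open>m\<close>, and its semisimple part inherits this.\<close>

lemma T_R: assumes x: "x \<in> carrier W" shows "T (R x v) = R x (T v)"
proof -
  interpret vspace_pair scale scale ..
  note J = jordan_funpow[OF jordan_Phi, of m]
  have "(\<Phi> ^^ m) (R x v) = R x ((\<Phi> ^^ m) v)" for v
  proof -
    have c: "Up n ((\<rho> \<phi> ^^ m) v) = (\<rho> \<phi> ^^ m) (Up n v)" for n v
      by (rule GL_int_pow_commute[OF U_GL, symmetric]) (induction m arbitrary: v, simp_all add: U_rho phi_W)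
    show ?thesis
      by (simp add: smult_funpow SU(3) R_def linD[OF lin_pow[OF SU(3)]] linD[OF rho(1)[OF x]] linD[OF lin_Up]
        comm[OF x] c mult.commute)
  qed
  then show ?thesis by (intro jordan_intertwine[OF fin fin J J lin_R[OF x], symmetric]) simp
qed

sublocale P: pure_rep scale W R N val "of_nat q" t "wt m"
proof
  show "rep_on W R UNIV" by (rule rep_R)
  show "R x (N v) = of_nat q powi (- val x) \<cdot> N (R x v)" if "x \<in> carrier W" for x v using that by (rule R_N)
  show "wt m (k + 2) (of_nat q powi val t * c) \<longleftrightarrow> wt m k c" for k c
  proof
    assume "wt m (k + 2) (of_nat q powi val t * c)"
    from wt_shift[OF this, of "-1"] show "wt m k c"
      using q_gt_0 by (simp add: t(2) power_int_minus power_mult_distrib[symmetric] mult.assoc[symmetric])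
  next
    assume "wt m k c"
    from wt_shift[OF this, of 1] show "wt m (k + 2) (of_nat q powi val t * c)" by (simp add: t(2))
  qed
  show "bij_betw (N ^^ k) (eig (R t) c) (eig (R t) (c / (of_nat q powi val t) ^ k))" if "wt m (int k) c" for k c
    using pure_bij[OF that] by (simp add: R_t t(2))
qed (use fin N Q0 t m val_mult T_R diagT Wt_ex wt_unique[OF m] in \<open>auto simp: R_t linD[OF N]\<close>)

end

text \<open>Multiples of a suitable exponent are suitable, which lets two representations share
  one.\<close>

lemma weil_rep_power_exists:
  assumes W: "weil_rep sc av Ql K l \<phi> B \<rho> N \<psi> s w"
  shows "\<exists>M m. \<forall>n>0. weil_rep_power sc av Ql K l \<phi> B \<rho> N \<psi> s w (m * n) M \<and> m > 0"
proof -
  interpret weil_rep sc av Ql K l \<phi> B \<rho> N \<psi> s 0 w by (rule W)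
  obtain m where m: "m > 0" "\<forall>x\<in>carrier (weil_group av K). \<forall>v. (\<rho> \<phi> ^^ m) (\<rho> x v) = \<rho> x ((\<rho> \<phi> ^^ m) v)"
    using inertia_commute_exists by blast
  obtain M where M: "monodromy_filtration sc N M"
    "\<And>i a. gr_eigenvalue sc M (\<rho> \<phi>) i a \<Longrightarrow> weil_number (residue_card av K) (w + i) a"
    using pure unfolding pure_of_weight_def by blast
  have "(\<rho> \<phi> ^^ (m * n)) (\<rho> x v) = \<rho> x ((\<rho> \<phi> ^^ (m * n)) v)" if "x \<in> carrier (weil_group av K)" for n x v
    unfolding funpow_mult[symmetric] by (induction n) (use m(2) that in simp_all)
  then have "weil_rep_power sc av Ql K l \<phi> B \<rho> N \<psi> s w (m * n) M" if "n > 0" for n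
    using m(1) M that by (intro weil_rep_power.intro W weil_rep_power_axioms.intro) (simp_all add: q_def)
  then show ?thesis using m(1) by blast
qed

theorem theorem3p1:
  fixes Ql K :: "'k::{alg_closed_field, field_char_0} set" and av :: "'k \<Rightarrow> real"
    and Qp :: "'c::{alg_closed_field, field_char_0} set" and avp :: "'c \<Rightarrow> real"
    and sc1 :: "'c \<Rightarrow> 'v1::ab_group_add \<Rightarrow> 'v1" and B1 :: "'v1 set"
    and sc2 :: "'c \<Rightarrow> 'v2::ab_group_add \<Rightarrow> 'v2" and B2 :: "'v2 set"
    and l p q :: nat and w1 w2 :: int and sqrt_q :: 'c
    and \<psi> :: "('k \<Rightarrow> 'k) \<Rightarrow> 'c" and \<phi> :: "'k \<Rightarrow> 'k"
    and \<rho>1 :: "('k \<Rightarrow> 'k) \<Rightarrow> 'v1 \<Rightarrow> 'v1" and N1 :: "'v1 \<Rightarrow> 'v1"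
    and \<rho>2 :: "('k \<Rightarrow> 'k) \<Rightarrow> 'v2 \<Rightarrow> 'v2" and N2 :: "'v2 \<Rightarrow> 'v2"
  assumes "prime l" and "prime p" and "p \<noteq> l"
    and "padic_closure l Ql av" and "finite_extension Ql K"
    and "padic_closure p Qp avp"
    and "q = residue_card av K" and "sqrt_q ^ 2 = of_nat q"
    and "\<phi> \<in> geom_frob av K"
    and "unramified_char av K \<psi>" and "\<psi> \<phi> = sqrt_q"
    and "finite_dimensional_vector_space sc1 B1"
    and "finite_dimensional_vector_space sc2 B2"
    and "wd_rep av K sc1 (\<rho>1, N1)" and "wd_rep av K sc2 (\<rho>2, N2)"
    and "pure_of_weight av K \<phi> sc1 w1 (\<rho>1, N1)"
    and "pure_of_weight av K \<phi> sc2 w2 (\<rho>2, N2)"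
    and "\<forall>\<sigma>\<in>carrier (weil_group av K).
           normalized_trace sc1 B1 \<psi> w1 (\<rho>1, N1) \<sigma> = normalized_trace sc2 B2 \<psi> w2 (\<rho>2, N2) \<sigma>"
  shows "wd_iso av K sc1 sc2
           (frob_ss av K \<phi> sc1 (\<rho>1, N1))
           (wd_twist sc2 (\<lambda>\<sigma>. \<psi> \<sigma> powi (w1 - w2)) (frob_ss av K \<phi> sc2 (\<rho>2, N2)))"
proof -
  note V1 = \<open>finite_dimensional_vector_space sc1 B1\<close> and V2 = \<open>finite_dimensional_vector_space sc2 B2\<close>
  interpret V1: finite_dimensional_vector_space sc1 B1 by (rule V1)
  interpret V2: finite_dimensional_vector_space sc2 B2 by (rule V2)
  interpret vspace_pair sc1 sc2 by unfold_locales
  have B1: "v1.basis_of B1 UNIV" and B2: "v2.basis_of B2 UNIV"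
    unfolding v1.basis_of_def v2.basis_of_def
    using V1.finite_Basis V1.independent_Basis V1.span_Basis V2.finite_Basis V2.independent_Basis V2.span_Basis by simp_all
  interpret weil_setting av Ql K l \<phi> using assms by unfold_locales
  have s: "sqrt_q ^ 2 = of_nat (weil_setting.q av K)" using assms by (simp add: q_def)
  have "weil_rep sc1 av Ql K l \<phi> B1 \<rho>1 N1 \<psi> sqrt_q w1"
    using assms B1 s by (intro weil_rep.intro weil_rep_axioms.intro v1.vspace_axioms weil_setting_axioms) simp_all
  from weil_rep_power_exists[OF this] obtain M1 m1 where
    1: "\<And>n. n > 0 \<Longrightarrow> weil_rep_power sc1 av Ql K l \<phi> B1 \<rho>1 N1 \<psi> sqrt_q w1 (m1 * n) M1 \<and> m1 > 0" by metis
  have "weil_rep sc2 av Ql K l \<phi> B2 \<rho>2 N2 \<psi> sqrt_q w2"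
    using assms B2 s by (intro weil_rep.intro weil_rep_axioms.intro v2.vspace_axioms weil_setting_axioms) simp_all
  from weil_rep_power_exists[OF this] obtain M2 m2 where
    2: "\<And>n. n > 0 \<Longrightarrow> weil_rep_power sc2 av Ql K l \<phi> B2 \<rho>2 N2 \<psi> sqrt_q w2 (m2 * n) M2 \<and> m2 > 0" by metis
  \<comment> \<open>A common multiple of both exponents, so that one element of the Weil group
    splits both representations.\<close>
  define m where "m = m1 * m2"
  interpret A: weil_rep_power sc1 av Ql K l \<phi> B1 \<rho>1 N1 \<psi> sqrt_q 0 w1 m M1
    unfolding m_def using 1[of m2] 2[of 1] by simp
  \<comment> \<open>The whole twist sits on this side: \<open>w2 + (w1 - w2) = w1\<close>, so the
    weight predicates of \<open>A\<close> and \<open>B\<close> coincide.\<close>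
  interpret B: weil_rep_power sc2 av Ql K l \<phi> B2 \<rho>2 N2 \<psi> sqrt_q "w1 - w2" w2 m M2
    unfolding m_def using 2[of m1] 1[of 1] by (simp add: mult.commute)
  have wt: "B.wt m = A.wt m" by (simp add: A.wt_def B.wt_def fun_eq_iff)
  have traces: "v1.tr UNIV (A.R x) = v2.tr UNIV (B.R x)" if x: "x \<in> carrier W" for x
  proof -
    have n1: "normalized_trace sc1 B1 \<psi> w1 (\<rho>1, N1) x = \<psi> x powi (- w1) * v1.tr UNIV (\<rho>1 x)"
      using v1.tr_eq[OF B1 v1.lin_smult[OF A.rho(1)[OF x]]] v1.tr_smult[OF B1 A.rho(1)[OF x]]
      by (simp add: normalized_trace_def wd_twist_def)
    have n2: "normalized_trace sc2 B2 \<psi> w2 (\<rho>2, N2) x = \<psi> x powi (- w2) * v2.tr UNIV (\<rho>2 x)"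
      using v2.tr_eq[OF B2 v2.lin_smult[OF B.rho(1)[OF x]]] v2.tr_smult[OF B2 B.rho(1)[OF x]]
      by (simp add: normalized_trace_def wd_twist_def)
    have e: "\<psi> x powi (- w1) * v1.tr UNIV (\<rho>1 x) = \<psi> x powi (- w2) * v2.tr UNIV (\<rho>2 x)"
      using assms(18) x unfolding n1[symmetric] n2[symmetric] by blast
    have "v1.tr UNIV (\<rho>1 x) = \<psi> x powi w1 * (\<psi> x powi (- w1) * v1.tr UNIV (\<rho>1 x))"
      using A.psi_0[OF x] by (simp add: power_int_minus)
    also have "\<dots> = \<psi> x powi (w1 - w2) * v2.tr UNIV (\<rho>2 x)"
      unfolding e using A.psi_0[OF x] by (simp add: power_int_diff power_int_minus divide_inverse mult.assoc)
    finally show ?thesis using A.tr_R[OF x] B.tr_R[OF x] by simp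
  qed
  interpret pure_pair sc1 sc2 W A.R N1 val "of_nat (weil_setting.q av K)" A.t "A.wt m" B.R N2
  proof (intro pure_pair.intro vspace_pair_axioms A.P.pure_rep_axioms pure_pair_axioms.intro)
    show "pure_rep sc2 W B.R N2 val (of_nat (weil_setting.q av K)) A.t (A.wt m)"
      using B.P.pure_rep_axioms unfolding wt .
    fix n :: int
    let ?f = "\<phi> [^]\<^bsub>W\<^esub> n"
    \<comment> \<open>Elements of valuation \<open>n\<close> lie in one coset of inertia, whose
      image is finite on both sides.\<close>
    have "{x \<in> carrier W. val x = n} \<subseteq> (\<lambda>i. i \<otimes>\<^bsub>W\<^esub> ?f) ` I"
    proof
      fix x assume "x \<in> {x \<in> carrier W. val x = n}"
      then have x: "x \<in> carrier W" "val x = n" by auto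
      have "W = G\<lparr>carrier := carrier W\<rparr>" by (simp add: weil_group_def)
      then have "\<phi> [^]\<^bsub>G\<^esub> n = ?f" using G.int_pow_consistent[OF subgroup_W phi_W, of n] by simp
      then show "x \<in> (\<lambda>i. i \<otimes>\<^bsub>W\<^esub> ?f) ` I" using val_mem[OF x(1)] unfolding x(2) r_coset_def by (auto simp: W_mult)
    qed
    then have sub: "x \<in> (\<lambda>i. i \<otimes>\<^bsub>W\<^esub> ?f) ` I" if "x \<in> carrier W" "val x = n" for x using that by blast
    have "(\<lambda>x. (A.R x, B.R x)) ` {x \<in> carrier W. val x = n}
      \<subseteq> (\<lambda>(a, b). (a \<circ> A.R ?f, b \<circ> B.R ?f)) ` (A.R ` I \<times> B.R ` I)"
    proof (rule image_subsetI)
      fix x assume "x \<in> {x \<in> carrier W. val x = n}"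
      then obtain i where i: "i \<in> I" "x = i \<otimes>\<^bsub>W\<^esub> ?f" using sub by blast
      have "A.R x = A.R i \<circ> A.R ?f" "B.R x = B.R i \<circ> B.R ?f" unfolding i(2) fun_eq_iff o_apply
        using A.R_mult[OF inertia_W(1)[OF i(1)] W.int_pow_closed[OF phi_W]]
          B.R_mult[OF inertia_W(1)[OF i(1)] W.int_pow_closed[OF phi_W]] by blast+
      then show "(A.R x, B.R x) \<in> (\<lambda>(a, b). (a \<circ> A.R ?f, b \<circ> B.R ?f)) ` (A.R ` I \<times> B.R ` I)"
        using i(1) by (intro image_eqI[of _ _ "(A.R i, B.R i)"]) simp_all
    qed
    then show "finite ((\<lambda>x. (A.R x, B.R x)) ` {x \<in> carrier W. val x = n})"
      by (rule finite_subset) (simp add: A.finite_R_inertia B.finite_R_inertia)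
  qed (rule traces)
  obtain f where f: "hom f" "bij f" "\<forall>x\<in>carrier W. \<forall>v. f (A.R x v) = B.R x (f v)" "\<forall>v. f (N1 v) = N2 (f v)"
    using pure_isomorphism by blast
  have "frob_ss av K \<phi> sc1 (\<rho>1, N1) = (A.R, N1)"
    using A.twist_frob_ss by (simp add: wd_twist_def frob_ss_def)
  then show ?thesis unfolding B.twist_frob_ss wd_iso_def using f by (auto simp: fun_eq_iff)
qed

end
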